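(* Let $\mathcal{C}$ be a modular tensor category that is weakly integral (that is, $\operatorname{FPdim}(\mathcal{C})$ is an integer), and suppose that $|\mathcal{G}(\mathcal{C})|=p^2$ for an odd prime $p$. If $\mathcal{G}(\mathcal{C})\cong \mathbb{Z}_p\times\mathbb{Z}_p$, then $\mathcal{C}$ contains a pointed modular subcategory of Frobenius-Perron dimension $[\mathcal{G}(\mathcal{C}):\mathcal{G}(\mathcal{C}_{\mathrm{ad}})]$.
   Context: All categories are over an algebraically closed field $\mathbf{k}$ of characteristic zero. A modular tensor category is a (semisimple) braided fusion category with a spherical structure whose $S$-matrix is invertible. $\operatorname{FPdim}$ denotes the Frobenius-Perron dimension, with $\operatorname{FPdim}(\mathcal{C})=\sum_X \operatorname{FPdim}(X)^2$ over isomorphism classes of simple objects. $\mathcal{G}(\mathcal{D})$ is the group of isomorphism classes of invertible objects of a fusion category $\mathcal{D}$; $\mathcal{C}_{\mathrm{ad}}$ is the adjoint subcategory, the fusion subcategory generated by $X\otimes X^*$ for all simple $X\in\mathcal{C}$. A fusion category is pointed if all its simple objects are invertible. For a fusion subcategory $\mathcal{K}\subseteq\mathcal{C}$, its Müger centralizer $\mathcal{K}'$ is the fusion subcategory of all $Y\in\mathcal{C}$ with $c_{Y,X}c_{X,Y}=\mathrm{id}_{X\otimes Y}$ for all $X\in\mathcal{K}$; $\mathcal{K}$ is a modular subcategory if $\mathcal{K}\cap\mathcal{K}'=\mathrm{Vec}$. *)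

theory Defs
  imports
    "HOL-Algebra.Elementary_Groups"
    "HOL-Number_Theory.Number_Theory"
    "Jordan_Normal_Form.VS_Connect"
    "Jordan_Normal_Form.Char_Poly"
begin

section \<open>Linear abelian categories\<close>

text \<open>
  A small category enriched in vector spaces: \<open>Hom C X Y\<close> is the hom-space with its linear
  structure, given as a module record over \<open>class_ring :: 'k ring\<close>, whose ring multiplication and
  unit (inherited fields of that record type) play no role.  Objects are the elements of \<open>Obj C\<close>;
  hom-sets of different pairs of objects need not be disjoint, so a morphism is
  always considered together with its source and target.  The full subcategory on a set
  \<open>K\<close> of objects is \<open>C\<lparr>Obj := K\<rparr>\<close>.
\<close>

record ('o, 'm, 'k) lincat =
  Obj :: "'o set"
  Hom :: "'o \<Rightarrow> 'o \<Rightarrow> ('k, 'm) module"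
  Comp :: "'m \<Rightarrow> 'm \<Rightarrow> 'm"  (infixr \<open>\<cdot>\<index>\<close> 75)
  Ident :: "'o \<Rightarrow> 'm"

abbreviation arr :: "('o, 'm, 'k, 'r) lincat_scheme \<Rightarrow> 'o \<Rightarrow> 'o \<Rightarrow> 'm set" where
  "arr C X Y \<equiv> carrier (Hom C X Y)"

definition iso_arr :: "('o, 'm, 'k, 'r) lincat_scheme \<Rightarrow> 'o \<Rightarrow> 'o \<Rightarrow> 'm \<Rightarrow> bool" where
  "iso_arr C X Y f \<longleftrightarrow> f \<in> arr C X Y \<and>
     (\<exists>g\<in>arr C Y X. g \<cdot>\<^bsub>C\<^esub> f = Ident C X \<and> f \<cdot>\<^bsub>C\<^esub> g = Ident C Y)"

definition inv_arr :: "('o, 'm, 'k, 'r) lincat_scheme \<Rightarrow> 'o \<Rightarrow> 'o \<Rightarrow> 'm \<Rightarrow> 'm" where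
  "inv_arr C X Y f =
     (THE g. g \<in> arr C Y X \<and> g \<cdot>\<^bsub>C\<^esub> f = Ident C X \<and> f \<cdot>\<^bsub>C\<^esub> g = Ident C Y)"

definition isomorphic :: "('o, 'm, 'k, 'r) lincat_scheme \<Rightarrow> 'o \<Rightarrow> 'o \<Rightarrow> bool" where
  "isomorphic C X Y \<longleftrightarrow> (\<exists>f. iso_arr C X Y f)"

definition mono_arr :: "('o, 'm, 'k, 'r) lincat_scheme \<Rightarrow> 'o \<Rightarrow> 'o \<Rightarrow> 'm \<Rightarrow> bool" where
  "mono_arr C X Y f \<longleftrightarrow> f \<in> arr C X Y \<and>
     (\<forall>W\<in>Obj C. \<forall>g\<in>arr C W X. \<forall>h\<in>arr C W X. f \<cdot>\<^bsub>C\<^esub> g = f \<cdot>\<^bsub>C\<^esub> h \<longrightarrow> g = h)"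

definition epi_arr :: "('o, 'm, 'k, 'r) lincat_scheme \<Rightarrow> 'o \<Rightarrow> 'o \<Rightarrow> 'm \<Rightarrow> bool" where
  "epi_arr C X Y f \<longleftrightarrow> f \<in> arr C X Y \<and>
     (\<forall>Z\<in>Obj C. \<forall>g\<in>arr C Y Z. \<forall>h\<in>arr C Y Z. g \<cdot>\<^bsub>C\<^esub> f = h \<cdot>\<^bsub>C\<^esub> f \<longrightarrow> g = h)"

definition zero_obj :: "('o, 'm, 'k, 'r) lincat_scheme \<Rightarrow> 'o \<Rightarrow> bool" where
  "zero_obj C X \<longleftrightarrow> X \<in> Obj C \<and>
     (\<forall>Y\<in>Obj C. (\<exists>!f. f \<in> arr C X Y) \<and> (\<exists>!f. f \<in> arr C Y X))"

definition direct_sum :: "('o, 'm, 'k, 'r) lincat_scheme \<Rightarrow> 'o \<Rightarrow> 'o list \<Rightarrow> bool" where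
  "direct_sum C X Xs \<longleftrightarrow> X \<in> Obj C \<and> set Xs \<subseteq> Obj C \<and>
     (\<exists>i p. (\<forall>a<length Xs. i a \<in> arr C (Xs ! a) X \<and> p a \<in> arr C X (Xs ! a)) \<and>
        (\<forall>a<length Xs. \<forall>b<length Xs. p a \<cdot>\<^bsub>C\<^esub> i b =
           (if a = b then Ident C (Xs ! a) else \<zero>\<^bsub>Hom C (Xs ! b) (Xs ! a)\<^esub>)) \<and>
        (\<Oplus>\<^bsub>Hom C X X\<^esub> a\<in>{..<length Xs}. i a \<cdot>\<^bsub>C\<^esub> p a) = Ident C X)"

definition kernel_arr ::
    "('o, 'm, 'k, 'r) lincat_scheme \<Rightarrow> 'o \<Rightarrow> 'o \<Rightarrow> 'o \<Rightarrow> 'm \<Rightarrow> 'm \<Rightarrow> bool" where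
  "kernel_arr C K X Y k f \<longleftrightarrow> k \<in> arr C K X \<and> f \<in> arr C X Y \<and> f \<cdot>\<^bsub>C\<^esub> k = \<zero>\<^bsub>Hom C K Y\<^esub> \<and>
     (\<forall>W\<in>Obj C. \<forall>g\<in>arr C W X. f \<cdot>\<^bsub>C\<^esub> g = \<zero>\<^bsub>Hom C W Y\<^esub> \<longrightarrow>
        (\<exists>!h. h \<in> arr C W K \<and> k \<cdot>\<^bsub>C\<^esub> h = g))"

definition cokernel_arr ::
    "('o, 'm, 'k, 'r) lincat_scheme \<Rightarrow> 'o \<Rightarrow> 'o \<Rightarrow> 'o \<Rightarrow> 'm \<Rightarrow> 'm \<Rightarrow> bool" where
  "cokernel_arr C X Y Q f q \<longleftrightarrow> f \<in> arr C X Y \<and> q \<in> arr C Y Q \<and> q \<cdot>\<^bsub>C\<^esub> f = \<zero>\<^bsub>Hom C X Q\<^esub> \<and>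
     (\<forall>W\<in>Obj C. \<forall>g\<in>arr C Y W. g \<cdot>\<^bsub>C\<^esub> f = \<zero>\<^bsub>Hom C X W\<^esub> \<longrightarrow>
        (\<exists>!h. h \<in> arr C Q W \<and> h \<cdot>\<^bsub>C\<^esub> q = g))"

definition simple_obj :: "('o, 'm, 'k, 'r) lincat_scheme \<Rightarrow> 'o \<Rightarrow> bool" where
  "simple_obj C X \<longleftrightarrow> X \<in> Obj C \<and> \<not> zero_obj C X \<and>
     (\<forall>Y\<in>Obj C. \<forall>f. mono_arr C Y X f \<longrightarrow> zero_obj C Y \<or> iso_arr C Y X f)"

definition simple_reps :: "('o, 'm, 'k, 'r) lincat_scheme \<Rightarrow> 'o list \<Rightarrow> bool" where
  "simple_reps C Xs \<longleftrightarrow> (\<forall>X\<in>set Xs. simple_obj C X) \<and>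
     (\<forall>X. simple_obj C X \<longrightarrow> (\<exists>!a. a < length Xs \<and> isomorphic C X (Xs ! a)))"

text \<open>
  A chosen enumeration of the isomorphism classes of simple objects by representatives.
  Everything defined from it below is independent of the choice.
\<close>

definition simples :: "('o, 'm, 'k, 'r) lincat_scheme \<Rightarrow> 'o list" where
  "simples C = (SOME Xs. simple_reps C Xs)"

locale linear_category =
  fixes C :: "('o, 'm, 'k::field, 'r) lincat_scheme" (structure)
  assumes hom_vectorspace:
      "\<lbrakk>X \<in> Obj C; Y \<in> Obj C\<rbrakk> \<Longrightarrow> vectorspace class_ring (Hom C X Y)"
    and Ident_arr: "X \<in> Obj C \<Longrightarrow> Ident C X \<in> arr C X X"
    and Comp_arr:
      "\<lbrakk>X \<in> Obj C; Y \<in> Obj C; Z \<in> Obj C; f \<in> arr C X Y; g \<in> arr C Y Z\<rbrakk> \<Longrightarrow> g \<cdot> f \<in> arr C X Z"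
    and Comp_assoc:
      "\<lbrakk>W \<in> Obj C; X \<in> Obj C; Y \<in> Obj C; Z \<in> Obj C;
        f \<in> arr C W X; g \<in> arr C X Y; h \<in> arr C Y Z\<rbrakk> \<Longrightarrow> (h \<cdot> g) \<cdot> f = h \<cdot> (g \<cdot> f)"
    and Ident_left: "\<lbrakk>X \<in> Obj C; Y \<in> Obj C; f \<in> arr C X Y\<rbrakk> \<Longrightarrow> Ident C Y \<cdot> f = f"
    and Ident_right: "\<lbrakk>X \<in> Obj C; Y \<in> Obj C; f \<in> arr C X Y\<rbrakk> \<Longrightarrow> f \<cdot> Ident C X = f"
    and Comp_add_left:
      "\<lbrakk>X \<in> Obj C; Y \<in> Obj C; Z \<in> Obj C; f \<in> arr C X Y; g \<in> arr C Y Z; h \<in> arr C Y Z\<rbrakk> \<Longrightarrow>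
        (g \<oplus>\<^bsub>Hom C Y Z\<^esub> h) \<cdot> f = (g \<cdot> f) \<oplus>\<^bsub>Hom C X Z\<^esub> (h \<cdot> f)"
    and Comp_add_right:
      "\<lbrakk>X \<in> Obj C; Y \<in> Obj C; Z \<in> Obj C; f \<in> arr C X Y; g \<in> arr C X Y; h \<in> arr C Y Z\<rbrakk> \<Longrightarrow>
        h \<cdot> (f \<oplus>\<^bsub>Hom C X Y\<^esub> g) = (h \<cdot> f) \<oplus>\<^bsub>Hom C X Z\<^esub> (h \<cdot> g)"
    and Comp_smult_left:
      "\<lbrakk>X \<in> Obj C; Y \<in> Obj C; Z \<in> Obj C; f \<in> arr C X Y; g \<in> arr C Y Z\<rbrakk> \<Longrightarrow>
        (c \<odot>\<^bsub>Hom C Y Z\<^esub> g) \<cdot> f = c \<odot>\<^bsub>Hom C X Z\<^esub> (g \<cdot> f)"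
    and Comp_smult_right:
      "\<lbrakk>X \<in> Obj C; Y \<in> Obj C; Z \<in> Obj C; f \<in> arr C X Y; g \<in> arr C Y Z\<rbrakk> \<Longrightarrow>
        g \<cdot> (c \<odot>\<^bsub>Hom C X Y\<^esub> f) = c \<odot>\<^bsub>Hom C X Z\<^esub> (g \<cdot> f)"

text \<open>The empty list in \<open>direct_sums\<close> yields a zero object.\<close>

locale abelian_category = linear_category C
  for C :: "('o, 'm, 'k::field, 'r) lincat_scheme" (structure) +
  assumes direct_sums: "set Xs \<subseteq> Obj C \<Longrightarrow> \<exists>X. direct_sum C X Xs"
    and kernels: "\<lbrakk>X \<in> Obj C; Y \<in> Obj C; f \<in> arr C X Y\<rbrakk> \<Longrightarrow> \<exists>K\<in>Obj C. \<exists>k. kernel_arr C K X Y k f"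
    and cokernels:
      "\<lbrakk>X \<in> Obj C; Y \<in> Obj C; f \<in> arr C X Y\<rbrakk> \<Longrightarrow> \<exists>Q\<in>Obj C. \<exists>q. cokernel_arr C X Y Q f q"
    and mono_is_kernel:
      "\<lbrakk>X \<in> Obj C; Y \<in> Obj C; mono_arr C X Y f\<rbrakk> \<Longrightarrow> \<exists>Z\<in>Obj C. \<exists>g. kernel_arr C X Y Z f g"
    and epi_is_cokernel:
      "\<lbrakk>X \<in> Obj C; Y \<in> Obj C; epi_arr C X Y f\<rbrakk> \<Longrightarrow> \<exists>W\<in>Obj C. \<exists>g. cokernel_arr C W X Y g f"


section \<open>Rigid monoidal categories\<close>

record ('o, 'm, 'k) moncat = "('o, 'm, 'k) lincat" +
  TensO :: "'o \<Rightarrow> 'o \<Rightarrow> 'o"  (infixr \<open>\<otimes>\<^sub>o\<index>\<close> 80)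
  TensM :: "'m \<Rightarrow> 'm \<Rightarrow> 'm"  (infixr \<open>\<otimes>\<^sub>m\<index>\<close> 80)
  UnitO :: "'o"
  Assoc :: "'o \<Rightarrow> 'o \<Rightarrow> 'o \<Rightarrow> 'm"
  LUnit :: "'o \<Rightarrow> 'm"
  RUnit :: "'o \<Rightarrow> 'm"

abbreviation Assoc_inv :: "('o, 'm, 'k, 'r) moncat_scheme \<Rightarrow> 'o \<Rightarrow> 'o \<Rightarrow> 'o \<Rightarrow> 'm" where
  "Assoc_inv C X Y Z \<equiv>
     inv_arr C ((X \<otimes>\<^sub>o\<^bsub>C\<^esub> Y) \<otimes>\<^sub>o\<^bsub>C\<^esub> Z) (X \<otimes>\<^sub>o\<^bsub>C\<^esub> (Y \<otimes>\<^sub>o\<^bsub>C\<^esub> Z)) (Assoc C X Y Z)"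

locale monoidal_category = linear_category C
  for C :: "('o, 'm, 'k::field, 'r) moncat_scheme" (structure) +
  assumes UnitO_Obj: "UnitO C \<in> Obj C"
    and TensO_Obj: "\<lbrakk>X \<in> Obj C; Y \<in> Obj C\<rbrakk> \<Longrightarrow> X \<otimes>\<^sub>o Y \<in> Obj C"
    and TensM_arr:
      "\<lbrakk>X \<in> Obj C; Y \<in> Obj C; X' \<in> Obj C; Y' \<in> Obj C; f \<in> arr C X Y; g \<in> arr C X' Y'\<rbrakk> \<Longrightarrow>
        f \<otimes>\<^sub>m g \<in> arr C (X \<otimes>\<^sub>o X') (Y \<otimes>\<^sub>o Y')"
    and TensM_Ident:
      "\<lbrakk>X \<in> Obj C; Y \<in> Obj C\<rbrakk> \<Longrightarrow> Ident C X \<otimes>\<^sub>m Ident C Y = Ident C (X \<otimes>\<^sub>o Y)"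
    and TensM_Comp:
      "\<lbrakk>X \<in> Obj C; Y \<in> Obj C; Z \<in> Obj C; X' \<in> Obj C; Y' \<in> Obj C; Z' \<in> Obj C;
        f \<in> arr C X Y; g \<in> arr C Y Z; f' \<in> arr C X' Y'; g' \<in> arr C Y' Z'\<rbrakk> \<Longrightarrow>
        (g \<cdot> f) \<otimes>\<^sub>m (g' \<cdot> f') = (g \<otimes>\<^sub>m g') \<cdot> (f \<otimes>\<^sub>m f')"
    and TensM_add_left:
      "\<lbrakk>X \<in> Obj C; Y \<in> Obj C; X' \<in> Obj C; Y' \<in> Obj C;
        f \<in> arr C X Y; g \<in> arr C X Y; h \<in> arr C X' Y'\<rbrakk> \<Longrightarrow>
        (f \<oplus>\<^bsub>Hom C X Y\<^esub> g) \<otimes>\<^sub>m h =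
        (f \<otimes>\<^sub>m h) \<oplus>\<^bsub>Hom C (X \<otimes>\<^sub>o X') (Y \<otimes>\<^sub>o Y')\<^esub> (g \<otimes>\<^sub>m h)"
    and TensM_add_right:
      "\<lbrakk>X \<in> Obj C; Y \<in> Obj C; X' \<in> Obj C; Y' \<in> Obj C;
        f \<in> arr C X Y; g \<in> arr C X' Y'; h \<in> arr C X' Y'\<rbrakk> \<Longrightarrow>
        f \<otimes>\<^sub>m (g \<oplus>\<^bsub>Hom C X' Y'\<^esub> h) =
        (f \<otimes>\<^sub>m g) \<oplus>\<^bsub>Hom C (X \<otimes>\<^sub>o X') (Y \<otimes>\<^sub>o Y')\<^esub> (f \<otimes>\<^sub>m h)"
    and TensM_smult_left:
      "\<lbrakk>X \<in> Obj C; Y \<in> Obj C; X' \<in> Obj C; Y' \<in> Obj C; f \<in> arr C X Y; g \<in> arr C X' Y'\<rbrakk> \<Longrightarrow>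
        (c \<odot>\<^bsub>Hom C X Y\<^esub> f) \<otimes>\<^sub>m g = c \<odot>\<^bsub>Hom C (X \<otimes>\<^sub>o X') (Y \<otimes>\<^sub>o Y')\<^esub> (f \<otimes>\<^sub>m g)"
    and TensM_smult_right:
      "\<lbrakk>X \<in> Obj C; Y \<in> Obj C; X' \<in> Obj C; Y' \<in> Obj C; f \<in> arr C X Y; g \<in> arr C X' Y'\<rbrakk> \<Longrightarrow>
        f \<otimes>\<^sub>m (c \<odot>\<^bsub>Hom C X' Y'\<^esub> g) = c \<odot>\<^bsub>Hom C (X \<otimes>\<^sub>o X') (Y \<otimes>\<^sub>o Y')\<^esub> (f \<otimes>\<^sub>m g)"
    and Assoc_iso:
      "\<lbrakk>X \<in> Obj C; Y \<in> Obj C; Z \<in> Obj C\<rbrakk> \<Longrightarrow>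
        iso_arr C ((X \<otimes>\<^sub>o Y) \<otimes>\<^sub>o Z) (X \<otimes>\<^sub>o (Y \<otimes>\<^sub>o Z)) (Assoc C X Y Z)"
    and LUnit_iso: "X \<in> Obj C \<Longrightarrow> iso_arr C (UnitO C \<otimes>\<^sub>o X) X (LUnit C X)"
    and RUnit_iso: "X \<in> Obj C \<Longrightarrow> iso_arr C (X \<otimes>\<^sub>o UnitO C) X (RUnit C X)"
    and Assoc_natural:
      "\<lbrakk>X \<in> Obj C; Y \<in> Obj C; Z \<in> Obj C; X' \<in> Obj C; Y' \<in> Obj C; Z' \<in> Obj C;
        f \<in> arr C X X'; g \<in> arr C Y Y'; h \<in> arr C Z Z'\<rbrakk> \<Longrightarrow>
        Assoc C X' Y' Z' \<cdot> ((f \<otimes>\<^sub>m g) \<otimes>\<^sub>m h) = (f \<otimes>\<^sub>m (g \<otimes>\<^sub>m h)) \<cdot> Assoc C X Y Z"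
    and LUnit_natural:
      "\<lbrakk>X \<in> Obj C; Y \<in> Obj C; f \<in> arr C X Y\<rbrakk> \<Longrightarrow>
        LUnit C Y \<cdot> (Ident C (UnitO C) \<otimes>\<^sub>m f) = f \<cdot> LUnit C X"
    and RUnit_natural:
      "\<lbrakk>X \<in> Obj C; Y \<in> Obj C; f \<in> arr C X Y\<rbrakk> \<Longrightarrow>
        RUnit C Y \<cdot> (f \<otimes>\<^sub>m Ident C (UnitO C)) = f \<cdot> RUnit C X"
    and pentagon:
      "\<lbrakk>W \<in> Obj C; X \<in> Obj C; Y \<in> Obj C; Z \<in> Obj C\<rbrakk> \<Longrightarrow>
        (Ident C W \<otimes>\<^sub>m Assoc C X Y Z) \<cdot> Assoc C W (X \<otimes>\<^sub>o Y) Z \<cdot> (Assoc C W X Y \<otimes>\<^sub>m Ident C Z) =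
        Assoc C W X (Y \<otimes>\<^sub>o Z) \<cdot> Assoc C (W \<otimes>\<^sub>o X) Y Z"
    and triangle:
      "\<lbrakk>X \<in> Obj C; Y \<in> Obj C\<rbrakk> \<Longrightarrow>
        (Ident C X \<otimes>\<^sub>m LUnit C Y) \<cdot> Assoc C X (UnitO C) Y = RUnit C X \<otimes>\<^sub>m Ident C Y"

text \<open>\<open>D\<close> is a left dual of \<open>X\<close>: evaluation \<open>e : D \<otimes> X \<rightarrow> 1\<close>, coevaluation \<open>n : 1 \<rightarrow> X \<otimes> D\<close>.\<close>

definition left_dual ::
    "('o, 'm, 'k, 'r) moncat_scheme \<Rightarrow> 'o \<Rightarrow> 'o \<Rightarrow> 'm \<Rightarrow> 'm \<Rightarrow> bool" where
  "left_dual C X D e n \<longleftrightarrow> D \<in> Obj C \<and>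
     e \<in> arr C (D \<otimes>\<^sub>o\<^bsub>C\<^esub> X) (UnitO C) \<and> n \<in> arr C (UnitO C) (X \<otimes>\<^sub>o\<^bsub>C\<^esub> D) \<and>
     RUnit C X \<cdot>\<^bsub>C\<^esub> (Ident C X \<otimes>\<^sub>m\<^bsub>C\<^esub> e) \<cdot>\<^bsub>C\<^esub> Assoc C X D X \<cdot>\<^bsub>C\<^esub> (n \<otimes>\<^sub>m\<^bsub>C\<^esub> Ident C X) = LUnit C X \<and>
     LUnit C D \<cdot>\<^bsub>C\<^esub> (e \<otimes>\<^sub>m\<^bsub>C\<^esub> Ident C D) \<cdot>\<^bsub>C\<^esub> Assoc_inv C D X D \<cdot>\<^bsub>C\<^esub> (Ident C D \<otimes>\<^sub>m\<^bsub>C\<^esub> n) = RUnit C D"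

text \<open>
  Left duals are a chosen part of the structure (needed to speak of the functor \<open>X \<mapsto> X**\<close>);
  they are unique up to unique isomorphism.  Right duals are only required to exist.
\<close>

record ('o, 'm, 'k) rigcat = "('o, 'm, 'k) moncat" +
  Dual :: "'o \<Rightarrow> 'o"
  Ev :: "'o \<Rightarrow> 'm"
  Coev :: "'o \<Rightarrow> 'm"

locale rigid_category = monoidal_category C
  for C :: "('o, 'm, 'k::field, 'r) rigcat_scheme" (structure) +
  assumes left_duals: "X \<in> Obj C \<Longrightarrow> left_dual C X (Dual C X) (Ev C X) (Coev C X)"
    and right_duals: "X \<in> Obj C \<Longrightarrow> \<exists>D\<in>Obj C. \<exists>e n. left_dual C D X e n"

locale fusion_category = abelian_category C + rigid_category C
  for C :: "('o, 'm, 'k::field, 'r) rigcat_scheme" (structure) +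
  assumes hom_fin_dim:
      "\<lbrakk>X \<in> Obj C; Y \<in> Obj C\<rbrakk> \<Longrightarrow> vectorspace.fin_dim class_ring (Hom C X Y)"
    and semisimple:
      "X \<in> Obj C \<Longrightarrow> \<exists>Xs. (\<forall>Y\<in>set Xs. simple_obj C Y) \<and> direct_sum C X Xs"
    and finitely_many_simples: "\<exists>Xs. simple_reps C Xs"
    and simple_UnitO: "simple_obj C (UnitO C)"


section \<open>Invertible objects and Frobenius--Perron dimension\<close>

definition invertible_obj :: "('o, 'm, 'k, 'r) moncat_scheme \<Rightarrow> 'o \<Rightarrow> bool" where
  "invertible_obj C X \<longleftrightarrow> X \<in> Obj C \<and>
     (\<exists>Y\<in>Obj C. isomorphic C (X \<otimes>\<^sub>o\<^bsub>C\<^esub> Y) (UnitO C) \<and> isomorphic C (Y \<otimes>\<^sub>o\<^bsub>C\<^esub> X) (UnitO C))"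

definition pointed :: "('o, 'm, 'k, 'r) moncat_scheme \<Rightarrow> bool" where
  "pointed C \<longleftrightarrow> (\<forall>X. simple_obj C X \<longrightarrow> invertible_obj C X)"

definition iso_class :: "('o, 'm, 'k, 'r) lincat_scheme \<Rightarrow> 'o \<Rightarrow> 'o set" where
  "iso_class C X = {Y \<in> Obj C. isomorphic C X Y}"

definition invertibles :: "('o, 'm, 'k, 'r) moncat_scheme \<Rightarrow> 'o set monoid" where
  "invertibles C = \<lparr>carrier = iso_class C ` {X. invertible_obj C X},
     monoid.mult = (\<lambda>A B. {Z \<in> Obj C. \<exists>X\<in>A. \<exists>Y\<in>B. isomorphic C (X \<otimes>\<^sub>o\<^bsub>C\<^esub> Y) Z}),
     one = iso_class C (UnitO C)\<rparr>"

text \<open>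
  The matrix of left multiplication by \<open>X\<close> on the Grothendieck ring: its entry in row \<open>k\<close> and column
  \<open>j\<close> is the multiplicity of the \<open>k\<close>-th simple object in \<open>X\<close> tensored with the \<open>j\<close>-th one, which is
  the dimension of a hom-space because \<open>'k\<close> will be algebraically closed.
\<close>

definition fusion_mat :: "('o, 'm, 'k::field, 'r) moncat_scheme \<Rightarrow> 'o \<Rightarrow> real mat" where
  "fusion_mat C X = mat (length (simples C)) (length (simples C))
     (\<lambda>(k, j). real (vectorspace.dim class_ring
        (Hom C (simples C ! k) (X \<otimes>\<^sub>o\<^bsub>C\<^esub> (simples C ! j)))))"

definition FPdim_obj :: "('o, 'm, 'k::field, 'r) moncat_scheme \<Rightarrow> 'o \<Rightarrow> real" where
  "FPdim_obj C X = Max {x. 0 \<le> x \<and> eigenvalue (fusion_mat C X) x}"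

definition FPdim :: "('o, 'm, 'k::field, 'r) moncat_scheme \<Rightarrow> real" where
  "FPdim C = (\<Sum>X\<leftarrow>simples C. (FPdim_obj C X)\<^sup>2)"


section \<open>Fusion subcategories\<close>

text \<open>
  A fusion subcategory is a full subcategory, given by its set of objects.  Closure under
  subobjects includes closure under isomorphism.
\<close>

definition fusion_subcategory :: "('o, 'm, 'k, 'r) rigcat_scheme \<Rightarrow> 'o set \<Rightarrow> bool" where
  "fusion_subcategory C K \<longleftrightarrow> K \<subseteq> Obj C \<and> UnitO C \<in> K \<and>
     (\<forall>X\<in>K. \<forall>Y\<in>K. X \<otimes>\<^sub>o\<^bsub>C\<^esub> Y \<in> K) \<and>
     (\<forall>X\<in>K. Dual C X \<in> K) \<and>
     (\<forall>Xs X. set Xs \<subseteq> K \<and> direct_sum C X Xs \<longrightarrow> X \<in> K) \<and>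
     (\<forall>X\<in>K. \<forall>Y\<in>Obj C. \<forall>f. mono_arr C Y X f \<longrightarrow> Y \<in> K)"

definition adjoint_subcategory :: "('o, 'm, 'k, 'r) rigcat_scheme \<Rightarrow> 'o set" where
  "adjoint_subcategory C = \<Inter> {K. fusion_subcategory C K \<and>
     (\<forall>X. simple_obj C X \<longrightarrow> X \<otimes>\<^sub>o\<^bsub>C\<^esub> Dual C X \<in> K)}"

text \<open>The subcategory of multiples of the unit object.\<close>

definition Vec_subcategory :: "('o, 'm, 'k, 'r) moncat_scheme \<Rightarrow> 'o set" where
  "Vec_subcategory C = {X. \<exists>n. direct_sum C X (replicate n (UnitO C))}"


section \<open>Braidings\<close>

record ('o, 'm, 'k) brcat = "('o, 'm, 'k) rigcat" +
  Braid :: "'o \<Rightarrow> 'o \<Rightarrow> 'm"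

locale braided_fusion_category = fusion_category C
  for C :: "('o, 'm, 'k::field, 'r) brcat_scheme" (structure) +
  assumes Braid_iso:
      "\<lbrakk>X \<in> Obj C; Y \<in> Obj C\<rbrakk> \<Longrightarrow> iso_arr C (X \<otimes>\<^sub>o Y) (Y \<otimes>\<^sub>o X) (Braid C X Y)"
    and Braid_natural:
      "\<lbrakk>X \<in> Obj C; Y \<in> Obj C; X' \<in> Obj C; Y' \<in> Obj C; f \<in> arr C X X'; g \<in> arr C Y Y'\<rbrakk> \<Longrightarrow>
        Braid C X' Y' \<cdot> (f \<otimes>\<^sub>m g) = (g \<otimes>\<^sub>m f) \<cdot> Braid C X Y"
    and hexagon1:
      "\<lbrakk>X \<in> Obj C; Y \<in> Obj C; Z \<in> Obj C\<rbrakk> \<Longrightarrow>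
        Assoc C Y Z X \<cdot> Braid C X (Y \<otimes>\<^sub>o Z) \<cdot> Assoc C X Y Z =
        (Ident C Y \<otimes>\<^sub>m Braid C X Z) \<cdot> Assoc C Y X Z \<cdot> (Braid C X Y \<otimes>\<^sub>m Ident C Z)"
    and hexagon2:
      "\<lbrakk>X \<in> Obj C; Y \<in> Obj C; Z \<in> Obj C\<rbrakk> \<Longrightarrow>
        Assoc_inv C Z X Y \<cdot> Braid C (X \<otimes>\<^sub>o Y) Z \<cdot> Assoc_inv C X Y Z =
        (Braid C X Z \<otimes>\<^sub>m Ident C Y) \<cdot> Assoc_inv C X Z Y \<cdot> (Ident C X \<otimes>\<^sub>m Braid C Y Z)"

definition centralizer :: "('o, 'm, 'k, 'r) brcat_scheme \<Rightarrow> 'o set \<Rightarrow> 'o set" where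
  "centralizer C K =
     {Y \<in> Obj C. \<forall>X\<in>K. Braid C Y X \<cdot>\<^bsub>C\<^esub> Braid C X Y = Ident C (X \<otimes>\<^sub>o\<^bsub>C\<^esub> Y)}"

definition modular_subcategory :: "('o, 'm, 'k, 'r) brcat_scheme \<Rightarrow> 'o set \<Rightarrow> bool" where
  "modular_subcategory C K \<longleftrightarrow>
     fusion_subcategory C K \<and> K \<inter> centralizer C K = Vec_subcategory C"


section \<open>Spherical structures and modular categories\<close>

text \<open>
  For a pairing \<open>e : W \<otimes> Z \<rightarrow> 1\<close>, the induced morphism \<open>W \<rightarrow> Z*\<close>.  It gives the action of duality on
  morphisms, \<open>f* : Y* \<rightarrow> X*\<close> for \<open>f : X \<rightarrow> Y\<close>, and the canonical isomorphism
  \<open>Y* \<otimes> X* \<rightarrow> (X \<otimes> Y)*\<close>.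
\<close>

definition mate :: "('o, 'm, 'k, 'r) rigcat_scheme \<Rightarrow> 'o \<Rightarrow> 'o \<Rightarrow> 'm \<Rightarrow> 'm" where
  "mate C W Z e =
     LUnit C (Dual C Z) \<cdot>\<^bsub>C\<^esub> (e \<otimes>\<^sub>m\<^bsub>C\<^esub> Ident C (Dual C Z)) \<cdot>\<^bsub>C\<^esub> Assoc_inv C W Z (Dual C Z) \<cdot>\<^bsub>C\<^esub>
     (Ident C W \<otimes>\<^sub>m\<^bsub>C\<^esub> Coev C Z) \<cdot>\<^bsub>C\<^esub> inv_arr C (W \<otimes>\<^sub>o\<^bsub>C\<^esub> UnitO C) W (RUnit C W)"

definition dual_arr :: "('o, 'm, 'k, 'r) rigcat_scheme \<Rightarrow> 'o \<Rightarrow> 'o \<Rightarrow> 'm \<Rightarrow> 'm" where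
  "dual_arr C X Y f =
     mate C (Dual C Y) X (Ev C Y \<cdot>\<^bsub>C\<^esub> (Ident C (Dual C Y) \<otimes>\<^sub>m\<^bsub>C\<^esub> f))"

definition dual_tens :: "('o, 'm, 'k, 'r) rigcat_scheme \<Rightarrow> 'o \<Rightarrow> 'o \<Rightarrow> 'm" where
  "dual_tens C X Y = mate C (Dual C Y \<otimes>\<^sub>o\<^bsub>C\<^esub> Dual C X) (X \<otimes>\<^sub>o\<^bsub>C\<^esub> Y)
     (Ev C Y \<cdot>\<^bsub>C\<^esub>
      (Ident C (Dual C Y) \<otimes>\<^sub>m\<^bsub>C\<^esub>
        (LUnit C Y \<cdot>\<^bsub>C\<^esub> (Ev C X \<otimes>\<^sub>m\<^bsub>C\<^esub> Ident C Y) \<cdot>\<^bsub>C\<^esub> Assoc_inv C (Dual C X) X Y)) \<cdot>\<^bsub>C\<^esub>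
      Assoc C (Dual C Y) (Dual C X) (X \<otimes>\<^sub>o\<^bsub>C\<^esub> Y))"

text \<open>\<open>Piv C X\<close> is a component \<open>X \<rightarrow> X**\<close> of a pivotal structure.\<close>

record ('o, 'm, 'k) spcat = "('o, 'm, 'k) brcat" +
  Piv :: "'o \<Rightarrow> 'm"

text \<open>
  The trace \<open>1 \<rightarrow> X \<otimes> X* \<rightarrow> X** \<otimes> X* \<rightarrow> 1\<close> of an endomorphism, read as a scalar via
  \<open>End(1) = k\<close>.
\<close>

definition trace_arr :: "('o, 'm, 'k, 'r) spcat_scheme \<Rightarrow> 'o \<Rightarrow> 'm \<Rightarrow> 'k" where
  "trace_arr C X f = (THE c. c \<odot>\<^bsub>Hom C (UnitO C) (UnitO C)\<^esub> Ident C (UnitO C) =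
     Ev C (Dual C X) \<cdot>\<^bsub>C\<^esub> ((Piv C X \<cdot>\<^bsub>C\<^esub> f) \<otimes>\<^sub>m\<^bsub>C\<^esub> Ident C (Dual C X)) \<cdot>\<^bsub>C\<^esub> Coev C X)"

definition S_matrix :: "('o, 'm, 'k, 'r) spcat_scheme \<Rightarrow> 'k mat" where
  "S_matrix C = mat (length (simples C)) (length (simples C))
     (\<lambda>(i, j). let X = simples C ! i; Y = simples C ! j in
        trace_arr C (X \<otimes>\<^sub>o\<^bsub>C\<^esub> Y) (Braid C Y X \<cdot>\<^bsub>C\<^esub> Braid C X Y))"

text \<open>
  \<open>Piv_tens\<close> says that the pivotal structure is monoidal; it is the usual condition with the
  inverse of \<open>(dual_tens C X Y)*\<close> moved to the other side.  Compatibility with the unit object is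
  automatic.
\<close>

locale modular_category = braided_fusion_category C
  for C :: "('o, 'm, 'k::field, 'r) spcat_scheme" (structure) +
  assumes Piv_iso: "X \<in> Obj C \<Longrightarrow> iso_arr C X (Dual C (Dual C X)) (Piv C X)"
    and Piv_natural:
      "\<lbrakk>X \<in> Obj C; Y \<in> Obj C; f \<in> arr C X Y\<rbrakk> \<Longrightarrow>
        Piv C Y \<cdot> f = dual_arr C (Dual C Y) (Dual C X) (dual_arr C X Y f) \<cdot> Piv C X"
    and Piv_tens:
      "\<lbrakk>X \<in> Obj C; Y \<in> Obj C\<rbrakk> \<Longrightarrow>
        dual_arr C (Dual C Y \<otimes>\<^sub>o Dual C X) (Dual C (X \<otimes>\<^sub>o Y)) (dual_tens C X Y) \<cdot> Piv C (X \<otimes>\<^sub>o Y) =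
        dual_tens C (Dual C Y) (Dual C X) \<cdot> (Piv C X \<otimes>\<^sub>m Piv C Y)"
    and spherical:
      "X \<in> Obj C \<Longrightarrow> trace_arr C X (Ident C X) = trace_arr C (Dual C X) (Ident C (Dual C X))"
    and S_matrix_invertible: "invertible_mat (S_matrix C)"

end

theory Submission
  imports Defs
begin

text \<open>
  Double braiding restricts to a bicharacter on \<open>\<G>(C)\<close>, and \<open>\<G>(C\<^sub>a\<^sub>d)\<close> is its radical.  Indeed
  each \<open>Z \<otimes> Z*\<close> braids trivially with invertible objects.  Conversely, the rows of the S-matrix give
  all characters of the fusion ring, and those trivial on \<open>C\<^sub>a\<^sub>d\<close> come from invertible objects; a
  nonzero element \<open>a\<close> of the fusion ring of \<open>C\<^sub>a\<^sub>d\<close> that is killed by all other characters satisfies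
  \<open>g a = dim(g) a\<close> for each \<open>g\<close> in the radical, which puts \<open>g\<close> into \<open>C\<^sub>a\<^sub>d\<close>.

  Hence a complement \<open>W\<close> of \<open>\<G>(C\<^sub>a\<^sub>d)\<close> in \<open>\<G>(C)\<close>, which exists in \<open>\<int>\<^sub>p \<times> \<int>\<^sub>p\<close>, generates a pointed
  modular subcategory of dimension \<open>|W| = [\<G>(C) : \<G>(C\<^sub>a\<^sub>d)]\<close>.

  Coherence isomorphisms are avoided by computing in a strict monoidal category into which \<open>C\<close>
  embeds.
\<close>

section \<open>Typed arrows\<close>

text \<open>A closed loop of \<open>V\<close> around a simple object \<open>X\<close> acts as a
  scalar \<open>chi X V\<close>. The hexagons and the pivotal structure make it a character of the
  fusion ring in the variable \<open>V\<close>, and \<open>chi X V * dd X\<close> is the S-matrix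
  entry. Invertibility of the S-matrix thus makes dimensions nonzero, lets characters separate
  elements of the fusion ring, and forces every character to be one of these.

  The delicate point is that a character agreeing with that of the unit on all
  \<open>Z \<otimes> Z*\<close> belongs to an invertible object: transposing the S-matrix only
  yields a multiple of the unit object, and a separate diagrammatic argument bounds the multiple by
  one. The element \<open>a\<close> is then a product, over the noninvertible simple objects, of
  classes \<open>Z \<otimes> Z*\<close> minus a scalar.

  A complement \<open>W\<close> is nondegenerate for a formal reason: what is orthogonal to
  \<open>W\<close> within \<open>W\<close> is also orthogonal to the radical, hence to all
  invertible objects, hence lies in the radical and is trivial. Its dimension is a count of classes,
  since the fusion matrices of a pointed category are permutation matrices.\<close>

text \<open>
  \<open>Null\<close> stands for every ill-typed expression and is absorbing.  This makes associativity of
  composition, and later all laws of whiskering, unconditional equations.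
\<close>

datatype ('x, 'm) arw = Null | Arw (dm: 'x) (cd: 'x) (mp: 'm)

context linear_category
begin

definition ar :: "('o, 'm) arw \<Rightarrow> bool" where
  "ar f \<longleftrightarrow> f \<noteq> Null \<and> dm f \<in> Obj C \<and> cd f \<in> Obj C \<and> mp f \<in> arr C (dm f) (cd f)"

definition cmp :: "('o, 'm) arw \<Rightarrow> ('o, 'm) arw \<Rightarrow> ('o, 'm) arw"  (infixr \<open>\<star>\<close> 72) where
  "g \<star> f = (if ar g \<and> ar f \<and> dm g = cd f then Arw (dm f) (cd g) (Comp C (mp g) (mp f)) else Null)"

definition idn :: "'o \<Rightarrow> ('o, 'm) arw" where
  "idn X = (if X \<in> Obj C then Arw X X (Ident C X) else Null)"

lemma ar_Null [simp]: "\<not> ar Null"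
  by (simp add: ar_def)

lemma ar_Arw [simp]: "ar (Arw X Y f) \<longleftrightarrow> X \<in> Obj C \<and> Y \<in> Obj C \<and> f \<in> arr C X Y"
  by (simp add: ar_def)

lemma ar_mp: "ar f \<Longrightarrow> mp f \<in> arr C (dm f) (cd f)"
  by (simp add: ar_def)

lemma ar_objs [simp, dest]: "ar f \<Longrightarrow> dm f \<in> Obj C" "ar f \<Longrightarrow> cd f \<in> Obj C"
  by (simp_all add: ar_def)

lemma ar_eqI: "\<lbrakk>ar f; ar g; dm f = dm g; cd f = cd g; mp f = mp g\<rbrakk> \<Longrightarrow> f = g"
  by (cases f; cases g) auto

lemma ar_Arw_mp [simp]: "ar f \<Longrightarrow> Arw (dm f) (cd f) (mp f) = f"
  by (cases f) auto

lemma ar_cmp [simp]: "ar (g \<star> f) \<longleftrightarrow> ar g \<and> ar f \<and> dm g = cd f"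
  using Comp_arr[of "dm f" "cd f" "cd g" "mp f" "mp g"] ar_mp[of f] ar_mp[of g] by (auto simp: cmp_def)

lemma dm_cmp [simp]: "\<lbrakk>ar g; ar f; dm g = cd f\<rbrakk> \<Longrightarrow> dm (g \<star> f) = dm f"
  and cd_cmp [simp]: "\<lbrakk>ar g; ar f; dm g = cd f\<rbrakk> \<Longrightarrow> cd (g \<star> f) = cd g"
  by (simp_all add: cmp_def)

lemma mp_cmp: "\<lbrakk>ar g; ar f; dm g = cd f\<rbrakk> \<Longrightarrow> mp (g \<star> f) = Comp C (mp g) (mp f)"
  by (simp add: cmp_def)

lemma cmp_Null [simp]: "Null \<star> f = Null" "g \<star> Null = Null"
  by (simp_all add: cmp_def)

lemma cmp_bad: "\<not> (ar g \<and> ar f \<and> dm g = cd f) \<Longrightarrow> g \<star> f = Null"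
  by (auto simp: cmp_def)

lemma not_ar_cmp: "\<not> ar (g \<star> f) \<Longrightarrow> g \<star> f = Null"
  using cmp_bad by auto

lemma cmp_assoc: "(h \<star> g) \<star> f = h \<star> (g \<star> f)"
proof (cases "ar h \<and> ar g \<and> ar f \<and> dm h = cd g \<and> dm g = cd f")
  case True
  then show ?thesis
    using Comp_assoc[of "dm f" "cd f" "dm h" "cd h" "mp f" "mp g" "mp h"] ar_mp[of f] ar_mp[of g] ar_mp[of h]
    by (intro ar_eqI) (auto simp: mp_cmp)
next
  case False
  then have "\<not> ar ((h \<star> g) \<star> f)" "\<not> ar (h \<star> (g \<star> f))"
    by auto
  then show ?thesis
    by (metis not_ar_cmp)
qed

lemma ar_idn [simp]: "ar (idn X) \<longleftrightarrow> X \<in> Obj C"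
  by (simp add: idn_def Ident_arr)

lemma dm_idn [simp]: "X \<in> Obj C \<Longrightarrow> dm (idn X) = X"
  and cd_idn [simp]: "X \<in> Obj C \<Longrightarrow> cd (idn X) = X"
  and mp_idn: "X \<in> Obj C \<Longrightarrow> mp (idn X) = Ident C X"
  by (simp_all add: idn_def)

lemma cmp_idn_left [simp]: "\<lbrakk>ar f; cd f = Y\<rbrakk> \<Longrightarrow> idn Y \<star> f = f"
  by (rule ar_eqI) (auto simp: mp_cmp mp_idn intro!: Ident_left ar_mp)

lemma cmp_idn_right [simp]: "\<lbrakk>ar f; dm f = X\<rbrakk> \<Longrightarrow> f \<star> idn X = f"
  by (rule ar_eqI) (auto simp: mp_cmp mp_idn intro!: Ident_right ar_mp)


subsection \<open>Linear structure\<close>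

definition ad :: "('o, 'm) arw \<Rightarrow> ('o, 'm) arw \<Rightarrow> ('o, 'm) arw"  (infixl \<open>\<boxplus>\<close> 65) where
  "f \<boxplus> g = (if ar f \<and> ar g \<and> dm f = dm g \<and> cd f = cd g
     then Arw (dm f) (cd f) (mp f \<oplus>\<^bsub>Hom C (dm f) (cd f)\<^esub> mp g) else Null)"

definition sc :: "'k \<Rightarrow> ('o, 'm) arw \<Rightarrow> ('o, 'm) arw" where
  "sc c f = (if ar f then Arw (dm f) (cd f) (c \<odot>\<^bsub>Hom C (dm f) (cd f)\<^esub> mp f) else Null)"

definition zr :: "'o \<Rightarrow> 'o \<Rightarrow> ('o, 'm) arw" where
  "zr X Y = (if X \<in> Obj C \<and> Y \<in> Obj C then Arw X Y \<zero>\<^bsub>Hom C X Y\<^esub> else Null)"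

lemma class_ring_simps [simp]:
  "carrier (class_ring :: 'k ring) = UNIV" "x \<otimes>\<^bsub>(class_ring :: 'k ring)\<^esub> y = x * y"
  "x \<oplus>\<^bsub>(class_ring :: 'k ring)\<^esub> y = x + y" "\<zero>\<^bsub>(class_ring :: 'k ring)\<^esub> = 0"
  "\<one>\<^bsub>(class_ring :: 'k ring)\<^esub> = 1"
  by simp_all

lemma hom_module: "\<lbrakk>X \<in> Obj C; Y \<in> Obj C\<rbrakk> \<Longrightarrow> module class_ring (Hom C X Y)"
  using hom_vectorspace by (simp add: vectorspace_def)

lemma hom_group: "\<lbrakk>X \<in> Obj C; Y \<in> Obj C\<rbrakk> \<Longrightarrow> abelian_group (Hom C X Y)"
  using hom_module by (simp add: module_def)

lemma hom_monoid: "\<lbrakk>X \<in> Obj C; Y \<in> Obj C\<rbrakk> \<Longrightarrow> abelian_monoid (Hom C X Y)"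
  using hom_group abelian_group.axioms(1) by blast

lemma ar_ad [simp]: "ar (f \<boxplus> g) \<longleftrightarrow> ar f \<and> ar g \<and> dm f = dm g \<and> cd f = cd g"
  using abelian_monoid.a_closed[OF hom_monoid, of "dm f" "cd f" "mp f" "mp g"] ar_mp[of f] ar_mp[of g]
  by (auto simp: ad_def)

lemma dm_ad [simp]: "\<lbrakk>ar f; ar g; dm f = dm g; cd f = cd g\<rbrakk> \<Longrightarrow> dm (f \<boxplus> g) = dm g"
  and cd_ad [simp]: "\<lbrakk>ar f; ar g; dm f = dm g; cd f = cd g\<rbrakk> \<Longrightarrow> cd (f \<boxplus> g) = cd g"
  and mp_ad: "\<lbrakk>ar f; ar g; dm f = dm g; cd f = cd g\<rbrakk> \<Longrightarrow> mp (f \<boxplus> g) = mp f \<oplus>\<^bsub>Hom C (dm f) (cd f)\<^esub> mp g"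
  by (simp_all add: ad_def)

lemma not_ar_ad: "\<not> ar (g \<boxplus> f) \<Longrightarrow> g \<boxplus> f = Null"
  unfolding ar_ad by (auto simp: ad_def)

lemma ar_sc [simp]: "ar (sc c f) \<longleftrightarrow> ar f"
  using module.smult_closed[OF hom_module, of "dm f" "cd f" c "mp f"] ar_mp[of f] by (auto simp: sc_def)

lemma dm_sc [simp]: "ar f \<Longrightarrow> dm (sc c f) = dm f"
  and cd_sc [simp]: "ar f \<Longrightarrow> cd (sc c f) = cd f"
  and mp_sc: "ar f \<Longrightarrow> mp (sc c f) = c \<odot>\<^bsub>Hom C (dm f) (cd f)\<^esub> mp f"
  by (simp_all add: sc_def)

lemma not_ar_sc: "\<not> ar (sc c f) \<Longrightarrow> sc c f = Null"
  unfolding ar_sc by (simp add: sc_def)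

lemma ar_zr [simp]: "ar (zr X Y) \<longleftrightarrow> X \<in> Obj C \<and> Y \<in> Obj C"
  by (auto simp: zr_def abelian_monoid.zero_closed hom_monoid)

lemma dm_zr [simp]: "\<lbrakk>X \<in> Obj C; Y \<in> Obj C\<rbrakk> \<Longrightarrow> dm (zr X Y) = X"
  and cd_zr [simp]: "\<lbrakk>X \<in> Obj C; Y \<in> Obj C\<rbrakk> \<Longrightarrow> cd (zr X Y) = Y"
  and mp_zr: "\<lbrakk>X \<in> Obj C; Y \<in> Obj C\<rbrakk> \<Longrightarrow> mp (zr X Y) = \<zero>\<^bsub>Hom C X Y\<^esub>"
  by (simp_all add: zr_def)

lemma ad_cmp: "(g \<boxplus> h) \<star> f = (g \<star> f) \<boxplus> (h \<star> f)"
proof (cases "ar f \<and> ar g \<and> ar h \<and> dm g = cd f \<and> dm h = cd f \<and> cd g = cd h")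
  case True
  then show ?thesis
    using Comp_add_left[of "dm f" "cd f" "cd g" "mp f" "mp g" "mp h"] ar_mp[of f] ar_mp[of g] ar_mp[of h]
    by (intro ar_eqI) (auto simp: mp_cmp mp_ad)
next
  case False
  then have "\<not> ar ((g \<boxplus> h) \<star> f)" "\<not> ar ((g \<star> f) \<boxplus> (h \<star> f))"
    by auto
  then show ?thesis
    by (metis not_ar_cmp not_ar_ad)
qed

lemma cmp_ad: "f \<star> (g \<boxplus> h) = (f \<star> g) \<boxplus> (f \<star> h)"
proof (cases "ar f \<and> ar g \<and> ar h \<and> dm f = cd g \<and> dm h = dm g \<and> cd g = cd h")
  case True
  then show ?thesis
    using Comp_add_right[of "dm g" "cd g" "cd f" "mp g" "mp h" "mp f"] ar_mp[of f] ar_mp[of g] ar_mp[of h]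
    by (intro ar_eqI) (auto simp: mp_cmp mp_ad)
next
  case False
  then have "\<not> ar (f \<star> (g \<boxplus> h))" "\<not> ar ((f \<star> g) \<boxplus> (f \<star> h))"
    by auto
  then show ?thesis
    by (metis not_ar_cmp not_ar_ad)
qed

lemma sc_cmp: "sc c g \<star> f = sc c (g \<star> f)"
proof (cases "ar f \<and> ar g \<and> dm g = cd f")
  case True
  then show ?thesis
    using Comp_smult_left[of "dm f" "cd f" "cd g" "mp f" "mp g" c] ar_mp[of f] ar_mp[of g]
    by (intro ar_eqI) (auto simp: mp_cmp mp_sc)
next
  case False
  then have "\<not> ar (sc c g \<star> f)" "\<not> ar (sc c (g \<star> f))"
    by auto
  then show ?thesis
    by (metis not_ar_cmp not_ar_sc)
qed

lemma cmp_sc: "g \<star> sc c f = sc c (g \<star> f)"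
proof (cases "ar f \<and> ar g \<and> dm g = cd f")
  case True
  then show ?thesis
    using Comp_smult_right[of "dm f" "cd f" "cd g" "mp f" "mp g" c] ar_mp[of f] ar_mp[of g]
    by (intro ar_eqI) (auto simp: mp_cmp mp_sc)
next
  case False
  then have "\<not> ar (g \<star> sc c f)" "\<not> ar (sc c (g \<star> f))"
    by auto
  then show ?thesis
    by (metis not_ar_cmp not_ar_sc)
qed

lemma sc_sc [simp]: "sc a (sc b f) = sc (a * b) f"
proof (cases "ar f")
  case True
  then show ?thesis
    using module.smult_assoc1[OF hom_module, of "dm f" "cd f" a b "mp f"] ar_mp[OF True]
    by (intro ar_eqI) (auto simp: mp_sc)
qed (simp add: sc_def)

lemma sc_1 [simp]: "ar f \<Longrightarrow> sc 1 f = f"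
  using module.smult_one[OF hom_module, of "dm f" "cd f" "mp f"]
  by (intro ar_eqI) (auto simp: mp_sc ar_mp)

lemma sc_0: "ar f \<Longrightarrow> sc 0 f = zr (dm f) (cd f)"
  using module.lmult_0[OF hom_module, of "dm f" "cd f" "mp f"]
  by (intro ar_eqI) (auto simp: mp_sc mp_zr ar_mp)

lemma sc_zr: "\<lbrakk>X \<in> Obj C; Y \<in> Obj C\<rbrakk> \<Longrightarrow> sc c (zr X Y) = zr X Y"
  using sc_0[of "zr X Y"] sc_sc[of c 0 "zr X Y"] by simp

lemma sc_ad: "sc (a + b) f = sc a f \<boxplus> sc b f"
proof (cases "ar f")
  case True
  then show ?thesis
    using module.smult_l_distr[OF hom_module, of "dm f" "cd f" a b "mp f"] ar_mp[OF True]
    by (intro ar_eqI) (auto simp: mp_sc mp_ad)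
qed (simp add: sc_def ad_def)

lemma ad_sc: "sc a (f \<boxplus> g) = sc a f \<boxplus> sc a g"
proof (cases "ar f \<and> ar g \<and> dm f = dm g \<and> cd f = cd g")
  case True
  then show ?thesis
    using module.smult_r_distr[OF hom_module, of "dm f" "cd f" a "mp f" "mp g"] ar_mp[of f] ar_mp[of g]
    by (intro ar_eqI) (auto simp: mp_sc mp_ad)
next
  case False
  then have "\<not> ar (sc a (f \<boxplus> g))" "\<not> ar (sc a f \<boxplus> sc a g)"
    by auto
  then show ?thesis
    by (metis not_ar_sc not_ar_ad)
qed

lemma ad_zr_left [simp]: "\<lbrakk>ar f; dm f = X; cd f = Y\<rbrakk> \<Longrightarrow> zr X Y \<boxplus> f = f"
  by (intro ar_eqI) (auto simp: mp_ad mp_zr ar_mp intro!: abelian_monoid.l_zero[OF hom_monoid])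

lemma ad_zr_right [simp]: "\<lbrakk>ar f; dm f = X; cd f = Y\<rbrakk> \<Longrightarrow> f \<boxplus> zr X Y = f"
  by (intro ar_eqI) (auto simp: mp_ad mp_zr ar_mp intro!: abelian_monoid.r_zero[OF hom_monoid])

lemma zr_cmp: "\<lbrakk>ar f; cd f = X; Y \<in> Obj C\<rbrakk> \<Longrightarrow> zr X Y \<star> f = zr (dm f) Y"
  using sc_cmp[of 0 "zr X Y" f] by (auto simp: sc_0)

lemma cmp_zr: "\<lbrakk>ar f; dm f = Y; X \<in> Obj C\<rbrakk> \<Longrightarrow> f \<star> zr X Y = zr X (cd f)"
  using cmp_sc[of f 0 "zr X Y"] by (auto simp: sc_0)

lemma ad_neg: "ar f \<Longrightarrow> f \<boxplus> sc (-1) f = zr (dm f) (cd f)"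
  using sc_ad[of 1 "-1" f] by (simp add: sc_0)

lemma sc_eq_zr: "\<lbrakk>ar f; sc c f = zr (dm f) (cd f); c \<noteq> 0\<rbrakk> \<Longrightarrow> f = zr (dm f) (cd f)"
  by (metis ar_objs left_inverse sc_1 sc_sc sc_zr)

lemma ad_assoc: "(f \<boxplus> g) \<boxplus> h = f \<boxplus> (g \<boxplus> h)"
proof (cases "ar f \<and> ar g \<and> ar h \<and> dm f = dm g \<and> cd f = cd g \<and> dm g = dm h \<and> cd g = cd h")
  case True
  then show ?thesis
    using abelian_monoid.a_assoc[OF hom_monoid, of "dm f" "cd f" "mp f" "mp g" "mp h"]
      ar_mp[of f] ar_mp[of g] ar_mp[of h]
    by (intro ar_eqI) (auto simp: mp_ad)
next
  case False
  then have "\<not> ar ((f \<boxplus> g) \<boxplus> h)" "\<not> ar (f \<boxplus> (g \<boxplus> h))"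
    by auto
  then show ?thesis
    by (metis not_ar_ad)
qed

lemma ad_eq_iff: "\<lbrakk>ar f; ar g; dm f = dm g; cd f = cd g\<rbrakk> \<Longrightarrow> f \<boxplus> sc (-1) g = zr (dm f) (cd f) \<longleftrightarrow> f = g"
proof
  assume a: "ar f" "ar g" "dm f = dm g" "cd f = cd g" and e: "f \<boxplus> sc (-1) g = zr (dm f) (cd f)"
  have "sc (-1) g \<boxplus> g = zr (dm g) (cd g)"
    using a sc_ad[of "-1" 1 g] by (simp add: sc_0)
  then have "f = f \<boxplus> (sc (-1) g \<boxplus> g)"
    using a by simp
  also have "\<dots> = g"
    using a e by (simp flip: ad_assoc)
  finally show "f = g" .
qed (simp add: ad_neg)


subsection \<open>Isomorphisms\<close>

text \<open>A relation instead of the choice \<open>inv_arr\<close>: inverses can be exhibited,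
  swapped and composed, and uniqueness identifies them with the chosen ones.\<close>

definition inverses :: "('o, 'm) arw \<Rightarrow> ('o, 'm) arw \<Rightarrow> bool" where
  "inverses f g \<longleftrightarrow> ar f \<and> ar g \<and> dm f = cd g \<and> cd f = dm g \<and> g \<star> f = idn (dm f) \<and> f \<star> g = idn (dm g)"

text \<open>The last two equations are unconditional rewrite rules that cancel adjacent inverses in
  right-nested composites; ill-typed arguments end in \<open>Null\<close>.\<close>

lemma inversesD:
  assumes "inverses f g"
  shows "ar f" "ar g" "dm g = cd f" "cd g = dm f" "g \<star> f = idn (dm f)" "f \<star> g = idn (cd f)"
    "g \<star> (f \<star> h) = (if cd h = dm f \<and> ar h then h else Null)" "f \<star> (g \<star> k) = (if cd k = cd f \<and> ar k then k else Null)"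
  using assms by (auto simp: inverses_def simp flip: cmp_assoc) (auto simp: cmp_def)

lemma inverses_sym: "inverses f g \<Longrightarrow> inverses g f"
  by (auto simp: inverses_def)

lemma inverses_unique: "\<lbrakk>inverses f g; inverses f h\<rbrakk> \<Longrightarrow> g = h"
  by (metis cmp_assoc cmp_idn_left cmp_idn_right inverses_def)

lemma iso_arr_inverses: "\<lbrakk>X \<in> Obj C; Y \<in> Obj C\<rbrakk> \<Longrightarrow> iso_arr C X Y f \<longleftrightarrow> (\<exists>g. inverses (Arw X Y f) g)"
proof
  assume o: "X \<in> Obj C" "Y \<in> Obj C" and "iso_arr C X Y f"
  then obtain g where "f \<in> arr C X Y" "g \<in> arr C Y X" "Comp C g f = Ident C X" "Comp C f g = Ident C Y"
    unfolding iso_arr_def by auto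
  then have "inverses (Arw X Y f) (Arw Y X g)"
    using o by (auto simp: inverses_def cmp_def idn_def)
  then show "\<exists>g. inverses (Arw X Y f) g"
    by blast
next
  assume o: "X \<in> Obj C" "Y \<in> Obj C" and "\<exists>g. inverses (Arw X Y f) g"
  then obtain g where g: "inverses (Arw X Y f) g"
    by blast
  then have m: "mp g \<in> arr C Y X"
    using ar_mp[of g] by (auto simp: inverses_def)
  have "Comp C (mp g) f = mp (g \<star> Arw X Y f)" "Comp C f (mp g) = mp (Arw X Y f \<star> g)"
    using g by (auto simp: inverses_def cmp_def)
  then have "Comp C (mp g) f = Ident C X" "Comp C f (mp g) = Ident C Y"
    using inversesD(5,6)[OF g] o by (simp_all add: mp_idn)
  then show "iso_arr C X Y f"
    using g m unfolding iso_arr_def inverses_def by auto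
qed

lemma inv_arr_inverses:
  assumes "X \<in> Obj C" "Y \<in> Obj C" "iso_arr C X Y f"
  shows "inverses (Arw X Y f) (Arw Y X (inv_arr C X Y f))"
proof -
  obtain g where g: "inverses (Arw X Y f) g"
    using assms iso_arr_inverses by blast
  then have gA: "g = Arw Y X (mp g)"
    by (cases g) (auto simp: inverses_def)
  have fa: "f \<in> arr C X Y"
    using assms(3) by (simp add: iso_arr_def)
  have "inv_arr C X Y f = mp g"
    unfolding inv_arr_def
  proof (rule the_equality)
    have "mp (g \<star> Arw X Y f) = Ident C X" "mp (Arw X Y f \<star> g) = Ident C Y"
      using inversesD(5,6)[OF g] assms by (simp_all add: mp_idn)
    then show "mp g \<in> arr C Y X \<and> Comp C (mp g) f = Ident C X \<and> Comp C f (mp g) = Ident C Y"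
      using g ar_mp[of g] by (auto simp: inverses_def cmp_def)
    fix h assume h: "h \<in> arr C Y X \<and> Comp C h f = Ident C X \<and> Comp C f h = Ident C Y"
    then have "inverses (Arw X Y f) (Arw Y X h)"
      using assms fa by (auto simp: inverses_def cmp_def idn_def)
    then show "h = mp g"
      using inverses_unique[OF g] by (metis arw.sel(3))
  qed
  then show ?thesis
    using g gA by simp
qed

lemma isomorphic_iff: "\<lbrakk>X \<in> Obj C; Y \<in> Obj C\<rbrakk> \<Longrightarrow> isomorphic C X Y \<longleftrightarrow> (\<exists>f g. inverses f g \<and> dm f = X \<and> cd f = Y)"
proof -
  assume o: "X \<in> Obj C" "Y \<in> Obj C"
  show ?thesis
  proof
    assume "isomorphic C X Y"
    then obtain f where "iso_arr C X Y f"
      by (auto simp: isomorphic_def)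
    then obtain g where "inverses (Arw X Y f) g"
      using o iso_arr_inverses by blast
    then show "\<exists>f g. inverses f g \<and> dm f = X \<and> cd f = Y"
      by fastforce
  next
    assume "\<exists>f g. inverses f g \<and> dm f = X \<and> cd f = Y"
    then obtain f g where "inverses f g" "dm f = X" "cd f = Y"
      by blast
    moreover then have "f = Arw X Y (mp f)"
      by (cases f) (auto simp: inverses_def)
    ultimately show "isomorphic C X Y"
      using o iso_arr_inverses unfolding isomorphic_def by metis
  qed
qed

lemma inverses_cmp: "\<lbrakk>inverses f g; inverses h k; dm h = cd f\<rbrakk> \<Longrightarrow> inverses (h \<star> f) (g \<star> k)"
  unfolding inverses_def by (auto simp: cmp_assoc) (metis cmp_assoc cmp_idn_left)+

lemma isomorphic_refl: "X \<in> Obj C \<Longrightarrow> isomorphic C X X"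
  using isomorphic_iff[of X X] by (auto simp: inverses_def intro!: exI[of _ "idn X"])

lemma isomorphic_sym: "\<lbrakk>X \<in> Obj C; Y \<in> Obj C; isomorphic C X Y\<rbrakk> \<Longrightarrow> isomorphic C Y X"
  using isomorphic_iff[of X Y] isomorphic_iff[of Y X] inverses_sym by (metis inverses_def)

lemma isomorphic_trans:
  assumes "X \<in> Obj C" "Y \<in> Obj C" "Z \<in> Obj C" "isomorphic C X Y" "isomorphic C Y Z"
  shows "isomorphic C X Z"
proof -
  obtain f g h k where "inverses f g" "dm f = X" "cd f = Y" "inverses h k" "dm h = Y" "cd h = Z"
    using assms isomorphic_iff by metis
  then show ?thesis
    using assms inverses_cmp[of f g h k] isomorphic_iff[of X Z] inversesD(1)[of f g] inversesD(1)[of h k]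
    by (metis dm_cmp cd_cmp)
qed

end

section \<open>Monoidal categories on typed arrows\<close>

context monoidal_category
begin

declare UnitO_Obj [simp] TensO_Obj [simp]

definition tns :: "('o, 'm) arw \<Rightarrow> ('o, 'm) arw \<Rightarrow> ('o, 'm) arw"  (infixr \<open>\<boxtimes>\<close> 75) where
  "f \<boxtimes> g = (if ar f \<and> ar g then Arw (dm f \<otimes>\<^sub>o dm g) (cd f \<otimes>\<^sub>o cd g) (mp f \<otimes>\<^sub>m mp g) else Null)"

lemma ar_tns [simp]: "ar (f \<boxtimes> g) \<longleftrightarrow> ar f \<and> ar g"
  using TensM_arr[of "dm f" "cd f" "dm g" "cd g" "mp f" "mp g"] ar_mp[of f] ar_mp[of g]
  by (auto simp: tns_def)

lemma dm_tns [simp]: "\<lbrakk>ar f; ar g\<rbrakk> \<Longrightarrow> dm (f \<boxtimes> g) = dm f \<otimes>\<^sub>o dm g"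
  and cd_tns [simp]: "\<lbrakk>ar f; ar g\<rbrakk> \<Longrightarrow> cd (f \<boxtimes> g) = cd f \<otimes>\<^sub>o cd g"
  and mp_tns: "\<lbrakk>ar f; ar g\<rbrakk> \<Longrightarrow> mp (f \<boxtimes> g) = mp f \<otimes>\<^sub>m mp g"
  by (simp_all add: tns_def)

lemma tns_Null [simp]: "Null \<boxtimes> f = Null" "f \<boxtimes> Null = Null"
  by (simp_all add: tns_def)

lemma not_ar_tns: "\<not> ar (f \<boxtimes> g) \<Longrightarrow> f \<boxtimes> g = Null"
  unfolding ar_tns by (simp add: tns_def)

lemma tns_cmp:
  assumes "dm g = cd f" "dm g' = cd f'"
  shows "(g \<star> f) \<boxtimes> (g' \<star> f') = (g \<boxtimes> g') \<star> (f \<boxtimes> f')"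
proof (cases "ar f \<and> ar g \<and> ar f' \<and> ar g'")
  case True
  then show ?thesis
    using assms TensM_Comp[of "dm f" "cd f" "cd g" "dm f'" "cd f'" "cd g'" "mp f" "mp g" "mp f'" "mp g'"]
      ar_mp[of f] ar_mp[of g] ar_mp[of f'] ar_mp[of g']
    by (intro ar_eqI) (auto simp: mp_cmp mp_tns)
next
  case False
  then have "\<not> ar ((g \<star> f) \<boxtimes> (g' \<star> f'))" "\<not> ar ((g \<boxtimes> g') \<star> (f \<boxtimes> f'))"
    by auto
  then show ?thesis
    by (metis not_ar_cmp not_ar_tns)
qed

lemma tns_idn [simp]: "\<lbrakk>X \<in> Obj C; Y \<in> Obj C\<rbrakk> \<Longrightarrow> idn X \<boxtimes> idn Y = idn (X \<otimes>\<^sub>o Y)"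
  by (intro ar_eqI) (auto simp: mp_idn mp_tns TensM_Ident)

lemma cmp_tns: "\<lbrakk>ar f; ar g; ar f'; ar g'; dm g = cd f; dm g' = cd f'\<rbrakk> \<Longrightarrow>
    (g \<boxtimes> g') \<star> (f \<boxtimes> f') = (g \<star> f) \<boxtimes> (g' \<star> f')"
  by (simp add: tns_cmp)

lemma idn_tns_cmp: "\<lbrakk>X \<in> Obj C; dm g = cd f\<rbrakk> \<Longrightarrow> idn X \<boxtimes> (g \<star> f) = (idn X \<boxtimes> g) \<star> (idn X \<boxtimes> f)"
  using tns_cmp[of "idn X" "idn X" g f] by simp

lemma cmp_tns_idn: "\<lbrakk>X \<in> Obj C; dm g = cd f\<rbrakk> \<Longrightarrow> (g \<star> f) \<boxtimes> idn X = (g \<boxtimes> idn X) \<star> (f \<boxtimes> idn X)"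
  using tns_cmp[of g f "idn X" "idn X"] by simp

lemma sc_tns: "sc c f \<boxtimes> g = sc c (f \<boxtimes> g)"
proof (cases "ar f \<and> ar g")
  case True
  then show ?thesis
    using TensM_smult_left[of "dm f" "cd f" "dm g" "cd g" "mp f" "mp g" c] ar_mp[of f] ar_mp[of g]
    by (intro ar_eqI) (auto simp: mp_tns mp_sc)
qed (auto simp: tns_def sc_def)

lemma tns_sc: "f \<boxtimes> sc c g = sc c (f \<boxtimes> g)"
proof (cases "ar f \<and> ar g")
  case True
  then show ?thesis
    using TensM_smult_right[of "dm f" "cd f" "dm g" "cd g" "mp f" "mp g" c] ar_mp[of f] ar_mp[of g]
    by (intro ar_eqI) (auto simp: mp_tns mp_sc)
qed (auto simp: tns_def sc_def)

lemma ad_tns: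
  assumes "ar f" "ar g" "dm f = dm g" "cd f = cd g"
  shows "(f \<boxplus> g) \<boxtimes> h = (f \<boxtimes> h) \<boxplus> (g \<boxtimes> h)"
proof (cases "ar h")
  case True
  then show ?thesis
    using assms TensM_add_left[of "dm f" "cd f" "dm h" "cd h" "mp f" "mp g" "mp h"] ar_mp[of f] ar_mp[of g] ar_mp[of h]
    by (intro ar_eqI) (auto simp: mp_ad mp_tns)
qed (simp add: tns_def ad_def)

lemma tns_ad:
  assumes "ar f" "ar g" "dm f = dm g" "cd f = cd g"
  shows "h \<boxtimes> (f \<boxplus> g) = (h \<boxtimes> f) \<boxplus> (h \<boxtimes> g)"
proof (cases "ar h")
  case True
  then show ?thesis
    using assms TensM_add_right[of "dm h" "cd h" "dm f" "cd f" "mp h" "mp f" "mp g"] ar_mp[of f] ar_mp[of g] ar_mp[of h]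
    by (intro ar_eqI) (auto simp: mp_ad mp_tns)
qed (simp add: tns_def ad_def)

definition alp :: "'o \<Rightarrow> 'o \<Rightarrow> 'o \<Rightarrow> ('o, 'm) arw" where
  "alp X Y Z = Arw ((X \<otimes>\<^sub>o Y) \<otimes>\<^sub>o Z) (X \<otimes>\<^sub>o Y \<otimes>\<^sub>o Z) (Assoc C X Y Z)"

definition alq :: "'o \<Rightarrow> 'o \<Rightarrow> 'o \<Rightarrow> ('o, 'm) arw" where
  "alq X Y Z = Arw (X \<otimes>\<^sub>o Y \<otimes>\<^sub>o Z) ((X \<otimes>\<^sub>o Y) \<otimes>\<^sub>o Z) (Assoc_inv C X Y Z)"

definition lu :: "'o \<Rightarrow> ('o, 'm) arw" where
  "lu X = Arw (UnitO C \<otimes>\<^sub>o X) X (LUnit C X)"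

definition lv :: "'o \<Rightarrow> ('o, 'm) arw" where
  "lv X = Arw X (UnitO C \<otimes>\<^sub>o X) (inv_arr C (UnitO C \<otimes>\<^sub>o X) X (LUnit C X))"

definition ru :: "'o \<Rightarrow> ('o, 'm) arw" where
  "ru X = Arw (X \<otimes>\<^sub>o UnitO C) X (RUnit C X)"

definition rv :: "'o \<Rightarrow> ('o, 'm) arw" where
  "rv X = Arw X (X \<otimes>\<^sub>o UnitO C) (inv_arr C (X \<otimes>\<^sub>o UnitO C) X (RUnit C X))"

lemma inverses_al: "\<lbrakk>X \<in> Obj C; Y \<in> Obj C; Z \<in> Obj C\<rbrakk> \<Longrightarrow> inverses (alp X Y Z) (alq X Y Z)"
  unfolding alp_def alq_def by (intro inv_arr_inverses Assoc_iso) auto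

lemma inverses_lu: "X \<in> Obj C \<Longrightarrow> inverses (lu X) (lv X)"
  unfolding lu_def lv_def by (intro inv_arr_inverses LUnit_iso) auto

lemma inverses_ru: "X \<in> Obj C \<Longrightarrow> inverses (ru X) (rv X)"
  unfolding ru_def rv_def by (intro inv_arr_inverses RUnit_iso) auto

lemma al_simps [simp]:
  "\<lbrakk>X \<in> Obj C; Y \<in> Obj C; Z \<in> Obj C\<rbrakk> \<Longrightarrow> ar (alp X Y Z)"
  "\<lbrakk>X \<in> Obj C; Y \<in> Obj C; Z \<in> Obj C\<rbrakk> \<Longrightarrow> ar (alq X Y Z)"
  "dm (alp X Y Z) = (X \<otimes>\<^sub>o Y) \<otimes>\<^sub>o Z" "cd (alp X Y Z) = X \<otimes>\<^sub>o Y \<otimes>\<^sub>o Z"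
  "cd (alq X Y Z) = (X \<otimes>\<^sub>o Y) \<otimes>\<^sub>o Z" "dm (alq X Y Z) = X \<otimes>\<^sub>o Y \<otimes>\<^sub>o Z"
  "\<lbrakk>X \<in> Obj C; Y \<in> Obj C; Z \<in> Obj C\<rbrakk> \<Longrightarrow> alp X Y Z \<star> alq X Y Z = idn (X \<otimes>\<^sub>o Y \<otimes>\<^sub>o Z)"
  "\<lbrakk>X \<in> Obj C; Y \<in> Obj C; Z \<in> Obj C\<rbrakk> \<Longrightarrow> alq X Y Z \<star> alp X Y Z = idn ((X \<otimes>\<^sub>o Y) \<otimes>\<^sub>o Z)"
  using inverses_al[of X Y Z] by (auto simp: inverses_def) (auto simp: alp_def alq_def)

lemma lu_simps [simp]:
  "X \<in> Obj C \<Longrightarrow> ar (lu X)" "X \<in> Obj C \<Longrightarrow> ar (lv X)"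
  "dm (lu X) = UnitO C \<otimes>\<^sub>o X" "cd (lu X) = X" "cd (lv X) = UnitO C \<otimes>\<^sub>o X" "dm (lv X) = X"
  "X \<in> Obj C \<Longrightarrow> lu X \<star> lv X = idn X" "X \<in> Obj C \<Longrightarrow> lv X \<star> lu X = idn (UnitO C \<otimes>\<^sub>o X)"
  using inverses_lu[of X] by (auto simp: inverses_def) (auto simp: lu_def lv_def)

lemma ru_simps [simp]:
  "X \<in> Obj C \<Longrightarrow> ar (ru X)" "X \<in> Obj C \<Longrightarrow> ar (rv X)"
  "dm (ru X) = X \<otimes>\<^sub>o UnitO C" "cd (ru X) = X" "cd (rv X) = X \<otimes>\<^sub>o UnitO C" "dm (rv X) = X"
  "X \<in> Obj C \<Longrightarrow> ru X \<star> rv X = idn X" "X \<in> Obj C \<Longrightarrow> rv X \<star> ru X = idn (X \<otimes>\<^sub>o UnitO C)"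
  using inverses_ru[of X] by (auto simp: inverses_def) (auto simp: ru_def rv_def)

lemma alp_nat: "\<lbrakk>ar f; ar g; ar h\<rbrakk> \<Longrightarrow>
    alp (cd f) (cd g) (cd h) \<star> ((f \<boxtimes> g) \<boxtimes> h) = (f \<boxtimes> g \<boxtimes> h) \<star> alp (dm f) (dm g) (dm h)"
  using Assoc_natural[of "dm f" "dm g" "dm h" "cd f" "cd g" "cd h" "mp f" "mp g" "mp h"]
    ar_mp[of f] ar_mp[of g] ar_mp[of h]
  by (intro ar_eqI) (auto simp: mp_cmp mp_tns, simp add: alp_def)

lemma lu_nat: "ar f \<Longrightarrow> lu (cd f) \<star> (idn (UnitO C) \<boxtimes> f) = f \<star> lu (dm f)"
  using LUnit_natural[of "dm f" "cd f" "mp f"] ar_mp[of f]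
  by (intro ar_eqI) (auto simp: mp_cmp mp_tns mp_idn, simp add: lu_def)

lemma ru_nat: "ar f \<Longrightarrow> ru (cd f) \<star> (f \<boxtimes> idn (UnitO C)) = f \<star> ru (dm f)"
  using RUnit_natural[of "dm f" "cd f" "mp f"] ar_mp[of f]
  by (intro ar_eqI) (auto simp: mp_cmp mp_tns mp_idn, simp add: ru_def)

lemma pentagon_arw: "\<lbrakk>W \<in> Obj C; X \<in> Obj C; Y \<in> Obj C; Z \<in> Obj C\<rbrakk> \<Longrightarrow>
    (idn W \<boxtimes> alp X Y Z) \<star> alp W (X \<otimes>\<^sub>o Y) Z \<star> (alp W X Y \<boxtimes> idn Z) = alp W X (Y \<otimes>\<^sub>o Z) \<star> alp (W \<otimes>\<^sub>o X) Y Z"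
  using pentagon[of W X Y Z]
  by (intro ar_eqI) (auto simp: mp_cmp mp_tns mp_idn, simp add: alp_def)

lemma triangle_arw: "\<lbrakk>X \<in> Obj C; Y \<in> Obj C\<rbrakk> \<Longrightarrow>
    (idn X \<boxtimes> lu Y) \<star> alp X (UnitO C) Y = ru X \<boxtimes> idn Y"
  using triangle[of X Y]
  by (intro ar_eqI) (auto simp: mp_cmp mp_tns mp_idn, simp add: alp_def lu_def ru_def)

text \<open>Inverting the two parallel isomorphisms of a commuting square gives a commuting square.
  Naturality and coherence thereby pass to inverses without a new diagram chase.\<close>

lemma nat_inverse:
  assumes "inverses a b" "inverses a' b'" "a' \<star> f = g \<star> a" "ar f" "ar g" "cd f = dm a'" "dm g = cd a"
  shows "b' \<star> g = f \<star> b"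
proof -
  note i = inversesD[OF assms(1)] inversesD[OF assms(2)]
  have d: "dm f = dm a"
    using dm_cmp[of a' f] dm_cmp[of g a] assms(3-7) i(1-4,9-12) by metis
  have "b' \<star> g = b' \<star> ((g \<star> a) \<star> b)"
    using i assms by (simp add: cmp_assoc)
  also have "\<dots> = b' \<star> ((a' \<star> f) \<star> b)"
    by (simp only: assms(3))
  also have "\<dots> = (b' \<star> a') \<star> f \<star> b"
    by (simp only: cmp_assoc)
  also have "\<dots> = f \<star> b"
    using i assms d by simp
  finally show ?thesis .
qed

text \<open>Naturality of the unit constraint makes tensoring with the unit object a conjugation by
  isomorphisms.\<close>

lemma faithful_unit_left: "\<lbrakk>ar f; ar g; dm f = dm g; cd f = cd g; idn (UnitO C) \<boxtimes> f = idn (UnitO C) \<boxtimes> g\<rbrakk> \<Longrightarrow> f = g"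
  using lu_nat[of f] lu_nat[of g] lu_simps(7)[of "dm g"]
  by (metis ar_objs(1) cmp_assoc cmp_idn_right)

lemma faithful_unit_right: "\<lbrakk>ar f; ar g; dm f = dm g; cd f = cd g; f \<boxtimes> idn (UnitO C) = g \<boxtimes> idn (UnitO C)\<rbrakk> \<Longrightarrow> f = g"
  using ru_nat[of f] ru_nat[of g] ru_simps(7)[of "dm g"]
  by (metis ar_objs(1) cmp_assoc cmp_idn_right)

lemma cancel_iso_right: "\<lbrakk>inverses a b; f \<star> a = g \<star> a; ar f; ar g; dm f = cd a; dm g = cd a\<rbrakk> \<Longrightarrow> f = g"
  by (metis cmp_assoc cmp_idn_right inversesD(6))

lemma inverses_tns: "\<lbrakk>inverses f g; inverses h k\<rbrakk> \<Longrightarrow> inverses (f \<boxtimes> h) (g \<boxtimes> k)"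
  by (auto simp: inverses_def cmp_tns)

lemma inverses_idn: "X \<in> Obj C \<Longrightarrow> inverses (idn X) (idn X)"
  by (simp add: inverses_def)

text \<open>Kelly's redundancy of one of Mac Lane's original axioms.\<close>

lemma lu_tns:
  assumes o: "X \<in> Obj C" "Y \<in> Obj C"
  shows "lu (X \<otimes>\<^sub>o Y) \<star> alp (UnitO C) X Y = lu X \<boxtimes> idn Y"
proof (rule faithful_unit_left)
  let ?I = "UnitO C"
  \<comment> \<open>Under an extra unit factor the triangle is available on both sides; the pentagon
    for \<open>I\<close>, \<open>I\<close>, \<open>X\<close>, \<open>Y\<close> connects its two
    instances.\<close>
  have "(idn ?I \<boxtimes> (lu (X \<otimes>\<^sub>o Y) \<star> alp ?I X Y)) \<star> alp ?I (?I \<otimes>\<^sub>o X) Y \<star> (alp ?I ?I X \<boxtimes> idn Y)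
      = (idn ?I \<boxtimes> lu (X \<otimes>\<^sub>o Y)) \<star> alp ?I ?I (X \<otimes>\<^sub>o Y) \<star> alp (?I \<otimes>\<^sub>o ?I) X Y"
    using o by (simp add: idn_tns_cmp cmp_assoc pentagon_arw)
  also have "\<dots> = (ru ?I \<boxtimes> idn X \<boxtimes> idn Y) \<star> alp (?I \<otimes>\<^sub>o ?I) X Y"
    using o triangle_arw[of ?I "X \<otimes>\<^sub>o Y"] by (simp flip: cmp_assoc)
  also have "\<dots> = alp ?I X Y \<star> ((ru ?I \<boxtimes> idn X) \<boxtimes> idn Y)"
    using o alp_nat[of "ru ?I" "idn X" "idn Y"] by simp
  also have "\<dots> = alp ?I X Y \<star> (((idn ?I \<boxtimes> lu X) \<star> alp ?I ?I X) \<boxtimes> idn Y)"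
    using o by (simp add: triangle_arw)
  also have "\<dots> = (alp ?I X Y \<star> ((idn ?I \<boxtimes> lu X) \<boxtimes> idn Y)) \<star> (alp ?I ?I X \<boxtimes> idn Y)"
    using o by (simp add: cmp_tns_idn cmp_assoc)
  also have "\<dots> = (idn ?I \<boxtimes> lu X \<boxtimes> idn Y) \<star> alp ?I (?I \<otimes>\<^sub>o X) Y \<star> (alp ?I ?I X \<boxtimes> idn Y)"
    using o alp_nat[of "idn ?I" "lu X" "idn Y"] by (simp add: cmp_assoc)
  finally have e: "(idn ?I \<boxtimes> (lu (X \<otimes>\<^sub>o Y) \<star> alp ?I X Y)) \<star> alp ?I (?I \<otimes>\<^sub>o X) Y \<star> (alp ?I ?I X \<boxtimes> idn Y)
      = (idn ?I \<boxtimes> lu X \<boxtimes> idn Y) \<star> alp ?I (?I \<otimes>\<^sub>o X) Y \<star> (alp ?I ?I X \<boxtimes> idn Y)" .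
  have i: "inverses (alp ?I (?I \<otimes>\<^sub>o X) Y \<star> (alp ?I ?I X \<boxtimes> idn Y)) ((alq ?I ?I X \<boxtimes> idn Y) \<star> alq ?I (?I \<otimes>\<^sub>o X) Y)"
    using o by (intro inverses_cmp inverses_tns inverses_al inverses_idn) auto
  show "idn ?I \<boxtimes> (lu (X \<otimes>\<^sub>o Y) \<star> alp ?I X Y) = idn ?I \<boxtimes> (lu X \<boxtimes> idn Y)"
    by (rule cancel_iso_right[OF i e]) (use o in auto)
qed (use o in auto)


section \<open>Strictification\<close>

text \<open>
  A list of objects acts on \<open>C\<close> by iterated left tensoring.  The strict category has lists as objects;
  an arrow is a natural transformation between these actions that is compatible with tensoring
  from the right.  Right whiskering is then substitution and left whiskering is pointwise, so the
  associativity constraints disappear.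
\<close>

fun act :: "'o list \<Rightarrow> 'o \<Rightarrow> 'o" where
  "act [] Z = Z"
| "act (X # l) Z = X \<otimes>\<^sub>o act l Z"

fun lw :: "'o list \<Rightarrow> ('o, 'm) arw \<Rightarrow> ('o, 'm) arw" where
  "lw [] f = f"
| "lw (X # l) f = idn X \<boxtimes> lw l f"

text \<open>The structure isomorphisms from \<open>act l Z \<otimes>\<^sub>o W\<close> to
  \<open>act l (Z \<otimes>\<^sub>o W)\<close> that make \<open>act l\<close> a functor of right
  module categories.\<close>

fun al :: "'o list \<Rightarrow> 'o \<Rightarrow> 'o \<Rightarrow> ('o, 'm) arw" where
  "al [] Z W = idn (Z \<otimes>\<^sub>o W)"
| "al (X # l) Z W = (idn X \<boxtimes> al l Z W) \<star> alp X (act l Z) W"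

lemma act_append [simp]: "act (l @ m) Z = act l (act m Z)"
  by (induction l) auto

lemma act_Obj [simp]: "\<lbrakk>set l \<subseteq> Obj C; Z \<in> Obj C\<rbrakk> \<Longrightarrow> act l Z \<in> Obj C"
  by (induction l) auto

lemma lw_append [simp]: "lw (l @ m) f = lw l (lw m f)"
  by (induction l) auto

lemma lw_simps [simp]:
  "\<lbrakk>set l \<subseteq> Obj C; ar f\<rbrakk> \<Longrightarrow> ar (lw l f)"
  "\<lbrakk>set l \<subseteq> Obj C; ar f\<rbrakk> \<Longrightarrow> dm (lw l f) = act l (dm f)"
  "\<lbrakk>set l \<subseteq> Obj C; ar f\<rbrakk> \<Longrightarrow> cd (lw l f) = act l (cd f)"
  by (induction l) auto

lemma lw_idn [simp]: "\<lbrakk>set l \<subseteq> Obj C; Z \<in> Obj C\<rbrakk> \<Longrightarrow> lw l (idn Z) = idn (act l Z)"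
  by (induction l) auto

lemma lw_cmp: "\<lbrakk>set l \<subseteq> Obj C; ar g; ar f; dm g = cd f\<rbrakk> \<Longrightarrow> lw l (g \<star> f) = lw l g \<star> lw l f"
  by (induction l) (auto simp: idn_tns_cmp)

lemma lw_sc: "lw l (sc c f) = sc c (lw l f)"
  by (induction l) (auto simp: tns_sc)

lemma lw_ad: "\<lbrakk>set l \<subseteq> Obj C; ar f; ar g; dm f = dm g; cd f = cd g\<rbrakk> \<Longrightarrow> lw l (f \<boxplus> g) = lw l f \<boxplus> lw l g"
  by (induction l) (auto simp: tns_ad)

lemma al_ar [simp]:
  "\<lbrakk>set l \<subseteq> Obj C; Z \<in> Obj C; W \<in> Obj C\<rbrakk> \<Longrightarrow> ar (al l Z W) \<and> dm (al l Z W) = act l Z \<otimes>\<^sub>o W \<and> cd (al l Z W) = act l (Z \<otimes>\<^sub>o W)"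
  by (induction l) auto

lemma al_append: "\<lbrakk>set l \<subseteq> Obj C; set m \<subseteq> Obj C; Z \<in> Obj C; W \<in> Obj C\<rbrakk> \<Longrightarrow>
    al (l @ m) Z W = lw l (al m Z W) \<star> al l (act m Z) W"
  by (induction l) (auto simp: idn_tns_cmp cmp_assoc)

lemma al_nat: "\<lbrakk>set l \<subseteq> Obj C; ar f; ar g\<rbrakk> \<Longrightarrow>
    al l (cd f) (cd g) \<star> (lw l f \<boxtimes> g) = lw l (f \<boxtimes> g) \<star> al l (dm f) (dm g)"
proof (induction l)
  case (Cons X l)
  have "al (X # l) (cd f) (cd g) \<star> (lw (X # l) f \<boxtimes> g)
      = (idn X \<boxtimes> al l (cd f) (cd g)) \<star> (idn X \<boxtimes> lw l f \<boxtimes> g) \<star> alp X (act l (dm f)) (dm g)"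
    using Cons.prems alp_nat[of "idn X" "lw l f" g] by (simp add: cmp_assoc)
  also have "\<dots> = (idn X \<boxtimes> (al l (cd f) (cd g) \<star> (lw l f \<boxtimes> g))) \<star> alp X (act l (dm f)) (dm g)"
    using Cons.prems by (simp add: idn_tns_cmp cmp_assoc)
  also have "\<dots> = lw (X # l) (f \<boxtimes> g) \<star> al (X # l) (dm f) (dm g)"
    using Cons by (simp add: idn_tns_cmp cmp_assoc)
  finally show ?case .
qed simp

text \<open>Morphisms of right module functors: the last two conjuncts are naturality and
  compatibility with \<open>al\<close>. Prescribing \<open>Null\<close> outside \<open>Obj C\<close>
  reduces equality of arrows to equality of components at objects.\<close>

definition sar :: "('o list, 'o \<Rightarrow> ('o, 'm) arw) arw \<Rightarrow> bool" where
  "sar F \<longleftrightarrow> F \<noteq> Null \<and> set (dm F) \<subseteq> Obj C \<and> set (cd F) \<subseteq> Obj C \<and>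
     (\<forall>Z\<in>Obj C. ar (mp F Z) \<and> dm (mp F Z) = act (dm F) Z \<and> cd (mp F Z) = act (cd F) Z) \<and>
     (\<forall>Z. Z \<notin> Obj C \<longrightarrow> mp F Z = Null) \<and>
     (\<forall>g. ar g \<longrightarrow> mp F (cd g) \<star> lw (dm F) g = lw (cd F) g \<star> mp F (dm g)) \<and>
     (\<forall>Z\<in>Obj C. \<forall>W\<in>Obj C. mp F (Z \<otimes>\<^sub>o W) \<star> al (dm F) Z W = al (cd F) Z W \<star> (mp F Z \<boxtimes> idn W))"

lemma sarI:
  assumes "set l \<subseteq> Obj C" "set m \<subseteq> Obj C"
    "\<And>Z. Z \<in> Obj C \<Longrightarrow> ar (\<phi> Z) \<and> dm (\<phi> Z) = act l Z \<and> cd (\<phi> Z) = act m Z"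
    "\<And>Z. Z \<notin> Obj C \<Longrightarrow> \<phi> Z = Null"
    "\<And>g. ar g \<Longrightarrow> \<phi> (cd g) \<star> lw l g = lw m g \<star> \<phi> (dm g)"
    "\<And>Z W. \<lbrakk>Z \<in> Obj C; W \<in> Obj C\<rbrakk> \<Longrightarrow> \<phi> (Z \<otimes>\<^sub>o W) \<star> al l Z W = al m Z W \<star> (\<phi> Z \<boxtimes> idn W)"
  shows "sar (Arw l m \<phi>)"
  using assms by (simp add: sar_def)

lemma sarD:
  assumes "sar F"
  shows "set (dm F) \<subseteq> Obj C" "set (cd F) \<subseteq> Obj C"
    "Z \<in> Obj C \<Longrightarrow> ar (mp F Z)" "Z \<in> Obj C \<Longrightarrow> dm (mp F Z) = act (dm F) Z"
    "Z \<in> Obj C \<Longrightarrow> cd (mp F Z) = act (cd F) Z" "Z \<notin> Obj C \<Longrightarrow> mp F Z = Null"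
    "ar g \<Longrightarrow> mp F (cd g) \<star> lw (dm F) g = lw (cd F) g \<star> mp F (dm g)"
    "\<lbrakk>Z \<in> Obj C; W \<in> Obj C\<rbrakk> \<Longrightarrow> mp F (Z \<otimes>\<^sub>o W) \<star> al (dm F) Z W = al (cd F) Z W \<star> (mp F Z \<boxtimes> idn W)"
  using assms unfolding sar_def by auto

lemma sar_Null [simp]: "\<not> sar Null"
  by (simp add: sar_def)

lemma sar_objs [simp]: "sar F \<Longrightarrow> set (dm F) \<subseteq> Obj C" "sar F \<Longrightarrow> set (cd F) \<subseteq> Obj C"
  using sarD by auto

lemma sar_objs' [simp]: "\<lbrakk>x \<in> set (dm F); sar F\<rbrakk> \<Longrightarrow> x \<in> Obj C" "\<lbrakk>x \<in> set (cd F); sar F\<rbrakk> \<Longrightarrow> x \<in> Obj C"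
  using sar_objs by blast+

lemma sar_eqI:
  assumes "sar F" "sar G" "dm F = dm G" "cd F = cd G" "\<And>Z. Z \<in> Obj C \<Longrightarrow> mp F Z = mp G Z"
  shows "F = G"
proof -
  have "mp F = mp G"
    using assms sarD(6)[of F] sarD(6)[of G] by (intro ext) metis
  then show ?thesis
    using assms by (cases F; cases G) auto
qed

definition cp :: "('o list, 'o \<Rightarrow> ('o, 'm) arw) arw \<Rightarrow> ('o list, 'o \<Rightarrow> ('o, 'm) arw) arw \<Rightarrow>
    ('o list, 'o \<Rightarrow> ('o, 'm) arw) arw"  (infixr \<open>\<diamond>\<close> 72) where
  "G \<diamond> F = (if sar G \<and> sar F \<and> dm G = cd F then Arw (dm F) (cd G) (\<lambda>Z. mp G Z \<star> mp F Z) else Null)"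

definition sid :: "'o list \<Rightarrow> ('o list, 'o \<Rightarrow> ('o, 'm) arw) arw" where
  "sid l = (if set l \<subseteq> Obj C then Arw l l (\<lambda>Z. if Z \<in> Obj C then idn (act l Z) else Null) else Null)"

definition wh :: "'o list \<Rightarrow> ('o list, 'o \<Rightarrow> ('o, 'm) arw) arw \<Rightarrow> 'o list \<Rightarrow>
    ('o list, 'o \<Rightarrow> ('o, 'm) arw) arw" where
  "wh l F r = (if set l \<subseteq> Obj C \<and> sar F \<and> set r \<subseteq> Obj C then
     Arw (l @ dm F @ r) (l @ cd F @ r) (\<lambda>Z. if Z \<in> Obj C then lw l (mp F (act r Z)) else Null) else Null)"

lemma sar_cp [simp]: "sar (G \<diamond> F) \<longleftrightarrow> sar G \<and> sar F \<and> dm G = cd F"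
proof
  assume "sar G \<and> sar F \<and> dm G = cd F"
  then have a: "sar G" "sar F" "dm G = cd F"
    by auto
  note s = sarD[OF a(1)] sarD[OF a(2)]
  have "sar (Arw (dm F) (cd G) (\<lambda>Z. mp G Z \<star> mp F Z))"
  proof (rule sarI)
    fix g assume g: "ar g"
    have "(mp G (cd g) \<star> mp F (cd g)) \<star> lw (dm F) g = mp G (cd g) \<star> lw (cd F) g \<star> mp F (dm g)"
      using s(15)[OF g] by (simp add: cmp_assoc)
    also have "\<dots> = lw (cd G) g \<star> mp G (dm g) \<star> mp F (dm g)"
      using s(7)[OF g] a(3) by (simp flip: cmp_assoc)
    finally show "(mp G (cd g) \<star> mp F (cd g)) \<star> lw (dm F) g = lw (cd G) g \<star> mp G (dm g) \<star> mp F (dm g)" .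
  next
    fix Z W assume o: "Z \<in> Obj C" "W \<in> Obj C"
    have "(mp G (Z \<otimes>\<^sub>o W) \<star> mp F (Z \<otimes>\<^sub>o W)) \<star> al (dm F) Z W = mp G (Z \<otimes>\<^sub>o W) \<star> al (cd F) Z W \<star> (mp F Z \<boxtimes> idn W)"
      using s(16)[OF o] by (simp add: cmp_assoc)
    also have "\<dots> = al (cd G) Z W \<star> (mp G Z \<boxtimes> idn W) \<star> (mp F Z \<boxtimes> idn W)"
      using s(8)[OF o] a(3) by (simp flip: cmp_assoc)
    also have "\<dots> = al (cd G) Z W \<star> ((mp G Z \<star> mp F Z) \<boxtimes> idn W)"
      using s o a(3) by (simp add: cmp_tns_idn)
    finally show "(mp G (Z \<otimes>\<^sub>o W) \<star> mp F (Z \<otimes>\<^sub>o W)) \<star> al (dm F) Z W = al (cd G) Z W \<star> ((mp G Z \<star> mp F Z) \<boxtimes> idn W)" .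
  qed (use s a in auto)
  then show "sar (G \<diamond> F)"
    using a by (simp add: cp_def)
qed (auto simp: cp_def split: if_splits)

lemma dm_cp [simp]: "\<lbrakk>sar G; sar F; dm G = cd F\<rbrakk> \<Longrightarrow> dm (G \<diamond> F) = dm F"
  and cd_cp [simp]: "\<lbrakk>sar G; sar F; dm G = cd F\<rbrakk> \<Longrightarrow> cd (G \<diamond> F) = cd G"
  and mp_cp: "\<lbrakk>sar G; sar F; dm G = cd F\<rbrakk> \<Longrightarrow> mp (G \<diamond> F) Z = mp G Z \<star> mp F Z"
  by (simp_all add: cp_def)

lemma cp_Null [simp]: "Null \<diamond> F = Null" "G \<diamond> Null = Null"
  by (simp_all add: cp_def)

lemma not_sar_cp: "\<not> sar (G \<diamond> F) \<Longrightarrow> G \<diamond> F = Null"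
  unfolding sar_cp by (auto simp: cp_def)

lemma cp_assoc: "(H \<diamond> G) \<diamond> F = H \<diamond> G \<diamond> F"
proof (cases "sar H \<and> sar G \<and> sar F \<and> dm H = cd G \<and> dm G = cd F")
  case True
  then show ?thesis
    by (intro sar_eqI) (auto simp: mp_cp cmp_assoc)
next
  case False
  then have "\<not> sar ((H \<diamond> G) \<diamond> F)" "\<not> sar (H \<diamond> G \<diamond> F)"
    by auto
  then show ?thesis
    by (metis not_sar_cp)
qed

lemma sar_sid [simp]: "sar (sid l) \<longleftrightarrow> set l \<subseteq> Obj C"
proof
  assume l: "set l \<subseteq> Obj C"
  then have "sar (Arw l l (\<lambda>Z. if Z \<in> Obj C then idn (act l Z) else Null))"
    by (intro sarI) auto
  then show "sar (sid l)"
    using l by (simp add: sid_def)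
qed (auto simp: sid_def split: if_splits)

lemma dm_sid [simp]: "set l \<subseteq> Obj C \<Longrightarrow> dm (sid l) = l"
  and cd_sid [simp]: "set l \<subseteq> Obj C \<Longrightarrow> cd (sid l) = l"
  and mp_sid: "\<lbrakk>set l \<subseteq> Obj C; Z \<in> Obj C\<rbrakk> \<Longrightarrow> mp (sid l) Z = idn (act l Z)"
  by (simp_all add: sid_def)

lemma cp_sid_left [simp]: "\<lbrakk>sar F; cd F = l\<rbrakk> \<Longrightarrow> sid l \<diamond> F = F"
  by (rule sar_eqI) (auto simp: mp_cp mp_sid sarD)

lemma cp_sid_right [simp]: "\<lbrakk>sar F; dm F = l\<rbrakk> \<Longrightarrow> F \<diamond> sid l = F"
  by (rule sar_eqI) (auto simp: mp_cp mp_sid sarD)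

lemma sar_wh [simp]: "sar (wh l F r) \<longleftrightarrow> set l \<subseteq> Obj C \<and> sar F \<and> set r \<subseteq> Obj C"
proof
  assume "set l \<subseteq> Obj C \<and> sar F \<and> set r \<subseteq> Obj C"
  then have a: "sar F" "set l \<subseteq> Obj C" "set r \<subseteq> Obj C"
    by auto
  note s = sarD[OF a(1)]
  have "sar (Arw (l @ dm F @ r) (l @ cd F @ r) (\<lambda>Z. if Z \<in> Obj C then lw l (mp F (act r Z)) else Null))"
  proof (rule sarI)
    fix g assume g: "ar g"
    have "lw l (mp F (act r (cd g))) \<star> lw (l @ dm F @ r) g = lw l (mp F (cd (lw r g)) \<star> lw (dm F) (lw r g))"
      using s g a by (simp add: lw_cmp)
    also have "\<dots> = lw l (lw (cd F) (lw r g) \<star> mp F (dm (lw r g)))"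
      using s(7)[of "lw r g"] g a by (metis lw_simps(1))
    also have "\<dots> = lw (l @ cd F @ r) g \<star> lw l (mp F (act r (dm g)))"
      using s g a by (simp add: lw_cmp)
    finally show "(if cd g \<in> Obj C then lw l (mp F (act r (cd g))) else Null) \<star> lw (l @ dm F @ r) g
        = lw (l @ cd F @ r) g \<star> (if dm g \<in> Obj C then lw l (mp F (act r (dm g))) else Null)"
      using g by simp
  next
    fix Z W assume o: "Z \<in> Obj C" "W \<in> Obj C"
    let ?Z = "act r Z"
    \<comment> \<open>Tensoring with \<open>W\<close> is moved out in three stages: past
      \<open>r\<close> by naturality of \<open>F\<close> along \<open>al r Z W\<close>, past
      \<open>F\<close> by its own compatibility, and past \<open>l\<close> by naturality of
      \<open>al\<close>.\<close>
    have n: "mp F (act r (Z \<otimes>\<^sub>o W)) \<star> lw (dm F) (al r Z W) = lw (cd F) (al r Z W) \<star> mp F (?Z \<otimes>\<^sub>o W)"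
      using s(7)[of "al r Z W"] o a by simp
    have m: "mp F (?Z \<otimes>\<^sub>o W) \<star> al (dm F) ?Z W = al (cd F) ?Z W \<star> (mp F ?Z \<boxtimes> idn W)"
      using s(8)[of ?Z W] o a by simp
    have "lw l (mp F (act r (Z \<otimes>\<^sub>o W))) \<star> al (l @ dm F @ r) Z W
        = lw l ((mp F (act r (Z \<otimes>\<^sub>o W)) \<star> lw (dm F) (al r Z W)) \<star> al (dm F) ?Z W) \<star> al l (act (dm F) ?Z) W"
      using s o a by (simp add: al_append lw_cmp cmp_assoc)
    also have "\<dots> = lw l (lw (cd F) (al r Z W) \<star> al (cd F) ?Z W \<star> (mp F ?Z \<boxtimes> idn W)) \<star> al l (act (dm F) ?Z) W"
      by (simp only: n cmp_assoc m)
    also have "\<dots> = lw l (lw (cd F) (al r Z W)) \<star> lw l (al (cd F) ?Z W) \<star> lw l (mp F ?Z \<boxtimes> idn W) \<star> al l (act (dm F) ?Z) W"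
      using s o a by (simp add: lw_cmp cmp_assoc)
    also have "lw l (mp F ?Z \<boxtimes> idn W) \<star> al l (act (dm F) ?Z) W = al l (act (cd F) ?Z) W \<star> (lw l (mp F ?Z) \<boxtimes> idn W)"
      using al_nat[of l "mp F ?Z" "idn W"] s o a by simp
    also have "lw l (lw (cd F) (al r Z W)) \<star> lw l (al (cd F) ?Z W) \<star> al l (act (cd F) ?Z) W \<star> (lw l (mp F ?Z) \<boxtimes> idn W)
        = al (l @ cd F @ r) Z W \<star> (lw l (mp F ?Z) \<boxtimes> idn W)"
      using s o a by (simp add: al_append lw_cmp cmp_assoc)
    finally show "(if Z \<otimes>\<^sub>o W \<in> Obj C then lw l (mp F (act r (Z \<otimes>\<^sub>o W))) else Null) \<star> al (l @ dm F @ r) Z W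
        = al (l @ cd F @ r) Z W \<star> ((if Z \<in> Obj C then lw l (mp F (act r Z)) else Null) \<boxtimes> idn W)"
      using o by simp
  qed (use s a in auto)
  then show "sar (wh l F r)"
    using a by (simp add: wh_def)
qed (auto simp: wh_def split: if_splits)

lemma dm_wh [simp]: "\<lbrakk>set l \<subseteq> Obj C; sar F; set r \<subseteq> Obj C\<rbrakk> \<Longrightarrow> dm (wh l F r) = l @ dm F @ r"
  and cd_wh [simp]: "\<lbrakk>set l \<subseteq> Obj C; sar F; set r \<subseteq> Obj C\<rbrakk> \<Longrightarrow> cd (wh l F r) = l @ cd F @ r"
  and mp_wh: "\<lbrakk>set l \<subseteq> Obj C; sar F; set r \<subseteq> Obj C; Z \<in> Obj C\<rbrakk> \<Longrightarrow> mp (wh l F r) Z = lw l (mp F (act r Z))"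
  by (simp_all add: wh_def)

lemma not_sar_wh: "\<not> sar (wh l F r) \<Longrightarrow> wh l F r = Null"
  unfolding sar_wh by (auto simp: wh_def)

lemma wh_cp [simp]: "wh l (G \<diamond> F) r = wh l G r \<diamond> wh l F r"
proof (cases "set l \<subseteq> Obj C \<and> set r \<subseteq> Obj C \<and> sar G \<and> sar F \<and> dm G = cd F")
  case True
  then show ?thesis
    by (intro sar_eqI) (auto simp: mp_cp mp_wh lw_cmp sarD)
next
  case False
  then have "\<not> sar (wh l (G \<diamond> F) r)" "\<not> sar (wh l G r \<diamond> wh l F r)"
    by auto
  then show ?thesis
    by (metis not_sar_cp not_sar_wh)
qed

lemma wh_wh [simp]: "wh l (wh l' F r') r = wh (l @ l') F (r' @ r)"
proof (cases "set l \<subseteq> Obj C \<and> set r \<subseteq> Obj C \<and> set l' \<subseteq> Obj C \<and> set r' \<subseteq> Obj C \<and> sar F")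
  case True
  then show ?thesis
    by (intro sar_eqI) (auto simp: mp_wh)
next
  case False
  then have "\<not> sar (wh l (wh l' F r') r)" "\<not> sar (wh (l @ l') F (r' @ r))"
    by auto
  then show ?thesis
    by (metis not_sar_wh)
qed

lemma wh_nil [simp]: "sar F \<Longrightarrow> wh [] F [] = F"
  by (rule sar_eqI) (auto simp: mp_wh)

lemma wh_sid [simp]: "\<lbrakk>set l \<subseteq> Obj C; set r \<subseteq> Obj C; set m \<subseteq> Obj C\<rbrakk> \<Longrightarrow> wh l (sid m) r = sid (l @ m @ r)"
  by (rule sar_eqI) (auto simp: mp_wh mp_sid)

text \<open>Naturality of \<open>F\<close> at the components of \<open>G\<close> is precisely the
  interchange law.\<close>

lemma exchange0:
  assumes "sar F" "sar G"
  shows "wh [] F (cd G) \<diamond> wh (dm F) G [] = wh (cd F) G [] \<diamond> wh [] F (dm G)"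
proof (rule sar_eqI)
  fix Z assume "Z \<in> Obj C"
  then show "mp (wh [] F (cd G) \<diamond> wh (dm F) G []) Z = mp (wh (cd F) G [] \<diamond> wh [] F (dm G)) Z"
    using assms sarD(7)[OF assms(1), of "mp G Z"] sarD(3-5)[OF assms(2), of Z] by (simp add: mp_cp mp_wh)
qed (use assms in auto)

text \<open>The move of string diagrams that slides two boxes on disjoint strands past one another;
  \<open>m\<close> is the word between them.\<close>

lemma exchange:
  assumes "sar F" "sar G" "set l \<subseteq> Obj C" "set m \<subseteq> Obj C" "set r \<subseteq> Obj C"
  shows "wh l F (m @ cd G @ r) \<diamond> wh (l @ dm F @ m) G r = wh (l @ cd F @ m) G r \<diamond> wh l F (m @ dm G @ r)"
proof -
  have "wh l (wh [] F (cd (wh m G r)) \<diamond> wh (dm F) (wh m G r) []) [] = wh l (wh (cd F) (wh m G r) [] \<diamond> wh [] F (dm (wh m G r))) []"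
    using assms exchange0[of F "wh m G r"] by simp
  then show ?thesis
    using assms by simp
qed

end

context monoidal_category
begin

subsection \<open>Embedding the category into its strictification\<close>

text \<open>By \<open>nat_inverse\<close>, componentwise inverses inherit both naturality and
  compatibility with \<open>al\<close>.\<close>

lemma sar_inverse:
  assumes F: "sar F" and G: "\<And>Z. Z \<in> Obj C \<Longrightarrow> inverses (mp F Z) (\<psi> Z)" "\<And>Z. Z \<notin> Obj C \<Longrightarrow> \<psi> Z = Null"
  shows "sar (Arw (cd F) (dm F) \<psi>)" "F \<diamond> Arw (cd F) (dm F) \<psi> = sid (cd F)" "Arw (cd F) (dm F) \<psi> \<diamond> F = sid (dm F)"
proof -
  note s = sarD[OF F]
  show S: "sar (Arw (cd F) (dm F) \<psi>)"
  proof (rule sarI)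
    fix Z assume "Z \<in> Obj C"
    then show "ar (\<psi> Z) \<and> dm (\<psi> Z) = act (cd F) Z \<and> cd (\<psi> Z) = act (dm F) Z"
      using s inversesD(1-4)[OF G(1)] by auto
  next
    fix g assume g: "ar g"
    show "\<psi> (cd g) \<star> lw (cd F) g = lw (dm F) g \<star> \<psi> (dm g)"
      by (rule nat_inverse[OF G(1) G(1)]) (use s g in auto)
  next
    fix Z W assume o: "Z \<in> Obj C" "W \<in> Obj C"
    show "\<psi> (Z \<otimes>\<^sub>o W) \<star> al (cd F) Z W = al (dm F) Z W \<star> (\<psi> Z \<boxtimes> idn W)"
      by (rule nat_inverse[OF inverses_tns[OF G(1) inverses_idn] G(1)]) (use s o in auto)
  qed (use s G in auto)
  show "F \<diamond> Arw (cd F) (dm F) \<psi> = sid (cd F)" "Arw (cd F) (dm F) \<psi> \<diamond> F = sid (dm F)"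
    by (rule sar_eqI; use S F s inversesD(5,6)[OF G(1)] in \<open>simp add: mp_cp mp_sid\<close>)+
qed

definition emb :: "('o, 'm) arw \<Rightarrow> ('o list, 'o \<Rightarrow> ('o, 'm) arw) arw" where
  "emb f = (if ar f then Arw [dm f] [cd f] (\<lambda>Z. if Z \<in> Obj C then f \<boxtimes> idn Z else Null) else Null)"

lemma sar_emb [simp]: "sar (emb f) \<longleftrightarrow> ar f"
proof
  assume f: "ar f"
  have "sar (Arw [dm f] [cd f] (\<lambda>Z. if Z \<in> Obj C then f \<boxtimes> idn Z else Null))"
  proof (rule sarI)
    fix Z W assume o: "Z \<in> Obj C" "W \<in> Obj C"
    then show "(if Z \<otimes>\<^sub>o W \<in> Obj C then f \<boxtimes> idn (Z \<otimes>\<^sub>o W) else Null) \<star> al [dm f] Z W =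
        al [cd f] Z W \<star> ((if Z \<in> Obj C then f \<boxtimes> idn Z else Null) \<boxtimes> idn W)"
      using f alp_nat[of f "idn Z" "idn W"] by simp
  qed (use f in \<open>auto simp: cmp_tns\<close>)
  then show "sar (emb f)"
    using f by (simp add: emb_def)
qed (auto simp: emb_def split: if_splits)

lemma dm_emb [simp]: "ar f \<Longrightarrow> dm (emb f) = [dm f]"
  and cd_emb [simp]: "ar f \<Longrightarrow> cd (emb f) = [cd f]"
  and mp_emb: "\<lbrakk>ar f; Z \<in> Obj C\<rbrakk> \<Longrightarrow> mp (emb f) Z = f \<boxtimes> idn Z"
  and emb_Null [simp]: "emb Null = Null"
  by (simp_all add: emb_def)

lemma emb_cmp: "emb (g \<star> f) = emb g \<diamond> emb f"
proof (cases "ar g \<and> ar f \<and> dm g = cd f")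
  case True
  then show ?thesis
    by (intro sar_eqI) (auto simp: mp_emb mp_cp cmp_tns_idn)
next
  case False
  then have "\<not> ar (g \<star> f)" "\<not> sar (emb g \<diamond> emb f)"
    by auto
  then show ?thesis
    by (metis not_ar_cmp not_sar_cp emb_Null)
qed

lemma emb_idn [simp]: "X \<in> Obj C \<Longrightarrow> emb (idn X) = sid [X]"
  by (rule sar_eqI) (auto simp: mp_emb mp_sid)

text \<open>The component at the unit object determines \<open>f\<close>, because tensoring with the
  unit is faithful. Equations in \<open>C\<close> may therefore be checked after embedding.\<close>

lemma emb_inj: "\<lbrakk>ar f; ar g; emb f = emb g\<rbrakk> \<Longrightarrow> f = g"
  by (metis UnitO_Obj cd_emb dm_emb faithful_unit_right list.inject mp_emb)

text \<open>\<open>mu\<close> merges two letters into their tensor product and \<open>nu\<close>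
  splits them again; \<open>ui\<close> creates and \<open>uo\<close> deletes a letter for the unit
  object. Through these isomorphisms every tensor product can be replaced by a word.\<close>

definition mu :: "'o \<Rightarrow> 'o \<Rightarrow> ('o list, 'o \<Rightarrow> ('o, 'm) arw) arw" where
  "mu X Y = Arw [X, Y] [X \<otimes>\<^sub>o Y] (\<lambda>Z. if Z \<in> Obj C then alq X Y Z else Null)"

definition nu :: "'o \<Rightarrow> 'o \<Rightarrow> ('o list, 'o \<Rightarrow> ('o, 'm) arw) arw" where
  "nu X Y = Arw [X \<otimes>\<^sub>o Y] [X, Y] (\<lambda>Z. if Z \<in> Obj C then alp X Y Z else Null)"

definition ui :: "('o list, 'o \<Rightarrow> ('o, 'm) arw) arw" where
  "ui = Arw [] [UnitO C] (\<lambda>Z. if Z \<in> Obj C then lv Z else Null)"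

definition uo :: "('o list, 'o \<Rightarrow> ('o, 'm) arw) arw" where
  "uo = Arw [UnitO C] [] (\<lambda>Z. if Z \<in> Obj C then lu Z else Null)"

text \<open>Naturality is that of the associator; compatibility with tensoring from the right is the
  pentagon.\<close>

lemma sar_nu [simp]: "\<lbrakk>X \<in> Obj C; Y \<in> Obj C\<rbrakk> \<Longrightarrow> sar (nu X Y)"
  unfolding nu_def
proof (rule sarI)
  assume o: "X \<in> Obj C" "Y \<in> Obj C"
  fix g assume "ar g"
  then show "(if cd g \<in> Obj C then alp X Y (cd g) else Null) \<star> lw [X \<otimes>\<^sub>o Y] g =
      lw [X, Y] g \<star> (if dm g \<in> Obj C then alp X Y (dm g) else Null)"
    using o alp_nat[of "idn X" "idn Y" g] by simp
next
  assume o: "X \<in> Obj C" "Y \<in> Obj C"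
  fix Z W assume "Z \<in> Obj C" "W \<in> Obj C"
  then show "(if Z \<otimes>\<^sub>o W \<in> Obj C then alp X Y (Z \<otimes>\<^sub>o W) else Null) \<star> al [X \<otimes>\<^sub>o Y] Z W =
      al [X, Y] Z W \<star> ((if Z \<in> Obj C then alp X Y Z else Null) \<boxtimes> idn W)"
    using o by (simp add: pentagon_arw cmp_assoc)
qed auto

text \<open>Compatibility with tensoring from the right is the identity \<open>lu_tns\<close>, which
  was proved for this purpose.\<close>

lemma sar_uo [simp]: "sar uo"
  unfolding uo_def
proof (rule sarI)
  fix g assume "ar g"
  then show "(if cd g \<in> Obj C then lu (cd g) else Null) \<star> lw [UnitO C] g = lw [] g \<star> (if dm g \<in> Obj C then lu (dm g) else Null)"
    by (simp add: lu_nat)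
next
  fix Z W assume "Z \<in> Obj C" "W \<in> Obj C"
  then show "(if Z \<otimes>\<^sub>o W \<in> Obj C then lu (Z \<otimes>\<^sub>o W) else Null) \<star> al [UnitO C] Z W =
      al [] Z W \<star> ((if Z \<in> Obj C then lu Z else Null) \<boxtimes> idn W)"
    by (simp add: lu_tns)
qed auto

lemma mu_nu_simps [simp]:
  "dm (mu X Y) = [X, Y]" "cd (mu X Y) = [X \<otimes>\<^sub>o Y]" "dm (nu X Y) = [X \<otimes>\<^sub>o Y]" "cd (nu X Y) = [X, Y]"
  "dm ui = []" "cd ui = [UnitO C]" "dm uo = [UnitO C]" "cd uo = []"
  by (simp_all add: mu_def nu_def ui_def uo_def)

lemma mp_mu: "Z \<in> Obj C \<Longrightarrow> mp (mu X Y) Z = alq X Y Z" "Z \<in> Obj C \<Longrightarrow> mp (nu X Y) Z = alp X Y Z"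
    "Z \<in> Obj C \<Longrightarrow> mp ui Z = lv Z" "Z \<in> Obj C \<Longrightarrow> mp uo Z = lu Z"
  by (simp_all add: mu_def nu_def ui_def uo_def)

lemma mu_nu [simp]:
  assumes "X \<in> Obj C" "Y \<in> Obj C"
  shows "sar (mu X Y)" "mu X Y \<diamond> nu X Y = sid [X \<otimes>\<^sub>o Y]" "nu X Y \<diamond> mu X Y = sid [X, Y]"
proof -
  have i: "inverses (mp (nu X Y) Z) (mp (mu X Y) Z)" if "Z \<in> Obj C" for Z
    using that assms inverses_al by (simp add: mp_mu)
  have n: "mp (mu X Y) Z = Null" if "Z \<notin> Obj C" for Z
    using that by (simp add: mu_def)
  have e: "Arw (cd (nu X Y)) (dm (nu X Y)) (mp (mu X Y)) = mu X Y"
    by (simp add: mu_def)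
  show "sar (mu X Y)" "mu X Y \<diamond> nu X Y = sid [X \<otimes>\<^sub>o Y]" "nu X Y \<diamond> mu X Y = sid [X, Y]"
    using sar_inverse[of "nu X Y" "mp (mu X Y)", OF sar_nu[OF assms] i n, unfolded e] by simp_all
qed

lemma ui_uo [simp]: "sar ui" "ui \<diamond> uo = sid [UnitO C]" "uo \<diamond> ui = sid []"
proof -
  have i: "inverses (mp uo Z) (mp ui Z)" if "Z \<in> Obj C" for Z
    using that inverses_lu by (simp add: mp_mu)
  have n: "mp ui Z = Null" if "Z \<notin> Obj C" for Z
    using that by (simp add: ui_def)
  have e: "Arw (cd uo) (dm uo) (mp ui) = ui"
    by (simp add: ui_def)
  show "sar ui" "ui \<diamond> uo = sid [UnitO C]" "uo \<diamond> ui = sid []"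
    using sar_inverse[of uo "mp ui", OF sar_uo i n, unfolded e] by simp_all
qed

lemma cp_cancel: "\<lbrakk>a \<diamond> b = sid l; sar F; cd F = l\<rbrakk> \<Longrightarrow> a \<diamond> b \<diamond> F = F"
  by (simp flip: cp_assoc)

lemma wh_cancel: "\<lbrakk>a \<diamond> b = sid m; set l \<subseteq> Obj C; set r \<subseteq> Obj C; set m \<subseteq> Obj C\<rbrakk> \<Longrightarrow> wh l a r \<diamond> wh l b r = sid (l @ m @ r)"
  by (metis wh_cp wh_sid)

lemma wh_cancel': "\<lbrakk>a \<diamond> b = sid m; set l \<subseteq> Obj C; set r \<subseteq> Obj C; set m \<subseteq> Obj C; sar F; cd F = l @ m @ r\<rbrakk> \<Longrightarrow>
    wh l a r \<diamond> wh l b r \<diamond> F = F"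
  by (simp add: wh_cancel flip: cp_assoc)

text \<open>Oriented for right-nested composites: a merge next to the matching split disappears,
  also under whiskering.\<close>

lemmas mu_nu_cancel [simp] = cp_cancel[OF mu_nu(2)] cp_cancel[OF mu_nu(3)] wh_cancel[OF mu_nu(2)] wh_cancel[OF mu_nu(3)]
  wh_cancel'[OF mu_nu(2)] wh_cancel'[OF mu_nu(3)]

lemmas ui_uo_cancel [simp] = cp_cancel[OF ui_uo(2)] cp_cancel[OF ui_uo(3)] wh_cancel[OF ui_uo(2)] wh_cancel[OF ui_uo(3)]
  wh_cancel'[OF ui_uo(2)] wh_cancel'[OF ui_uo(3)]

lemma cp_reassoc: "a \<diamond> b = c \<Longrightarrow> a \<diamond> b \<diamond> x = c \<diamond> x"
  by (simp flip: cp_assoc)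

lemma cp_reassoc2: "a \<diamond> b = c \<diamond> d \<Longrightarrow> a \<diamond> b \<diamond> x = c \<diamond> d \<diamond> x"
  by (simp flip: cp_assoc)

text \<open>Between a split and a merge, \<open>\<boxtimes>\<close> becomes one whiskering after
  another. Together with the formulas for the constraints below, it clears embedded equations of
  tensor products and coherence isomorphisms.\<close>

lemma emb_tns:
  assumes "ar f" "ar g"
  shows "emb (f \<boxtimes> g) = mu (cd f) (cd g) \<diamond> wh [] (emb f) [cd g] \<diamond> wh [dm f] (emb g) [] \<diamond> nu (dm f) (dm g)"
proof -
  have "emb (f \<boxtimes> g) \<diamond> mu (dm f) (dm g) = mu (cd f) (cd g) \<diamond> wh [] (emb f) [cd g] \<diamond> wh [dm f] (emb g) []"
  proof (rule sar_eqI)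
    fix Z assume Z: "Z \<in> Obj C"
    have "((f \<boxtimes> g) \<boxtimes> idn Z) \<star> alq (dm f) (dm g) Z = alq (cd f) (cd g) Z \<star> (f \<boxtimes> g \<boxtimes> idn Z)"
      using nat_inverse[OF inverses_al inverses_al alp_nat[of f g "idn Z"]] assms Z by simp
    then show "mp (emb (f \<boxtimes> g) \<diamond> mu (dm f) (dm g)) Z =
        mp (mu (cd f) (cd g) \<diamond> wh [] (emb f) [cd g] \<diamond> wh [dm f] (emb g) []) Z"
      using assms Z by (simp add: mp_cp mp_emb mp_wh mp_mu cmp_tns)
  qed (use assms in auto)
  then have "emb (f \<boxtimes> g) \<diamond> mu (dm f) (dm g) \<diamond> nu (dm f) (dm g) =
      mu (cd f) (cd g) \<diamond> wh [] (emb f) [cd g] \<diamond> wh [dm f] (emb g) [] \<diamond> nu (dm f) (dm g)"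
    by (metis cp_assoc)
  then show ?thesis
    using assms by simp
qed

text \<open>The associator only rebrackets, so it splits one bracketing into letters and merges them
  into the other. The pentagon, with the object acted upon as fourth entry, proves this.\<close>

lemma emb_alp:
  assumes "X \<in> Obj C" "Y \<in> Obj C" "Z \<in> Obj C"
  shows "emb (alp X Y Z) = mu X (Y \<otimes>\<^sub>o Z) \<diamond> wh [X] (mu Y Z) [] \<diamond> wh [] (nu X Y) [Z] \<diamond> nu (X \<otimes>\<^sub>o Y) Z"
proof -
  have "wh [X] (nu Y Z) [] \<diamond> nu X (Y \<otimes>\<^sub>o Z) \<diamond> emb (alp X Y Z) = wh [] (nu X Y) [Z] \<diamond> nu (X \<otimes>\<^sub>o Y) Z"
    using assms pentagon_arw[of X Y Z] by (intro sar_eqI) (auto simp: mp_cp mp_emb mp_wh mp_mu)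
  then have "mu X (Y \<otimes>\<^sub>o Z) \<diamond> wh [X] (mu Y Z) [] \<diamond> wh [X] (nu Y Z) [] \<diamond> nu X (Y \<otimes>\<^sub>o Z) \<diamond> emb (alp X Y Z) =
      mu X (Y \<otimes>\<^sub>o Z) \<diamond> wh [X] (mu Y Z) [] \<diamond> wh [] (nu X Y) [Z] \<diamond> nu (X \<otimes>\<^sub>o Y) Z"
    by simp
  then show ?thesis
    using assms by simp
qed

lemma emb_alq:
  assumes "X \<in> Obj C" "Y \<in> Obj C" "Z \<in> Obj C"
  shows "emb (alq X Y Z) = mu (X \<otimes>\<^sub>o Y) Z \<diamond> wh [] (mu X Y) [Z] \<diamond> wh [X] (nu Y Z) [] \<diamond> nu X (Y \<otimes>\<^sub>o Z)"
proof -
  have "emb (alq X Y Z) = emb (alq X Y Z) \<diamond> emb (alp X Y Z) \<diamond> mu (X \<otimes>\<^sub>o Y) Z \<diamond> wh [] (mu X Y) [Z] \<diamond> wh [X] (nu Y Z) [] \<diamond> nu X (Y \<otimes>\<^sub>o Z)"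
    using assms by (simp add: emb_alp cp_assoc)
  also have "\<dots> = (emb (alq X Y Z) \<diamond> emb (alp X Y Z)) \<diamond> mu (X \<otimes>\<^sub>o Y) Z \<diamond> wh [] (mu X Y) [Z] \<diamond> wh [X] (nu Y Z) [] \<diamond> nu X (Y \<otimes>\<^sub>o Z)"
    by (simp only: cp_assoc)
  also have "emb (alq X Y Z) \<diamond> emb (alp X Y Z) = sid [(X \<otimes>\<^sub>o Y) \<otimes>\<^sub>o Z]"
    using assms by (simp flip: emb_cmp)
  finally show ?thesis
    using assms by simp
qed

lemma emb_lu:
  assumes "X \<in> Obj C"
  shows "emb (lu X) = wh [] uo [X] \<diamond> nu (UnitO C) X"
  using assms lu_tns[of X] by (intro sar_eqI) (auto simp: mp_cp mp_emb mp_wh mp_mu)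

lemma emb_ru:
  assumes "X \<in> Obj C"
  shows "emb (ru X) = wh [X] uo [] \<diamond> nu X (UnitO C)"
  using assms triangle_arw[of X] by (intro sar_eqI) (auto simp: mp_cp mp_emb mp_wh mp_mu)

lemma emb_rv:
  assumes "X \<in> Obj C"
  shows "emb (rv X) = mu X (UnitO C) \<diamond> wh [X] ui []"
proof -
  have "emb (rv X) = emb (rv X) \<diamond> emb (ru X) \<diamond> mu X (UnitO C) \<diamond> wh [X] ui []"
    using assms by (simp add: emb_ru cp_assoc)
  also have "\<dots> = (emb (rv X) \<diamond> emb (ru X)) \<diamond> mu X (UnitO C) \<diamond> wh [X] ui []"
    by (simp only: cp_assoc)
  also have "emb (rv X) \<diamond> emb (ru X) = sid [X \<otimes>\<^sub>o UnitO C]"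
    using assms by (simp flip: emb_cmp)
  finally show ?thesis
    using assms by simp
qed

text \<open>Compatibility with tensoring from the right determines an arrow by its component at the unit.\<close>

lemma emb_full:
  assumes F: "sar F" "dm F = [X]" "cd F = [Y]"
  obtains f where "ar f" "dm f = X" "cd f = Y" "F = emb f"
proof -
  let ?I = "UnitO C"
  have o: "X \<in> Obj C" "Y \<in> Obj C"
    using F sar_objs[of F] by auto
  note s = sarD[OF F(1), unfolded F(2,3), simplified]
  define f where "f = ru Y \<star> mp F ?I \<star> rv X"
  have f: "ar f" "dm f = X" "cd f = Y"
    using s(3-5)[OF UnitO_Obj] o by (auto simp: f_def)
  have "F = emb f"
  proof (rule sar_eqI)
    fix W assume W: "W \<in> Obj C"
    have iX: "inverses (idn X \<boxtimes> lu W) (idn X \<boxtimes> lv W)"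
      using W o by (intro inverses_tns inverses_lu inverses_idn)
    \<comment> \<open>Naturality along \<open>lu W\<close> replaces \<open>W\<close> by
      \<open>UnitO C \<otimes>\<^sub>o W\<close>, where compatibility with \<open>al\<close>
      expresses the component by the one at the unit object.\<close>
    have "mp F W \<star> ((idn X \<boxtimes> lu W) \<star> alp X ?I W) = (idn Y \<boxtimes> lu W) \<star> mp F (?I \<otimes>\<^sub>o W) \<star> alp X ?I W"
      using s(7)[of "lu W"] W by (simp add: cp_assoc flip: cmp_assoc)
    also have "\<dots> = (idn Y \<boxtimes> lu W) \<star> alp Y ?I W \<star> (mp F ?I \<boxtimes> idn W)"
      using s(8)[of ?I W] W o s(3-5)[of ?I] s(3-5)[of "?I \<otimes>\<^sub>o W"] by simp
    also have "\<dots> = (ru Y \<boxtimes> idn W) \<star> (mp F ?I \<boxtimes> idn W)"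
      using W o triangle_arw[of Y W] by (simp flip: cmp_assoc)
    also have "\<dots> = (ru Y \<star> mp F ?I) \<boxtimes> idn W"
      using s(3-5)[of ?I] o W by (simp add: cmp_tns_idn)
    finally have "mp F W \<star> (ru X \<boxtimes> idn W) = (ru Y \<star> mp F ?I) \<boxtimes> idn W"
      using triangle_arw[of X W] o W by simp
    then have "mp F W \<star> (ru X \<boxtimes> idn W) \<star> (rv X \<boxtimes> idn W) = ((ru Y \<star> mp F ?I) \<boxtimes> idn W) \<star> (rv X \<boxtimes> idn W)"
      by (metis cmp_assoc)
    then show "mp F W = mp (emb f) W"
      using o W s(3-5)[of ?I] s(3-5)[of W] f by (simp add: mp_emb cmp_tns f_def cmp_assoc)
  qed (use F f in auto)
  then show ?thesis
    using that f by blast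
qed


subsection \<open>Linear structure of the strictification\<close>

definition smul :: "'k \<Rightarrow> ('o list, 'o \<Rightarrow> ('o, 'm) arw) arw \<Rightarrow> ('o list, 'o \<Rightarrow> ('o, 'm) arw) arw" where
  "smul c F = (if sar F then Arw (dm F) (cd F) (\<lambda>Z. sc c (mp F Z)) else Null)"

definition sadd :: "('o list, 'o \<Rightarrow> ('o, 'm) arw) arw \<Rightarrow> ('o list, 'o \<Rightarrow> ('o, 'm) arw) arw \<Rightarrow>
    ('o list, 'o \<Rightarrow> ('o, 'm) arw) arw"  where
  "sadd F G = (if sar F \<and> sar G \<and> dm F = dm G \<and> cd F = cd G
     then Arw (dm F) (cd F) (\<lambda>Z. mp F Z \<boxplus> mp G Z) else Null)"

lemma sar_smul [simp]: "sar (smul c F) \<longleftrightarrow> sar F"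
proof
  assume F: "sar F"
  note s = sarD[OF F]
  have "sar (Arw (dm F) (cd F) (\<lambda>Z. sc c (mp F Z)))"
    by (rule sarI) (use s in \<open>auto simp: sc_cmp cmp_sc sc_tns\<close>, simp add: sc_def)
  then show "sar (smul c F)"
    using F by (simp add: smul_def)
qed (auto simp: smul_def split: if_splits)

lemma smul_simps [simp]: "sar F \<Longrightarrow> dm (smul c F) = dm F" "sar F \<Longrightarrow> cd (smul c F) = cd F"
  and mp_smul: "sar F \<Longrightarrow> mp (smul c F) Z = sc c (mp F Z)"
  by (simp_all add: smul_def)

lemma smul_Null [simp]: "smul c Null = Null"
  by (simp add: smul_def)

lemma sar_sadd [simp]: "sar (sadd F G) \<longleftrightarrow> sar F \<and> sar G \<and> dm F = dm G \<and> cd F = cd G"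
proof
  assume "sar F \<and> sar G \<and> dm F = dm G \<and> cd F = cd G"
  then have a: "sar F" "sar G" "dm F = dm G" "cd F = cd G"
    by auto
  note s = sarD[OF a(1)] sarD[OF a(2)]
  have "sar (Arw (dm F) (cd F) (\<lambda>Z. mp F Z \<boxplus> mp G Z))"
    by (rule sarI) (use s a in \<open>auto simp: ad_cmp cmp_ad ad_tns\<close>, simp add: ad_def)
  then show "sar (sadd F G)"
    using a by (simp add: sadd_def)
qed (auto simp: sadd_def split: if_splits)

lemma sadd_simps [simp]: "\<lbrakk>sar F; sar G; dm F = dm G; cd F = cd G\<rbrakk> \<Longrightarrow> dm (sadd F G) = dm G"
    "\<lbrakk>sar F; sar G; dm F = dm G; cd F = cd G\<rbrakk> \<Longrightarrow> cd (sadd F G) = cd G"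
  and mp_sadd: "\<lbrakk>sar F; sar G; dm F = dm G; cd F = cd G\<rbrakk> \<Longrightarrow> mp (sadd F G) Z = mp F Z \<boxplus> mp G Z"
  by (simp_all add: sadd_def)

lemma not_sar_sadd: "\<not> sar (sadd F G) \<Longrightarrow> sadd F G = Null"
  unfolding sar_sadd by (auto simp: sadd_def)

lemma smul_cp: "smul c G \<diamond> F = smul c (G \<diamond> F)"
proof (cases "sar G \<and> sar F \<and> dm G = cd F")
  case True
  then show ?thesis
    by (intro sar_eqI) (auto simp: mp_smul mp_cp sc_cmp)
next
  case False
  then have "\<not> sar (smul c G \<diamond> F)" "\<not> sar (G \<diamond> F)"
    by (auto simp: smul_def)
  then show ?thesis
    by (metis not_sar_cp smul_Null)
qed

lemma cp_smul: "G \<diamond> smul c F = smul c (G \<diamond> F)"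
proof (cases "sar G \<and> sar F \<and> dm G = cd F")
  case True
  then show ?thesis
    by (intro sar_eqI) (auto simp: mp_smul mp_cp cmp_sc)
next
  case False
  then have "\<not> sar (G \<diamond> smul c F)" "\<not> sar (G \<diamond> F)"
    by (auto simp: smul_def)
  then show ?thesis
    by (metis not_sar_cp smul_Null)
qed

lemma wh_smul: "wh l (smul c F) r = smul c (wh l F r)"
proof (cases "set l \<subseteq> Obj C \<and> set r \<subseteq> Obj C \<and> sar F")
  case True
  then show ?thesis
    by (intro sar_eqI) (auto simp: mp_smul mp_wh lw_sc)
next
  case False
  then have "\<not> sar (wh l (smul c F) r)" "\<not> sar (wh l F r)"
    by auto
  then show ?thesis
    by (metis not_sar_wh smul_Null)
qed

lemma smul_smul [simp]: "smul a (smul b F) = smul (a * b) F"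
proof (cases "sar F")
  case True
  then show ?thesis
    by (intro sar_eqI) (auto simp: mp_smul)
qed (simp add: smul_def)

lemma smul_1 [simp]: "sar F \<Longrightarrow> smul 1 F = F"
  by (rule sar_eqI) (auto simp: mp_smul sarD)

lemma emb_sc: "emb (sc c f) = smul c (emb f)"
proof (cases "ar f")
  case True
  then show ?thesis
    by (intro sar_eqI) (auto simp: mp_smul mp_emb sc_tns)
qed (simp add: emb_def smul_def)

lemma sadd_cp: "sadd F G \<diamond> H = sadd (F \<diamond> H) (G \<diamond> H)"
proof (cases "sar H \<and> sar (sadd F G) \<and> dm F = cd H")
  case True
  then show ?thesis
    by (intro sar_eqI) (auto simp: mp_sadd mp_cp ad_cmp)
next
  case False
  then have "\<not> sar (sadd F G \<diamond> H)" "\<not> sar (sadd (F \<diamond> H) (G \<diamond> H))"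
    by auto
  then show ?thesis
    by (metis not_sar_cp not_sar_sadd)
qed

lemma cp_sadd: "H \<diamond> sadd F G = sadd (H \<diamond> F) (H \<diamond> G)"
proof (cases "sar H \<and> sar (sadd F G) \<and> dm H = cd F")
  case True
  then show ?thesis
    by (intro sar_eqI) (auto simp: mp_sadd mp_cp cmp_ad)
next
  case False
  then have "\<not> sar (H \<diamond> sadd F G)" "\<not> sar (sadd (H \<diamond> F) (H \<diamond> G))"
    by auto
  then show ?thesis
    by (metis not_sar_cp not_sar_sadd)
qed

lemma wh_sadd: "wh l (sadd F G) r = sadd (wh l F r) (wh l G r)"
proof (cases "set l \<subseteq> Obj C \<and> set r \<subseteq> Obj C \<and> sar (sadd F G)")
  case True
  then show ?thesis
    by (intro sar_eqI) (auto simp: mp_sadd mp_wh lw_ad sarD)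
next
  case False
  then have "\<not> sar (wh l (sadd F G) r)" "\<not> sar (sadd (wh l F r) (wh l G r))"
    by auto
  then show ?thesis
    by (metis not_sar_wh not_sar_sadd)
qed

lemma emb_ad: "emb (f \<boxplus> g) = sadd (emb f) (emb g)"
proof (cases "ar (f \<boxplus> g)")
  case True
  then show ?thesis
    by (intro sar_eqI) (auto simp: mp_sadd mp_emb ad_tns)
next
  case False
  then have "\<not> sar (sadd (emb f) (emb g))"
    by auto
  then show ?thesis
    using False by (metis not_ar_ad not_sar_sadd emb_Null)
qed

lemma sadd_smul: "sadd (smul a F) (smul b F) = smul (a + b) F"
proof (cases "sar F")
  case True
  then show ?thesis
    by (intro sar_eqI) (auto simp: mp_sadd mp_smul sc_ad)
qed (simp add: sadd_def smul_def)

end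

section \<open>Dual pairs and mates\<close>

context monoidal_category
begin

text \<open>The two zigzag identities for words: \<open>B\<close> is a left dual of
  \<open>A\<close>. Admitting words lets duals of tensor products be built by concatenation.\<close>

definition dpair :: "'o list \<Rightarrow> 'o list \<Rightarrow> ('o list, 'o \<Rightarrow> ('o, 'm) arw) arw \<Rightarrow>
    ('o list, 'o \<Rightarrow> ('o, 'm) arw) arw \<Rightarrow> bool" where
  "dpair A B e n \<longleftrightarrow> sar e \<and> sar n \<and> dm e = B @ A \<and> cd e = [] \<and> dm n = [] \<and> cd n = A @ B \<and>
     wh A e [] \<diamond> wh [] n A = sid A \<and> wh [] e B \<diamond> wh B n [] = sid B"

text \<open>The mate of \<open>f\<close>, running from the dual \<open>B'\<close> of its target to
  the dual \<open>B\<close> of its source. It uses the evaluation of the target and the coevaluation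
  of the source.\<close>

definition sdual :: "('o list, 'o \<Rightarrow> ('o, 'm) arw) arw \<Rightarrow> 'o list \<Rightarrow> ('o list, 'o \<Rightarrow> ('o, 'm) arw) arw \<Rightarrow>
    ('o list, 'o \<Rightarrow> ('o, 'm) arw) arw \<Rightarrow> 'o list \<Rightarrow> ('o list, 'o \<Rightarrow> ('o, 'm) arw) arw" where
  "sdual e' B' f n B = wh [] e' B \<diamond> wh B' f B \<diamond> wh B' n []"

lemma dpairD:
  assumes "dpair A B e n"
  shows "sar e" "sar n" "dm e = B @ A" "cd e = []" "dm n = []" "cd n = A @ B" "set A \<subseteq> Obj C" "set B \<subseteq> Obj C"
    "wh A e [] \<diamond> wh [] n A = sid A" "wh [] e B \<diamond> wh B n [] = sid B"
  using assms sar_objs[of e] by (auto simp: dpair_def)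

text \<open>Evaluations and coevaluations are nested; interchange separates the two zigzags, which
  are then straightened one at a time.\<close>

lemma dpair_append:
  assumes "dpair A B e n" "dpair A' B' e' n'"
  shows "dpair (A @ A') (B' @ B) (e' \<diamond> wh B' e A') (wh A n' B \<diamond> n)"
proof -
  note d = dpairD[OF assms(1)] dpairD[OF assms(2)]
  have x: "wh A n' A' \<diamond> wh A e A' = wh (A @ A' @ B') e A' \<diamond> wh A n' (B @ A @ A')"
    using exchange[of n' e A "[]" A'] d by simp
  have z1: "wh (A @ A') e' [] \<diamond> wh A n' A' = sid (A @ A')"
    using arg_cong[OF d(19), of "\<lambda>F. wh A F []"] d(1-8,11-18) by simp
  have z2: "wh A e A' \<diamond> wh [] n (A @ A') = sid (A @ A')"
    using arg_cong[OF d(9), of "\<lambda>F. wh [] F A'"] d(1-8,11-18) by simp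
  have "wh (A @ A') (e' \<diamond> wh B' e A') [] \<diamond> wh [] (wh A n' B \<diamond> n) (A @ A')
      = wh (A @ A') e' [] \<diamond> (wh (A @ A' @ B') e A' \<diamond> wh A n' (B @ A @ A')) \<diamond> wh [] n (A @ A')"
    by (simp add: cp_assoc)
  also have "\<dots> = (wh (A @ A') e' [] \<diamond> wh A n' A') \<diamond> (wh A e A' \<diamond> wh [] n (A @ A'))"
    by (simp only: x[symmetric] cp_assoc)
  also have "\<dots> = sid (A @ A')"
    using d by (simp add: z1 z2)
  finally have 1: "wh (A @ A') (e' \<diamond> wh B' e A') [] \<diamond> wh [] (wh A n' B \<diamond> n) (A @ A') = sid (A @ A')" .
  have z1: "wh [] e' (B' @ B) \<diamond> wh B' n' B = sid (B' @ B)"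
    using arg_cong[OF d(20), of "\<lambda>F. wh [] F B"] d(1-8,11-18) by simp
  have z2: "wh B' e B \<diamond> wh (B' @ B) n [] = sid (B' @ B)"
    using arg_cong[OF d(10), of "\<lambda>F. wh B' F []"] d(1-8,11-18) by simp
  have "wh [] (e' \<diamond> wh B' e A') (B' @ B) \<diamond> wh (B' @ B) (wh A n' B \<diamond> n) []
      = wh [] e' (B' @ B) \<diamond> (wh B' e (A' @ B' @ B) \<diamond> wh (B' @ B @ A) n' B) \<diamond> wh (B' @ B) n []"
    by (simp add: cp_assoc)
  also have "wh B' e (A' @ B' @ B) \<diamond> wh (B' @ B @ A) n' B = wh B' n' B \<diamond> wh B' e B"
    using exchange[of e n' B' "[]" B] d by simp
  also have "wh [] e' (B' @ B) \<diamond> (wh B' n' B \<diamond> wh B' e B) \<diamond> wh (B' @ B) n []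
      = (wh [] e' (B' @ B) \<diamond> wh B' n' B) \<diamond> (wh B' e B \<diamond> wh (B' @ B) n [])"
    by (simp only: cp_assoc)
  also have "\<dots> = sid (B' @ B)"
    using d by (simp add: z1 z2)
  finally have 2: "wh [] (e' \<diamond> wh B' e A') (B' @ B) \<diamond> wh (B' @ B) (wh A n' B \<diamond> n) [] = sid (B' @ B)" .
  show ?thesis
    unfolding dpair_def using 1 2 d by simp
qed

text \<open>Transport of duality along an isomorphism: interchange brings \<open>f\<close> and
  \<open>g\<close> together around the old zigzag.\<close>

lemma dpair_iso:
  assumes "dpair A B e n" and f: "sar f" "dm f = A" "cd f = A2" and g: "sar g" "dm g = A2" "cd g = A"
    and fg: "g \<diamond> f = sid A" "f \<diamond> g = sid A2"
  shows "dpair A2 B (e \<diamond> wh B g []) (wh [] f B \<diamond> n)"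
proof -
  note d = dpairD[OF assms(1)]
  have s: "set A2 \<subseteq> Obj C"
    using f sar_objs by metis
  have "wh A2 (e \<diamond> wh B g []) [] \<diamond> wh [] (wh [] f B \<diamond> n) A2
      = wh A2 e [] \<diamond> (wh (A2 @ B) g [] \<diamond> wh [] f (B @ A2)) \<diamond> wh [] n A2"
    by (simp add: cp_assoc)
  also have "wh (A2 @ B) g [] \<diamond> wh [] f (B @ A2) = wh [] f (B @ A) \<diamond> wh (A @ B) g []"
    using exchange[of f g "[]" B "[]"] d f g by simp
  also have "wh A2 e [] \<diamond> (wh [] f (B @ A) \<diamond> wh (A @ B) g []) \<diamond> wh [] n A2
      = (wh A2 e [] \<diamond> wh [] f (B @ A)) \<diamond> (wh (A @ B) g [] \<diamond> wh [] n A2)"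
    by (simp only: cp_assoc)
  also have "wh A2 e [] \<diamond> wh [] f (B @ A) = f \<diamond> wh A e []"
    using exchange[of f e "[]" "[]" "[]"] d f by simp
  also have "wh (A @ B) g [] \<diamond> wh [] n A2 = wh [] n A \<diamond> g"
    using exchange[of n g "[]" "[]" "[]"] d g by simp
  also have "(f \<diamond> wh A e []) \<diamond> wh [] n A \<diamond> g = f \<diamond> (wh A e [] \<diamond> wh [] n A) \<diamond> g"
    by (simp only: cp_assoc)
  also have "\<dots> = sid A2"
    using d f g fg by simp
  finally have 1: "wh A2 (e \<diamond> wh B g []) [] \<diamond> wh [] (wh [] f B \<diamond> n) A2 = sid A2" .
  have "wh [] (e \<diamond> wh B g []) B \<diamond> wh B (wh [] f B \<diamond> n) [] = wh [] e B \<diamond> wh B (g \<diamond> f) B \<diamond> wh B n []"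
    by (simp add: cp_assoc)
  also have "\<dots> = sid B"
    using d fg by simp
  finally show ?thesis
    unfolding dpair_def using 1 d f g s by simp
qed

lemma sdual_simps [simp]:
  assumes "dpair A B e n" "dpair A' B' e' n'" "sar f" "dm f = A" "cd f = A'"
  shows "sar (sdual e' B' f n B)" "dm (sdual e' B' f n B) = B'" "cd (sdual e' B' f n B) = B"
  using dpairD[OF assms(1)] dpairD[OF assms(2)] assms(3-5) by (simp_all add: sdual_def)

text \<open>Interchange moves the second coevaluation next to the evaluation inside the mate, and
  the resulting zigzag is straightened.\<close>

lemma sdual_coev:
  assumes "dpair A B e n" "dpair A' B' e' n'" "sar f" "dm f = A" "cd f = A'"
  shows "wh A' (sdual e' B' f n B) [] \<diamond> n' = wh [] f B \<diamond> n"
proof -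
  note d = dpairD[OF assms(1)] dpairD[OF assms(2)] assms(3-5)
  have "wh A' (sdual e' B' f n B) [] \<diamond> n' = wh A' e' B \<diamond> (wh (A' @ B') (wh [] f B \<diamond> n) [] \<diamond> wh [] n' [])"
    using d by (simp add: sdual_def cp_assoc)
  also have "wh (A' @ B') (wh [] f B \<diamond> n) [] \<diamond> wh [] n' [] = wh [] n' (A' @ B) \<diamond> wh [] f B \<diamond> n"
    using exchange[of n' "wh [] f B \<diamond> n" "[]" "[]" "[]"] d by simp
  also have "wh A' e' B \<diamond> wh [] n' (A' @ B) \<diamond> wh [] f B \<diamond> n = wh [] (wh A' e' [] \<diamond> wh [] n' A') B \<diamond> wh [] f B \<diamond> n"
    by (simp add: cp_assoc)
  also have "\<dots> = wh [] f B \<diamond> n"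
    using d by simp
  finally show ?thesis .
qed

lemma sdual_ev:
  assumes "dpair A B e n" "dpair A' B' e' n'" "sar f" "dm f = A" "cd f = A'"
  shows "e \<diamond> wh [] (sdual e' B' f n B) A = e' \<diamond> wh B' f []"
proof -
  note d = dpairD[OF assms(1)] dpairD[OF assms(2)] assms(3-5)
  have "e \<diamond> wh [] (sdual e' B' f n B) A = (wh [] e [] \<diamond> wh [] (e' \<diamond> wh B' f []) (B @ A)) \<diamond> wh B' n A"
    using d by (simp add: sdual_def cp_assoc)
  also have "wh [] e [] \<diamond> wh [] (e' \<diamond> wh B' f []) (B @ A) = (e' \<diamond> wh B' f []) \<diamond> wh (B' @ A) e []"
    using exchange[of "e' \<diamond> wh B' f []" e "[]" "[]" "[]"] d by simp
  also have "((e' \<diamond> wh B' f []) \<diamond> wh (B' @ A) e []) \<diamond> wh B' n A = e' \<diamond> wh B' f [] \<diamond> wh B' (wh A e [] \<diamond> wh [] n A) []"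
    by (simp add: cp_assoc)
  also have "\<dots> = e' \<diamond> wh B' f []"
    using d by simp
  finally show ?thesis .
qed

text \<open>Bending the strand back with the evaluation recovers a map out of \<open>B\<close> from
  its composite with the coevaluation.\<close>

lemma coev_cancel:
  assumes "dpair A B e n" "sar F" "sar G" "dm F = B" "dm G = B" "cd F = cd G"
    and eq: "wh A F [] \<diamond> n = wh A G [] \<diamond> n"
  shows "F = G"
proof -
  note d = dpairD[OF assms(1)]
  have "wh [] e (cd H) \<diamond> wh B (wh A H [] \<diamond> n) [] = H" if H: "sar H" "dm H = B" for H
  proof -
    have "wh [] e (cd H) \<diamond> wh B (wh A H [] \<diamond> n) [] = (wh [] e (cd H) \<diamond> wh (B @ A) H []) \<diamond> wh B n []"
      by (simp add: cp_assoc)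
    also have "wh [] e (cd H) \<diamond> wh (B @ A) H [] = H \<diamond> wh [] e B"
      using exchange[of e H "[]" "[]" "[]"] d H by simp
    finally show ?thesis
      using d H by (simp add: cp_assoc)
  qed
  then show ?thesis
    using assms by metis
qed

text \<open>Contravariant functoriality. Both sides have the same composite with the coevaluation,
  by repeated use of \<open>sdual_coev\<close>.\<close>

lemma sdual_cp:
  assumes "dpair A B e n" "dpair A' B' e' n'" "dpair A'' B'' e'' n''"
    "sar f" "dm f = A" "cd f = A'" "sar g" "dm g = A'" "cd g = A''"
  shows "sdual e'' B'' (g \<diamond> f) n B = sdual e' B' f n B \<diamond> sdual e'' B'' g n' B'"
proof (rule coev_cancel[OF assms(3)])
  note d = dpairD[OF assms(1)] dpairD[OF assms(2)] dpairD[OF assms(3)] assms(4-9)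
  note s = sdual_simps[OF assms(1,2,4-6)] sdual_simps[OF assms(2,3,7-9)]
  have "wh A'' (sdual e' B' f n B \<diamond> sdual e'' B'' g n' B') [] \<diamond> n''
      = wh A'' (sdual e' B' f n B) [] \<diamond> wh [] g B' \<diamond> n'"
    using sdual_coev[OF assms(2,3,7-9)] by (simp add: cp_assoc)
  also have "\<dots> = (wh A'' (sdual e' B' f n B) [] \<diamond> wh [] g B') \<diamond> n'"
    by (simp only: cp_assoc)
  also have "wh A'' (sdual e' B' f n B) [] \<diamond> wh [] g B' = wh [] g B \<diamond> wh A' (sdual e' B' f n B) []"
    using exchange[of g "sdual e' B' f n B" "[]" "[]" "[]"] d s by simp
  also have "(wh [] g B \<diamond> wh A' (sdual e' B' f n B) []) \<diamond> n' = wh [] g B \<diamond> wh [] f B \<diamond> n"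
    using sdual_coev[OF assms(1,2,4-6)] by (simp add: cp_assoc)
  finally show "wh A'' (sdual e'' B'' (g \<diamond> f) n B) [] \<diamond> n'' = wh A'' (sdual e' B' f n B \<diamond> sdual e'' B'' g n' B') [] \<diamond> n''"
    using sdual_coev[OF assms(1,3), of "g \<diamond> f"] d by (simp add: cp_assoc)
  show "sar (sdual e'' B'' (g \<diamond> f) n B)" "dm (sdual e'' B'' (g \<diamond> f) n B) = B''"
    "cd (sdual e'' B'' (g \<diamond> f) n B) = cd (sdual e' B' f n B \<diamond> sdual e'' B'' g n' B')"
    using sdual_simps[OF assms(1,3), of "g \<diamond> f"] d s by simp_all
qed (use sdual_simps[OF assms(1,2,4-6)] sdual_simps[OF assms(2,3,7-9)] in simp_all)

lemma sdual_sid: "dpair A B e n \<Longrightarrow> sdual e B (sid A) n B = sid B"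
  using dpairD[of A B e n] by (simp add: sdual_def)

text \<open>Uniqueness of duals: by functoriality, the two mates of the identity between two duals
  of one word are mutually inverse.\<close>

lemma sdual_sid_inverse:
  assumes "dpair A B e n" "dpair A B' e' n'"
  shows "sdual e B (sid A) n' B' \<diamond> sdual e' B' (sid A) n B = sid B'"
  using sdual_cp[OF assms(2,1,2), of "sid A" "sid A"] dpairD[OF assms(1)] sdual_sid[OF assms(2)] by simp

text \<open>Embedding the two duality axioms and cancelling merges against splits leaves the strict
  zigzags.\<close>

lemma emb_of_left_dual:
  assumes ld: "left_dual C X D e n" and X: "X \<in> Obj C"
  shows "dpair [X] [D] (uo \<diamond> emb (Arw (D \<otimes>\<^sub>o X) (UnitO C) e) \<diamond> mu D X)
    (nu X D \<diamond> emb (Arw (UnitO C) (X \<otimes>\<^sub>o D) n) \<diamond> ui)"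
proof -
  let ?I = "UnitO C" and ?e = "Arw (D \<otimes>\<^sub>o X) (UnitO C) e" and ?n = "Arw (UnitO C) (X \<otimes>\<^sub>o D) n"
  have D: "D \<in> Obj C" "e \<in> arr C (D \<otimes>\<^sub>o X) ?I" "n \<in> arr C ?I (X \<otimes>\<^sub>o D)"
    using ld by (auto simp: left_dual_def)
  have "ru X \<star> (idn X \<boxtimes> ?e) \<star> alp X D X \<star> (?n \<boxtimes> idn X) = lu X"
    using ld X D unfolding left_dual_def
    by (intro ar_eqI) (auto simp: mp_cmp mp_tns mp_idn, simp add: ru_def alp_def lu_def)
  then have "emb (ru X \<star> (idn X \<boxtimes> ?e) \<star> alp X D X \<star> (?n \<boxtimes> idn X)) \<diamond> mu ?I X \<diamond> wh [] ui [X] = emb (lu X) \<diamond> mu ?I X \<diamond> wh [] ui [X]"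
    by simp
  then have 1: "wh [X] uo [] \<diamond> wh [X] (emb ?e) [] \<diamond> wh [X] (mu D X) [] \<diamond> wh [] (nu X D) [X] \<diamond> wh [] (emb ?n) [X] \<diamond> wh [] ui [X] = sid [X]"
    using X D by (simp add: emb_cmp emb_tns emb_alp emb_lu emb_ru cp_assoc)
  have "lu D \<star> (?e \<boxtimes> idn D) \<star> alq D X D \<star> (idn D \<boxtimes> ?n) = ru D"
    using ld X D unfolding left_dual_def
    by (intro ar_eqI) (auto simp: mp_cmp mp_tns mp_idn, simp add: ru_def alq_def lu_def)
  then have "emb (lu D \<star> (?e \<boxtimes> idn D) \<star> alq D X D \<star> (idn D \<boxtimes> ?n)) \<diamond> mu D ?I \<diamond> wh [D] ui [] = emb (ru D) \<diamond> mu D ?I \<diamond> wh [D] ui []"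
    by simp
  then have 2: "wh [] uo [D] \<diamond> wh [] (emb ?e) [D] \<diamond> wh [] (mu D X) [D] \<diamond> wh [D] (nu X D) [] \<diamond> wh [D] (emb ?n) [] \<diamond> wh [D] ui [] = sid [D]"
    using X D by (simp add: emb_cmp emb_tns emb_alq emb_lu emb_ru cp_assoc)
  show ?thesis
    unfolding dpair_def using 1 2 X D by (simp add: cp_assoc)
qed

end

context rigid_category
begin

abbreviation Ds :: "'o \<Rightarrow> 'o"  (\<open>_\<^bold>*\<close> [1000] 1000) where "X\<^bold>* \<equiv> Dual C X"

lemma Dual_Obj [simp]: "X \<in> Obj C \<Longrightarrow> X\<^bold>* \<in> Obj C"
  using left_duals by (auto simp: left_dual_def)

lemma Ev_arr [simp]: "X \<in> Obj C \<Longrightarrow> Ev C X \<in> arr C (X\<^bold>* \<otimes>\<^sub>o X) (UnitO C)"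
  and Coev_arr [simp]: "X \<in> Obj C \<Longrightarrow> Coev C X \<in> arr C (UnitO C) (X \<otimes>\<^sub>o X\<^bold>*)"
  using left_duals by (auto simp: left_dual_def)

definition ev :: "'o \<Rightarrow> ('o list, 'o \<Rightarrow> ('o, 'm) arw) arw" where
  "ev X = uo \<diamond> emb (Arw (X\<^bold>* \<otimes>\<^sub>o X) (UnitO C) (Ev C X)) \<diamond> mu (X\<^bold>*) X"

definition coev :: "'o \<Rightarrow> ('o list, 'o \<Rightarrow> ('o, 'm) arw) arw" where
  "coev X = nu X (X\<^bold>*) \<diamond> emb (Arw (UnitO C) (X \<otimes>\<^sub>o X\<^bold>*) (Coev C X)) \<diamond> ui"

lemma dpair_ev: "X \<in> Obj C \<Longrightarrow> dpair [X] [X\<^bold>*] (ev X) (coev X)"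
  unfolding ev_def coev_def by (intro emb_of_left_dual left_duals)

lemma ev_simps [simp]: "X \<in> Obj C \<Longrightarrow> sar (ev X)" "X \<in> Obj C \<Longrightarrow> sar (coev X)"
  "X \<in> Obj C \<Longrightarrow> dm (ev X) = [X\<^bold>*, X]" "X \<in> Obj C \<Longrightarrow> cd (ev X) = []"
  "X \<in> Obj C \<Longrightarrow> dm (coev X) = []" "X \<in> Obj C \<Longrightarrow> cd (coev X) = [X, X\<^bold>*]"
  using dpairD[OF dpair_ev] by auto

definition du :: "'o \<Rightarrow> 'o \<Rightarrow> ('o list, 'o \<Rightarrow> ('o, 'm) arw) arw \<Rightarrow> ('o list, 'o \<Rightarrow> ('o, 'm) arw) arw" where
  "du X Y f = sdual (ev Y) [Y\<^bold>*] f (coev X) [X\<^bold>*]"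

lemma du_simps [simp]:
  "\<lbrakk>X \<in> Obj C; Y \<in> Obj C; sar f; dm f = [X]; cd f = [Y]\<rbrakk> \<Longrightarrow> sar (du X Y f)"
  "\<lbrakk>X \<in> Obj C; Y \<in> Obj C; sar f; dm f = [X]; cd f = [Y]\<rbrakk> \<Longrightarrow> dm (du X Y f) = [Y\<^bold>*]"
  "\<lbrakk>X \<in> Obj C; Y \<in> Obj C; sar f; dm f = [X]; cd f = [Y]\<rbrakk> \<Longrightarrow> cd (du X Y f) = [X\<^bold>*]"
  unfolding du_def using sdual_simps[OF dpair_ev dpair_ev, of X Y f] by auto

lemma du_coev: "\<lbrakk>X \<in> Obj C; Y \<in> Obj C; sar f; dm f = [X]; cd f = [Y]\<rbrakk> \<Longrightarrow>
    wh [Y] (du X Y f) [] \<diamond> coev Y = wh [] f [X\<^bold>*] \<diamond> coev X"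
  unfolding du_def by (rule sdual_coev[OF dpair_ev dpair_ev])

lemma du_ev: "\<lbrakk>X \<in> Obj C; Y \<in> Obj C; sar f; dm f = [X]; cd f = [Y]\<rbrakk> \<Longrightarrow>
    ev X \<diamond> wh [] (du X Y f) [X] = ev Y \<diamond> wh [Y\<^bold>*] f []"
  unfolding du_def by (rule sdual_ev[OF dpair_ev dpair_ev])

lemma emb_mate:
  assumes "W \<in> Obj C" "Z \<in> Obj C" "e \<in> arr C (W \<otimes>\<^sub>o Z) (UnitO C)"
  shows "ar (Arw W (Z\<^bold>*) (mate C W Z e))"
    "emb (Arw W (Z\<^bold>*) (mate C W Z e)) = wh [] (uo \<diamond> emb (Arw (W \<otimes>\<^sub>o Z) (UnitO C) e) \<diamond> mu W Z) [Z\<^bold>*] \<diamond> wh [W] (coev Z) []"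
proof -
  let ?D = "Z\<^bold>*" and ?e = "Arw (W \<otimes>\<^sub>o Z) (UnitO C) e" and ?n = "Arw (UnitO C) (Z \<otimes>\<^sub>o Z\<^bold>*) (Coev C Z)"
  have e: "Arw W ?D (mate C W Z e) = lu ?D \<star> (?e \<boxtimes> idn ?D) \<star> alq W Z ?D \<star> (idn W \<boxtimes> ?n) \<star> rv W" (is "_ = ?r")
  proof -
    have "ar ?r" "dm ?r = W" "cd ?r = ?D"
      using assms by auto
    moreover have "mp ?r = mate C W Z e"
      using assms by (auto simp: mate_def mp_cmp mp_tns mp_idn, simp add: rv_def alq_def lu_def)
    ultimately show ?thesis
      by (metis ar_Arw_mp)
  qed
  show "ar (Arw W (Z\<^bold>*) (mate C W Z e))"
    unfolding e using assms by simp
  show "emb (Arw W (Z\<^bold>*) (mate C W Z e)) = wh [] (uo \<diamond> emb ?e \<diamond> mu W Z) [Z\<^bold>*] \<diamond> wh [W] (coev Z) []"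
    unfolding e using assms by (simp add: emb_cmp emb_tns emb_alq emb_lu emb_rv cp_assoc coev_def)
qed

lemma emb_dual_arr:
  assumes "ar f"
  shows "ar (Arw ((cd f)\<^bold>*) ((dm f)\<^bold>*) (dual_arr C (dm f) (cd f) (mp f)))"
    "emb (Arw ((cd f)\<^bold>*) ((dm f)\<^bold>*) (dual_arr C (dm f) (cd f) (mp f))) = du (dm f) (cd f) (emb f)"
proof -
  let ?X = "dm f" and ?Y = "cd f"
  let ?e = "Arw (?Y\<^bold>* \<otimes>\<^sub>o ?Y) (UnitO C) (Ev C ?Y) \<star> (idn (?Y\<^bold>*) \<boxtimes> f)"
  have ar: "ar ?e" "dm ?e = ?Y\<^bold>* \<otimes>\<^sub>o ?X" "cd ?e = UnitO C" "mp ?e = Ev C ?Y \<cdot> (Ident C (?Y\<^bold>*) \<otimes>\<^sub>m mp f)"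
    using assms by (auto simp: mp_cmp mp_tns mp_idn)
  have e: "Ev C ?Y \<cdot> (Ident C (?Y\<^bold>*) \<otimes>\<^sub>m mp f) \<in> arr C (?Y\<^bold>* \<otimes>\<^sub>o ?X) (UnitO C)"
      "Arw (?Y\<^bold>* \<otimes>\<^sub>o ?X) (UnitO C) (Ev C ?Y \<cdot> (Ident C (?Y\<^bold>*) \<otimes>\<^sub>m mp f)) = ?e"
    using ar_mp[OF ar(1)] ar_Arw_mp[OF ar(1)] unfolding ar(2-4) by blast+
  show "ar (Arw (?Y\<^bold>*) (?X\<^bold>*) (dual_arr C ?X ?Y (mp f)))"
    unfolding dual_arr_def using emb_mate(1)[of "?Y\<^bold>*" ?X, OF _ _ e(1)] assms by simp
  show "emb (Arw (?Y\<^bold>*) (?X\<^bold>*) (dual_arr C ?X ?Y (mp f))) = du ?X ?Y (emb f)"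
    unfolding dual_arr_def using emb_mate(2)[of "?Y\<^bold>*" ?X, OF _ _ e(1)] assms unfolding e(2)
    by (simp add: emb_cmp emb_tns du_def sdual_def ev_def cp_assoc)
qed

text \<open>The comparison \<open>Y* \<otimes> X* \<rightarrow> (X \<otimes> Y)*\<close> with the tensor factors of the source kept apart.\<close>

definition dt :: "'o \<Rightarrow> 'o \<Rightarrow> ('o list, 'o \<Rightarrow> ('o, 'm) arw) arw" where
  "dt X Y = sdual (ev Y \<diamond> wh [Y\<^bold>*] (ev X) [Y] \<diamond> wh [Y\<^bold>*, X\<^bold>*] (nu X Y) []) [Y\<^bold>*, X\<^bold>*] (sid [X \<otimes>\<^sub>o Y]) (coev (X \<otimes>\<^sub>o Y)) [(X \<otimes>\<^sub>o Y)\<^bold>*]"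

text \<open>Concatenation gives a dual pair for the word \<open>[X, Y]\<close>, which
  \<open>mu\<close> and \<open>nu\<close> transport to the single letter
  \<open>X \<otimes>\<^sub>o Y\<close>.\<close>

lemma dpair_tens:
  assumes "X \<in> Obj C" "Y \<in> Obj C"
  shows "dpair [X \<otimes>\<^sub>o Y] [Y\<^bold>*, X\<^bold>*] (ev Y \<diamond> wh [Y\<^bold>*] (ev X) [Y] \<diamond> wh [Y\<^bold>*, X\<^bold>*] (nu X Y) [])
    (wh [] (mu X Y) [Y\<^bold>*, X\<^bold>*] \<diamond> wh [X] (coev Y) [X\<^bold>*] \<diamond> coev X)"
  using dpair_iso[OF dpair_append[OF dpair_ev dpair_ev], of X Y "mu X Y" _ "nu X Y"] assms by (simp add: cp_assoc)

lemma dt_simps [simp]: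
  assumes "X \<in> Obj C" "Y \<in> Obj C"
  shows "sar (dt X Y)" "dm (dt X Y) = [Y\<^bold>*, X\<^bold>*]" "cd (dt X Y) = [(X \<otimes>\<^sub>o Y)\<^bold>*]"
  unfolding dt_def using sdual_simps[OF dpair_ev dpair_tens, of "X \<otimes>\<^sub>o Y" X Y] assms by auto

lemma dt_coev:
  assumes "X \<in> Obj C" "Y \<in> Obj C"
  shows "wh [X \<otimes>\<^sub>o Y] (dt X Y) [] \<diamond> wh [] (mu X Y) [Y\<^bold>*, X\<^bold>*] \<diamond> wh [X] (coev Y) [X\<^bold>*] \<diamond> coev X = coev (X \<otimes>\<^sub>o Y)"
  unfolding dt_def using sdual_coev[OF dpair_ev dpair_tens, of "X \<otimes>\<^sub>o Y" X Y] assms by auto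

lemma dt_ev:
  assumes "X \<in> Obj C" "Y \<in> Obj C"
  shows "ev (X \<otimes>\<^sub>o Y) \<diamond> wh [] (dt X Y) [X \<otimes>\<^sub>o Y] = ev Y \<diamond> wh [Y\<^bold>*] (ev X) [Y] \<diamond> wh [Y\<^bold>*, X\<^bold>*] (nu X Y) []"
  unfolding dt_def using sdual_ev[OF dpair_ev dpair_tens, of "X \<otimes>\<^sub>o Y" X Y] assms by auto

lemma dt_iso:
  assumes "X \<in> Obj C" "Y \<in> Obj C"
  obtains F where "sar F" "dm F = [(X \<otimes>\<^sub>o Y)\<^bold>*]" "cd F = [Y\<^bold>*, X\<^bold>*]" "F \<diamond> dt X Y = sid [Y\<^bold>*, X\<^bold>*]" "dt X Y \<diamond> F = sid [(X \<otimes>\<^sub>o Y)\<^bold>*]"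
proof -
  have XY: "X \<otimes>\<^sub>o Y \<in> Obj C"
    using assms by simp
  note p = dpair_tens[OF assms] and q = dpair_ev[OF XY]
  show ?thesis
    using that sdual_simps[OF p q, of "sid [X \<otimes>\<^sub>o Y]"] sdual_sid_inverse[OF p q] sdual_sid_inverse[OF q p] XY
    unfolding dt_def by simp
qed

lemma emb_dual_tens:
  assumes "X \<in> Obj C" "Y \<in> Obj C"
  shows "ar (Arw (Y\<^bold>* \<otimes>\<^sub>o X\<^bold>*) ((X \<otimes>\<^sub>o Y)\<^bold>*) (dual_tens C X Y))"
    "emb (Arw (Y\<^bold>* \<otimes>\<^sub>o X\<^bold>*) ((X \<otimes>\<^sub>o Y)\<^bold>*) (dual_tens C X Y)) = dt X Y \<diamond> nu (Y\<^bold>*) (X\<^bold>*)"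
proof -
  let ?D = "Y\<^bold>*" and ?E = "X\<^bold>*" and ?I = "UnitO C"
  let ?eX = "Arw (?E \<otimes>\<^sub>o X) ?I (Ev C X)" and ?eY = "Arw (?D \<otimes>\<^sub>o Y) ?I (Ev C Y)"
  let ?e = "?eY \<star> (idn ?D \<boxtimes> (lu Y \<star> (?eX \<boxtimes> idn Y) \<star> alq ?E X Y)) \<star> alp ?D ?E (X \<otimes>\<^sub>o Y)"
  let ?m = "Ev C Y \<cdot> (Ident C ?D \<otimes>\<^sub>m (LUnit C Y \<cdot> (Ev C X \<otimes>\<^sub>m Ident C Y) \<cdot> Assoc_inv C ?E X Y)) \<cdot> Assoc C ?D ?E (X \<otimes>\<^sub>o Y)"
  have ar: "ar ?e" "dm ?e = (?D \<otimes>\<^sub>o ?E) \<otimes>\<^sub>o X \<otimes>\<^sub>o Y" "cd ?e = ?I"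
    using assms by auto
  have m: "mp ?e = ?m"
    using assms by (auto simp: mp_cmp mp_tns mp_idn, simp add: lu_def alp_def alq_def)
  have e: "?m \<in> arr C ((?D \<otimes>\<^sub>o ?E) \<otimes>\<^sub>o X \<otimes>\<^sub>o Y) ?I" "Arw ((?D \<otimes>\<^sub>o ?E) \<otimes>\<^sub>o X \<otimes>\<^sub>o Y) ?I ?m = ?e"
    using ar_mp[OF ar(1)] ar_Arw_mp[OF ar(1)] unfolding ar(2,3) m by blast+
  show "ar (Arw (?D \<otimes>\<^sub>o ?E) ((X \<otimes>\<^sub>o Y)\<^bold>*) (dual_tens C X Y))"
    unfolding dual_tens_def using emb_mate(1)[OF _ _ e(1)] assms by simp
  have "emb (Arw (?D \<otimes>\<^sub>o ?E) ((X \<otimes>\<^sub>o Y)\<^bold>*) (dual_tens C X Y))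
      = wh [] (uo \<diamond> emb ?e \<diamond> mu (?D \<otimes>\<^sub>o ?E) (X \<otimes>\<^sub>o Y)) [(X \<otimes>\<^sub>o Y)\<^bold>*] \<diamond> wh [?D \<otimes>\<^sub>o ?E] (coev (X \<otimes>\<^sub>o Y)) []"
    unfolding dual_tens_def using emb_mate(2)[OF _ _ e(1)] assms unfolding e(2) by simp
  also have "uo \<diamond> emb ?e \<diamond> mu (?D \<otimes>\<^sub>o ?E) (X \<otimes>\<^sub>o Y)
      = (ev Y \<diamond> wh [?D] (ev X) [Y] \<diamond> wh [?D, ?E] (nu X Y) []) \<diamond> wh [] (nu ?D ?E) [X \<otimes>\<^sub>o Y]"
    using assms by (simp add: emb_cmp emb_tns emb_alq emb_alp emb_lu ev_def cp_assoc)
  also have "wh [] ((ev Y \<diamond> wh [?D] (ev X) [Y] \<diamond> wh [?D, ?E] (nu X Y) []) \<diamond> wh [] (nu ?D ?E) [X \<otimes>\<^sub>o Y]) [(X \<otimes>\<^sub>o Y)\<^bold>*] \<diamond> wh [?D \<otimes>\<^sub>o ?E] (coev (X \<otimes>\<^sub>o Y)) []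
      = wh [] (ev Y \<diamond> wh [?D] (ev X) [Y] \<diamond> wh [?D, ?E] (nu X Y) []) [(X \<otimes>\<^sub>o Y)\<^bold>*] \<diamond>
        (wh [] (nu ?D ?E) [X \<otimes>\<^sub>o Y, (X \<otimes>\<^sub>o Y)\<^bold>*] \<diamond> wh [?D \<otimes>\<^sub>o ?E] (coev (X \<otimes>\<^sub>o Y)) [])"
    by (simp add: cp_assoc)
  also have "wh [] (nu ?D ?E) [X \<otimes>\<^sub>o Y, (X \<otimes>\<^sub>o Y)\<^bold>*] \<diamond> wh [?D \<otimes>\<^sub>o ?E] (coev (X \<otimes>\<^sub>o Y)) [] = wh [?D, ?E] (coev (X \<otimes>\<^sub>o Y)) [] \<diamond> nu ?D ?E"
    using exchange[of "nu ?D ?E" "coev (X \<otimes>\<^sub>o Y)" "[]" "[]" "[]"] assms by simp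
  finally show "emb (Arw (?D \<otimes>\<^sub>o ?E) ((X \<otimes>\<^sub>o Y)\<^bold>*) (dual_tens C X Y)) = dt X Y \<diamond> nu ?D ?E"
    using assms by (simp add: dt_def sdual_def cp_assoc)
qed

end

section \<open>Braidings\<close>

context braided_fusion_category
begin

definition bd :: "'o \<Rightarrow> 'o \<Rightarrow> ('o, 'm) arw" where
  "bd X Y = Arw (X \<otimes>\<^sub>o Y) (Y \<otimes>\<^sub>o X) (Braid C X Y)"

lemma bd_inverses: "\<lbrakk>X \<in> Obj C; Y \<in> Obj C\<rbrakk> \<Longrightarrow> \<exists>g. inverses (bd X Y) g"
  unfolding bd_def using Braid_iso[of X Y] iso_arr_inverses[of "X \<otimes>\<^sub>o Y" "Y \<otimes>\<^sub>o X"] by simp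

lemma bd_simps [simp]: "\<lbrakk>X \<in> Obj C; Y \<in> Obj C\<rbrakk> \<Longrightarrow> ar (bd X Y)"
    "dm (bd X Y) = X \<otimes>\<^sub>o Y" "cd (bd X Y) = Y \<otimes>\<^sub>o X"
  using bd_inverses[of X Y] by (auto simp: inverses_def) (simp_all add: bd_def)

lemma bd_nat: "\<lbrakk>ar f; ar g\<rbrakk> \<Longrightarrow> bd (cd f) (cd g) \<star> (f \<boxtimes> g) = (g \<boxtimes> f) \<star> bd (dm f) (dm g)"
  using Braid_natural[of "dm f" "dm g" "cd f" "cd g" "mp f" "mp g"] ar_mp[of f] ar_mp[of g]
  by (intro ar_eqI) (auto simp: mp_cmp mp_tns, simp add: bd_def)

definition br :: "'o \<Rightarrow> 'o \<Rightarrow> ('o list, 'o \<Rightarrow> ('o, 'm) arw) arw" where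
  "br X Y = nu Y X \<diamond> emb (bd X Y) \<diamond> mu X Y"

lemma br_simps [simp]: "\<lbrakk>X \<in> Obj C; Y \<in> Obj C\<rbrakk> \<Longrightarrow> sar (br X Y)"
    "\<lbrakk>X \<in> Obj C; Y \<in> Obj C\<rbrakk> \<Longrightarrow> dm (br X Y) = [X, Y]" "\<lbrakk>X \<in> Obj C; Y \<in> Obj C\<rbrakk> \<Longrightarrow> cd (br X Y) = [Y, X]"
  by (simp_all add: br_def)

lemma br_nat1: "\<lbrakk>ar f; Y \<in> Obj C\<rbrakk> \<Longrightarrow> br (cd f) Y \<diamond> wh [] (emb f) [Y] = wh [Y] (emb f) [] \<diamond> br (dm f) Y"
proof -
  assume a: "ar f" "Y \<in> Obj C"
  then have "nu Y (cd f) \<diamond> emb (bd (cd f) Y \<star> (f \<boxtimes> idn Y)) \<diamond> mu (dm f) Y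
      = nu Y (cd f) \<diamond> emb ((idn Y \<boxtimes> f) \<star> bd (dm f) Y) \<diamond> mu (dm f) Y"
    using bd_nat[of f "idn Y"] by simp
  then show ?thesis
    using a by (simp add: br_def emb_cmp emb_tns cp_assoc)
qed

lemma br_nat2: "\<lbrakk>ar f; X \<in> Obj C\<rbrakk> \<Longrightarrow> br X (cd f) \<diamond> wh [X] (emb f) [] = wh [] (emb f) [X] \<diamond> br X (dm f)"
proof -
  assume a: "ar f" "X \<in> Obj C"
  then have "nu (cd f) X \<diamond> emb (bd X (cd f) \<star> (idn X \<boxtimes> f)) \<diamond> mu X (dm f)
      = nu (cd f) X \<diamond> emb ((f \<boxtimes> idn X) \<star> bd X (dm f)) \<diamond> mu X (dm f)"
    using bd_nat[of "idn X" f] by simp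
  then show ?thesis
    using a by (simp add: br_def emb_cmp emb_tns cp_assoc)
qed

text \<open>Freed of associators, the hexagon says that crossing a tensor product means crossing its
  factors in turn.\<close>

lemma br_hexagon1:
  assumes o: "X \<in> Obj C" "Y \<in> Obj C" "Z \<in> Obj C"
  shows "br X (Y \<otimes>\<^sub>o Z) \<diamond> wh [X] (mu Y Z) [] = wh [] (mu Y Z) [X] \<diamond> wh [Y] (br X Z) [] \<diamond> wh [] (br X Y) [Z]"
proof -
  have "alp Y Z X \<star> bd X (Y \<otimes>\<^sub>o Z) \<star> alp X Y Z = (idn Y \<boxtimes> bd X Z) \<star> alp Y X Z \<star> (bd X Y \<boxtimes> idn Z)"
    using hexagon1[of X Y Z] o by (intro ar_eqI) (auto simp: mp_cmp mp_tns mp_idn, simp add: bd_def alp_def)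
  then have "wh [] (mu Y Z) [X] \<diamond> wh [Y] (nu Z X) [] \<diamond> nu Y (Z \<otimes>\<^sub>o X) \<diamond>
        emb (alp Y Z X \<star> bd X (Y \<otimes>\<^sub>o Z) \<star> alp X Y Z) \<diamond> mu (X \<otimes>\<^sub>o Y) Z \<diamond> wh [] (mu X Y) [Z]
      = wh [] (mu Y Z) [X] \<diamond> wh [Y] (nu Z X) [] \<diamond> nu Y (Z \<otimes>\<^sub>o X) \<diamond>
        emb ((idn Y \<boxtimes> bd X Z) \<star> alp Y X Z \<star> (bd X Y \<boxtimes> idn Z)) \<diamond> mu (X \<otimes>\<^sub>o Y) Z \<diamond> wh [] (mu X Y) [Z]"
    by simp
  then show ?thesis
    using o by (simp add: emb_cmp emb_tns emb_alp br_def cp_assoc)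
qed

lemma br_hexagon2:
  assumes o: "X \<in> Obj C" "Y \<in> Obj C" "Z \<in> Obj C"
  shows "br (X \<otimes>\<^sub>o Y) Z \<diamond> wh [] (mu X Y) [Z] = wh [Z] (mu X Y) [] \<diamond> wh [] (br X Z) [Y] \<diamond> wh [X] (br Y Z) []"
proof -
  have "alq Z X Y \<star> bd (X \<otimes>\<^sub>o Y) Z \<star> alq X Y Z = (bd X Z \<boxtimes> idn Y) \<star> alq X Z Y \<star> (idn X \<boxtimes> bd Y Z)"
    using hexagon2[of X Y Z] o by (intro ar_eqI) (auto simp: mp_cmp mp_tns mp_idn, simp add: bd_def alq_def)
  then have "wh [Z] (mu X Y) [] \<diamond> wh [] (nu Z X) [Y] \<diamond> nu (Z \<otimes>\<^sub>o X) Y \<diamond>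
        emb (alq Z X Y \<star> bd (X \<otimes>\<^sub>o Y) Z \<star> alq X Y Z) \<diamond> mu X (Y \<otimes>\<^sub>o Z) \<diamond> wh [X] (mu Y Z) []
      = wh [Z] (mu X Y) [] \<diamond> wh [] (nu Z X) [Y] \<diamond> nu (Z \<otimes>\<^sub>o X) Y \<diamond>
        emb ((bd X Z \<boxtimes> idn Y) \<star> alq X Z Y \<star> (idn X \<boxtimes> bd Y Z)) \<diamond> mu X (Y \<otimes>\<^sub>o Z) \<diamond> wh [X] (mu Y Z) []"
    by simp
  then show ?thesis
    using o by (simp add: emb_cmp emb_tns emb_alq br_def cp_assoc)
qed

definition db :: "'o \<Rightarrow> 'o \<Rightarrow> ('o list, 'o \<Rightarrow> ('o, 'm) arw) arw" where
  "db X Y = br Y X \<diamond> br X Y"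

lemma db_simps [simp]: "\<lbrakk>X \<in> Obj C; Y \<in> Obj C\<rbrakk> \<Longrightarrow> sar (db X Y)"
    "\<lbrakk>X \<in> Obj C; Y \<in> Obj C\<rbrakk> \<Longrightarrow> dm (db X Y) = [X, Y]" "\<lbrakk>X \<in> Obj C; Y \<in> Obj C\<rbrakk> \<Longrightarrow> cd (db X Y) = [X, Y]"
  by (simp_all add: db_def)

lemma db_emb: "\<lbrakk>X \<in> Obj C; Y \<in> Obj C\<rbrakk> \<Longrightarrow> db X Y = nu X Y \<diamond> emb (bd Y X \<star> bd X Y) \<diamond> mu X Y"
  by (simp add: db_def br_def emb_cmp cp_assoc)

lemma db_nat: "\<lbrakk>ar f; X \<in> Obj C\<rbrakk> \<Longrightarrow> db X (cd f) \<diamond> wh [X] (emb f) [] = wh [X] (emb f) [] \<diamond> db X (dm f)"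
  using br_nat2[of f X] cp_reassoc2[OF br_nat1[of f X]] by (simp add: db_def cp_assoc)

text \<open>Both hexagons together: the full twist of \<open>X\<close> around \<open>Y\<close> and
  \<open>Z\<close> has the twist around \<open>Z\<close> nested between the two crossings with
  \<open>Y\<close>.\<close>

lemma db_tens:
  assumes "X \<in> Obj C" "Y \<in> Obj C" "Z \<in> Obj C"
  shows "db X (Y \<otimes>\<^sub>o Z) \<diamond> wh [X] (mu Y Z) [] =
    wh [X] (mu Y Z) [] \<diamond> wh [] (br Y X) [Z] \<diamond> wh [Y] (db X Z) [] \<diamond> wh [] (br X Y) [Z]"
  using br_hexagon1[OF assms] cp_reassoc[OF br_hexagon2[of Y Z X]] assms by (simp add: db_def cp_assoc)

end


section \<open>Partial traces\<close>

context modular_category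
begin

definition pv :: "'o \<Rightarrow> ('o, 'm) arw" where
  "pv X = Arw X (X\<^bold>*\<^bold>*) (Piv C X)"

lemma pv_simps [simp]: "X \<in> Obj C \<Longrightarrow> ar (pv X)" "dm (pv X) = X" "cd (pv X) = X\<^bold>*\<^bold>*" "mp (pv X) = Piv C X"
  using Piv_iso[of X] by (simp_all add: pv_def iso_arr_def)

text \<open>The evaluation on the other side, from \<open>X \<otimes> X*\<close> to the unit; it
  exists because the pivotal structure identifies \<open>X\<close> with its double dual.\<close>

definition tv :: "'o \<Rightarrow> ('o list, 'o \<Rightarrow> ('o, 'm) arw) arw" where
  "tv X = ev (X\<^bold>*) \<diamond> wh [] (emb (pv X)) [X\<^bold>*]"

lemma tv_simps [simp]: "X \<in> Obj C \<Longrightarrow> sar (tv X)" "X \<in> Obj C \<Longrightarrow> dm (tv X) = [X, X\<^bold>*]" "X \<in> Obj C \<Longrightarrow> cd (tv X) = []"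
  by (simp_all add: tv_def)

lemma pv_nat:
  assumes "ar f"
  shows "emb (pv (cd f)) \<diamond> emb f = du ((cd f)\<^bold>*) ((dm f)\<^bold>*) (du (dm f) (cd f) (emb f)) \<diamond> emb (pv (dm f))"
proof -
  let ?g = "Arw ((cd f)\<^bold>*) ((dm f)\<^bold>*) (dual_arr C (dm f) (cd f) (mp f))"
  let ?h = "Arw ((dm f)\<^bold>*\<^bold>*) ((cd f)\<^bold>*\<^bold>*) (dual_arr C ((cd f)\<^bold>*) ((dm f)\<^bold>*) (dual_arr C (dm f) (cd f) (mp f)))"
  note g = emb_dual_arr[OF assms]
  have h: "ar ?h" "emb ?h = du ((cd f)\<^bold>*) ((dm f)\<^bold>*) (emb ?g)"
    using emb_dual_arr[OF g(1)] by simp_all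
  have "pv (cd f) \<star> f = ?h \<star> pv (dm f)"
    using Piv_natural[of "dm f" "cd f" "mp f"] assms ar_mp[of f] h(1)
    by (intro ar_eqI) (auto simp: mp_cmp)
  then have "emb (pv (cd f)) \<diamond> emb f = emb ?h \<diamond> emb (pv (dm f))"
    by (metis emb_cmp)
  then show ?thesis
    by (simp add: h(2) g(2))
qed

text \<open>Naturality of the pivotal structure lets a map pass over the cap: on the other leg it
  reappears as its dual.\<close>

lemma tv_slide:
  assumes "ar f"
  shows "tv (cd f) \<diamond> wh [] (emb f) [(cd f)\<^bold>*] = tv (dm f) \<diamond> wh [dm f] (du (dm f) (cd f) (emb f)) []"
proof -
  let ?X = "dm f" and ?Y = "cd f"
  let ?g = "du ?X ?Y (emb f)"
  have s: "sar ?g" "dm ?g = [?Y\<^bold>*]" "cd ?g = [?X\<^bold>*]"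
    using assms by simp_all
  have "tv ?Y \<diamond> wh [] (emb f) [?Y\<^bold>*] = ev (?Y\<^bold>*) \<diamond> wh [] (emb (pv ?Y) \<diamond> emb f) [?Y\<^bold>*]"
    by (simp add: tv_def cp_assoc)
  also have "\<dots> = (ev (?Y\<^bold>*) \<diamond> wh [] (du (?Y\<^bold>*) (?X\<^bold>*) ?g) [?Y\<^bold>*]) \<diamond> wh [] (emb (pv ?X)) [?Y\<^bold>*]"
    by (simp add: pv_nat[OF assms] cp_assoc)
  also have "ev (?Y\<^bold>*) \<diamond> wh [] (du (?Y\<^bold>*) (?X\<^bold>*) ?g) [?Y\<^bold>*] = ev (?X\<^bold>*) \<diamond> wh [?X\<^bold>*\<^bold>*] ?g []"
    using du_ev[of "?Y\<^bold>*" "?X\<^bold>*" ?g] s assms by simp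
  also have "(ev (?X\<^bold>*) \<diamond> wh [?X\<^bold>*\<^bold>*] ?g []) \<diamond> wh [] (emb (pv ?X)) [?Y\<^bold>*] =
      ev (?X\<^bold>*) \<diamond> (wh [?X\<^bold>*\<^bold>*] ?g [] \<diamond> wh [] (emb (pv ?X)) [?Y\<^bold>*])"
    by (simp only: cp_assoc)
  also have "wh [?X\<^bold>*\<^bold>*] ?g [] \<diamond> wh [] (emb (pv ?X)) [?Y\<^bold>*] = wh [] (emb (pv ?X)) [?X\<^bold>*] \<diamond> wh [?X] ?g []"
    using exchange[of "emb (pv ?X)" ?g "[]" "[]" "[]"] s assms by simp
  finally show ?thesis
    by (simp add: tv_def cp_assoc)
qed

lemma pv_tens:
  assumes "X \<in> Obj C" "Y \<in> Obj C"
  shows "du (Y\<^bold>* \<otimes>\<^sub>o X\<^bold>*) ((X \<otimes>\<^sub>o Y)\<^bold>*) (dt X Y \<diamond> nu (Y\<^bold>*) (X\<^bold>*)) \<diamond> emb (pv (X \<otimes>\<^sub>o Y)) \<diamond> mu X Y =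
    dt (Y\<^bold>*) (X\<^bold>*) \<diamond> wh [] (emb (pv X)) [Y\<^bold>*\<^bold>*] \<diamond> wh [X] (emb (pv Y)) []"
proof -
  let ?d = "Arw (Y\<^bold>* \<otimes>\<^sub>o X\<^bold>*) ((X \<otimes>\<^sub>o Y)\<^bold>*) (dual_tens C X Y)"
  let ?d' = "Arw (X\<^bold>*\<^bold>* \<otimes>\<^sub>o Y\<^bold>*\<^bold>*) ((Y\<^bold>* \<otimes>\<^sub>o X\<^bold>*)\<^bold>*) (dual_tens C (Y\<^bold>*) (X\<^bold>*))"
  let ?dd = "Arw ((X \<otimes>\<^sub>o Y)\<^bold>*\<^bold>*) ((Y\<^bold>* \<otimes>\<^sub>o X\<^bold>*)\<^bold>*) (dual_arr C (Y\<^bold>* \<otimes>\<^sub>o X\<^bold>*) ((X \<otimes>\<^sub>o Y)\<^bold>*) (dual_tens C X Y))"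
  note d = emb_dual_tens[OF assms]
  have d': "ar ?d'" "emb ?d' = dt (Y\<^bold>*) (X\<^bold>*) \<diamond> nu (X\<^bold>*\<^bold>*) (Y\<^bold>*\<^bold>*)"
    using emb_dual_tens[of "Y\<^bold>*" "X\<^bold>*"] assms by simp_all
  have dd: "ar ?dd" "emb ?dd = du (Y\<^bold>* \<otimes>\<^sub>o X\<^bold>*) ((X \<otimes>\<^sub>o Y)\<^bold>*) (emb ?d)"
    using emb_dual_arr[OF d(1)] by simp_all
  have "?dd \<star> pv (X \<otimes>\<^sub>o Y) = ?d' \<star> (pv X \<boxtimes> pv Y)"
    using Piv_tens[OF assms] assms dd(1) d'(1)
    by (intro ar_eqI) (auto simp: mp_cmp mp_tns)
  then have "emb (?dd \<star> pv (X \<otimes>\<^sub>o Y)) \<diamond> mu X Y = emb (?d' \<star> (pv X \<boxtimes> pv Y)) \<diamond> mu X Y"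
    by simp
  then show ?thesis
    unfolding emb_cmp dd(2) d(2) d'(2) using assms by (simp add: emb_tns cp_assoc)
qed

text \<open>Monoidality of the pivotal structure turns the cap of a tensor product into nested caps.
  To reach it, \<open>dt X Y\<close> is passed across the evaluation, where its dual meets
  \<open>Piv\<close> as in \<open>pv_tens\<close>.\<close>

lemma tv_tens:
  assumes o: "X \<in> Obj C" "Y \<in> Obj C"
  shows "tv (X \<otimes>\<^sub>o Y) \<diamond> wh [] (mu X Y) [(X \<otimes>\<^sub>o Y)\<^bold>*] \<diamond> wh [X, Y] (dt X Y) [] = tv X \<diamond> wh [X] (tv Y) [X\<^bold>*]"
proof -
  let ?Z = "X \<otimes>\<^sub>o Y" and ?X = "X\<^bold>*" and ?Y = "Y\<^bold>*"
  let ?g = "dt X Y \<diamond> nu ?Y ?X" and ?a = "emb (pv ?Z) \<diamond> mu X Y"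
  have "tv ?Z \<diamond> wh [] (mu X Y) [?Z\<^bold>*] \<diamond> wh [X, Y] (dt X Y) [] =
      ev (?Z\<^bold>*) \<diamond> (wh [] ?a [?Z\<^bold>*] \<diamond> wh [X, Y] ?g []) \<diamond> wh [X, Y] (mu ?Y ?X) []"
    using o by (simp add: tv_def cp_assoc)
  also have "wh [] ?a [?Z\<^bold>*] \<diamond> wh [X, Y] ?g [] = wh [?Z\<^bold>*\<^bold>*] ?g [] \<diamond> wh [] ?a [?Y \<otimes>\<^sub>o ?X]"
    using exchange[of ?a ?g "[]" "[]" "[]"] o by simp
  also have "ev (?Z\<^bold>*) \<diamond> (wh [?Z\<^bold>*\<^bold>*] ?g [] \<diamond> wh [] ?a [?Y \<otimes>\<^sub>o ?X]) \<diamond> wh [X, Y] (mu ?Y ?X) []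
      = (ev (?Z\<^bold>*) \<diamond> wh [?Z\<^bold>*\<^bold>*] ?g []) \<diamond> wh [] ?a [?Y \<otimes>\<^sub>o ?X] \<diamond> wh [X, Y] (mu ?Y ?X) []"
    by (simp only: cp_assoc)
  also have "ev (?Z\<^bold>*) \<diamond> wh [?Z\<^bold>*\<^bold>*] ?g [] = ev (?Y \<otimes>\<^sub>o ?X) \<diamond> wh [] (du (?Y \<otimes>\<^sub>o ?X) (?Z\<^bold>*) ?g) [?Y \<otimes>\<^sub>o ?X]"
    using du_ev[of "?Y \<otimes>\<^sub>o ?X" "?Z\<^bold>*" ?g] o by simp
  also have "(ev (?Y \<otimes>\<^sub>o ?X) \<diamond> wh [] (du (?Y \<otimes>\<^sub>o ?X) (?Z\<^bold>*) ?g) [?Y \<otimes>\<^sub>o ?X]) \<diamond> wh [] ?a [?Y \<otimes>\<^sub>o ?X] \<diamond> wh [X, Y] (mu ?Y ?X) []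
      = ev (?Y \<otimes>\<^sub>o ?X) \<diamond> wh [] (du (?Y \<otimes>\<^sub>o ?X) (?Z\<^bold>*) ?g \<diamond> ?a) [?Y \<otimes>\<^sub>o ?X] \<diamond> wh [X, Y] (mu ?Y ?X) []"
    by (simp add: cp_assoc)
  also have "du (?Y \<otimes>\<^sub>o ?X) (?Z\<^bold>*) ?g \<diamond> ?a = dt ?Y ?X \<diamond> wh [] (emb (pv X)) [?Y\<^bold>*] \<diamond> wh [X] (emb (pv Y)) []"
    using pv_tens[OF o] by simp
  also have "ev (?Y \<otimes>\<^sub>o ?X) \<diamond> wh [] (dt ?Y ?X \<diamond> wh [] (emb (pv X)) [?Y\<^bold>*] \<diamond> wh [X] (emb (pv Y)) []) [?Y \<otimes>\<^sub>o ?X] \<diamond> wh [X, Y] (mu ?Y ?X) []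
      = (ev (?Y \<otimes>\<^sub>o ?X) \<diamond> wh [] (dt ?Y ?X) [?Y \<otimes>\<^sub>o ?X]) \<diamond>
        (wh [] (wh [] (emb (pv X)) [?Y\<^bold>*] \<diamond> wh [X] (emb (pv Y)) []) [?Y \<otimes>\<^sub>o ?X] \<diamond> wh [X, Y] (mu ?Y ?X) [])"
    by (simp add: cp_assoc)
  also have "wh [] (wh [] (emb (pv X)) [?Y\<^bold>*] \<diamond> wh [X] (emb (pv Y)) []) [?Y \<otimes>\<^sub>o ?X] \<diamond> wh [X, Y] (mu ?Y ?X) []
      = wh [?X\<^bold>*, ?Y\<^bold>*] (mu ?Y ?X) [] \<diamond> wh [] (emb (pv X)) [?Y\<^bold>*, ?Y, ?X] \<diamond> wh [X] (emb (pv Y)) [?Y, ?X]"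
    using exchange[of "wh [] (emb (pv X)) [?Y\<^bold>*] \<diamond> wh [X] (emb (pv Y)) []" "mu ?Y ?X" "[]" "[]" "[]"] o by simp
  also have "ev (?Y \<otimes>\<^sub>o ?X) \<diamond> wh [] (dt ?Y ?X) [?Y \<otimes>\<^sub>o ?X] = ev ?X \<diamond> wh [?X\<^bold>*] (ev ?Y) [?X] \<diamond> wh [?X\<^bold>*, ?Y\<^bold>*] (nu ?Y ?X) []"
    using dt_ev[of ?Y ?X] o by simp
  also have "(ev ?X \<diamond> wh [?X\<^bold>*] (ev ?Y) [?X] \<diamond> wh [?X\<^bold>*, ?Y\<^bold>*] (nu ?Y ?X) []) \<diamond>
        wh [?X\<^bold>*, ?Y\<^bold>*] (mu ?Y ?X) [] \<diamond> wh [] (emb (pv X)) [?Y\<^bold>*, ?Y, ?X] \<diamond> wh [X] (emb (pv Y)) [?Y, ?X]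
      = ev ?X \<diamond> (wh [?X\<^bold>*] (ev ?Y) [?X] \<diamond> wh [] (emb (pv X)) [?Y\<^bold>*, ?Y, ?X]) \<diamond> wh [X] (emb (pv Y)) [?Y, ?X]"
    using o by (simp add: cp_assoc)
  also have "wh [?X\<^bold>*] (ev ?Y) [?X] \<diamond> wh [] (emb (pv X)) [?Y\<^bold>*, ?Y, ?X] = wh [] (emb (pv X)) [?X] \<diamond> wh [X] (ev ?Y) [?X]"
    using exchange[of "emb (pv X)" "ev ?Y" "[]" "[]" "[?X]"] o by simp
  finally show ?thesis
    using o by (simp add: tv_def cp_assoc)
qed

text \<open>The partial trace: for \<open>f\<close> from \<open>l @ [V]\<close> to
  \<open>m @ [V]\<close> the last strand is closed to a loop, leaving a map from \<open>l\<close> to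
  \<open>m\<close>.\<close>

definition ptr :: "'o list \<Rightarrow> 'o \<Rightarrow> ('o list, 'o \<Rightarrow> ('o, 'm) arw) arw \<Rightarrow> 'o list \<Rightarrow> ('o list, 'o \<Rightarrow> ('o, 'm) arw) arw" where
  "ptr m V f l = wh m (tv V) [] \<diamond> wh [] f [V\<^bold>*] \<diamond> wh l (coev V) []"

lemma ptr_simps [simp]:
  assumes "V \<in> Obj C" "sar f" "dm f = l @ [V]" "cd f = m @ [V]"
  shows "sar (ptr m V f l)" "dm (ptr m V f l) = l" "cd (ptr m V f l) = m"
  using assms sar_objs[of f] by (simp_all add: ptr_def)

lemma ptr_cp_left:
  assumes "V \<in> Obj C" "sar a" "dm a = m'" "cd a = m"
  shows "ptr m V (wh [] a [V] \<diamond> f) l = a \<diamond> ptr m' V f l"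
proof -
  have "wh m (tv V) [] \<diamond> wh [] a [V, V\<^bold>*] = a \<diamond> wh m' (tv V) []"
    using exchange[of a "tv V" "[]" "[]" "[]"] assms by simp
  from cp_reassoc2[OF this] show ?thesis
    unfolding ptr_def by (simp add: cp_assoc)
qed

lemma ptr_cp_right:
  assumes "V \<in> Obj C" "sar a" "dm a = l" "cd a = l'"
  shows "ptr m V (f \<diamond> wh [] a [V]) l = ptr m V f l' \<diamond> a"
proof -
  have "wh [] a [V, V\<^bold>*] \<diamond> wh l (coev V) [] = wh l' (coev V) [] \<diamond> a"
    using exchange[of a "coev V" "[]" "[]" "[]"] assms by simp
  then show ?thesis
    unfolding ptr_def using assms by (simp add: cp_assoc)
qed

lemma ptr_wh: "set k \<subseteq> Obj C \<Longrightarrow> ptr (k @ m) V (wh k f []) (k @ l) = wh k (ptr m V f l) []"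
  by (simp add: ptr_def)

text \<open>The map \<open>i\<close> travels round the loop: over the cap by
  \<open>tv_slide\<close>, down the strand of the dual by interchange, and through the coevaluation
  by \<open>du_coev\<close>.\<close>

lemma ptr_cyclic:
  assumes "ar i" "dm i = V'" "cd i = V" "sar f" "dm f = l @ [V]" "cd f = m @ [V']"
  shows "ptr m V (wh m (emb i) [] \<diamond> f) l = ptr m V' (f \<diamond> wh l (emb i) []) l"
proof -
  let ?g = "du V' V (emb i)"
  have o: "V \<in> Obj C" "V' \<in> Obj C" "set l \<subseteq> Obj C" "set m \<subseteq> Obj C"
    using assms sar_objs[of f] by auto
  have g: "sar ?g" "dm ?g = [V\<^bold>*]" "cd ?g = [V'\<^bold>*]"
    using assms o by simp_all
  have "ptr m V (wh m (emb i) [] \<diamond> f) l = wh m (tv V \<diamond> wh [] (emb i) [V\<^bold>*]) [] \<diamond> wh [] f [V\<^bold>*] \<diamond> wh l (coev V) []"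
    by (simp add: ptr_def cp_assoc)
  also have "tv V \<diamond> wh [] (emb i) [V\<^bold>*] = tv V' \<diamond> wh [V'] ?g []"
    using tv_slide[of i] assms by simp
  also have "wh m (tv V' \<diamond> wh [V'] ?g []) [] \<diamond> wh [] f [V\<^bold>*] \<diamond> wh l (coev V) []
      = wh m (tv V') [] \<diamond> (wh (m @ [V']) ?g [] \<diamond> wh [] f [V\<^bold>*]) \<diamond> wh l (coev V) []"
    by (simp add: cp_assoc)
  also have "wh (m @ [V']) ?g [] \<diamond> wh [] f [V\<^bold>*] = wh [] f [V'\<^bold>*] \<diamond> wh (l @ [V]) ?g []"
    using exchange[of f ?g "[]" "[]" "[]"] assms g by simp
  also have "wh m (tv V') [] \<diamond> (wh [] f [V'\<^bold>*] \<diamond> wh (l @ [V]) ?g []) \<diamond> wh l (coev V) []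
      = wh m (tv V') [] \<diamond> wh [] f [V'\<^bold>*] \<diamond> wh l (wh [V] ?g [] \<diamond> coev V) []"
    by (simp add: cp_assoc)
  also have "wh [V] ?g [] \<diamond> coev V = wh [] (emb i) [V'\<^bold>*] \<diamond> coev V'"
    using du_coev[of V' V "emb i"] assms o by simp
  finally show ?thesis
    by (simp add: ptr_def cp_assoc)
qed

text \<open>Closing a tensor product closes its factors one after the other. The comparison
  \<open>dt\<close> arises at the coevaluation, slides past \<open>f\<close> on the dual strands,
  and is absorbed at the cap by \<open>tv_tens\<close>.\<close>

lemma ptr_tens:
  assumes o: "V \<in> Obj C" "W \<in> Obj C" and f: "sar f" "dm f = l @ [V, W]" "cd f = m @ [V, W]"
  shows "ptr m (V \<otimes>\<^sub>o W) (wh m (mu V W) [] \<diamond> f \<diamond> wh l (nu V W) []) l = ptr m V (ptr (m @ [V]) W f (l @ [V])) l"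
proof -
  let ?Z = "V \<otimes>\<^sub>o W"
  have s: "set l \<subseteq> Obj C" "set m \<subseteq> Obj C"
    using f sar_objs[of f] by auto
  have n: "wh [] (nu V W) [?Z\<^bold>*] \<diamond> coev ?Z = wh [V, W] (dt V W) [] \<diamond> wh [V] (coev W) [V\<^bold>*] \<diamond> coev V"
  proof -
    have "wh [] (nu V W) [?Z\<^bold>*] \<diamond> coev ?Z = (wh [] (nu V W) [?Z\<^bold>*] \<diamond> wh [?Z] (dt V W) []) \<diamond>
        wh [] (mu V W) [W\<^bold>*, V\<^bold>*] \<diamond> wh [V] (coev W) [V\<^bold>*] \<diamond> coev V"
      using dt_coev[OF o] by (simp add: cp_assoc)
    also have "wh [] (nu V W) [?Z\<^bold>*] \<diamond> wh [?Z] (dt V W) [] = wh [V, W] (dt V W) [] \<diamond> wh [] (nu V W) [W\<^bold>*, V\<^bold>*]"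
      using exchange[of "nu V W" "dt V W" "[]" "[]" "[]"] o by simp
    finally show ?thesis
      using o by (simp add: cp_assoc)
  qed
  have "ptr m ?Z (wh m (mu V W) [] \<diamond> f \<diamond> wh l (nu V W) []) l
      = wh m (tv ?Z) [] \<diamond> wh m (mu V W) [?Z\<^bold>*] \<diamond> wh [] f [?Z\<^bold>*] \<diamond> wh l (wh [] (nu V W) [?Z\<^bold>*] \<diamond> coev ?Z) []"
    by (simp add: ptr_def cp_assoc)
  also have "\<dots> = wh m (tv ?Z) [] \<diamond> wh m (mu V W) [?Z\<^bold>*] \<diamond>
      (wh [] f [?Z\<^bold>*] \<diamond> wh (l @ [V, W]) (dt V W) []) \<diamond> wh l (wh [V] (coev W) [V\<^bold>*] \<diamond> coev V) []"
    by (simp add: n cp_assoc)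
  also have "wh [] f [?Z\<^bold>*] \<diamond> wh (l @ [V, W]) (dt V W) [] = wh (m @ [V, W]) (dt V W) [] \<diamond> wh [] f [W\<^bold>*, V\<^bold>*]"
    using exchange[of f "dt V W" "[]" "[]" "[]"] o f by simp
  also have "wh m (tv ?Z) [] \<diamond> wh m (mu V W) [?Z\<^bold>*] \<diamond> (wh (m @ [V, W]) (dt V W) [] \<diamond> wh [] f [W\<^bold>*, V\<^bold>*]) \<diamond> wh l (wh [V] (coev W) [V\<^bold>*] \<diamond> coev V) []
      = wh m (tv ?Z \<diamond> wh [] (mu V W) [?Z\<^bold>*] \<diamond> wh [V, W] (dt V W) []) [] \<diamond> wh [] f [W\<^bold>*, V\<^bold>*] \<diamond> wh l (wh [V] (coev W) [V\<^bold>*] \<diamond> coev V) []"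
    by (simp add: cp_assoc)
  also have "tv ?Z \<diamond> wh [] (mu V W) [?Z\<^bold>*] \<diamond> wh [V, W] (dt V W) [] = tv V \<diamond> wh [V] (tv W) [V\<^bold>*]"
    by (rule tv_tens[OF o])
  finally show ?thesis
    by (simp add: ptr_def cp_assoc)
qed

lemma ptr_smul: "ptr m V (smul c f) l = smul c (ptr m V f l)"
  by (simp add: ptr_def wh_smul smul_cp cp_smul)

lemma ptr_sadd: "ptr m V (sadd f g) l = sadd (ptr m V f l) (ptr m V g l)"
  by (simp add: ptr_def wh_sadd sadd_cp cp_sadd)

text \<open>Source of multiplicativity: by \<open>db_tens\<close> the loop of \<open>W\<close> lies
  inside that of \<open>V\<close>. It is closed first and contributes only the scalar
  \<open>c\<close>, after which the two crossings with \<open>V\<close> form its double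
  braiding.\<close>

lemma ptr_db_tens:
  assumes o: "X \<in> Obj C" "V \<in> Obj C" "W \<in> Obj C" and c: "ptr [X] W (db X W) [X] = smul c (sid [X])"
  shows "ptr [X] (V \<otimes>\<^sub>o W) (db X (V \<otimes>\<^sub>o W)) [X] = smul c (ptr [X] V (db X V) [X])"
proof -
  let ?f = "wh [] (br V X) [W] \<diamond> wh [V] (db X W) [] \<diamond> wh [] (br X V) [W]"
  have "db X (V \<otimes>\<^sub>o W) = (db X (V \<otimes>\<^sub>o W) \<diamond> wh [X] (mu V W) []) \<diamond> wh [X] (nu V W) []"
    using o by (simp add: cp_assoc)
  also have "\<dots> = wh [X] (mu V W) [] \<diamond> ?f \<diamond> wh [X] (nu V W) []"
    using db_tens[OF o] by (simp add: cp_assoc)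
  finally have "ptr [X] (V \<otimes>\<^sub>o W) (db X (V \<otimes>\<^sub>o W)) [X] = ptr [X] V (ptr ([X] @ [V]) W ?f ([X] @ [V])) [X]"
    using ptr_tens[OF o(2,3), of ?f "[X]" "[X]"] o by simp
  also have "ptr ([X] @ [V]) W ?f ([X] @ [V]) = br V X \<diamond> ptr [V, X] W (wh [V] (db X W) [] \<diamond> wh [] (br X V) [W]) [X, V]"
    using ptr_cp_left[of W "br V X" "[V, X]" "[X, V]" _ "[X, V]"] o by simp
  also have "ptr [V, X] W (wh [V] (db X W) [] \<diamond> wh [] (br X V) [W]) [X, V] = ptr ([V] @ [X]) W (wh [V] (db X W) []) ([V] @ [X]) \<diamond> br X V"
    using ptr_cp_right[of W "br X V" "[X, V]" "[V, X]"] o by simp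
  also have "ptr ([V] @ [X]) W (wh [V] (db X W) []) ([V] @ [X]) = smul c (sid [V, X])"
    using ptr_wh[of "[V]" "[X]" W "db X W" "[X]"] o c by (simp add: wh_smul)
  also have "br V X \<diamond> smul c (sid [V, X]) \<diamond> br X V = smul c (db X V)"
    using o by (simp add: smul_cp cp_smul db_def)
  finally show ?thesis
    by (simp add: ptr_smul)
qed

text \<open>Both sides are traces of the composite of two braidings, taken in opposite orders, so
  cyclicity identifies them. This is the symmetry of the Hopf link.\<close>

lemma ptr_sym:
  assumes "X \<in> Obj C" "Y \<in> Obj C"
  shows "ptr [] X (ptr [X] Y (db X Y) [X]) [] = ptr [] Y (ptr [Y] X (db Y X) [Y]) []"
proof -
  have e: "ptr [] X (ptr [X] Y (db X Y) [X]) [] = ptr [] (X \<otimes>\<^sub>o Y) (emb (bd Y X \<star> bd X Y)) []"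
    if "X \<in> Obj C" "Y \<in> Obj C" for X Y
    using ptr_tens[of X Y "db X Y" "[]" "[]"] that by (simp add: db_emb cp_assoc)
  have "ptr [] (X \<otimes>\<^sub>o Y) (wh [] (emb (bd Y X)) [] \<diamond> emb (bd X Y)) []
      = ptr [] (Y \<otimes>\<^sub>o X) (emb (bd X Y) \<diamond> wh [] (emb (bd Y X)) []) []"
    by (rule ptr_cyclic) (use assms in auto)
  then show ?thesis
    using assms by (simp add: e emb_cmp)
qed

text \<open>Relates the trace used in the S-matrix to the partial trace onto the empty word;
  \<open>ui\<close> and \<open>uo\<close> translate between endomorphisms of the unit object and of
  the empty word.\<close>

lemma trace_arr_eq:
  assumes "ar f" "dm f = X" "cd f = X"
  shows "trace_arr C X (mp f) = (THE c. ptr [] X (emb f) [] = smul c (sid []))"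
proof -
  let ?I = "UnitO C"
  have X: "X \<in> Obj C"
    using assms by auto
  let ?e = "Arw (X\<^bold>*\<^bold>* \<otimes>\<^sub>o X\<^bold>*) ?I (Ev C (X\<^bold>*))" and ?n = "Arw ?I (X \<otimes>\<^sub>o X\<^bold>*) (Coev C X)"
  define t where "t = ?e \<star> ((pv X \<star> f) \<boxtimes> idn (X\<^bold>*)) \<star> ?n"
  have t: "ar t" "dm t = ?I" "cd t = ?I"
    using assms X by (auto simp: t_def)
  have m: "mp t = Ev C (X\<^bold>*) \<cdot> ((Piv C X \<cdot> mp f) \<otimes>\<^sub>m Ident C (X\<^bold>*)) \<cdot> Coev C X"
    using assms X by (simp add: t_def mp_cmp mp_tns mp_idn)
  have p: "uo \<diamond> emb t \<diamond> ui = ptr [] X (emb f) []"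
    using assms X by (simp add: t_def emb_cmp emb_tns ptr_def tv_def ev_def coev_def cp_assoc)
  have et: "sar (emb t)" "dm (emb t) = [?I]" "cd (emb t) = [?I]"
    using t by simp_all
  have "c \<odot>\<^bsub>Hom C ?I ?I\<^esub> Ident C ?I = mp t \<longleftrightarrow> ptr [] X (emb f) [] = smul c (sid [])" for c
  proof
    assume "c \<odot>\<^bsub>Hom C ?I ?I\<^esub> Ident C ?I = mp t"
    then have "t = sc c (idn ?I)"
      using t by (intro ar_eqI) (simp_all add: mp_sc mp_idn)
    then show "ptr [] X (emb f) [] = smul c (sid [])"
      unfolding p[symmetric] by (simp add: emb_sc smul_cp cp_smul)
  next
    assume "ptr [] X (emb f) [] = smul c (sid [])"
    then have "ui \<diamond> (uo \<diamond> emb t \<diamond> ui) \<diamond> uo = ui \<diamond> smul c (sid []) \<diamond> uo"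
      by (simp add: p)
    then have "emb t = emb (sc c (idn ?I))"
      using et by (simp add: cp_assoc emb_sc smul_cp cp_smul)
    then have "t = sc c (idn ?I)"
      using t by (intro emb_inj) simp_all
    then show "c \<odot>\<^bsub>Hom C ?I ?I\<^esub> Ident C ?I = mp t"
      by (simp add: mp_sc mp_idn)
  qed
  then show ?thesis
    unfolding trace_arr_def m by simp
qed

end

section \<open>Semisimplicity\<close>

context linear_category
begin

definition hm :: "('o, 'm) arw \<Rightarrow> 'o \<Rightarrow> 'o \<Rightarrow> bool" where
  "hm f X Y \<longleftrightarrow> ar f \<and> dm f = X \<and> cd f = Y"

lemma hm_objs: "hm f X Y \<Longrightarrow> X \<in> Obj C" "hm f X Y \<Longrightarrow> Y \<in> Obj C"
  by (auto simp: hm_def)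

lemma hm_idn [simp]: "hm (idn X) X' Y' \<longleftrightarrow> X = X' \<and> X = Y' \<and> X \<in> Obj C"
  by (auto simp: hm_def)

lemma hm_zr [simp]: "hm (zr X Y) X' Y' \<longleftrightarrow> X = X' \<and> Y = Y' \<and> X \<in> Obj C \<and> Y \<in> Obj C"
  by (auto simp: hm_def)

lemma hm_cmp: "\<lbrakk>hm g Y Z; hm f X Y\<rbrakk> \<Longrightarrow> hm (g \<star> f) X Z"
  by (auto simp: hm_def)

lemma hm_ad: "\<lbrakk>hm g X Y; hm f X Y\<rbrakk> \<Longrightarrow> hm (g \<boxplus> f) X Y"
  by (auto simp: hm_def)

lemma hm_sc: "hm f X Y \<Longrightarrow> hm (sc c f) X Y"
  by (auto simp: hm_def)

lemma hm_mp: "hm f X Y \<Longrightarrow> mp f \<in> arr C X Y"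
  using ar_mp by (auto simp: hm_def)

lemma hm_Arw: "hm f X Y \<Longrightarrow> Arw X Y (mp f) = f"
  by (auto simp: hm_def)

lemma hm_ArwI: "\<lbrakk>X \<in> Obj C; Y \<in> Obj C; f \<in> arr C X Y\<rbrakk> \<Longrightarrow> hm (Arw X Y f) X Y"
  by (simp add: hm_def)

lemma ad_comm: "f \<boxplus> g = g \<boxplus> f"
proof (cases "ar f \<and> ar g \<and> dm f = dm g \<and> cd f = cd g")
  case True
  then show ?thesis
    using abelian_monoid.a_comm[OF hom_monoid, of "dm f" "cd f" "mp f" "mp g"] ar_mp[of f] ar_mp[of g]
    by (intro ar_eqI) (auto simp: mp_ad)
next
  case False
  then have "\<not> ar (f \<boxplus> g)" "\<not> ar (g \<boxplus> f)"
    by auto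
  then show ?thesis
    by (metis not_ar_ad)
qed

lemma ad_lcomm: "f \<boxplus> (g \<boxplus> h) = g \<boxplus> (f \<boxplus> h)"
  by (simp only: ad_assoc[symmetric] ad_comm[of f g])

definition mono :: "('o, 'm) arw \<Rightarrow> bool" where
  "mono f \<longleftrightarrow> ar f \<and> (\<forall>W g h. hm g W (dm f) \<and> hm h W (dm f) \<and> f \<star> g = f \<star> h \<longrightarrow> g = h)"

lemma mono_mono_arr: "\<lbrakk>X \<in> Obj C; Y \<in> Obj C\<rbrakk> \<Longrightarrow> mono_arr C X Y f \<longleftrightarrow> mono (Arw X Y f)"
proof
  assume o: "X \<in> Obj C" "Y \<in> Obj C" and m: "mono_arr C X Y f"
  then have f: "f \<in> arr C X Y"
    by (simp add: mono_arr_def)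
  show "mono (Arw X Y f)"
    unfolding mono_def
  proof (intro conjI allI impI)
    fix W g h assume "hm g W (dm (Arw X Y f)) \<and> hm h W (dm (Arw X Y f)) \<and> Arw X Y f \<star> g = Arw X Y f \<star> h"
    then have gh: "hm g W X" "hm h W X" "Arw X Y f \<star> g = Arw X Y f \<star> h"
      by auto
    then have "mp (Arw X Y f \<star> g) = mp (Arw X Y f \<star> h)"
      by simp
    then have "Comp C f (mp g) = Comp C f (mp h)"
      using gh(1,2) o f by (simp add: mp_cmp hm_def)
    then have "mp g = mp h"
      using m hm_mp[OF gh(1)] hm_mp[OF gh(2)] hm_objs[OF gh(1)] unfolding mono_arr_def by blast
    then show "g = h"
      using gh(1,2) hm_Arw by metis
  qed (use o f in simp)
next
  assume o: "X \<in> Obj C" "Y \<in> Obj C" and m: "mono (Arw X Y f)"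
  show "mono_arr C X Y f"
    unfolding mono_arr_def
  proof (intro conjI ballI impI)
    show f: "f \<in> arr C X Y"
      using m o by (simp add: mono_def)
    fix W g h assume a: "W \<in> Obj C" "g \<in> arr C W X" "h \<in> arr C W X" "Comp C f g = Comp C f h"
    then have "Arw X Y f \<star> Arw W X g = Arw X Y f \<star> Arw W X h"
      using o f by (simp add: cmp_def)
    then have "Arw W X g = Arw W X h"
      using m a o hm_ArwI unfolding mono_def by (metis arw.sel(1))
    then show "g = h"
      by simp
  qed
qed

lemma monoD: "\<lbrakk>mono f; hm g W (dm f); hm h W (dm f); f \<star> g = f \<star> h\<rbrakk> \<Longrightarrow> g = h"
  unfolding mono_def by blast

lemma mono_ar: "mono f \<Longrightarrow> ar f"
  by (simp add: mono_def)

lemma mono_cmp: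
  assumes "mono f" "mono g" "dm g = cd f"
  shows "mono (g \<star> f)"
  unfolding mono_def
proof (intro conjI allI impI)
  fix W a b assume "hm a W (dm (g \<star> f)) \<and> hm b W (dm (g \<star> f)) \<and> (g \<star> f) \<star> a = (g \<star> f) \<star> b"
  then have ab: "hm a W (dm f)" "hm b W (dm f)" "g \<star> f \<star> a = g \<star> f \<star> b"
    using assms mono_ar by (auto simp: cmp_assoc)
  have f: "hm f (dm f) (dm g)"
    using assms mono_ar by (simp add: hm_def)
  have "f \<star> a = f \<star> b"
    using monoD[OF assms(2) _ _ ab(3)] hm_cmp[OF f] ab(1,2) by blast
  then show "a = b"
    using monoD[OF assms(1) ab(1,2)] by blast
qed (use assms mono_ar in auto)

lemma split_mono:
  assumes "ar f" "ar g" "dm g = cd f" "g \<star> f = idn (dm f)"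
  shows "mono f"
  unfolding mono_def
proof (intro conjI allI impI)
  fix W a b assume ab: "hm a W (dm f) \<and> hm b W (dm f) \<and> f \<star> a = f \<star> b"
  then have "(g \<star> f) \<star> a = (g \<star> f) \<star> b"
    by (simp add: cmp_assoc)
  then show "a = b"
    using ab assms by (simp add: hm_def)
qed (rule assms)

lemma inverses_mono: "inverses f g \<Longrightarrow> mono f"
  by (rule split_mono[of f g]) (auto simp: inverses_def)

text \<open>If the identity vanishes, every map into or out of \<open>X\<close> factors through
  zero; conversely, a one-element endomorphism space forces identity and zero to coincide.\<close>

lemma zero_obj_iff: "X \<in> Obj C \<Longrightarrow> zero_obj C X \<longleftrightarrow> idn X = zr X X"
proof
  assume o: "X \<in> Obj C" and "zero_obj C X"
  then have "\<exists>!f. f \<in> arr C X X"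
    by (auto simp: zero_obj_def)
  then have "Ident C X = \<zero>\<^bsub>Hom C X X\<^esub>"
    using hm_mp[of "idn X" X X] hm_mp[of "zr X X" X X] o by (auto simp: mp_idn mp_zr)
  then show "idn X = zr X X"
    using o by (simp add: idn_def zr_def)
next
  assume o: "X \<in> Obj C" and z: "idn X = zr X X"
  show "zero_obj C X"
    unfolding zero_obj_def
  proof (intro conjI ballI o)
    fix Y assume Y: "Y \<in> Obj C"
    have m: "mp (zr X Y) \<in> arr C X Y"
      using hm_mp[of "zr X Y" X Y] o Y by simp
    have "f = mp (zr X Y)" if "f \<in> arr C X Y" for f
    proof -
      have "Arw X Y f = Arw X Y f \<star> idn X"
        using that o Y by simp
      also have "\<dots> = zr X Y"
        unfolding z using that o Y by (simp add: cmp_zr)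
      finally show ?thesis
        by (metis arw.sel(3))
    qed
    then show "\<exists>!f. f \<in> arr C X Y"
      using m by blast
    have m: "mp (zr Y X) \<in> arr C Y X"
      using hm_mp[of "zr Y X" Y X] o Y by simp
    have "f = mp (zr Y X)" if "f \<in> arr C Y X" for f
    proof -
      have "Arw Y X f = idn X \<star> Arw Y X f"
        using that o Y by simp
      also have "\<dots> = zr Y X"
        unfolding z using that o Y by (simp add: zr_cmp)
      finally show ?thesis
        by (metis arw.sel(3))
    qed
    then show "\<exists>!f. f \<in> arr C Y X"
      using m by blast
  qed
qed

lemma zero_idn:
  assumes "idn X = zr X X" "X \<in> Obj C"
  shows "hm f X Y \<Longrightarrow> f = zr X Y" "hm f Y X \<Longrightarrow> f = zr Y X"
proof -
  assume f: "hm f X Y"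
  then have "f = f \<star> idn X"
    by (simp add: hm_def)
  then show "f = zr X Y"
    unfolding assms(1) using f assms by (simp add: hm_def cmp_zr)
next
  assume f: "hm f Y X"
  then have "f = idn X \<star> f"
    by (simp add: hm_def)
  also have "\<dots> = zr Y X"
    unfolding assms(1) using f assms by (auto simp: hm_def zr_cmp)
  finally show "f = zr Y X" .
qed

lemma simple_iff: "simple_obj C X \<longleftrightarrow> X \<in> Obj C \<and> idn X \<noteq> zr X X \<and>
    (\<forall>f. mono f \<and> cd f = X \<longrightarrow> idn (dm f) = zr (dm f) (dm f) \<or> (\<exists>g. inverses f g))"
proof (cases "X \<in> Obj C")
  case X: True
  have "(\<forall>Y\<in>Obj C. \<forall>f. mono_arr C Y X f \<longrightarrow> zero_obj C Y \<or> iso_arr C Y X f) \<longleftrightarrow>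
      (\<forall>f. mono f \<and> cd f = X \<longrightarrow> idn (dm f) = zr (dm f) (dm f) \<or> (\<exists>g. inverses f g))"
  proof
    assume L: "\<forall>Y\<in>Obj C. \<forall>f. mono_arr C Y X f \<longrightarrow> zero_obj C Y \<or> iso_arr C Y X f"
    show "\<forall>f. mono f \<and> cd f = X \<longrightarrow> idn (dm f) = zr (dm f) (dm f) \<or> (\<exists>g. inverses f g)"
    proof (intro allI impI)
      fix f assume f: "mono f \<and> cd f = X"
      then have "Arw (dm f) X (mp f) = f" "dm f \<in> Obj C"
        using mono_ar by auto
      then show "idn (dm f) = zr (dm f) (dm f) \<or> (\<exists>g. inverses f g)"
        using L mono_mono_arr[of "dm f" X "mp f"] iso_arr_inverses[of "dm f" X "mp f"] zero_obj_iff[of "dm f"] X f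
        by metis
    qed
  next
    assume R: "\<forall>f. mono f \<and> cd f = X \<longrightarrow> idn (dm f) = zr (dm f) (dm f) \<or> (\<exists>g. inverses f g)"
    show "\<forall>Y\<in>Obj C. \<forall>f. mono_arr C Y X f \<longrightarrow> zero_obj C Y \<or> iso_arr C Y X f"
    proof (intro ballI allI impI)
      fix Y f assume "Y \<in> Obj C" "mono_arr C Y X f"
      then show "zero_obj C Y \<or> iso_arr C Y X f"
        using R X mono_mono_arr iso_arr_inverses zero_obj_iff by (metis arw.sel(1,2))
    qed
  qed
  then show ?thesis
    using X zero_obj_iff[of X] unfolding simple_obj_def by blast
qed (simp add: simple_obj_def)

lemma simple_Obj [simp]: "simple_obj C X \<Longrightarrow> X \<in> Obj C"
  by (simp add: simple_obj_def)

lemma simple_nz: "simple_obj C X \<Longrightarrow> idn X \<noteq> zr X X"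
  by (simp add: simple_iff)

lemma simple_isomorphic:
  assumes "simple_obj C X" "Y \<in> Obj C" "isomorphic C X Y"
  shows "simple_obj C Y"
proof -
  obtain a b where ab: "inverses a b" "dm a = X" "cd a = Y"
    using assms isomorphic_iff by (metis simple_Obj)
  note i = inversesD[OF ab(1)]
  show ?thesis
    unfolding simple_iff
  proof (intro conjI allI impI assms(2) notI)
    assume z: "idn Y = zr Y Y"
    have "idn X = b \<star> idn Y \<star> a"
      using i ab by simp
    also have "\<dots> = zr X X"
      unfolding z using i ab assms by (simp add: zr_cmp cmp_zr)
    finally show False
      using simple_nz assms by blast
  next
    fix f assume f: "mono f \<and> cd f = Y"
    have "mono (b \<star> f)"
      using f ab i inverses_mono[OF inverses_sym[OF ab(1)]] by (intro mono_cmp) auto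
    then consider "idn (dm f) = zr (dm f) (dm f)" | g where "inverses (b \<star> f) g"
      using assms(1) f ab i mono_ar[of f] unfolding simple_iff by (metis cd_cmp dm_cmp)
    then show "idn (dm f) = zr (dm f) (dm f) \<or> (\<exists>g. inverses f g)"
    proof cases
      case 2
      then have "inverses (a \<star> b \<star> f) (g \<star> b)"
        using ab i f mono_ar[of f] by (intro inverses_cmp) auto
      moreover have "a \<star> b \<star> f = f"
        using i f ab mono_ar[of f] by simp
      ultimately show ?thesis
        by metis
    qed blast
  qed
qed


subsection \<open>Direct sums\<close>

text \<open>A recursion in place of \<open>finsum\<close>, so that composition and other additive
  operations distribute over it by induction.\<close>

fun ssum :: "'o \<Rightarrow> (nat \<Rightarrow> ('o, 'm) arw) \<Rightarrow> nat \<Rightarrow> ('o, 'm) arw" where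
  "ssum X f 0 = zr X X"
| "ssum X f (Suc n) = f n \<boxplus> ssum X f n"

definition dsum :: "'o \<Rightarrow> 'o list \<Rightarrow> (nat \<Rightarrow> ('o, 'm) arw) \<Rightarrow> (nat \<Rightarrow> ('o, 'm) arw) \<Rightarrow> bool" where
  "dsum X Xs i p \<longleftrightarrow> X \<in> Obj C \<and> set Xs \<subseteq> Obj C \<and>
     (\<forall>a<length Xs. hm (i a) (Xs ! a) X \<and> hm (p a) X (Xs ! a)) \<and>
     (\<forall>a<length Xs. \<forall>b<length Xs. p a \<star> i b = (if a = b then idn (Xs ! a) else zr (Xs ! b) (Xs ! a))) \<and>
     ssum X (\<lambda>a. i a \<star> p a) (length Xs) = idn X"

lemma ssum_hm: "\<lbrakk>X \<in> Obj C; \<And>a. a < n \<Longrightarrow> hm (f a) X X\<rbrakk> \<Longrightarrow> hm (ssum X f n) X X"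
  by (induction n) (auto simp: hm_ad)

lemma ssum_finsum:
  assumes X: "X \<in> Obj C" and "\<And>a. a < n \<Longrightarrow> f a \<in> arr C X X"
  shows "ssum X (\<lambda>a. Arw X X (f a)) n = Arw X X (\<Oplus>\<^bsub>Hom C X X\<^esub> a\<in>{..<n}. f a)"
  using assms(2)
proof (induction n)
  case 0
  interpret abelian_monoid "Hom C X X"
    using X by (rule hom_monoid[OF X])
  show ?case
    using X by (simp add: zr_def)
next
  case (Suc n)
  interpret abelian_monoid "Hom C X X"
    by (rule hom_monoid[OF X X])
  have "(\<Oplus>\<^bsub>Hom C X X\<^esub> a\<in>{..<n}. f a) \<in> arr C X X"
    using Suc.prems by (intro finsum_closed) auto
  moreover have "(\<Oplus>\<^bsub>Hom C X X\<^esub> a\<in>{..<Suc n}. f a) = f n \<oplus>\<^bsub>Hom C X X\<^esub> (\<Oplus>\<^bsub>Hom C X X\<^esub> a\<in>{..<n}. f a)"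
    unfolding lessThan_Suc using Suc.prems by (intro finsum_insert) auto
  ultimately show ?case
    using Suc X by (simp add: ad_def)
qed

lemma ssum_cong: "(\<And>a. a < n \<Longrightarrow> f a = g a) \<Longrightarrow> ssum X f n = ssum X g n"
  by (induction n) auto

lemma direct_sum_dsum:
  assumes "direct_sum C X Xs"
  obtains i p where "dsum X Xs i p"
proof -
  obtain i p where ip: "\<And>a. a < length Xs \<Longrightarrow> i a \<in> arr C (Xs ! a) X \<and> p a \<in> arr C X (Xs ! a)"
    "\<And>a b. \<lbrakk>a < length Xs; b < length Xs\<rbrakk> \<Longrightarrow> Comp C (p a) (i b) = (if a = b then Ident C (Xs ! a) else \<zero>\<^bsub>Hom C (Xs ! b) (Xs ! a)\<^esub>)"
    "(\<Oplus>\<^bsub>Hom C X X\<^esub> a\<in>{..<length Xs}. Comp C (i a) (p a)) = Ident C X"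
    using assms unfolding direct_sum_def by blast
  have o: "X \<in> Obj C" "set Xs \<subseteq> Obj C"
    using assms by (auto simp: direct_sum_def)
  have oa: "Xs ! a \<in> Obj C" if "a < length Xs" for a
    using that o(2) by auto
  have c: "Comp C (i a) (p a) \<in> arr C X X" if "a < length Xs" for a
    using ip(1)[OF that] oa[OF that] o Comp_arr by blast
  have "dsum X Xs (\<lambda>a. Arw (Xs ! a) X (i a)) (\<lambda>a. Arw X (Xs ! a) (p a))"
    unfolding dsum_def
  proof (intro conjI allI impI o)
    fix a b assume "a < length Xs" "b < length Xs"
    then show "Arw X (Xs ! a) (p a) \<star> Arw (Xs ! b) X (i b) = (if a = b then idn (Xs ! a) else zr (Xs ! b) (Xs ! a))"
      using ip(1,2) oa o by (auto simp: cmp_def idn_def zr_def)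
  next
    have "ssum X (\<lambda>a. Arw (Xs ! a) X (i a) \<star> Arw X (Xs ! a) (p a)) (length Xs)
        = ssum X (\<lambda>a. Arw X X (Comp C (i a) (p a))) (length Xs)"
      using ip(1) oa o by (intro ssum_cong) (auto simp: cmp_def)
    also have "\<dots> = idn X"
      using ip(3) ssum_finsum[OF o(1) c] o by (simp add: idn_def)
    finally show "ssum X (\<lambda>a. Arw (Xs ! a) X (i a) \<star> Arw X (Xs ! a) (p a)) (length Xs) = idn X" .
  qed (use ip(1) oa o in \<open>auto intro!: hm_ArwI\<close>)
  then show ?thesis
    by (rule that)
qed

lemma dsumD:
  assumes "dsum X Xs i p"
  shows "X \<in> Obj C" "set Xs \<subseteq> Obj C" "a < length Xs \<Longrightarrow> Xs ! a \<in> Obj C"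
    "a < length Xs \<Longrightarrow> hm (i a) (Xs ! a) X" "a < length Xs \<Longrightarrow> hm (p a) X (Xs ! a)"
    "\<lbrakk>a < length Xs; b < length Xs\<rbrakk> \<Longrightarrow> p a \<star> i b = (if a = b then idn (Xs ! a) else zr (Xs ! b) (Xs ! a))"
    "ssum X (\<lambda>a. i a \<star> p a) (length Xs) = idn X"
  using assms unfolding dsum_def by (auto simp: subset_iff)

lemma dsum_direct_sum:
  assumes "dsum X Xs i p"
  shows "direct_sum C X Xs"
proof -
  note d = dsumD[OF assms]
  have c: "mp (i a \<star> p a) \<in> arr C X X" if "a < length Xs" for a
    using d(4,5)[OF that] hm_cmp hm_mp by blast
  have m: "mp (i a \<star> p a) = Comp C (mp (i a)) (mp (p a))" if "a < length Xs" for a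
    using d(4,5)[OF that] by (simp add: mp_cmp hm_def)
  have "ssum X (\<lambda>a. Arw X X (mp (i a \<star> p a))) (length Xs) = ssum X (\<lambda>a. i a \<star> p a) (length Xs)"
    by (rule ssum_cong) (rule hm_Arw[OF hm_cmp[OF d(4) d(5)]])
  then have "Arw X X (\<Oplus>\<^bsub>Hom C X X\<^esub> a\<in>{..<length Xs}. mp (i a \<star> p a)) = idn X"
    using ssum_finsum[of X "length Xs" "\<lambda>a. mp (i a \<star> p a)", OF d(1) c] d(7) by simp
  then have f: "(\<Oplus>\<^bsub>Hom C X X\<^esub> a\<in>{..<length Xs}. mp (i a \<star> p a)) = Ident C X"
    using d(1) by (metis arw.sel(3) mp_idn)
  have e: "(\<Oplus>\<^bsub>Hom C X X\<^esub> a\<in>{..<length Xs}. mp (i a \<star> p a)) = (\<Oplus>\<^bsub>Hom C X X\<^esub> a\<in>{..<length Xs}. Comp C (mp (i a)) (mp (p a)))"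
  proof (rule abelian_monoid.finsum_cong'[OF hom_monoid[OF d(1) d(1)] refl])
    fix a assume "a \<in> {..<length Xs}"
    then show "mp (i a \<star> p a) = Comp C (mp (i a)) (mp (p a))"
      using m by blast
  next
    show "(\<lambda>a. Comp C (mp (i a)) (mp (p a))) \<in> {..<length Xs} \<rightarrow> arr C X X"
    proof (rule Pi_I)
      fix a assume "a \<in> {..<length Xs}"
      then show "Comp C (mp (i a)) (mp (p a)) \<in> arr C X X"
        using c[of a] m[of a] by simp
    qed
  qed
  have 1: "\<forall>a<length Xs. mp (i a) \<in> arr C (Xs ! a) X \<and> mp (p a) \<in> arr C X (Xs ! a)"
    using d(4,5) hm_mp by blast
  have 2: "Comp C (mp (p a)) (mp (i b)) = (if a = b then Ident C (Xs ! a) else \<zero>\<^bsub>Hom C (Xs ! b) (Xs ! a)\<^esub>)"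
    if ab: "a < length Xs" "b < length Xs" for a b
  proof -
    have "Comp C (mp (p a)) (mp (i b)) = mp (p a \<star> i b)"
      using d(4)[OF ab(2)] d(5)[OF ab(1)] by (simp add: mp_cmp hm_def)
    then show ?thesis
      using d(6)[OF ab] d(3)[OF ab(1)] d(3)[OF ab(2)] by (simp add: mp_idn mp_zr)
  qed
  show ?thesis
    unfolding direct_sum_def
    by (rule conjI[OF d(1)], rule conjI[OF d(2)], rule exI[of _ "\<lambda>a. mp (i a)"], rule exI[of _ "\<lambda>a. mp (p a)"])
      (use 1 2 e f in simp)
qed

text \<open>The identity of a direct sum is the sum of the projectors
  \<open>i a \<star> p a\<close>; this passes additive properties from the summands to the
  whole.\<close>

lemma dsum_induct:
  assumes d: "dsum X Xs i p" and "P (zr X X)" "\<And>a. a < length Xs \<Longrightarrow> P (i a \<star> p a)"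
    "\<And>f g. \<lbrakk>hm f X X; hm g X X; P f; P g\<rbrakk> \<Longrightarrow> P (f \<boxplus> g)"
  shows "P (idn X)"
proof -
  have "P (ssum X (\<lambda>a. i a \<star> p a) n)" if "n \<le> length Xs" for n
    using that
  proof (induction n)
    case (Suc n)
    have "hm (i a \<star> p a) X X" if "a < length Xs" for a
      using dsumD(4,5)[OF d that] hm_cmp by blast
    then show ?case
      using Suc assms ssum_hm[OF dsumD(1)[OF d], of n "\<lambda>a. i a \<star> p a"] by auto
  qed (simp add: assms)
  then show ?thesis
    using dsumD(7)[OF d] by (metis order_refl)
qed

lemma dsum_functional:
  fixes \<phi> :: "('o, 'm) arw \<Rightarrow> 'k"
  assumes d: "dsum X Xs i p" and \<phi>: "\<And>f g. \<lbrakk>hm f X X; hm g X X\<rbrakk> \<Longrightarrow> \<phi> (f \<boxplus> g) = \<phi> f + \<phi> g"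
  shows "\<phi> (idn X) = (\<Sum>a<length Xs. \<phi> (i a \<star> p a))"
proof -
  have "\<phi> (ssum X (\<lambda>a. i a \<star> p a) n) = (\<Sum>a<n. \<phi> (i a \<star> p a))" if "n \<le> length Xs" for n
    using that
  proof (induction n)
    case 0
    have "\<phi> (zr X X) = \<phi> (zr X X) + \<phi> (zr X X)"
      using \<phi>[of "zr X X" "zr X X"] dsumD(1)[OF d] by simp
    then have "\<phi> (zr X X) = 0"
      by (metis add_cancel_right_right)
    then show ?case
      by simp
  next
    case (Suc n)
    have "hm (i a \<star> p a) X X" if "a < length Xs" for a
      using dsumD(4,5)[OF d that] hm_cmp by blast
    then show ?case
      using Suc \<phi> ssum_hm[OF dsumD(1)[OF d], of n "\<lambda>a. i a \<star> p a"] by auto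
  qed
  then show ?thesis
    using dsumD(7)[OF d] by (metis order_refl)
qed

lemma dsum_detect:
  assumes d: "dsum X Xs i p" and f: "hm f W X" "f \<noteq> zr W X"
  obtains a where "a < length Xs" "p a \<star> f \<noteq> zr W (Xs ! a)"
proof (rule ccontr)
  assume "\<not> thesis"
  then have z: "p a \<star> f = zr W (Xs ! a)" if "a < length Xs" for a
    using that \<open>\<And>a. \<lbrakk>a < length Xs; p a \<star> f \<noteq> zr W (Xs ! a)\<rbrakk> \<Longrightarrow> thesis\<close> by blast
  have o: "W \<in> Obj C" "X \<in> Obj C"
    using f hm_objs by auto
  have "idn X \<star> f = zr W X"
  proof (rule dsum_induct[OF d])
    fix a assume a: "a < length Xs"
    show "(i a \<star> p a) \<star> f = zr W X"
      unfolding cmp_assoc z[OF a] using dsumD(4)[OF d a] o by (auto simp: cmp_zr hm_def)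
  qed (use f o in \<open>auto simp: hm_def zr_cmp ad_cmp\<close>)
  then show False
    using f by (simp add: hm_def)
qed

lemma dsum_iso:
  assumes d: "dsum X Xs i p" and f: "inverses f g" "dm f = X" "cd f = Y"
  shows "dsum Y Xs (\<lambda>a. f \<star> i a) (\<lambda>a. p a \<star> g)"
  unfolding dsum_def
proof (intro conjI allI impI)
  note i = inversesD[OF f(1)]
  show Y: "Y \<in> Obj C"
    using f i by auto
  have "ssum Y (\<lambda>a. (f \<star> i a) \<star> p a \<star> g) n = f \<star> ssum X (\<lambda>a. i a \<star> p a) n \<star> g" for n
    using i f dsumD(1)[OF d] by (induction n) (auto simp: zr_cmp cmp_zr cmp_ad ad_cmp cmp_assoc)
  then show "ssum Y (\<lambda>a. (f \<star> i a) \<star> p a \<star> g) (length Xs) = idn Y"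
    using dsumD(7)[OF d] i f by simp
  fix a b assume a: "a < length Xs" and b: "b < length Xs"
  have "(p a \<star> g) \<star> f \<star> i b = p a \<star> i b"
    using i f dsumD(4)[OF d b] by (simp add: cmp_assoc hm_def)
  then show "(p a \<star> g) \<star> f \<star> i b = (if a = b then idn (Xs ! a) else zr (Xs ! b) (Xs ! a))"
    using dsumD(6)[OF d a b] by simp
qed (use assms dsumD[OF d] inversesD[OF f(1)] in \<open>auto simp: hm_def\<close>)

lemma dsum_singleton: "X \<in> Obj C \<Longrightarrow> dsum X [X] (\<lambda>_. idn X) (\<lambda>_. idn X)"
  by (simp add: dsum_def)

text \<open>The inclusion of a nonzero summand into a simple object is an isomorphism with inverse
  the projection, which leaves no room for a second summand.\<close>

lemma simple_dsum:
  assumes s: "simple_obj C X" and d: "dsum X Ys i p" and nz: "\<And>Y. Y \<in> set Ys \<Longrightarrow> idn Y \<noteq> zr Y Y"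
  shows "length Ys = 1" "isomorphic C X (Ys ! 0)"
proof -
  note D = dsumD[OF d]
  have "Ys \<noteq> []"
    using D(7) simple_nz[OF s] by auto
  then have 0: "0 < length Ys"
    by simp
  note i0 = D(4)[OF 0] and p0 = D(5)[OF 0]
  have "mono (i 0)"
    by (rule split_mono[of _ "p 0"]) (use i0 p0 D(6)[OF 0 0] in \<open>auto simp: hm_def\<close>)
  then obtain g where g: "inverses (i 0) g"
    using s i0 nz[of "Ys ! 0"] 0 unfolding simple_iff by (metis hm_def nth_mem)
  have "p 0 = p 0 \<star> i 0 \<star> g"
    using inversesD[OF g] i0 p0 by (simp add: hm_def)
  also have "\<dots> = (p 0 \<star> i 0) \<star> g"
    by (simp only: cmp_assoc)
  also have "\<dots> = g"
    using D(6)[OF 0 0] inversesD[OF g] i0 by (simp add: hm_def)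
  finally have pg: "p 0 = g" .
  then show "isomorphic C X (Ys ! 0)"
    using isomorphic_iff[of X "Ys ! 0"] D(1) D(3)[OF 0] inverses_sym[OF g] p0 by (auto simp: hm_def)
  show "length Ys = 1"
  proof (rule ccontr)
    assume "length Ys \<noteq> 1"
    then have 1: "1 < length Ys"
      using 0 by arith
    note i1 = D(4)[OF 1] and p1 = D(5)[OF 1]
    have "i 1 = i 0 \<star> p 0 \<star> i 1"
      unfolding pg using inversesD[OF g] i0 i1 by (simp add: hm_def)
    also have "\<dots> = zr (Ys ! 1) X"
      using D(6)[OF 0 1] D(3)[OF 1] i0 by (simp add: hm_def cmp_zr)
    finally have "p 1 \<star> i 1 = zr (Ys ! 1) (Ys ! 1)"
      using p1 D(3)[OF 1] by (simp add: hm_def cmp_zr)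
    then show False
      using D(6)[OF 1 1] nz[of "Ys ! 1"] 1 by simp
  qed
qed

end

section \<open>Kernels and Schur's lemma\<close>

context abelian_category
begin

lemma kernel_mono:
  assumes k: "kernel_arr C K X Y k f" and o: "K \<in> Obj C" "X \<in> Obj C" "Y \<in> Obj C"
  shows "mono (Arw K X k)" "Arw X Y f \<star> Arw K X k = zr K Y"
proof -
  have a: "k \<in> arr C K X" "f \<in> arr C X Y" "Comp C f k = \<zero>\<^bsub>Hom C K Y\<^esub>"
    using k by (auto simp: kernel_arr_def)
  show z: "Arw X Y f \<star> Arw K X k = zr K Y"
    using a o by (simp add: cmp_def zr_def)
  have "g = h" if gh: "W \<in> Obj C" "g \<in> arr C W K" "h \<in> arr C W K" "Comp C k g = Comp C k h" for W g h
  proof -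
    have "(Arw X Y f \<star> Arw K X k) \<star> Arw W K g = zr W Y"
      unfolding z using gh o by (simp add: zr_cmp)
    then have "Comp C f (Comp C k g) = \<zero>\<^bsub>Hom C W Y\<^esub>"
      using gh o a Comp_arr[of W K X g k] by (simp add: cmp_assoc) (simp add: cmp_def zr_def)
    then have "\<exists>!h'. h' \<in> arr C W K \<and> Comp C k h' = Comp C k g"
      using k gh o Comp_arr[of W K X g k] a unfolding kernel_arr_def by blast
    then show ?thesis
      using gh by metis
  qed
  then have "mono_arr C K X k"
    using a unfolding mono_arr_def by blast
  then show "mono (Arw K X k)"
    using mono_mono_arr o by blast
qed

text \<open>The kernel of \<open>f\<close> is a subobject of the simple \<open>X\<close> but not all
  of it, hence zero. By additivity, equality after \<open>f\<close> means that the difference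
  factors through the kernel.\<close>

lemma mono_from_simple:
  assumes s: "simple_obj C X" and f: "hm f X Y" "f \<noteq> zr X Y"
  shows "mono f"
proof -
  have o: "X \<in> Obj C" "Y \<in> Obj C"
    using f hm_objs by auto
  obtain K k where K: "K \<in> Obj C" "kernel_arr C K X Y k (mp f)"
    using kernels[of X Y "mp f"] o hm_mp[OF f(1)] by blast
  have fe: "Arw X Y (mp f) = f"
    using hm_Arw f by simp
  let ?k = "Arw K X k"
  note k = kernel_mono[OF K(2) K(1) o, unfolded fe]
  have "\<not> (\<exists>g. inverses ?k g)"
  proof
    assume "\<exists>g. inverses ?k g"
    then obtain g where g: "inverses ?k g"
      by blast
    have "f = (f \<star> ?k) \<star> g"
      using inversesD[OF g] f by (simp add: cmp_assoc hm_def)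
    also have "\<dots> = zr X Y"
      unfolding k(2) using inversesD[OF g] o by (simp add: zr_cmp)
    finally show False
      using f by simp
  qed
  then have kz: "idn K = zr K K"
    using s k(1) unfolding simple_iff by (metis arw.sel(1,2))
  show ?thesis
    unfolding mono_def
  proof (intro conjI allI impI)
    fix W g h assume "hm g W (dm f) \<and> hm h W (dm f) \<and> f \<star> g = f \<star> h"
    then have gh: "hm g W X" "hm h W X" "f \<star> g = f \<star> h"
      using f by (auto simp: hm_def)
    let ?d = "g \<boxplus> sc (-1) h"
    have d: "hm ?d W X"
      using gh hm_ad hm_sc by blast
    have W: "W \<in> Obj C"
      using gh hm_objs by blast
    have "f \<star> ?d = (f \<star> h) \<boxplus> sc (-1) (f \<star> h)"
      using gh(3) by (simp add: cmp_ad cmp_sc)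
    then have "f \<star> ?d = zr W Y"
      using ad_neg[of "f \<star> h"] f gh by (simp add: hm_def)
    then have "Comp C (mp f) (mp ?d) = \<zero>\<^bsub>Hom C W Y\<^esub>"
      using f d W o by (metis hm_def mp_cmp mp_zr)
    then obtain l where l: "l \<in> arr C W K" "Comp C k l = mp ?d"
      using K(2) W hm_mp[OF d] unfolding kernel_arr_def by metis
    have ka: "k \<in> arr C K X"
      using K(2) by (simp add: kernel_arr_def)
    have "?d = ?k \<star> Arw W K l"
      using l W o K ka hm_Arw[OF d] by (simp add: cmp_def)
    also have "Arw W K l = zr W K"
      using zero_idn(2)[OF kz K(1)] l W K hm_ArwI by blast
    also have "?k \<star> zr W K = zr W X"
      using W K ka o by (simp add: cmp_zr)
    finally show "g = h"
      using ad_eq_iff[of g h] gh by (simp add: hm_def)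
  qed (use f in \<open>simp add: hm_def\<close>)
qed

lemma Schur_iso:
  assumes "simple_obj C X" "simple_obj C Y" "hm f X Y" "f \<noteq> zr X Y"
  obtains g where "inverses f g"
  using mono_from_simple[OF assms(1,3,4)] assms(2) simple_nz[OF assms(1)] assms(3)
  unfolding simple_iff hm_def by blast

lemma Schur_zero: "\<lbrakk>simple_obj C X; simple_obj C Y; \<not> isomorphic C X Y; hm f X Y\<rbrakk> \<Longrightarrow> f = zr X Y"
  using Schur_iso isomorphic_iff by (metis hm_def simple_Obj)

end

context fusion_category
begin

lemma semisimple_dsum:
  assumes "X \<in> Obj C"
  obtains Ys i p where "dsum X Ys i p" "\<And>Y. Y \<in> set Ys \<Longrightarrow> simple_obj C Y"
  using semisimple[OF assms] direct_sum_dsum by metis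

text \<open>The projector onto a simple summand is a scalar endomorphism. It is nonzero, so the
  summand is already everything.\<close>

lemma simple_of_scalar_endos:
  assumes X: "X \<in> Obj C" "idn X \<noteq> zr X X" and e: "\<And>f. hm f X X \<Longrightarrow> \<exists>c. f = sc c (idn X)"
  shows "simple_obj C X"
proof -
  obtain Ys i p where d: "dsum X Ys i p" and s: "\<And>Y. Y \<in> set Ys \<Longrightarrow> simple_obj C Y"
    using semisimple_dsum[OF X(1)] by blast
  note D = dsumD[OF d]
  have "Ys \<noteq> []"
    using D(7) X by auto
  then have 0: "0 < length Ys"
    by simp
  obtain c where c: "i 0 \<star> p 0 = sc c (idn X)"
    using e[of "i 0 \<star> p 0"] hm_cmp[OF D(4)[OF 0] D(5)[OF 0]] by blast
  have pc: "p 0 = sc c (p 0)"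
  proof -
    have "p 0 = (p 0 \<star> i 0) \<star> p 0"
      using D(6)[OF 0 0] D(5)[OF 0] by (simp add: hm_def)
    also have "\<dots> = sc c (p 0)"
      unfolding cmp_assoc c using D(5)[OF 0] by (simp add: cmp_sc hm_def)
    finally show ?thesis .
  qed
  have c0: "c \<noteq> 0"
  proof
    assume "c = 0"
    then have "p 0 = zr X (Ys ! 0)"
      using pc D(5)[OF 0] sc_0[of "p 0"] by (simp add: hm_def)
    then have "idn (Ys ! 0) = zr (Ys ! 0) (Ys ! 0)"
      using D(6)[OF 0 0] D(4)[OF 0] D(3)[OF 0] by (simp add: zr_cmp hm_def)
    then show False
      using simple_nz s 0 by (metis nth_mem)
  qed
  have "inverses (i 0) (sc (inverse c) (p 0))"
  proof -
    have "sc (inverse c) (p 0) \<star> i 0 = idn (Ys ! 0)"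
    proof -
      have "p 0 \<star> i 0 = sc c (p 0 \<star> i 0)"
        using pc sc_cmp by metis
      then have "sc (inverse c) (p 0 \<star> i 0) = p 0 \<star> i 0"
        using c0 D(6)[OF 0 0] D(3)[OF 0] by (metis ar_idn left_inverse sc_1 sc_sc)
      then show ?thesis
        using D(6)[OF 0 0] by (simp add: sc_cmp)
    qed
    moreover have "i 0 \<star> sc (inverse c) (p 0) = idn X"
      unfolding cmp_sc c using c0 X by simp
    ultimately show ?thesis
      using D(4)[OF 0] D(5)[OF 0] by (simp add: inverses_def hm_def)
  qed
  then have "isomorphic C (Ys ! 0) X"
    using isomorphic_iff[of "Ys ! 0" X] D(3)[OF 0] X D(4)[OF 0] by (auto simp: hm_def)
  then show ?thesis
    using simple_isomorphic s 0 X nth_mem by blast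
qed

end


subsection \<open>Schur's lemma over an algebraically closed field\<close>

text \<open>Algebraic closedness and characteristic zero are carried by the sort of
  \<open>'k\<close>; the locale adds no further assumption.\<close>

locale ac_modular_category = modular_category C
  for C :: "('o, 'm, 'k::{alg_closed_field, field_char_0}, 'r) spcat_scheme" (structure)
begin

text \<open>Evaluation of a polynomial at an endomorphism, by Horner's scheme.\<close>

definition peval :: "('o, 'm) arw \<Rightarrow> 'k poly \<Rightarrow> ('o, 'm) arw" where
  "peval f q = fold_coeffs (\<lambda>a g. sc a (idn (dm f)) \<boxplus> f \<star> g) q (zr (dm f) (dm f))"

context
  fixes f X
  assumes f: "hm f X X"
begin

lemma peval_0: "peval f 0 = zr X X"
  using f by (simp add: peval_def hm_def)

lemma peval_pCons: "peval f (pCons a q) = sc a (idn X) \<boxplus> f \<star> peval f q"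
proof (cases "a = 0 \<and> q = 0")
  case True
  then show ?thesis
    using f by (auto simp: peval_0 sc_0 cmp_zr hm_def)
next
  case False
  then have "peval f (pCons a q) = sc a (idn (dm f)) \<boxplus> f \<star> peval f q"
    unfolding peval_def by (cases "a = 0") (auto simp: fold_coeffs_pCons_not_0_0_eq fold_coeffs_pCons_coeff_not_0_eq)
  then show ?thesis
    using f by (simp add: hm_def)
qed

lemma hm_peval: "hm (peval f q) X X"
proof (induction q)
  case 0
  then show ?case
    using f by (auto simp: peval_0 dest: hm_objs)
next
  case (pCons a q)
  then show ?case
    using f hm_objs[OF f] by (simp add: peval_pCons) (intro hm_ad hm_sc hm_cmp, auto)
qed

lemma peval_smult: "peval f (Polynomial.smult c q) = sc c (peval f q)"
  using hm_objs[OF f] by (induction q) (auto simp: peval_0 peval_pCons sc_zr ad_sc cmp_sc)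

lemma peval_add: "peval f (p + q) = peval f p \<boxplus> peval f q"
proof (induction p q rule: poly_induct2)
  case 0
  then show ?case
    using hm_objs[OF f] by (simp add: peval_0)
next
  case (pCons a p b q)
  have "sc (a + b) (idn X) \<boxplus> (f \<star> peval f p \<boxplus> f \<star> peval f q)
      = (sc a (idn X) \<boxplus> f \<star> peval f p) \<boxplus> (sc b (idn X) \<boxplus> f \<star> peval f q)"
    by (simp only: sc_ad ad_assoc ad_comm ad_lcomm)
  then show ?case
    using pCons by (simp add: peval_pCons cmp_ad)
qed

lemma peval_mult: "peval f (p * q) = peval f p \<star> peval f q"
proof (induction p)
  case 0
  then show ?case
    using hm_peval[of q] by (auto simp: peval_0 zr_cmp hm_def)
next
  case (pCons a p)
  have "hm (f \<star> peval f p \<star> peval f q) X X"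
    using hm_peval f hm_cmp by blast
  then have "peval f (pCons 0 (p * q)) = f \<star> peval f p \<star> peval f q"
    using hm_objs[OF f] by (simp add: peval_pCons pCons sc_0 hm_def)
  then show ?case
    using hm_peval[of q] hm_objs[OF f]
    by (simp add: peval_add peval_smult peval_pCons ad_cmp sc_cmp cmp_assoc hm_def)
qed

text \<open>Turns a linear combination in a hom-space, whose coefficients are indexed by the vectors
  themselves, into a polynomial in \<open>f\<close>; \<open>idx\<close> tells which power of
  \<open>f\<close> a vector is.\<close>

lemma peval_lincomb:
  assumes "finite A" "\<And>v. v \<in> A \<Longrightarrow> Arw X X v = peval f (monom 1 (idx v))"
  shows "Arw X X (\<Oplus>\<^bsub>Hom C X X\<^esub> v\<in>A. b v \<odot>\<^bsub>Hom C X X\<^esub> v) = peval f (\<Sum>v\<in>A. monom (b v) (idx v))"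
  using assms
proof (induction A rule: finite_induct)
  case empty
  interpret abelian_monoid "Hom C X X"
    using hom_monoid hm_objs[OF f] by blast
  show ?case
    using hm_objs[OF f] by (simp add: peval_0 zr_def)
next
  case (insert x A)
  interpret abelian_monoid "Hom C X X"
    using hom_monoid hm_objs[OF f] by blast
  have o: "X \<in> Obj C"
    using hm_objs[OF f] by blast
  have v: "v \<in> arr C X X" "b v \<odot>\<^bsub>Hom C X X\<^esub> v \<in> arr C X X" "Arw X X (b v \<odot>\<^bsub>Hom C X X\<^esub> v) = peval f (monom (b v) (idx v))"
    if "v \<in> insert x A" for v
  proof -
    have "Arw X X v = peval f (monom 1 (idx v))"
      using insert.prems that by blast
    moreover from this show v: "v \<in> arr C X X"
      using hm_peval[of "monom 1 (idx v)"] hm_mp by (metis arw.sel(3))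
    ultimately show "Arw X X (b v \<odot>\<^bsub>Hom C X X\<^esub> v) = peval f (monom (b v) (idx v))"
      using peval_smult[of "b v" "monom 1 (idx v)"] o by (simp add: smult_monom sc_def flip: \<open>Arw X X v = _\<close>)
    then show "b v \<odot>\<^bsub>Hom C X X\<^esub> v \<in> arr C X X"
      using hm_peval hm_mp by (metis arw.sel(3))
  qed
  have "(\<Oplus>\<^bsub>Hom C X X\<^esub> v\<in>insert x A. b v \<odot>\<^bsub>Hom C X X\<^esub> v) =
      (b x \<odot>\<^bsub>Hom C X X\<^esub> x) \<oplus>\<^bsub>Hom C X X\<^esub> (\<Oplus>\<^bsub>Hom C X X\<^esub> v\<in>A. b v \<odot>\<^bsub>Hom C X X\<^esub> v)"
    using insert.hyps v by (intro finsum_insert) auto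
  moreover have "(\<Oplus>\<^bsub>Hom C X X\<^esub> v\<in>A. b v \<odot>\<^bsub>Hom C X X\<^esub> v) \<in> arr C X X"
    using v by (intro finsum_closed) auto
  ultimately have "Arw X X (\<Oplus>\<^bsub>Hom C X X\<^esub> v\<in>insert x A. b v \<odot>\<^bsub>Hom C X X\<^esub> v) =
      Arw X X (b x \<odot>\<^bsub>Hom C X X\<^esub> x) \<boxplus> Arw X X (\<Oplus>\<^bsub>Hom C X X\<^esub> v\<in>A. b v \<odot>\<^bsub>Hom C X X\<^esub> v)"
    using v(2)[of x] o by (simp add: ad_def)
  then show ?case
    using insert v(3)[of x] by (simp add: peval_add)
qed

lemma annihilating_poly: "\<exists>q. q \<noteq> 0 \<and> peval f q = zr X X"
proof -
  have o: "X \<in> Obj C"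
    using hm_objs[OF f] by blast
  interpret V: vectorspace class_ring "Hom C X X"
    using hom_vectorspace o by blast
  define e where "e n = mp (peval f (monom 1 n))" for n
  have e: "Arw X X (e n) = peval f (monom 1 n)" for n
    unfolding e_def using hm_Arw[OF hm_peval] by simp
  \<comment> \<open>Linear dependence is a property of sets, so two coinciding powers of
    \<open>f\<close> must be treated apart: they give a difference of monomials. Otherwise more
    vectors than the dimension are dependent.\<close>
  show ?thesis
  proof (cases "inj_on e {..V.dim}")
    case False
    then obtain m n where mn: "m \<noteq> n" "e m = e n"
      unfolding inj_on_def by blast
    have "peval f (monom 1 m) = peval f (monom 1 n)"
      using e[of m] e[of n] mn by simp
    then have "peval f (monom 1 m + Polynomial.smult (-1) (monom 1 n)) = zr X X"
      using ad_neg[of "peval f (monom 1 n)"] hm_peval[of "monom 1 n"] unfolding peval_add peval_smult hm_def by simp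
    moreover have "coeff (monom 1 m + Polynomial.smult (-1) (monom 1 n)) m \<noteq> (0::'k)"
      using mn by simp
    ultimately show ?thesis
      by (metis coeff_0)
  next
    case True
    have ec: "e ` {..V.dim} \<subseteq> arr C X X"
      using hm_mp[OF hm_peval] by (auto simp: e_def)
    have "card (e ` {..V.dim}) > V.dim"
      using card_image[OF True] by simp
    then have "V.lin_dep (e ` {..V.dim})"
      using V.li_le_dim(2)[OF hom_fin_dim[OF o o] ec] by linarith
    then obtain A b v where A: "finite A" "A \<subseteq> e ` {..V.dim}" "V.lincomb b A = \<zero>\<^bsub>Hom C X X\<^esub>" "v \<in> A" "b v \<noteq> 0"
      unfolding V.lin_dep_def by auto
    define idx where "idx v = (SOME n. e n = v)" for v
    have idx: "e (idx v) = v" if v: "v \<in> A" for v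
    proof -
      obtain n where "e n = v"
        using A(2) v by auto
      then show ?thesis
        unfolding idx_def by (rule someI)
    qed
    let ?q = "\<Sum>v\<in>A. monom (b v) (idx v)"
    have "peval f ?q = Arw X X (V.lincomb b A)"
      unfolding V.lincomb_def
    proof (rule peval_lincomb[OF A(1), symmetric])
      fix v assume "v \<in> A"
      then show "Arw X X v = peval f (monom 1 (idx v))"
        using e[of "idx v"] idx[of v] by simp
    qed
    then have "peval f ?q = zr X X"
      using A(3) o by (simp add: zr_def)
    moreover have "coeff ?q (idx v) = b v"
    proof -
      have i: "idx w = idx v \<longleftrightarrow> w = v" if "w \<in> A" for w
        using idx[OF that] idx[OF A(4)] by metis
      have "coeff ?q (idx v) = (\<Sum>w\<in>A. if w = v then b w else 0)"
        unfolding coeff_sum by (rule sum.cong) (simp_all add: i)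
      then show ?thesis
        using A by simp
    qed
    ultimately show ?thesis
      using A(5) by (metis coeff_0)
  qed
qed

end

text \<open>Induction on the degree of an annihilating polynomial. For a root \<open>r\<close>,
  Schur's lemma makes \<open>f - r\<close> zero or invertible; in the latter case the linear factor
  can be cancelled.\<close>

lemma Schur_scalar:
  assumes s: "simple_obj C X" and f: "hm f X X"
  shows "\<exists>c. f = sc c (idn X)"
proof -
  have o: "X \<in> Obj C"
    using s by simp
  have "\<exists>c. f = sc c (idn X)" if "q \<noteq> 0" "peval f q = zr X X" for q
    using that
  proof (induction "degree q" arbitrary: q rule: less_induct)
    case less
    show ?case
    proof (cases "degree q = 0")
      case True
      then obtain a where q: "q = [:a:]" "a \<noteq> 0"
        using less.prems degree_eq_zeroE by (metis pCons_0_0)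
      have "sc a (idn X) = zr X X"
        using less.prems(2) q f o by (auto simp: peval_pCons[OF f] peval_0[OF f] cmp_zr hm_def)
      then have "idn X = zr X X"
        using sc_eq_zr[of "idn X" a] q o by simp
      then show ?thesis
        using simple_nz[OF s] by simp
    next
      case False
      then obtain r where r: "poly q r = 0"
        using alg_closed_imp_poly_has_root by blast
      then obtain q' where q': "q = [:- r, 1:] * q'"
        using poly_eq_0_iff_dvd by (metis dvdE)
      have q'0: "q' \<noteq> 0"
        using q' less.prems by auto
      then have deg: "degree q' < degree q"
        using q' degree_mult_eq[of "[:- r, 1:]" q'] by (simp del: mult_pCons_left)
      let ?g = "peval f [:- r, 1:]"
      have g: "?g = f \<boxplus> sc (-1) (sc r (idn X))"
        using f o by (auto simp: peval_pCons[OF f] peval_0[OF f] cmp_zr hm_def ad_comm)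
      have gz: "?g \<star> peval f q' = zr X X"
        using less.prems(2) q' peval_mult[OF f] by metis
      show ?thesis
      proof (cases "?g = zr X X")
        case True
        then have "f = sc r (idn X)"
          using g ad_eq_iff[of f "sc r (idn X)"] f o by (auto simp: hm_def)
        then show ?thesis
          by blast
      next
        case False
        then obtain h where h: "inverses ?g h"
          using Schur_iso[OF s s hm_peval[OF f]] by blast
        have "peval f q' = h \<star> ?g \<star> peval f q'"
          using inversesD[OF h] hm_peval[OF f, of q'] hm_peval[OF f, of "[:- r, 1:]"] by (simp add: hm_def)
        also have "\<dots> = zr X X"
          unfolding gz using inversesD[OF h] hm_peval[OF f, of "[:- r, 1:]"] o by (simp add: cmp_zr hm_def)
        finally show ?thesis
          using less.hyps[OF deg q'0] by blast
      qed
    qed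
  qed
  then show ?thesis
    using annihilating_poly[OF f] by blast
qed

lemma sc_idn_inj: "\<lbrakk>X \<in> Obj C; idn X \<noteq> zr X X; sc a (idn X) = sc b (idn X)\<rbrakk> \<Longrightarrow> a = b"
proof (rule ccontr)
  assume a: "X \<in> Obj C" "idn X \<noteq> zr X X" "sc a (idn X) = sc b (idn X)" "a \<noteq> b"
  have "sc (a + - b) (idn X) = sc b (idn X) \<boxplus> sc (- b) (idn X)"
    using a by (simp only: sc_ad)
  also have "\<dots> = zr X X"
    using ad_neg[of "sc b (idn X)"] a by simp
  finally show False
    using sc_eq_zr[of "idn X" "a + - b"] a by simp
qed

end

section \<open>Characters of the fusion ring\<close>

context linear_category
begin

lemma isomorphicI: "\<lbrakk>inverses f g; dm f = X; cd f = Y\<rbrakk> \<Longrightarrow> isomorphic C X Y"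
  using isomorphic_iff[OF ar_objs[OF inversesD(1)]] by blast

lemma isomorphicE:
  assumes "isomorphic C X Y" "X \<in> Obj C" "Y \<in> Obj C"
  obtains f g where "inverses f g" "dm f = X" "cd f = Y"
  using isomorphic_iff[OF assms(2,3)] assms(1) by blast

end

context monoidal_category
begin

lemma smul_sid_inj:
  assumes "X \<in> Obj C" "smul a (sid [X]) = smul b (sid [X])"
  shows "sc a (idn X) = sc b (idn X)"
  using assms by (intro emb_inj) (simp_all add: emb_sc)

text \<open>The embedding is full and faithful on one-letter words, so isomorphisms between them
  come from \<open>C\<close>.\<close>

lemma sar_iso_isomorphic:
  assumes "sar F" "dm F = [X]" "cd F = [Y]" "sar G" "dm G = [Y]" "cd G = [X]" "G \<diamond> F = sid [X]" "F \<diamond> G = sid [Y]"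
  shows "isomorphic C X Y"
proof -
  obtain f where f: "ar f" "dm f = X" "cd f = Y" "F = emb f"
    using emb_full[OF assms(1-3)] .
  obtain g where g: "ar g" "dm g = Y" "cd g = X" "G = emb g"
    using emb_full[OF assms(4-6)] .
  have "g \<star> f = idn X"
    using assms(7) f g by (intro emb_inj) (auto simp: emb_cmp)
  moreover have "f \<star> g = idn Y"
    using assms(8) f g by (intro emb_inj) (auto simp: emb_cmp)
  ultimately show ?thesis
    using f g by (intro isomorphicI[of f g]) (auto simp: inverses_def)
qed

end

section \<open>Duality as a contravariant linear functor\<close>

context rigid_category
begin

definition dua :: "('o, 'm) arw \<Rightarrow> ('o, 'm) arw" where
  "dua f = Arw ((cd f)\<^bold>*) ((dm f)\<^bold>*) (dual_arr C (dm f) (cd f) (mp f))"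

lemma hm_dua: "hm f X Y \<Longrightarrow> hm (dua f) (Y\<^bold>*) (X\<^bold>*)"
  using emb_dual_arr(1)[of f] by (auto simp: hm_def dua_def)

lemma emb_dua: "hm f X Y \<Longrightarrow> emb (dua f) = du X Y (emb f)"
  using emb_dual_arr(2)[of f] by (auto simp: hm_def dua_def)

lemma hm_eqI: "\<lbrakk>hm f X Y; hm g X Y; emb f = emb g\<rbrakk> \<Longrightarrow> f = g"
  by (auto simp: hm_def intro: emb_inj)

lemma dua_cmp:
  assumes "hm f X Y" "hm g Y Z"
  shows "dua (g \<star> f) = dua f \<star> dua g"
proof (rule hm_eqI)
  have o: "X \<in> Obj C" "Y \<in> Obj C" "Z \<in> Obj C"
    using assms hm_objs by auto
  show "hm (dua (g \<star> f)) (Z\<^bold>*) (X\<^bold>*)" "hm (dua f \<star> dua g) (Z\<^bold>*) (X\<^bold>*)"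
    using assms hm_dua hm_cmp by blast+
  have "sdual (ev Z) [Z\<^bold>*] (emb g \<diamond> emb f) (coev X) [X\<^bold>*] = sdual (ev Y) [Y\<^bold>*] (emb f) (coev X) [X\<^bold>*] \<diamond> sdual (ev Z) [Z\<^bold>*] (emb g) (coev Y) [Y\<^bold>*]"
    by (rule sdual_cp[OF dpair_ev[OF o(1)] dpair_ev[OF o(2)] dpair_ev[OF o(3)]]) (use assms in \<open>auto simp: hm_def\<close>)
  then show "emb (dua (g \<star> f)) = emb (dua f \<star> dua g)"
    using emb_dua[OF hm_cmp[OF assms(2,1)]] emb_dua[OF assms(1)] emb_dua[OF assms(2)]
    by (simp add: emb_cmp du_def)
qed

lemma dua_ad:
  assumes "hm f X Y" "hm g X Y"
  shows "dua (f \<boxplus> g) = dua f \<boxplus> dua g"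
proof (rule hm_eqI)
  show "hm (dua (f \<boxplus> g)) (Y\<^bold>*) (X\<^bold>*)" "hm (dua f \<boxplus> dua g) (Y\<^bold>*) (X\<^bold>*)"
    using assms hm_dua hm_ad by blast+
  show "emb (dua (f \<boxplus> g)) = emb (dua f \<boxplus> dua g)"
    using emb_dua[OF hm_ad[OF assms]] emb_dua[OF assms(1)] emb_dua[OF assms(2)]
    by (simp add: emb_ad du_def sdual_def wh_sadd sadd_cp cp_sadd)
qed

lemma dua_sc:
  assumes "hm f X Y"
  shows "dua (sc c f) = sc c (dua f)"
proof (rule hm_eqI)
  show "hm (dua (sc c f)) (Y\<^bold>*) (X\<^bold>*)" "hm (sc c (dua f)) (Y\<^bold>*) (X\<^bold>*)"
    using assms hm_dua hm_sc by blast+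
  show "emb (dua (sc c f)) = emb (sc c (dua f))"
    using emb_dua[OF hm_sc[OF assms]] emb_dua[OF assms]
    by (simp add: emb_sc du_def sdual_def wh_smul smul_cp cp_smul)
qed

lemma dua_zr: "\<lbrakk>X \<in> Obj C; Y \<in> Obj C\<rbrakk> \<Longrightarrow> dua (zr X Y) = zr (Y\<^bold>*) (X\<^bold>*)"
proof -
  assume o: "X \<in> Obj C" "Y \<in> Obj C"
  have z: "hm (zr X Y) X Y"
    using o by simp
  have "dua (zr X Y) = dua (sc 0 (zr X Y))"
    using o by (simp add: sc_zr)
  also have "\<dots> = sc 0 (dua (zr X Y))"
    by (rule dua_sc[OF z])
  also have "\<dots> = zr (Y\<^bold>*) (X\<^bold>*)"
    using hm_dua[OF z] sc_0[of "dua (zr X Y)"] by (simp add: hm_def)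
  finally show ?thesis .
qed

lemma dua_idn: "X \<in> Obj C \<Longrightarrow> dua (idn X) = idn (X\<^bold>*)"
proof (rule hm_eqI)
  assume X: "X \<in> Obj C"
  show "hm (dua (idn X)) (X\<^bold>*) (X\<^bold>*)" "hm (idn (X\<^bold>*)) (X\<^bold>*) (X\<^bold>*)"
    using X hm_dua[of "idn X" X X] by simp_all
  show "emb (dua (idn X)) = emb (idn (X\<^bold>*))"
    using X emb_dua[of "idn X" X X] sdual_sid[OF dpair_ev[OF X]] by (simp add: du_def)
qed

lemma dual_isomorphic:
  assumes "X \<in> Obj C" "Y \<in> Obj C" "isomorphic C X Y"
  shows "isomorphic C (X\<^bold>*) (Y\<^bold>*)"
proof -
  obtain f g where fg: "inverses f g" "dm f = X" "cd f = Y"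
    using assms isomorphic_iff by blast
  then have h: "hm f X Y" "hm g Y X"
    by (auto simp: inverses_def hm_def)
  have "dua g \<star> dua f = idn (Y\<^bold>*)" "dua f \<star> dua g = idn (X\<^bold>*)"
    using dua_cmp[OF h] dua_cmp[OF h(2,1)] inversesD(5,6)[OF fg(1)] fg assms by (simp_all add: dua_idn)
  then have "inverses (dua g) (dua f)"
    using hm_dua[OF h(1)] hm_dua[OF h(2)] by (simp add: inverses_def hm_def)
  then show ?thesis
    by (rule isomorphicI) (use hm_dua[OF h(2)] in \<open>auto simp: hm_def\<close>)
qed

text \<open>Duality is additive and reverses arrows, so inclusions and projections trade
  places.\<close>

lemma dual_dsum:
  assumes d: "dsum X Ys i p"
  shows "dsum (X\<^bold>*) (map (Dual C) Ys) (\<lambda>a. dua (p a)) (\<lambda>a. dua (i a))"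
  unfolding dsum_def
proof (intro conjI allI impI)
  note D = dsumD[OF d]
  show "X\<^bold>* \<in> Obj C" "set (map (Dual C) Ys) \<subseteq> Obj C"
    using D(1,2) by auto
  have "ssum (X\<^bold>*) (\<lambda>a. dua (p a) \<star> dua (i a)) n = dua (ssum X (\<lambda>a. i a \<star> p a) n) \<and> hm (ssum X (\<lambda>a. i a \<star> p a) n) X X"
    if "n \<le> length Ys" for n
    using that
  proof (induction n)
    case 0
    then show ?case
      using D(1) by (simp add: dua_zr)
  next
    case (Suc n)
    then have n: "hm (i n \<star> p n) X X" "dua (p n) \<star> dua (i n) = dua (i n \<star> p n)"
      using D(4,5)[of n] hm_cmp dua_cmp by (auto simp: Suc_le_eq)
    then show ?case
      using Suc dua_ad[OF n(1)] hm_ad by simp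
  qed
  then show "ssum (X\<^bold>*) (\<lambda>a. dua (p a) \<star> dua (i a)) (length (map (Dual C) Ys)) = idn (X\<^bold>*)"
    using D(1,7) by (simp add: dua_idn)
  fix a b assume "a < length (map (Dual C) Ys)" "b < length (map (Dual C) Ys)"
  then have ab: "a < length Ys" "b < length Ys"
    by simp_all
  have "dua (i a) \<star> dua (p b) = dua (p b \<star> i a)"
    using dua_cmp[OF D(4)[OF ab(1)] D(5)[OF ab(2)]] by simp
  then show "dua (i a) \<star> dua (p b) = (if a = b then idn (map (Dual C) Ys ! a) else zr (map (Dual C) Ys ! b) (map (Dual C) Ys ! a))"
    using D(6)[OF ab(2,1)] D(3)[OF ab(1)] D(3)[OF ab(2)] ab by (simp add: dua_idn dua_zr)
next
  note D = dsumD[OF d]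
  fix a assume "a < length (map (Dual C) Ys)"
  then show "hm (dua (p a)) (map (Dual C) Ys ! a) (X\<^bold>*)" "hm (dua (i a)) (X\<^bold>*) (map (Dual C) Ys ! a)"
    using hm_dua[OF D(5)[of a]] hm_dua[OF D(4)[of a]] by simp_all
qed

lemma dual_tens_isomorphic:
  assumes "X \<in> Obj C" "Y \<in> Obj C"
  shows "isomorphic C (Y\<^bold>* \<otimes>\<^sub>o X\<^bold>*) ((X \<otimes>\<^sub>o Y)\<^bold>*)"
proof -
  obtain F where F: "sar F" "dm F = [(X \<otimes>\<^sub>o Y)\<^bold>*]" "cd F = [Y\<^bold>*, X\<^bold>*]" "F \<diamond> dt X Y = sid [Y\<^bold>*, X\<^bold>*]" "dt X Y \<diamond> F = sid [(X \<otimes>\<^sub>o Y)\<^bold>*]"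
    using dt_iso[OF assms] .
  show ?thesis
  proof (rule sar_iso_isomorphic)
    show "(mu (Y\<^bold>*) (X\<^bold>*) \<diamond> F) \<diamond> (dt X Y \<diamond> nu (Y\<^bold>*) (X\<^bold>*)) = sid [Y\<^bold>* \<otimes>\<^sub>o X\<^bold>*]"
      using F assms cp_cancel[OF F(4)] by (simp add: cp_assoc)
    show "(dt X Y \<diamond> nu (Y\<^bold>*) (X\<^bold>*)) \<diamond> (mu (Y\<^bold>*) (X\<^bold>*) \<diamond> F) = sid [(X \<otimes>\<^sub>o Y)\<^bold>*]"
      using F assms by (simp add: cp_assoc)
  qed (use F assms in auto)
qed

end

context linear_category
begin

lemma dsum_replace:
  assumes d: "dsum X Ys i p" and l: "length Zs = length Ys" and iso: "\<And>a. a < length Ys \<Longrightarrow> isomorphic C (Ys ! a) (Zs ! a)"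
    and o: "set Zs \<subseteq> Obj C"
  shows "\<exists>i' p'. dsum X Zs i' p'"
proof -
  note D = dsumD[OF d]
  have "\<exists>f g. inverses f g \<and> dm f = Ys ! a \<and> cd f = Zs ! a" if "a < length Ys" for a
    using isomorphic_iff[of "Ys ! a" "Zs ! a"] iso[OF that] D(3)[OF that] o l that by (auto simp: subset_iff)
  then obtain F G where FG: "\<And>a. a < length Ys \<Longrightarrow> inverses (F a) (G a) \<and> dm (F a) = Ys ! a \<and> cd (F a) = Zs ! a"
    by metis
  have I: "hm (F a) (Ys ! a) (Zs ! a)" "hm (G a) (Zs ! a) (Ys ! a)" "G a \<star> F a = idn (Ys ! a)" "F a \<star> G a = idn (Zs ! a)"
    if "a < length Ys" for a
    using FG[OF that] by (auto simp: inverses_def hm_def)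
  have "dsum X Zs (\<lambda>a. i a \<star> G a) (\<lambda>a. F a \<star> p a)"
    unfolding dsum_def
  proof (intro conjI allI impI D(1) o)
    have "(i a \<star> G a) \<star> F a \<star> p a = i a \<star> p a" if "a < length Ys" for a
    proof -
      have "(i a \<star> G a) \<star> F a \<star> p a = i a \<star> (G a \<star> F a) \<star> p a"
        by (simp only: cmp_assoc)
      then show ?thesis
        using I[OF that] D(5)[OF that] by (simp add: hm_def)
    qed
    then have "ssum X (\<lambda>a. (i a \<star> G a) \<star> F a \<star> p a) (length Ys) = ssum X (\<lambda>a. i a \<star> p a) (length Ys)"
      by (rule ssum_cong)
    then show "ssum X (\<lambda>a. (i a \<star> G a) \<star> F a \<star> p a) (length Zs) = idn X"
      using D(7) l by simp
    fix a b assume "a < length Zs" "b < length Zs"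
    then have ab: "a < length Ys" "b < length Ys"
      using l by simp_all
    have "(F a \<star> p a) \<star> i b \<star> G b = F a \<star> (p a \<star> i b) \<star> G b"
      by (simp only: cmp_assoc)
    then show "(F a \<star> p a) \<star> i b \<star> G b = (if a = b then idn (Zs ! a) else zr (Zs ! b) (Zs ! a))"
      using D(6)[OF ab] I[OF ab(1)] I[OF ab(2)] hm_objs[OF I(1)[OF ab(1)]] hm_objs[OF I(1)[OF ab(2)]]
      by (auto simp: hm_def zr_cmp cmp_zr)
  next
    fix a assume "a < length Zs"
    then have a: "a < length Ys"
      using l by simp
    show "hm (i a \<star> G a) (Zs ! a) X" "hm (F a \<star> p a) X (Zs ! a)"
      using hm_cmp[OF D(4)[OF a] I(2)[OF a]] hm_cmp[OF I(1)[OF a] D(5)[OF a]] by simp_all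
  qed
  then show ?thesis
    by blast
qed

lemma dsum_single_isomorphic:
  assumes "dsum X [Y] i p"
  shows "isomorphic C X Y"
proof -
  note D = dsumD[OF assms]
  have h: "hm (i 0) Y X" "hm (p 0) X Y" "p 0 \<star> i 0 = idn Y"
    using D(4)[of 0] D(5)[of 0] D(6)[of 0 0] by simp_all
  moreover have "i 0 \<star> p 0 = idn X"
    using D(7) hm_cmp[OF h(1,2)] by (simp add: hm_def)
  ultimately have "inverses (p 0) (i 0)"
    by (simp add: inverses_def hm_def)
  then show ?thesis
    by (rule isomorphicI) (use h in \<open>auto simp: hm_def\<close>)
qed

end

section \<open>Scalars, quantum dimensions and characters\<close>

context ac_modular_category
begin

lemma unit_simple [simp]: "simple_obj C (UnitO C)"
  by (rule simple_UnitO)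

definition sval :: "'o \<Rightarrow> ('o list, 'o \<Rightarrow> ('o, 'm) arw) arw \<Rightarrow> 'k" where
  "sval X F = (THE c. F = smul c (sid [X]))"

lemma sval_smul [simp]: "simple_obj C X \<Longrightarrow> sval X (smul c (sid [X])) = c"
  unfolding sval_def
proof (rule the_equality)
  fix a assume s: "simple_obj C X" and "smul c (sid [X]) = smul a (sid [X])"
  then have "sc a (idn X) = sc c (idn X)"
    using smul_sid_inj simple_Obj by metis
  then show "a = c"
    using sc_idn_inj simple_nz[OF s] simple_Obj[OF s] by blast
qed (rule refl)

lemma sval_eq:
  assumes "simple_obj C X" "sar F" "dm F = [X]" "cd F = [X]"
  shows "F = smul (sval X F) (sid [X])"
proof -
  obtain f where f: "ar f" "dm f = X" "cd f = X" "F = emb f"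
    using emb_full[OF assms(2-4)] .
  then obtain c where "f = sc c (idn X)"
    using Schur_scalar[OF assms(1), of f] by (auto simp: hm_def)
  then have "F = smul c (sid [X])"
    using f assms(1) by (simp add: emb_sc)
  then show ?thesis
    using assms(1) by simp
qed

lemma sval_sadd:
  assumes "simple_obj C X" "sar F" "dm F = [X]" "cd F = [X]" "sar G" "dm G = [X]" "cd G = [X]"
  shows "sval X (sadd F G) = sval X F + sval X G"
proof -
  have "sadd F G = smul (sval X F + sval X G) (sid [X])"
    using sval_eq[OF assms(1-4)] sval_eq[OF assms(1,5-7)] sadd_smul by metis
  then show ?thesis
    using assms(1) by simp
qed

definition scal :: "('o list, 'o \<Rightarrow> ('o, 'm) arw) arw \<Rightarrow> 'k" where
  "scal F = (THE c. F = smul c (sid []))"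

lemma scal_smul [simp]: "scal (smul c (sid [])) = c"
  unfolding scal_def
proof (rule the_equality)
  fix a assume "smul c (sid []) = smul a (sid [])"
  then have "ui \<diamond> smul c (sid []) \<diamond> uo = ui \<diamond> smul a (sid []) \<diamond> uo"
    by simp
  then have "smul c (sid [UnitO C]) = smul a (sid [UnitO C])"
    by (simp add: smul_cp cp_smul)
  then show "a = c"
    using sval_smul[OF unit_simple] by metis
qed simp

text \<open>Conjugation by \<open>ui\<close> and \<open>uo\<close> moves the endomorphism to the
  unit object, which is simple.\<close>

lemma scal_eq:
  assumes "sar F" "dm F = []" "cd F = []"
  shows "F = smul (scal F) (sid [])"
proof -
  define c where "c = sval (UnitO C) (ui \<diamond> F \<diamond> uo)"
  have "ui \<diamond> F \<diamond> uo = smul c (sid [UnitO C])"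
    unfolding c_def by (rule sval_eq) (use assms in auto)
  then have "uo \<diamond> (ui \<diamond> F \<diamond> uo) \<diamond> ui = uo \<diamond> smul c (sid [UnitO C]) \<diamond> ui"
    by simp
  then have "F = smul c (sid [])"
    using assms by (simp add: cp_assoc smul_cp cp_smul)
  then show ?thesis
    by simp
qed

text \<open>The scalar by which a loop of \<open>V\<close> encircling \<open>X\<close> acts: the
  S-matrix entry divided by the dimension of \<open>X\<close>. As a function of \<open>V\<close> it
  will be a character of the fusion ring.\<close>

definition chi :: "'o \<Rightarrow> 'o \<Rightarrow> 'k" where
  "chi X V = sval X (ptr [X] V (db X V) [X])"

text \<open>The quantum dimension, read off from a closed loop as an endomorphism of the empty
  word.\<close>

definition dd :: "'o \<Rightarrow> 'k" where
  "dd X = scal (ptr [] X (sid [X]) [])"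

lemma chi_eq: "\<lbrakk>simple_obj C X; V \<in> Obj C\<rbrakk> \<Longrightarrow> ptr [X] V (db X V) [X] = smul (chi X V) (sid [X])"
  unfolding chi_def by (rule sval_eq) auto

lemma dd_eq: "X \<in> Obj C \<Longrightarrow> ptr [] X (sid [X]) [] = smul (dd X) (sid [])"
  unfolding dd_def by (rule scal_eq) auto

lemma chi_tens: "\<lbrakk>simple_obj C X; V \<in> Obj C; W \<in> Obj C\<rbrakk> \<Longrightarrow> chi X (V \<otimes>\<^sub>o W) = chi X V * chi X W"
proof -
  assume a: "simple_obj C X" "V \<in> Obj C" "W \<in> Obj C"
  have "ptr [X] (V \<otimes>\<^sub>o W) (db X (V \<otimes>\<^sub>o W)) [X] = smul (chi X W) (ptr [X] V (db X V) [X])"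
    using a by (intro ptr_db_tens chi_eq) auto
  also have "\<dots> = smul (chi X V * chi X W) (sid [X])"
    using chi_eq[OF a(1,2)] by (simp add: mult.commute)
  finally show ?thesis
    unfolding chi_def[of X "V \<otimes>\<^sub>o W"] using a by simp
qed

lemma chi_scalar:
  assumes "simple_obj C X" "V \<in> Obj C" "db X V = smul c (sid [X, V])"
  shows "chi X V = c * dd V"
proof -
  have "ptr ([X] @ []) V (wh [X] (sid [V]) []) ([X] @ []) = wh [X] (ptr [] V (sid [V]) []) []"
    using assms by (intro ptr_wh) auto
  then have "ptr [X] V (sid [X, V]) [X] = smul (dd V) (sid [X])"
    using assms dd_eq[of V] by (simp add: wh_smul)
  then have "ptr [X] V (db X V) [X] = smul (c * dd V) (sid [X])"
    by (simp add: assms(3) ptr_smul)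
  then show ?thesis
    unfolding chi_def using assms by simp
qed

lemma ptr_ptr_db:
  assumes "X \<in> Obj C" "Y \<in> Obj C"
  shows "ptr [] X (ptr [X] Y (db X Y) [X]) [] = ptr [] (X \<otimes>\<^sub>o Y) (emb (bd Y X \<star> bd X Y)) []"
  using ptr_tens[of X Y "db X Y" "[]" "[]"] assms by (simp add: db_emb cp_assoc)

lemma chi_dd:
  assumes "simple_obj C X" "V \<in> Obj C"
  shows "ptr [] X (ptr [X] V (db X V) [X]) [] = smul (chi X V * dd X) (sid [])"
  using assms chi_eq[OF assms] dd_eq[of X] by (simp add: ptr_smul)

lemma trace_double_braiding:
  assumes "simple_obj C X" "V \<in> Obj C"
  shows "trace_arr C (X \<otimes>\<^sub>o V) (Braid C V X \<cdot> Braid C X V) = chi X V * dd X"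
proof -
  have o: "X \<in> Obj C"
    using assms by simp
  have m: "mp (bd V X \<star> bd X V) = Braid C V X \<cdot> Braid C X V"
    using assms o by (simp add: mp_cmp) (simp add: bd_def)
  have "trace_arr C (X \<otimes>\<^sub>o V) (mp (bd V X \<star> bd X V)) = scal (ptr [] (X \<otimes>\<^sub>o V) (emb (bd V X \<star> bd X V)) [])"
    unfolding scal_def using assms o by (intro trace_arr_eq) auto
  also have "\<dots> = chi X V * dd X"
    using chi_dd[OF assms] ptr_ptr_db[OF o assms(2)] by simp
  finally show ?thesis
    by (simp add: m)
qed

lemma dd_trace:
  assumes "X \<in> Obj C"
  shows "dd X = trace_arr C X (Ident C X)"
  using trace_arr_eq[of "idn X" X] assms by (simp add: mp_idn dd_def scal_def)

lemma dd_dual: "X \<in> Obj C \<Longrightarrow> dd (X\<^bold>*) = dd X"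
  using spherical[of X] by (simp add: dd_trace)

lemma chi_sym:
  assumes "simple_obj C X" "simple_obj C Y"
  shows "chi X Y * dd X = chi Y X * dd Y"
proof -
  have "smul (chi X Y * dd X) (sid []) = smul (chi Y X * dd Y) (sid [])"
    using chi_dd[of X Y] chi_dd[of Y X] ptr_sym[of X Y] assms by simp
  then show ?thesis
    using scal_smul by metis
qed

text \<open>Put a box \<open>h\<close> on the loop: the result is additive in \<open>h\<close>. For
  \<open>h = i a \<star> p a\<close>, naturality of the double braiding and cyclicity move
  \<open>i a\<close> round the loop to meet \<open>p a\<close>, leaving the loop of the
  summand.\<close>

lemma chi_dsum:
  assumes s: "simple_obj C X" and d: "dsum V Ys i p"
  shows "chi X V = (\<Sum>a<length Ys. chi X (Ys ! a))"
proof -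
  note D = dsumD[OF d]
  define \<phi> where "\<phi> h = sval X (ptr [X] V (db X V \<diamond> wh [X] (emb h) []) [X])" for h
  have "\<phi> (f \<boxplus> g) = \<phi> f + \<phi> g" if "hm f V V" "hm g V V" for f g
    unfolding \<phi>_def emb_ad wh_sadd cp_sadd ptr_sadd
    using that s D(1) by (intro sval_sadd) (auto simp: hm_def)
  from dsum_functional[OF d this] have "\<phi> (idn V) = (\<Sum>a<length Ys. \<phi> (i a \<star> p a))" .
  moreover have "\<phi> (idn V) = chi X V"
    using s D(1) by (simp add: \<phi>_def chi_def)
  moreover have "\<phi> (i a \<star> p a) = chi X (Ys ! a)" if a: "a < length Ys" for a
  proof -
    have i: "ar (i a)" "dm (i a) = Ys ! a" "cd (i a) = V" and p: "ar (p a)" "dm (p a) = V" "cd (p a) = Ys ! a"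
      using D(4,5)[OF a] by (auto simp: hm_def)
    have X: "X \<in> Obj C"
      using s by simp
    let ?f = "db X (Ys ! a) \<diamond> wh [X] (emb (p a)) []"
    have "db X V \<diamond> wh [X] (emb (i a)) [] = wh [X] (emb (i a)) [] \<diamond> db X (Ys ! a)"
      using db_nat[OF i(1) X] i by simp
    from cp_reassoc2[OF this]
    have "db X V \<diamond> wh [X] (emb (i a \<star> p a)) [] = wh [X] (emb (i a)) [] \<diamond> ?f"
      by (simp add: emb_cmp)
    then have "ptr [X] V (db X V \<diamond> wh [X] (emb (i a \<star> p a)) []) [X] = ptr [X] (Ys ! a) (?f \<diamond> wh [X] (emb (i a)) []) [X]"
      using ptr_cyclic[of "i a" "Ys ! a" V ?f "[X]" "[X]"] i p X D(3)[OF a] by simp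
    also have "?f \<diamond> wh [X] (emb (i a)) [] = db X (Ys ! a) \<diamond> wh [X] (emb (p a \<star> i a)) []"
      by (simp add: emb_cmp cp_assoc)
    also have "\<dots> = db X (Ys ! a)"
      using D(6)[OF a a] D(3)[OF a] X by simp
    finally show ?thesis
      by (simp add: \<phi>_def chi_def)
  qed
  ultimately show ?thesis
    by simp
qed

lemma chi_isomorphic:
  assumes s: "simple_obj C X" and o: "V \<in> Obj C" "W \<in> Obj C" and i: "isomorphic C V W"
  shows "chi X V = chi X W"
proof -
  obtain f g where "inverses f g" "dm f = V" "cd f = W"
    using i o isomorphic_iff by blast
  from dsum_iso[OF dsum_singleton[OF o(1)] this] show ?thesis
    using chi_dsum[OF s] by fastforce
qed

lemma dd_isomorphic:
  assumes o: "V \<in> Obj C" "W \<in> Obj C" and i: "isomorphic C V W"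
  shows "dd V = dd W"
proof -
  obtain f g where fg: "inverses f g" "dm f = V" "cd f = W"
    using i o isomorphic_iff by blast
  note I = inversesD[OF fg(1)]
  have "ptr [] W (wh [] (emb f) [] \<diamond> emb g) [] = ptr [] V (emb g \<diamond> wh [] (emb f) []) []"
    by (rule ptr_cyclic) (use I fg in auto)
  then have "ptr [] W (emb (f \<star> g)) [] = ptr [] V (emb (g \<star> f)) []"
    using I(1,2) by (simp only: emb_cmp wh_nil sar_emb)
  then show ?thesis
    using I(5,6) fg o by (simp add: dd_def)
qed

end

section \<open>The S-matrix and the adjoint subcategory\<close>

context rigid_category
begin

lemma fusion_subcategoryD:
  assumes "fusion_subcategory C K"
  shows "K \<subseteq> Obj C" "UnitO C \<in> K" "\<lbrakk>X \<in> K; Y \<in> K\<rbrakk> \<Longrightarrow> X \<otimes>\<^sub>o Y \<in> K" "X \<in> K \<Longrightarrow> X\<^bold>* \<in> K"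
    "\<lbrakk>set Xs \<subseteq> K; direct_sum C X Xs\<rbrakk> \<Longrightarrow> X \<in> K"
  using assms unfolding fusion_subcategory_def by auto

lemma fusion_subcategory_mono:
  assumes K: "fusion_subcategory C K" and f: "mono f" "cd f \<in> K"
  shows "dm f \<in> K"
proof -
  have "ar f"
    using f mono_ar by blast
  then have "mono_arr C (dm f) (cd f) (mp f)" "dm f \<in> Obj C"
    using mono_mono_arr[of "dm f" "cd f" "mp f"] f by auto
  then show ?thesis
    using K f unfolding fusion_subcategory_def by blast
qed

lemma fusion_subcategory_isomorphic:
  assumes K: "fusion_subcategory C K" and X: "X \<in> K" and Y: "Y \<in> Obj C" and i: "isomorphic C X Y"
  shows "Y \<in> K"
proof -
  obtain f g where fg: "inverses f g" "dm f = X" "cd f = Y"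
    using isomorphicE[OF i] X Y fusion_subcategoryD(1)[OF K] by blast
  then show ?thesis
    using fusion_subcategory_mono[OF K inverses_mono[OF inverses_sym[OF fg(1)]]] inversesD(3,4)[OF fg(1)] X by simp
qed

text \<open>The intersected family contains \<open>Obj C\<close>, so it is nonempty, and each
  closure property passes to intersections.\<close>

lemma fusion_subcategory_adjoint: "fusion_subcategory C (adjoint_subcategory C)"
proof -
  let ?S = "{K. fusion_subcategory C K \<and> (\<forall>X. simple_obj C X \<longrightarrow> X \<otimes>\<^sub>o X\<^bold>* \<in> K)}"
  have "fusion_subcategory C (Obj C)"
    unfolding fusion_subcategory_def by (auto simp: direct_sum_def)
  then have "Obj C \<in> ?S"
    by simp
  then have "\<Inter>?S \<subseteq> Obj C"
    by blast
  moreover have "UnitO C \<in> \<Inter>?S"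
    using fusion_subcategoryD(2) by blast
  moreover have "\<forall>X\<in>\<Inter>?S. \<forall>Y\<in>\<Inter>?S. X \<otimes>\<^sub>o Y \<in> \<Inter>?S"
    using fusion_subcategoryD(3) by blast
  moreover have "\<forall>X\<in>\<Inter>?S. X\<^bold>* \<in> \<Inter>?S"
    using fusion_subcategoryD(4) by blast
  moreover have "\<forall>Xs X. set Xs \<subseteq> \<Inter>?S \<and> direct_sum C X Xs \<longrightarrow> X \<in> \<Inter>?S"
  proof (intro allI impI InterI)
    fix Xs X K assume a: "set Xs \<subseteq> \<Inter>?S \<and> direct_sum C X Xs" "K \<in> ?S"
    then have "set Xs \<subseteq> K" "fusion_subcategory C K"
      by blast+
    then show "X \<in> K"
      using a fusion_subcategoryD(5) by blast
  qed
  moreover have "\<forall>X\<in>\<Inter>?S. \<forall>Y\<in>Obj C. \<forall>f. mono_arr C Y X f \<longrightarrow> Y \<in> \<Inter>?S"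
  proof (intro ballI allI impI InterI)
    fix X Y f K assume "X \<in> \<Inter>?S" "Y \<in> Obj C" "mono_arr C Y X f" "K \<in> ?S"
    then show "Y \<in> K"
      unfolding fusion_subcategory_def by blast
  qed
  ultimately show ?thesis
    unfolding adjoint_subcategory_def fusion_subcategory_def by blast
qed

lemma adjoint_subcategory_simple: "simple_obj C X \<Longrightarrow> X \<otimes>\<^sub>o X\<^bold>* \<in> adjoint_subcategory C"
  unfolding adjoint_subcategory_def by blast

lemma tens_isomorphic:
  assumes "X \<in> Obj C" "X' \<in> Obj C" "Y \<in> Obj C" "Y' \<in> Obj C" "isomorphic C X X'" "isomorphic C Y Y'"
  shows "isomorphic C (X \<otimes>\<^sub>o Y) (X' \<otimes>\<^sub>o Y')"
proof -
  obtain f g where fg: "inverses f g" "dm f = X" "cd f = X'"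
    using isomorphicE assms by blast
  obtain h k where hk: "inverses h k" "dm h = Y" "cd h = Y'"
    using isomorphicE assms by blast
  show ?thesis
    by (rule isomorphicI[OF inverses_tns[OF fg(1) hk(1)]]) (use fg hk in \<open>auto simp: inverses_def\<close>)
qed

lemma assoc_isomorphic: "\<lbrakk>X \<in> Obj C; Y \<in> Obj C; Z \<in> Obj C\<rbrakk> \<Longrightarrow> isomorphic C ((X \<otimes>\<^sub>o Y) \<otimes>\<^sub>o Z) (X \<otimes>\<^sub>o Y \<otimes>\<^sub>o Z)"
  using isomorphicI[OF inverses_al] by simp

lemma unit_left_isomorphic: "X \<in> Obj C \<Longrightarrow> isomorphic C (UnitO C \<otimes>\<^sub>o X) X"
  using isomorphicI[OF inverses_lu] by simp

lemma unit_right_isomorphic: "X \<in> Obj C \<Longrightarrow> isomorphic C (X \<otimes>\<^sub>o UnitO C) X"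
  using isomorphicI[OF inverses_ru] by simp

lemma invertible_Obj: "invertible_obj C X \<Longrightarrow> X \<in> Obj C"
  by (simp add: invertible_obj_def)

lemma invertible_isomorphic:
  assumes "invertible_obj C X" "Y \<in> Obj C" "isomorphic C X Y"
  shows "invertible_obj C Y"
proof -
  obtain Z where Z: "Z \<in> Obj C" "isomorphic C (X \<otimes>\<^sub>o Z) (UnitO C)" "isomorphic C (Z \<otimes>\<^sub>o X) (UnitO C)"
    using assms(1) by (auto simp: invertible_obj_def)
  have X: "X \<in> Obj C"
    using assms invertible_Obj by blast
  have YX: "isomorphic C Y X"
    by (rule isomorphic_sym[OF X assms(2,3)])
  have "isomorphic C (Y \<otimes>\<^sub>o Z) (X \<otimes>\<^sub>o Z)"
    by (rule tens_isomorphic[OF _ _ _ _ YX isomorphic_refl[OF Z(1)]]) (use assms(2) X Z in simp_all)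
  from isomorphic_trans[OF _ _ _ this Z(2)] have 1: "isomorphic C (Y \<otimes>\<^sub>o Z) (UnitO C)"
    using assms(2) X Z by simp
  have "isomorphic C (Z \<otimes>\<^sub>o Y) (Z \<otimes>\<^sub>o X)"
    by (rule tens_isomorphic[OF _ _ _ _ isomorphic_refl[OF Z(1)] YX]) (use assms(2) X Z in simp_all)
  from isomorphic_trans[OF _ _ _ this Z(3)] have 2: "isomorphic C (Z \<otimes>\<^sub>o Y) (UnitO C)"
    using assms(2) X Z by simp
  from 1 2
  show ?thesis
    unfolding invertible_obj_def using Z assms(2) by blast
qed

text \<open>Tensoring further with an inverse \<open>h\<close> of \<open>g\<close> and rebracketing
  gives the action of the unit object, which is faithful.\<close>

lemma tens_idn_faithful:
  assumes g: "invertible_obj C g" and f: "hm f X Y" "hm f' X Y" "idn g \<boxtimes> f = idn g \<boxtimes> f'"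
  shows "f = f'"
proof -
  obtain h where h: "h \<in> Obj C" "isomorphic C (h \<otimes>\<^sub>o g) (UnitO C)"
    using g by (auto simp: invertible_obj_def)
  have go: "g \<in> Obj C"
    using g invertible_Obj by blast
  obtain a b where ab: "inverses a b" "dm a = h \<otimes>\<^sub>o g" "cd a = UnitO C"
    using isomorphicE[OF h(2)] h(1) go by auto
  note i = inversesD[OF ab(1)]
  have e: "idn (UnitO C) \<boxtimes> u = (a \<boxtimes> idn Y) \<star> alq h g Y \<star> (idn h \<boxtimes> idn g \<boxtimes> u) \<star> alp h g X \<star> (b \<boxtimes> idn X)"
    if u: "hm u X Y" for u
  proof -
    have o: "X \<in> Obj C" "Y \<in> Obj C" "ar u" "dm u = X" "cd u = Y"
      using u by (auto simp: hm_def)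
    have n: "(idn h \<boxtimes> idn g \<boxtimes> u) \<star> alp h g X = alp h g Y \<star> ((idn h \<boxtimes> idn g) \<boxtimes> u)"
      using alp_nat[of "idn h" "idn g" u] o h go by simp
    have "alq h g Y \<star> (idn h \<boxtimes> idn g \<boxtimes> u) \<star> alp h g X = (alq h g Y \<star> alp h g Y) \<star> ((idn h \<boxtimes> idn g) \<boxtimes> u)"
      by (simp only: n cmp_assoc)
    also have "\<dots> = idn (h \<otimes>\<^sub>o g) \<boxtimes> u"
      using o h go by simp
    finally have "(alq h g Y \<star> (idn h \<boxtimes> idn g \<boxtimes> u) \<star> alp h g X) \<star> (b \<boxtimes> idn X) = b \<boxtimes> u"
      using o i ab h go by (simp add: cmp_tns)
    then have "(a \<boxtimes> idn Y) \<star> alq h g Y \<star> (idn h \<boxtimes> idn g \<boxtimes> u) \<star> alp h g X \<star> (b \<boxtimes> idn X) = (a \<boxtimes> idn Y) \<star> (b \<boxtimes> u)"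
      by (simp add: cmp_assoc)
    also have "\<dots> = idn (UnitO C) \<boxtimes> u"
      using o i ab by (simp add: cmp_tns)
    finally show ?thesis
      by simp
  qed
  have "idn (UnitO C) \<boxtimes> f = (a \<boxtimes> idn Y) \<star> alq h g Y \<star> (idn h \<boxtimes> idn g \<boxtimes> f') \<star> alp h g X \<star> (b \<boxtimes> idn X)"
    by (rule e[OF f(1), unfolded f(3)])
  also have "\<dots> = idn (UnitO C) \<boxtimes> f'"
    by (rule e[OF f(2), symmetric])
  finally have t: "idn (UnitO C) \<boxtimes> f = idn (UnitO C) \<boxtimes> f'" .
  have "ar f" "ar f'" "dm f = dm f'" "cd f = cd f'"
    using f(1,2) by (simp_all add: hm_def)
  then show ?thesis
    using t by (rule faithful_unit_left)
qed

end

section \<open>Invertible objects acting on simple objects\<close>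

context ac_modular_category
begin

text \<open>Tensoring with an inverse \<open>h\<close> maps endomorphisms of
  \<open>g \<otimes>\<^sub>o X\<close> faithfully to those of an object isomorphic to
  \<open>X\<close>, where they are scalars. Semisimplicity then yields simplicity.\<close>

lemma invertible_tens_simple:
  assumes g: "invertible_obj C g" and X: "simple_obj C X"
  shows "simple_obj C (g \<otimes>\<^sub>o X)"
proof -
  have o: "g \<in> Obj C" "X \<in> Obj C"
    using g X invertible_Obj by auto
  obtain h where h: "h \<in> Obj C" "isomorphic C (h \<otimes>\<^sub>o g) (UnitO C)" "isomorphic C (g \<otimes>\<^sub>o h) (UnitO C)"
    using g by (auto simp: invertible_obj_def)
  have hi: "invertible_obj C h"
    unfolding invertible_obj_def using h o(1) by blast
  have 1: "isomorphic C (h \<otimes>\<^sub>o g \<otimes>\<^sub>o X) ((h \<otimes>\<^sub>o g) \<otimes>\<^sub>o X)"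
    by (rule isomorphic_sym[OF _ _ assoc_isomorphic[OF h(1) o]]) (use o h in simp_all)
  have 2: "isomorphic C ((h \<otimes>\<^sub>o g) \<otimes>\<^sub>o X) (UnitO C \<otimes>\<^sub>o X)"
    by (rule tens_isomorphic[OF _ _ _ _ h(2) isomorphic_refl[OF o(2)]]) (use o h in simp_all)
  have 3: "isomorphic C ((h \<otimes>\<^sub>o g) \<otimes>\<^sub>o X) X"
    by (rule isomorphic_trans[OF _ _ _ 2 unit_left_isomorphic[OF o(2)]]) (use o h in simp_all)
  have 4: "isomorphic C (h \<otimes>\<^sub>o g \<otimes>\<^sub>o X) X"
    by (rule isomorphic_trans[OF _ _ _ 1 3]) (use o h in simp_all)
  have "isomorphic C X (h \<otimes>\<^sub>o g \<otimes>\<^sub>o X)"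
    by (rule isomorphic_sym[OF _ _ 4]) (use o h in simp_all)
  then have s: "simple_obj C (h \<otimes>\<^sub>o g \<otimes>\<^sub>o X)"
    by (rule simple_isomorphic[OF X, rotated]) (use o h in simp_all)
  show ?thesis
  proof (rule simple_of_scalar_endos)
    show gX: "g \<otimes>\<^sub>o X \<in> Obj C"
      using o by simp
    show "idn (g \<otimes>\<^sub>o X) \<noteq> zr (g \<otimes>\<^sub>o X) (g \<otimes>\<^sub>o X)"
    proof
      assume "idn (g \<otimes>\<^sub>o X) = zr (g \<otimes>\<^sub>o X) (g \<otimes>\<^sub>o X)"
      then have "idn h \<boxtimes> idn (g \<otimes>\<^sub>o X) = sc 0 (idn h \<boxtimes> idn (g \<otimes>\<^sub>o X))"
        using sc_0[of "idn (g \<otimes>\<^sub>o X)"] gX tns_sc[of "idn h" 0 "idn (g \<otimes>\<^sub>o X)"] by simp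
      then show False
        using simple_nz[OF s] sc_0[of "idn (h \<otimes>\<^sub>o g \<otimes>\<^sub>o X)"] o h by simp
    qed
    fix f assume f: "hm f (g \<otimes>\<^sub>o X) (g \<otimes>\<^sub>o X)"
    have "hm (idn h \<boxtimes> f) (h \<otimes>\<^sub>o g \<otimes>\<^sub>o X) (h \<otimes>\<^sub>o g \<otimes>\<^sub>o X)"
      using f h by (simp add: hm_def)
    then obtain c where "idn h \<boxtimes> f = sc c (idn (h \<otimes>\<^sub>o g \<otimes>\<^sub>o X))"
      using Schur_scalar[OF s] by blast
    then have "idn h \<boxtimes> f = idn h \<boxtimes> sc c (idn (g \<otimes>\<^sub>o X))"
      using h o by (simp add: tns_sc)
    then show "\<exists>c. f = sc c (idn (g \<otimes>\<^sub>o X))"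
      using tens_idn_faithful[OF hi f] hm_sc gX by (metis hm_idn)
  qed
qed

lemma invertible_simple: "invertible_obj C g \<Longrightarrow> simple_obj C g"
  using invertible_tens_simple[of g "UnitO C"] simple_isomorphic[OF _ _ unit_right_isomorphic] invertible_Obj by auto

text \<open>
  If \<open>Y \<otimes> Y'\<close> is a multiple of the unit object, then maps \<open>e : 1 \<rightarrow> Y \<otimes> Y'\<close> and \<open>r : Y' \<otimes> Y \<rightarrow> 1\<close>
  compose to scalars on \<open>Y\<close> and on \<open>Y'\<close>.  Sliding \<open>r\<close> between two independent maps \<open>e\<close> shows that
  these scalars vanish, although they sum up to the identity.
\<close>

lemma unit_multiple_bound:
  assumes Y: "simple_obj C Y" "simple_obj C Y'" and d: "dsum (Y \<otimes>\<^sub>o Y') (replicate m (UnitO C)) i p"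
  shows "m \<le> 1"
proof (rule ccontr)
  assume "\<not> m \<le> 1"
  then have m: "0 < m" "1 < m"
    by simp_all
  let ?I = "UnitO C"
  have o [simp]: "Y \<in> Obj C" "Y' \<in> Obj C"
    using Y by simp_all
  have D: "hm (i a) ?I (Y \<otimes>\<^sub>o Y')" "hm (p a) (Y \<otimes>\<^sub>o Y') ?I" if "a < m" for a
    using dsumD(4,5)[OF d, of a] that by simp_all
  have pi: "p a \<star> i b = (if a = b then idn ?I else zr ?I ?I)" if "a < m" "b < m" for a b
    using dsumD(6)[OF d, of a b] that by simp
  define e where "e a = nu Y Y' \<diamond> emb (i a) \<diamond> ui" for a
  define q where "q a = uo \<diamond> emb (p a) \<diamond> mu Y Y'" for a
  have e [simp]: "sar (e a)" "dm (e a) = []" "cd (e a) = [Y, Y']" and q [simp]: "sar (q a)" "dm (q a) = [Y, Y']" "cd (q a) = []"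
    if "a < m" for a
    using D[OF that] by (simp_all add: e_def q_def hm_def)
  have qe: "q a \<diamond> e b = (if a = b then sid [] else smul 0 (sid []))" if "a < m" "b < m" for a b
  proof -
    have "q a \<diamond> e b = uo \<diamond> emb (p a \<star> i b) \<diamond> ui"
      using D[OF that(1)] D[OF that(2)] by (simp add: q_def e_def emb_cmp cp_assoc hm_def)
    moreover have "zr ?I ?I = sc 0 (idn ?I)"
      by (simp add: sc_0)
    ultimately show ?thesis
      using pi[OF that] by (simp add: emb_sc smul_cp cp_smul)
  qed
  have key: "wh [Y] r [] \<diamond> wh [] (e 0) [Y] = smul 0 (sid [Y])" if r: "sar r" "dm r = [Y', Y]" "cd r = []" for r
  proof -
    let ?F = "wh [Y] r [] \<diamond> wh [] (e 0) [Y]" and ?G = "wh [] r [Y'] \<diamond> wh [Y'] (e 1) []"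
    have F: "?F = smul (sval Y ?F) (sid [Y])"
      by (rule sval_eq[OF Y(1)]) (use r m in auto)
    have G: "?G = smul (sval Y' ?G) (sid [Y'])"
      by (rule sval_eq[OF Y(2)]) (use r m in auto)
    have "wh [] ?F [Y'] \<diamond> e 1 = wh [Y] r [Y'] \<diamond> (wh [] (e 0) [Y, Y'] \<diamond> wh [] (e 1) [])"
      using m by (simp add: cp_assoc)
    also have "wh [] (e 0) [Y, Y'] \<diamond> wh [] (e 1) [] = wh [Y, Y'] (e 1) [] \<diamond> e 0"
      using exchange[of "e 0" "e 1" "[]" "[]" "[]"] m by simp
    also have "wh [Y] r [Y'] \<diamond> wh [Y, Y'] (e 1) [] \<diamond> e 0 = wh [Y] ?G [] \<diamond> e 0"
      by (simp add: cp_assoc)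
    finally have "wh [] (smul (sval Y ?F) (sid [Y])) [Y'] \<diamond> e 1 = wh [Y] (smul (sval Y' ?G) (sid [Y'])) [] \<diamond> e 0"
      using F G by metis
    then have "smul (sval Y ?F) (e 1) = smul (sval Y' ?G) (e 0)"
      using m by (simp add: wh_smul smul_cp)
    then have "q 1 \<diamond> smul (sval Y ?F) (e 1) = q 1 \<diamond> smul (sval Y' ?G) (e 0)"
      by simp
    then have "smul (sval Y ?F) (sid []) = smul 0 (sid [])"
      using qe[of 1 1] qe[of 1 0] m by (simp add: cp_smul)
    then have "sval Y ?F = 0"
      using scal_smul by metis
    then show ?thesis
      using F by simp
  qed
  obtain g where g: "inverses (bd Y' Y) g"
    using bd_inverses[of Y' Y] by auto
  have g': "dm g = Y \<otimes>\<^sub>o Y'" "cd g = Y' \<otimes>\<^sub>o Y" "ar g"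
    using inversesD[OF g] by simp_all
  \<comment> \<open>The braiding transports the decomposition to
    \<open>Y' \<otimes>\<^sub>o Y\<close>. Its identity is inserted between \<open>e 0\<close> and
    \<open>q 0\<close>, which compose to 1; expanded, each term contains a map \<open>r\<close> as
    in \<open>key\<close> and vanishes.\<close>
  note d' = dsum_iso[OF d inverses_sym[OF g] g'(1,2)]
  define \<phi> where "\<phi> h = sval Y (wh [] (q 0) [Y] \<diamond> wh [Y] (nu Y' Y \<diamond> emb h \<diamond> mu Y' Y) [] \<diamond> wh [] (e 0) [Y])" for h
  have "\<phi> (a \<boxplus> b) = \<phi> a + \<phi> b" if "hm a (Y' \<otimes>\<^sub>o Y) (Y' \<otimes>\<^sub>o Y)" "hm b (Y' \<otimes>\<^sub>o Y) (Y' \<otimes>\<^sub>o Y)" for a b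
    unfolding \<phi>_def emb_ad wh_sadd cp_sadd sadd_cp
    by (rule sval_sadd[OF Y(1)]) (use that m in \<open>auto simp: hm_def\<close>)
  from dsum_functional[OF d' this]
  have "\<phi> (idn (Y' \<otimes>\<^sub>o Y)) = (\<Sum>a<m. \<phi> ((g \<star> i a) \<star> p a \<star> bd Y' Y))"
    by simp
  moreover have "\<phi> (idn (Y' \<otimes>\<^sub>o Y)) = 1"
  proof -
    have "wh [] (q 0) [Y] \<diamond> wh [] (e 0) [Y] = wh [] (q 0 \<diamond> e 0) [Y]"
      by simp
    also have "\<dots> = smul 1 (sid [Y])"
      unfolding qe[OF m(1) m(1)] by simp
    finally have "\<phi> (idn (Y' \<otimes>\<^sub>o Y)) = sval Y (smul 1 (sid [Y]))"
      using m by (simp add: \<phi>_def)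
    then show ?thesis
      by (simp only: sval_smul[OF Y(1)])
  qed
  moreover have "\<phi> ((g \<star> i a) \<star> p a \<star> bd Y' Y) = 0" if a: "a < m" for a
  proof -
    let ?r = "uo \<diamond> emb (p a \<star> bd Y' Y) \<diamond> mu Y' Y"
    let ?A = "wh [] (q 0) [Y] \<diamond> wh [Y] (nu Y' Y \<diamond> emb (g \<star> i a) \<diamond> ui) []"
    have h: "ar (g \<star> i a)" "dm (g \<star> i a) = ?I" "cd (g \<star> i a) = Y' \<otimes>\<^sub>o Y"
        "ar (p a \<star> bd Y' Y)" "dm (p a \<star> bd Y' Y) = Y' \<otimes>\<^sub>o Y" "cd (p a \<star> bd Y' Y) = ?I"
      using D[OF a] g' by (auto simp: hm_def)
    have r: "sar ?r" "dm ?r = [Y', Y]" "cd ?r = []"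
      using h by simp_all
    have A: "sar ?A" "dm ?A = [Y]" "cd ?A = [Y]"
      using h m by simp_all
    have "wh [] (q 0) [Y] \<diamond> wh [Y] (nu Y' Y \<diamond> emb ((g \<star> i a) \<star> p a \<star> bd Y' Y) \<diamond> mu Y' Y) [] \<diamond> wh [] (e 0) [Y]
        = ?A \<diamond> (wh [Y] ?r [] \<diamond> wh [] (e 0) [Y])"
      unfolding emb_cmp[of "g \<star> i a"] using h m by (simp del: ar_cmp dm_cmp cd_cmp add: cp_assoc)
    also have "\<dots> = smul 0 ?A"
      unfolding key[OF r] using A by (simp add: cp_smul del: wh_cp)
    also have "\<dots> = smul 0 (smul (sval Y ?A) (sid [Y]))"
      using sval_eq[OF Y(1) A] by metis
    finally show ?thesis
      unfolding \<phi>_def using Y(1) by simp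
  qed
  ultimately show False
    by simp
qed

end

lemma sum_if_mult:
  fixes f :: "nat \<Rightarrow> 'a::comm_semiring_1"
  assumes "i < n"
  shows "(\<Sum>k<n. (if k = i then c else 0) * f k) = c * f i"
proof -
  have "(\<Sum>k<n. (if k = i then c else 0) * f k) = (\<Sum>k<n. if k = i then c * f k else 0)"
    by (intro sum.cong) auto
  then show ?thesis
    using assms by simp
qed

section \<open>Multiplicities of simple objects\<close>

context ac_modular_category
begin

abbreviation L :: "'o list" where "L \<equiv> simples C"

lemma simple_reps_L: "simple_reps C L"
  unfolding simples_def using finitely_many_simples by (rule someI_ex)

lemma L_simple [simp]: "i < length L \<Longrightarrow> simple_obj C (L ! i)"
  using simple_reps_L by (auto simp: simple_reps_def)

lemma L_ex: "simple_obj C X \<Longrightarrow> \<exists>i<length L. isomorphic C X (L ! i)"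
  using simple_reps_L unfolding simple_reps_def by blast

lemma L_inj: "\<lbrakk>i < length L; j < length L; isomorphic C (L ! i) (L ! j)\<rbrakk> \<Longrightarrow> i = j"
  using simple_reps_L isomorphic_refl[of "L ! i"] L_simple[of i] unfolding simple_reps_def by (metis simple_Obj)

lemma L_unique:
  assumes "i < length L" "j < length L" "isomorphic C X (L ! i)" "isomorphic C X (L ! j)" "X \<in> Obj C"
  shows "i = j"
proof (rule L_inj[OF assms(1,2)])
  have o: "L ! i \<in> Obj C" "L ! j \<in> Obj C"
    using assms by auto
  show "isomorphic C (L ! i) (L ! j)"
    by (rule isomorphic_trans[OF o(1) assms(5) o(2) isomorphic_sym[OF assms(5) o(1) assms(3)] assms(4)])
qed

text \<open>Counted in one chosen decomposition. Values are computed later by comparing characters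
  through the invertible table \<open>ct\<close>, rather than by comparing decompositions.\<close>

definition mult :: "'o \<Rightarrow> nat \<Rightarrow> nat" where
  "mult V k = (let Ys = (SOME Ys. (\<forall>Y\<in>set Ys. simple_obj C Y) \<and> direct_sum C V Ys)
     in card {a. a < length Ys \<and> isomorphic C (Ys ! a) (L ! k)})"

lemma mult_dsum:
  assumes "V \<in> Obj C"
  shows "\<exists>Ys i p. dsum V Ys i p \<and> (\<forall>Y\<in>set Ys. simple_obj C Y) \<and>
    (\<forall>k. mult V k = card {a. a < length Ys \<and> isomorphic C (Ys ! a) (L ! k)})"
proof -
  define Ys where "Ys = (SOME Ys. (\<forall>Y\<in>set Ys. simple_obj C Y) \<and> direct_sum C V Ys)"
  have Ys: "(\<forall>Y\<in>set Ys. simple_obj C Y) \<and> direct_sum C V Ys"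
    unfolding Ys_def using semisimple[OF assms] by (rule someI_ex)
  then obtain i p where "dsum V Ys i p"
    using direct_sum_dsum by blast
  moreover have "mult V k = card {a. a < length Ys \<and> isomorphic C (Ys ! a) (L ! k)}" for k
    by (simp add: mult_def Let_def Ys_def)
  ultimately show ?thesis
    using Ys by blast
qed

lemma sum_over_classes:
  fixes \<phi> :: "'o \<Rightarrow> 'k"
  assumes s: "\<And>Y. Y \<in> set Ys \<Longrightarrow> simple_obj C Y"
    and \<phi>: "\<And>X Y. \<lbrakk>simple_obj C X; simple_obj C Y; isomorphic C X Y\<rbrakk> \<Longrightarrow> \<phi> X = \<phi> Y"
  shows "(\<Sum>a<length Ys. \<phi> (Ys ! a)) =
    (\<Sum>k<length L. of_nat (card {a. a < length Ys \<and> isomorphic C (Ys ! a) (L ! k)}) * \<phi> (L ! k))"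
proof -
  obtain \<kappa> where \<kappa>: "\<And>a. a < length Ys \<Longrightarrow> \<kappa> a < length L \<and> isomorphic C (Ys ! a) (L ! \<kappa> a)"
  proof -
    have "\<forall>a. \<exists>i. a < length Ys \<longrightarrow> i < length L \<and> isomorphic C (Ys ! a) (L ! i)"
      using L_ex s nth_mem by blast
    then show ?thesis
      using that by metis
  qed
  have e: "{a \<in> {..<length Ys}. \<kappa> a = k} = {a. a < length Ys \<and> isomorphic C (Ys ! a) (L ! k)}" if "k < length L" for k
  proof -
    have "\<kappa> a = k \<longleftrightarrow> isomorphic C (Ys ! a) (L ! k)" if a: "a < length Ys" for a
      using \<kappa>[OF a] L_unique[of "\<kappa> a" k "Ys ! a"] s[of "Ys ! a"] a \<open>k < length L\<close> by auto
    then show ?thesis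
      by auto
  qed
  have "(\<Sum>a<length Ys. \<phi> (Ys ! a)) = (\<Sum>k<length L. \<Sum>a\<in>{a \<in> {..<length Ys}. \<kappa> a = k}. \<phi> (Ys ! a))"
    using \<kappa> by (intro sum.group[symmetric]) auto
  also have "\<dots> = (\<Sum>k<length L. of_nat (card {a. a < length Ys \<and> isomorphic C (Ys ! a) (L ! k)}) * \<phi> (L ! k))"
  proof (rule sum.cong[OF refl])
    fix k assume "k \<in> {..<length L}"
    then have k: "k < length L"
      by simp
    have "(\<Sum>a\<in>{a \<in> {..<length Ys}. \<kappa> a = k}. \<phi> (Ys ! a)) = (\<Sum>a\<in>{a \<in> {..<length Ys}. \<kappa> a = k}. \<phi> (L ! k))"
      using \<kappa> k s \<phi> by (intro sum.cong[OF refl]) auto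
    then show "(\<Sum>a\<in>{a \<in> {..<length Ys}. \<kappa> a = k}. \<phi> (Ys ! a)) = of_nat (card {a. a < length Ys \<and> isomorphic C (Ys ! a) (L ! k)}) * \<phi> (L ! k)"
      unfolding e[OF k] by simp
  qed
  finally show ?thesis .
qed

lemma chi_mult:
  assumes "simple_obj C X" "V \<in> Obj C"
  shows "chi X V = (\<Sum>k<length L. of_nat (mult V k) * chi X (L ! k))"
proof -
  obtain Ys i p where Ys: "dsum V Ys i p" "\<And>Y. Y \<in> set Ys \<Longrightarrow> simple_obj C Y"
    "\<And>k. mult V k = card {a. a < length Ys \<and> isomorphic C (Ys ! a) (L ! k)}"
    using mult_dsum[OF assms(2)] by blast
  show ?thesis
    unfolding chi_dsum[OF assms(1) Ys(1)] Ys(3) using Ys(2) chi_isomorphic[OF assms(1)]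
    by (intro sum_over_classes) auto
qed

lemma mult_subobject:
  assumes "V \<in> Obj C" "k < length L" "mult V k \<noteq> 0"
  obtains f where "mono f" "dm f = L ! k" "cd f = V"
proof -
  obtain Ys i p where Ys: "dsum V Ys i p" "\<And>Y. Y \<in> set Ys \<Longrightarrow> simple_obj C Y"
    "\<And>k. mult V k = card {a. a < length Ys \<and> isomorphic C (Ys ! a) (L ! k)}"
    using mult_dsum[OF assms(1)] by blast
  then have "card {a. a < length Ys \<and> isomorphic C (Ys ! a) (L ! k)} \<noteq> 0"
    using assms(3) by simp
  then have "{a. a < length Ys \<and> isomorphic C (Ys ! a) (L ! k)} \<noteq> {}"
    by (rule contrapos_nn) (simp only: card.empty)
  then obtain a where a: "a < length Ys" "isomorphic C (Ys ! a) (L ! k)"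
    by blast
  note D = dsumD[OF Ys(1)]
  have h: "hm (i a) (Ys ! a) V" "hm (p a) V (Ys ! a)" "p a \<star> i a = idn (Ys ! a)"
    using D(4)[OF a(1)] D(5)[OF a(1)] D(6)[OF a(1) a(1)] by simp_all
  obtain f g where fg: "inverses f g" "dm f = Ys ! a" "cd f = L ! k"
    using isomorphicE[OF a(2)] D(3)[OF a(1)] assms(2) by auto
  have "mono (i a)"
    using h by (intro split_mono[of "i a" "p a"]) (auto simp: hm_def)
  then have "mono (i a \<star> g)"
    using fg h inverses_mono[OF inverses_sym[OF fg(1)]] inversesD[OF fg(1)] by (intro mono_cmp) (auto simp: hm_def)
  then show ?thesis
    using that[of "i a \<star> g"] fg h inversesD[OF fg(1)] by (simp add: hm_def)
qed


subsection \<open>Invertibility of the character table\<close>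

abbreviation ct :: "nat \<Rightarrow> nat \<Rightarrow> 'k" where "ct i j \<equiv> chi (L ! i) (L ! j)"

lemma S_matrix_entry: "\<lbrakk>i < length L; j < length L\<rbrakk> \<Longrightarrow> S_matrix C $$ (i, j) = ct i j * dd (L ! i)"
  unfolding S_matrix_def using trace_double_braiding[of "L ! i" "L ! j"] by (simp add: Let_def)

lemma S_inverse: "\<exists>B. (\<forall>i<length L. \<forall>k<length L. (\<Sum>j<length L. ct i j * dd (L ! i) * B j k) = (if i = k then 1 else 0)) \<and>
    (\<forall>i<length L. \<forall>k<length L. (\<Sum>j<length L. B i j * (ct j k * dd (L ! j))) = (if i = k then 1 else 0))"
proof -
  let ?n = "length L"
  have S: "S_matrix C \<in> carrier_mat ?n ?n"
    by (simp add: S_matrix_def)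
  obtain B where "inverts_mat (S_matrix C) B" "inverts_mat B (S_matrix C)"
    using S_matrix_invertible unfolding invertible_mat_def by blast
  then have B: "S_matrix C * B = 1\<^sub>m ?n" "B * S_matrix C = 1\<^sub>m (dim_row B)"
    using carrier_matD(1)[OF S] unfolding inverts_mat_def by simp_all
  have "dim_col (S_matrix C * B) = ?n" "dim_col (B * S_matrix C) = dim_row B"
    unfolding B by simp_all
  then have Bc: "B \<in> carrier_mat ?n ?n"
    using carrier_matD(2)[OF S] by (intro carrier_matI) simp_all
  have 1: "(\<Sum>j<?n. ct i j * dd (L ! i) * B $$ (j, k)) = (if i = k then 1 else 0)" if "i < ?n" "k < ?n" for i k
  proof -
    have "(S_matrix C * B) $$ (i, k) = (\<Sum>j<?n. S_matrix C $$ (i, j) * B $$ (j, k))"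
      using S Bc that by (auto simp: scalar_prod_def atLeast0LessThan intro!: sum.cong)
    then show ?thesis
      using that B(1) S_matrix_entry by simp
  qed
  have 2: "(\<Sum>j<?n. B $$ (i, j) * (ct j k * dd (L ! j))) = (if i = k then 1 else 0)" if "i < ?n" "k < ?n" for i k
  proof -
    have "(B * S_matrix C) $$ (i, k) = (\<Sum>j<?n. B $$ (i, j) * S_matrix C $$ (j, k))"
      using S Bc that by (auto simp: scalar_prod_def atLeast0LessThan intro!: sum.cong)
    then show ?thesis
      using that B(2) Bc S_matrix_entry by simp
  qed
  show ?thesis
    using 1 2 by (intro exI[of _ "\<lambda>i j. B $$ (i, j)"] conjI allI impI) blast+
qed

text \<open>A vanishing dimension would give the S-matrix a zero row.\<close>

lemma dd_nonzero_L: "i < length L \<Longrightarrow> dd (L ! i) \<noteq> 0"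
proof
  assume i: "i < length L" "dd (L ! i) = 0"
  obtain B where "\<forall>i<length L. \<forall>k<length L. (\<Sum>j<length L. ct i j * dd (L ! i) * B j k) = (if i = k then 1 else 0)"
    using S_inverse by blast
  then have "(\<Sum>j<length L. ct i j * dd (L ! i) * B j i) = 1"
    using i(1) by simp
  then show False
    using i by simp
qed

lemma dd_nonzero: "simple_obj C X \<Longrightarrow> dd X \<noteq> 0"
proof -
  assume X: "simple_obj C X"
  then obtain i where "i < length L" "isomorphic C X (L ! i)"
    using L_ex by blast
  then show ?thesis
    using dd_isomorphic[of X "L ! i"] dd_nonzero_L[of i] X by simp
qed

text \<open>The S-matrix is \<open>ct\<close> with rows scaled by the nonzero dimensions, so the
  inverse of \<open>ct\<close> is that of the S-matrix with columns scaled by them.\<close>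

lemma ct_inverse: "\<exists>M. (\<forall>i<length L. \<forall>k<length L. (\<Sum>j<length L. ct i j * M j k) = (if i = k then 1 else 0)) \<and>
    (\<forall>i<length L. \<forall>k<length L. (\<Sum>j<length L. M i j * ct j k) = (if i = k then 1 else 0))"
proof -
  obtain B where "(\<forall>i<length L. \<forall>k<length L. (\<Sum>j<length L. ct i j * dd (L ! i) * B j k) = (if i = k then 1 else 0)) \<and>
      (\<forall>i<length L. \<forall>k<length L. (\<Sum>j<length L. B i j * (ct j k * dd (L ! j))) = (if i = k then 1 else 0))"
    using S_inverse by blast
  then have B: "\<And>i k. \<lbrakk>i < length L; k < length L\<rbrakk> \<Longrightarrow> (\<Sum>j<length L. ct i j * dd (L ! i) * B j k) = (if i = k then 1 else 0)"
    "\<And>i k. \<lbrakk>i < length L; k < length L\<rbrakk> \<Longrightarrow> (\<Sum>j<length L. B i j * (ct j k * dd (L ! j))) = (if i = k then 1 else 0)"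
    by blast+
  have 1: "(\<Sum>j<length L. ct i j * (B j k * dd (L ! k))) = (if i = k then 1 else 0)" if "i < length L" "k < length L" for i k
  proof -
    have "dd (L ! i) * (\<Sum>j<length L. ct i j * (B j k * dd (L ! k))) = dd (L ! k) * (\<Sum>j<length L. ct i j * dd (L ! i) * B j k)"
      by (simp add: sum_distrib_left mult_ac)
    then show ?thesis
      using B(1)[OF that] dd_nonzero_L[OF that(1)] by (auto split: if_splits)
  qed
  have 2: "(\<Sum>j<length L. (B i j * dd (L ! j)) * ct j k) = (if i = k then 1 else 0)" if "i < length L" "k < length L" for i k
    using B(2)[OF that] by (simp add: mult_ac)
  show ?thesis
    using 1 2 by (intro exI[of _ "\<lambda>j k. B j k * dd (L ! k)"] conjI allI impI) blast+
qed

text \<open>Characters separate the elements of the fusion ring with extended scalars: multiply by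
  the inverse table.\<close>

lemma ct_row_inj:
  assumes "\<And>i. i < length L \<Longrightarrow> (\<Sum>k<length L. v k * ct i k) = 0" "k < length L"
  shows "v k = 0"
proof -
  obtain M where "\<forall>i<length L. \<forall>k<length L. (\<Sum>j<length L. M i j * ct j k) = (if i = k then 1 else 0)"
    using ct_inverse by blast
  then have M: "\<And>i k. \<lbrakk>i < length L; k < length L\<rbrakk> \<Longrightarrow> (\<Sum>j<length L. M i j * ct j k) = (if i = k then 1 else 0)"
    by blast
  have "v k = (\<Sum>l<length L. v l * (if k = l then 1 else 0))"
    using assms(2) by (simp add: if_distrib cong: if_cong)
  also have "\<dots> = (\<Sum>l<length L. v l * (\<Sum>j<length L. M k j * ct j l))"
    using M assms(2) by (intro sum.cong) auto
  also have "\<dots> = (\<Sum>l<length L. \<Sum>j<length L. M k j * (v l * ct j l))"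
    by (simp add: sum_distrib_left mult_ac)
  also have "\<dots> = (\<Sum>j<length L. \<Sum>l<length L. M k j * (v l * ct j l))"
    by (rule sum.swap)
  also have "\<dots> = (\<Sum>j<length L. M k j * (\<Sum>l<length L. v l * ct j l))"
    by (simp add: sum_distrib_left)
  also have "\<dots> = 0"
    using assms(1) by simp
  finally show ?thesis .
qed

text \<open>The dual statement: the characters \<open>chi (L ! i)\<close> are linearly
  independent.\<close>

lemma ct_col_inj:
  assumes "\<And>k. k < length L \<Longrightarrow> (\<Sum>i<length L. w i * ct i k) = 0" "i < length L"
  shows "w i = 0"
proof -
  obtain M where "\<forall>i<length L. \<forall>k<length L. (\<Sum>j<length L. ct i j * M j k) = (if i = k then 1 else 0)"
    using ct_inverse by blast
  then have M: "\<And>i k. \<lbrakk>i < length L; k < length L\<rbrakk> \<Longrightarrow> (\<Sum>j<length L. ct i j * M j k) = (if i = k then 1 else 0)"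
    by blast
  have "w i = (\<Sum>l<length L. w l * (if l = i then 1 else 0))"
    using assms(2) by (simp add: if_distrib cong: if_cong)
  also have "\<dots> = (\<Sum>l<length L. w l * (\<Sum>j<length L. ct l j * M j i))"
    using M assms(2) by (intro sum.cong) auto
  also have "\<dots> = (\<Sum>l<length L. \<Sum>j<length L. M j i * (w l * ct l j))"
    by (simp add: sum_distrib_left mult_ac)
  also have "\<dots> = (\<Sum>j<length L. \<Sum>l<length L. M j i * (w l * ct l j))"
    by (rule sum.swap)
  also have "\<dots> = (\<Sum>j<length L. M j i * (\<Sum>l<length L. w l * ct l j))"
    by (simp add: sum_distrib_left)
  also have "\<dots> = 0"
    using assms(1) by simp
  finally show ?thesis .
qed

lemma ct_row_eqI:
  assumes "\<And>i. i < length L \<Longrightarrow> (\<Sum>k<length L. v k * ct i k) = (\<Sum>k<length L. w k * ct i k)" "k < length L"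
  shows "v k = w k"
  using ct_row_inj[of "\<lambda>k. v k - w k" k] assms by (simp add: left_diff_distrib sum_subtractf)

text \<open>All characters agree on \<open>X\<close> and \<open>L ! i\<close>, which determines the
  multiplicities as field elements, hence as natural numbers in characteristic zero.\<close>

lemma mult_simple:
  assumes "simple_obj C X" "i < length L" "isomorphic C X (L ! i)" "k < length L"
  shows "mult X k = (if k = i then 1 else 0)"
proof -
  have "(of_nat (mult X k) :: 'k) = (if k = i then 1 else 0)"
  proof (rule ct_row_eqI[OF _ assms(4)])
    fix j assume j: "j < length L"
    have "(\<Sum>k<length L. of_nat (mult X k) * ct j k) = ct j i"
      using chi_mult[of "L ! j" X] chi_isomorphic[of "L ! j" X "L ! i"] j assms by simp
    then show "(\<Sum>k<length L. of_nat (mult X k) * ct j k) = (\<Sum>k<length L. (if k = i then 1 else 0) * ct j k)"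
      using assms(2) by (simp add: sum_if_mult)
  qed
  then show ?thesis
    by (auto split: if_splits)
qed

text \<open>The symmetry \<open>chi_sym\<close> moves \<open>X\<close> into the second argument,
  where invariance is known; nonzero dimensions can be divided out.\<close>

lemma chi_isomorphic_left:
  assumes X: "simple_obj C X" "simple_obj C X'" "isomorphic C X X'" and V: "V \<in> Obj C"
  shows "chi X V = chi X' V"
proof -
  have "chi X Y = chi X' Y" if Y: "simple_obj C Y" for Y
  proof -
    have "chi X Y * dd X = chi X' Y * dd X'"
      using chi_sym[OF X(1) Y] chi_sym[OF X(2) Y] chi_isomorphic[OF Y] X by simp
    then show ?thesis
      using dd_isomorphic[of X X'] dd_nonzero[OF X(1)] X by simp
  qed
  then show ?thesis
    using chi_mult[OF X(1) V] chi_mult[OF X(2) V] by simp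
qed

text \<open>The value is idempotent because the unit tensored with itself is the unit. If it were 0,
  multiplicativity would make a whole row of the invertible table vanish.\<close>

lemma chi_unit:
  assumes X: "simple_obj C X"
  shows "chi X (UnitO C) = 1"
proof -
  let ?I = "UnitO C"
  have "chi X ?I * chi X ?I = chi X ?I"
    using chi_tens[OF X, of ?I ?I] chi_isomorphic[OF X _ _ unit_left_isomorphic[of ?I]] by simp
  moreover have "chi X ?I \<noteq> 0"
  proof
    assume z: "chi X ?I = 0"
    have zero: "chi X V = 0" if "V \<in> Obj C" for V
      using chi_tens[OF X, of ?I V] chi_isomorphic[OF X _ _ unit_left_isomorphic[OF that]] z that by simp
    obtain i where i: "i < length L" "isomorphic C X (L ! i)"
      using L_ex[OF X] by blast
    have "ct i j = 0" if "j < length L" for j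
      using chi_isomorphic_left[OF X L_simple[OF i(1)] i(2), of "L ! j"] zero[of "L ! j"] that by simp
    moreover obtain M where "\<forall>i<length L. \<forall>k<length L. (\<Sum>j<length L. ct i j * M j k) = (if i = k then 1 else 0)"
      using ct_inverse by blast
    then have "(\<Sum>j<length L. ct i j * M j i) = 1"
      using i(1) by simp
    ultimately show False
      by simp
  qed
  ultimately show ?thesis
    by simp
qed

lemma chi_from_unit: "simple_obj C Z \<Longrightarrow> chi (UnitO C) Z * dd (UnitO C) = dd Z"
  using chi_sym[of "UnitO C" Z] chi_unit[of Z] by simp

text \<open>Expand \<open>\<psi>\<close> in the rows of the table with coordinates
  \<open>c j\<close>. Multiplicativity and linear independence of the rows give
  \<open>c j * (ct j i - \<psi> i) = 0\<close>, so any row with nonzero coordinate equals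
  \<open>\<psi>\<close>.\<close>

lemma character_is_chi:
  assumes m: "\<And>i j. \<lbrakk>i < length L; j < length L\<rbrakk> \<Longrightarrow> \<psi> i * \<psi> j = (\<Sum>k<length L. of_nat (mult (L ! i \<otimes>\<^sub>o L ! j) k) * \<psi> k)"
    and nz: "l < length L" "\<psi> l \<noteq> 0"
  shows "\<exists>j<length L. \<forall>i<length L. \<psi> i = ct j i"
proof -
  obtain M where "\<forall>i<length L. \<forall>k<length L. (\<Sum>j<length L. M i j * ct j k) = (if i = k then 1 else 0)"
    using ct_inverse by blast
  then have M: "\<And>i k. \<lbrakk>i < length L; k < length L\<rbrakk> \<Longrightarrow> (\<Sum>j<length L. M i j * ct j k) = (if i = k then 1 else 0)"
    by blast
  define c where "c j = (\<Sum>k<length L. \<psi> k * M k j)" for j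
  have c: "\<psi> i = (\<Sum>j<length L. c j * ct j i)" if i: "i < length L" for i
  proof -
    have "\<psi> i = (\<Sum>k<length L. \<psi> k * (if k = i then 1 else 0))"
      using i by (simp add: if_distrib cong: if_cong)
    also have "\<dots> = (\<Sum>k<length L. \<psi> k * (\<Sum>j<length L. M k j * ct j i))"
      using M i by (intro sum.cong) auto
    also have "\<dots> = (\<Sum>k<length L. \<Sum>j<length L. \<psi> k * M k j * ct j i)"
      by (simp add: sum_distrib_left mult_ac)
    also have "\<dots> = (\<Sum>j<length L. \<Sum>k<length L. \<psi> k * M k j * ct j i)"
      by (rule sum.swap)
    finally show ?thesis
      by (simp add: c_def sum_distrib_right)
  qed
  have z: "c j * (ct j i - \<psi> i) = 0" if i: "i < length L" and j: "j < length L" for i j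
  proof (rule ct_col_inj[OF _ j])
    fix k assume k: "k < length L"
    have "(\<Sum>j<length L. c j * ct j i * ct j k) = (\<Sum>j<length L. c j * (\<Sum>l<length L. of_nat (mult (L ! i \<otimes>\<^sub>o L ! k) l) * ct j l))"
      using chi_mult[of _ "L ! i \<otimes>\<^sub>o L ! k"] chi_tens i k by (intro sum.cong) (auto simp: mult_ac)
    also have "\<dots> = (\<Sum>j<length L. \<Sum>l<length L. of_nat (mult (L ! i \<otimes>\<^sub>o L ! k) l) * (c j * ct j l))"
      by (simp add: sum_distrib_left mult_ac)
    also have "\<dots> = (\<Sum>l<length L. \<Sum>j<length L. of_nat (mult (L ! i \<otimes>\<^sub>o L ! k) l) * (c j * ct j l))"
      by (rule sum.swap)
    also have "\<dots> = (\<Sum>l<length L. of_nat (mult (L ! i \<otimes>\<^sub>o L ! k) l) * \<psi> l)"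
      using c by (simp add: sum_distrib_left)
    also have "\<dots> = \<psi> i * (\<Sum>j<length L. c j * ct j k)"
      using m[OF i k] c[OF k] by simp
    finally have "(\<Sum>j<length L. c j * ct j i * ct j k) = (\<Sum>j<length L. \<psi> i * (c j * ct j k))"
      by (simp add: sum_distrib_left)
    then show "(\<Sum>j<length L. c j * (ct j i - \<psi> i) * ct j k) = 0"
      by (simp add: algebra_simps sum_subtractf)
  qed
  have "\<exists>j<length L. c j \<noteq> 0"
  proof (rule ccontr)
    assume "\<not> (\<exists>j<length L. c j \<noteq> 0)"
    then show False
      using c[OF nz(1)] nz(2) by simp
  qed
  then obtain j where j: "j < length L" "c j \<noteq> 0"
    by blast
  then show ?thesis
    using z[OF _ j(1)] by (intro exI[of _ j]) auto
qed

lemma chi_dual_mult: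
  assumes "simple_obj C Y" "V \<in> Obj C"
  shows "chi Y (V\<^bold>*) = (\<Sum>k<length L. of_nat (mult V k) * chi Y ((L ! k)\<^bold>*))"
proof -
  obtain Ys i p where Ys: "dsum V Ys i p" "\<And>Y. Y \<in> set Ys \<Longrightarrow> simple_obj C Y"
    "\<And>k. mult V k = card {a. a < length Ys \<and> isomorphic C (Ys ! a) (L ! k)}"
    using mult_dsum[OF assms(2)] by blast
  have "chi Y (V\<^bold>*) = (\<Sum>a<length Ys. chi Y ((Ys ! a)\<^bold>*))"
    using chi_dsum[OF assms(1) dual_dsum[OF Ys(1)]] by simp
  also have "\<dots> = (\<Sum>k<length L. of_nat (mult V k) * chi Y ((L ! k)\<^bold>*))"
    unfolding Ys(3) using Ys(2) chi_isomorphic[OF assms(1)] dual_isomorphic by (intro sum_over_classes) auto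
  finally show ?thesis .
qed

lemma double_dual_isomorphic: "X \<in> Obj C \<Longrightarrow> isomorphic C X (X\<^bold>*\<^bold>*)"
  using Piv_iso[of X] by (auto simp: isomorphic_def)

text \<open>Dualizing a decomposition of the dual of \<open>Z\<close> decomposes its double dual,
  which is simple; hence there was a single summand.\<close>

lemma simple_dual:
  assumes Z: "simple_obj C Z"
  shows "simple_obj C (Z\<^bold>*)"
proof -
  have Zo: "Z \<in> Obj C"
    using Z by simp
  obtain Ys i p where Ys: "dsum (Z\<^bold>*) Ys i p" "\<And>Y. Y \<in> set Ys \<Longrightarrow> simple_obj C Y"
    using semisimple_dsum[of "Z\<^bold>*"] Zo by auto
  have dd: "simple_obj C (X\<^bold>*\<^bold>*)" if "simple_obj C X" for X
    using simple_isomorphic[OF that _ double_dual_isomorphic] that by simp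
  have nz: "idn (S\<^bold>*) \<noteq> zr (S\<^bold>*) (S\<^bold>*)" if S: "simple_obj C S" for S
  proof
    assume "idn (S\<^bold>*) = zr (S\<^bold>*) (S\<^bold>*)"
    then have "dua (idn (S\<^bold>*)) = dua (zr (S\<^bold>*) (S\<^bold>*))"
      by simp
    then show False
      using simple_nz[OF dd[OF S]] S by (simp add: dua_idn dua_zr)
  qed
  have "length (map (Dual C) Ys) = 1"
    using Ys(2) nz by (intro simple_dsum(1)[OF dd[OF Z] dual_dsum[OF Ys(1)]]) auto
  then obtain S where S: "Ys = [S]"
    by (cases Ys) auto
  then show ?thesis
    using simple_isomorphic[of S "Z\<^bold>*"] Ys(2)[of S] Zo dsum_single_isomorphic[of "Z\<^bold>*" S i p] Ys(1)
      isomorphic_sym[of "Z\<^bold>*" S] by simp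
qed

text \<open>Duality reverses tensor products, which scalars do not notice, so evaluating
  \<open>chi Y\<close> on duals is again a character and occurs as a row. The object
  \<open>L ! j\<close> serves as a dual of \<open>Y\<close>.\<close>

lemma chi_dual:
  assumes Y: "simple_obj C Y"
  obtains j where "j < length L" "\<And>V. V \<in> Obj C \<Longrightarrow> chi (L ! j) V = chi Y (V\<^bold>*)"
proof -
  let ?\<psi> = "\<lambda>k. chi Y ((L ! k)\<^bold>*)"
  have m: "?\<psi> i * ?\<psi> j = (\<Sum>k<length L. of_nat (mult (L ! i \<otimes>\<^sub>o L ! j) k) * ?\<psi> k)" if "i < length L" "j < length L" for i j
  proof -
    have o: "L ! i \<in> Obj C" "L ! j \<in> Obj C"
      using that by auto
    have "?\<psi> i * ?\<psi> j = chi Y ((L ! j)\<^bold>* \<otimes>\<^sub>o (L ! i)\<^bold>*)"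
      using chi_tens[OF Y] o by (simp add: mult.commute)
    also have "\<dots> = chi Y ((L ! i \<otimes>\<^sub>o L ! j)\<^bold>*)"
      using chi_isomorphic[OF Y _ _ dual_tens_isomorphic[OF o]] o by simp
    also have "\<dots> = (\<Sum>k<length L. of_nat (mult (L ! i \<otimes>\<^sub>o L ! j) k) * ?\<psi> k)"
      by (rule chi_dual_mult[OF Y]) (use o in simp)
    finally show ?thesis .
  qed
  \<comment> \<open>To find a nonzero value, expand at the dual of the unit: the sum is the value at
    the double dual of the unit, which is 1.\<close>
  have "chi Y ((UnitO C)\<^bold>*\<^bold>*) = 1"
    using chi_isomorphic[OF Y _ _ double_dual_isomorphic[OF UnitO_Obj]] chi_unit[OF Y] by simp
  then have s: "(\<Sum>k<length L. of_nat (mult ((UnitO C)\<^bold>*) k) * ?\<psi> k) = 1"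
    using chi_dual_mult[OF Y, of "(UnitO C)\<^bold>*"] by simp
  have "\<exists>l<length L. ?\<psi> l \<noteq> 0"
  proof (rule ccontr)
    assume "\<not> (\<exists>l<length L. ?\<psi> l \<noteq> 0)"
    then have "(\<Sum>k<length L. of_nat (mult ((UnitO C)\<^bold>*) k) * ?\<psi> k) = 0"
      by (intro sum.neutral) auto
    then show False
      using s by simp
  qed
  then obtain l where "l < length L" "?\<psi> l \<noteq> 0"
    by blast
  from character_is_chi[of ?\<psi>, OF m this] obtain j where j: "j < length L" "\<And>i. i < length L \<Longrightarrow> ?\<psi> i = ct j i"
    by blast
  show ?thesis
  proof (rule that[OF j(1)])
    fix V assume V: "V \<in> Obj C"
    show "chi (L ! j) V = chi Y (V\<^bold>*)"
      unfolding chi_mult[OF L_simple[OF j(1)] V] chi_dual_mult[OF Y V] using j(2) by (intro sum.cong) auto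
  qed
qed

text \<open>
  The character of \<open>Y\<close> and its dual character multiply to that of the unit object; transposing the
  S-matrix, the product of the corresponding simple objects is a multiple of the unit object.
\<close>

lemma invertible_of_chi_eq:
  assumes Y: "simple_obj C Y"
    and eq: "\<And>Z. simple_obj C Z \<Longrightarrow> chi Y (Z \<otimes>\<^sub>o Z\<^bold>*) = chi (UnitO C) (Z \<otimes>\<^sub>o Z\<^bold>*)"
  shows "invertible_obj C Y"
proof -
  let ?I = "UnitO C"
  obtain j where j: "j < length L" "\<And>V. V \<in> Obj C \<Longrightarrow> chi (L ! j) V = chi Y (V\<^bold>*)"
    using chi_dual[OF Y] by blast
  let ?Y' = "L ! j"
  have Y': "simple_obj C ?Y'"
    using j by simp
  have o: "Y \<in> Obj C" "?Y' \<in> Obj C" "Y \<otimes>\<^sub>o ?Y' \<in> Obj C"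
    using Y Y' by auto
  obtain u where u: "u < length L" "isomorphic C ?I (L ! u)"
    using L_ex[OF unit_simple] by blast
  \<comment> \<open>The common value of all characters on \<open>Y \<otimes>\<^sub>o ?Y'\<close>.
    Transposing both factors contributes \<open>dd Y * dd ?Y'\<close> over the square of
    \<open>dd Z\<close>, while the product for the unit character is that square over the square of
    \<open>dd ?I\<close>; sphericity equates the dimensions of \<open>Z\<close> and its dual. The
    value 1 of \<open>dd ?I\<close> is computed only later.\<close>
  let ?\<mu> = "dd Y * dd ?Y' / (dd ?I * dd ?I)"
  have c: "chi Z (Y \<otimes>\<^sub>o ?Y') = ?\<mu>" if Z: "simple_obj C Z" for Z
  proof -
    have Zo: "Z \<in> Obj C"
      using Z by simp
    have dz: "dd Z \<noteq> 0" "dd ?I \<noteq> 0"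
      using dd_nonzero Z by auto
    have "chi Y Z * chi ?Y' Z = chi Y (Z \<otimes>\<^sub>o Z\<^bold>*)"
      using j(2)[OF Zo] chi_tens[OF Y Zo] Zo by simp
    also have "\<dots> = chi ?I Z * chi ?I (Z\<^bold>*)"
      using eq[OF Z] chi_tens[OF unit_simple Zo] Zo by simp
    finally have p: "chi Y Z * chi ?Y' Z = chi ?I Z * chi ?I (Z\<^bold>*)" .
    have "(chi Z Y * dd Z) * (chi Z ?Y' * dd Z) = (chi Y Z * chi ?Y' Z) * (dd Y * dd ?Y')"
      using chi_sym[OF Z Y] chi_sym[OF Z Y'] by simp
    also have "\<dots> * (dd ?I * dd ?I) = (dd Z * dd Z) * (dd Y * dd ?Y')"
      unfolding p using chi_from_unit[OF Z] chi_from_unit[OF simple_dual[OF Z]] dd_dual[OF Zo] by (simp add: algebra_simps)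
    finally show ?thesis
      using dz chi_tens[OF Z o(1,2)] by (simp add: field_simps)
  qed
  have mm: "(of_nat (mult (Y \<otimes>\<^sub>o ?Y') k) :: 'k) = (if k = u then ?\<mu> else 0)" if k: "k < length L" for k
  proof (rule ct_row_eqI[OF _ k])
    fix i assume i: "i < length L"
    have "ct i u = 1"
      using chi_isomorphic[OF L_simple[OF i] _ _ u(2)] chi_unit[OF L_simple[OF i]] u by simp
    then show "(\<Sum>k<length L. of_nat (mult (Y \<otimes>\<^sub>o ?Y') k) * ct i k) = (\<Sum>k<length L. (if k = u then ?\<mu> else 0) * ct i k)"
      using chi_mult[OF L_simple[OF i] o(3)] c[OF L_simple[OF i]] u \<open>ct i u = 1\<close> by (simp add: sum_if_mult)
  qed
  obtain Ys i p where Ys: "dsum (Y \<otimes>\<^sub>o ?Y') Ys i p" "\<And>Z. Z \<in> set Ys \<Longrightarrow> simple_obj C Z"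
    "\<And>k. mult (Y \<otimes>\<^sub>o ?Y') k = card {a. a < length Ys \<and> isomorphic C (Ys ! a) (L ! k)}"
    using mult_dsum[OF o(3)] by blast
  have iso: "isomorphic C (Ys ! a) ?I" if a: "a < length Ys" for a
  proof -
    have sa: "simple_obj C (Ys ! a)"
      using Ys(2) a by simp
    then obtain k where k: "k < length L" "isomorphic C (Ys ! a) (L ! k)"
      using L_ex by blast
    then have "{a. a < length Ys \<and> isomorphic C (Ys ! a) (L ! k)} \<noteq> {}"
      using a by blast
    moreover have "finite {a. a < length Ys \<and> isomorphic C (Ys ! a) (L ! k)}"
      by simp
    ultimately have "mult (Y \<otimes>\<^sub>o ?Y') k \<noteq> 0"
      by (simp only: Ys(3) card_eq_0_iff simp_thms)
    then have "k = u"
      using mm[OF k(1)] by (cases "k = u") simp_all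
    then show ?thesis
      using k u isomorphic_sym[OF _ _ u(2)] isomorphic_trans[of "Ys ! a" "L ! u" ?I] sa by simp
  qed
  have "set (replicate (length Ys) ?I) \<subseteq> Obj C"
    by (simp add: set_replicate_conv_if)
  then have "\<exists>i' p'. dsum (Y \<otimes>\<^sub>o ?Y') (replicate (length Ys) ?I) i' p'"
    using iso by (intro dsum_replace[OF Ys(1)]) simp_all
  then obtain i' p' where d: "dsum (Y \<otimes>\<^sub>o ?Y') (replicate (length Ys) ?I) i' p'"
    by blast
  have "length Ys \<noteq> 0"
  proof
    assume "length Ys = 0"
    then have "mult (Y \<otimes>\<^sub>o ?Y') u = 0"
      unfolding Ys(3) by simp
    then show False
      using mm[OF u(1)] dd_nonzero[OF Y] dd_nonzero[OF Y'] dd_nonzero[OF unit_simple] by simp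
  qed
  then have "length Ys = 1"
    using unit_multiple_bound[OF Y Y' d] by linarith
  then have 1: "isomorphic C (Y \<otimes>\<^sub>o ?Y') ?I"
    using dsum_single_isomorphic[of "Y \<otimes>\<^sub>o ?Y'" ?I i' p'] d by simp
  obtain g where "inverses (bd ?Y' Y) g"
    using bd_inverses o by blast
  then have "isomorphic C (?Y' \<otimes>\<^sub>o Y) (Y \<otimes>\<^sub>o ?Y')"
    by (rule isomorphicI) simp_all
  then have "isomorphic C (?Y' \<otimes>\<^sub>o Y) ?I"
    using isomorphic_trans[OF _ _ _ _ 1] o by simp
  then show ?thesis
    using 1 o unfolding invertible_obj_def by blast
qed

end

context ac_modular_category
begin

subsection \<open>Invertible objects of the adjoint subcategory\<close>

abbreviation Ad :: "'o set" where "Ad \<equiv> adjoint_subcategory C"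

text \<open>
  Elements of the fusion ring with scalars extended to the ground field are coefficient functions on
  the indices of \<open>L\<close>; \<open>fval X a\<close> is the character of \<open>X\<close> at \<open>a\<close>.
\<close>

definition fval :: "'o \<Rightarrow> (nat \<Rightarrow> 'k) \<Rightarrow> 'k" where
  "fval X a = (\<Sum>k<length L. a k * chi X (L ! k))"

definition in_ad :: "(nat \<Rightarrow> 'k) \<Rightarrow> bool" where
  "in_ad a \<longleftrightarrow> (\<forall>k<length L. a k \<noteq> 0 \<longrightarrow> L ! k \<in> Ad)"

lemma mult_in_ad:
  assumes "V \<in> Ad" "k < length L" "mult V k \<noteq> 0"
  shows "L ! k \<in> Ad"
proof -
  have "V \<in> Obj C"
    using assms(1) fusion_subcategoryD(1)[OF fusion_subcategory_adjoint] by blast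
  then obtain f where f: "mono f" "dm f = L ! k" "cd f = V"
    using mult_subobject[OF _ assms(2,3)] by blast
  then show ?thesis
    using fusion_subcategory_mono[OF fusion_subcategory_adjoint f(1)] assms(1) by simp
qed

text \<open>The product in the fusion ring. Its support stays in \<open>Ad\<close>, which is closed
  under tensor products and subobjects, and characters are multiplicative.\<close>

lemma fval_prod:
  assumes "in_ad a" "in_ad b"
  shows "\<exists>c. in_ad c \<and> (\<forall>X. simple_obj C X \<longrightarrow> fval X c = fval X a * fval X b)"
proof -
  define c where "c k = (\<Sum>i<length L. \<Sum>j<length L. a i * b j * of_nat (mult (L ! i \<otimes>\<^sub>o L ! j) k))" for k
  have "in_ad c"
    unfolding in_ad_def
  proof (intro allI impI)
    fix k assume k: "k < length L" "c k \<noteq> 0"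
    then obtain i where i: "i < length L" "(\<Sum>j<length L. a i * b j * of_nat (mult (L ! i \<otimes>\<^sub>o L ! j) k)) \<noteq> 0"
      unfolding c_def by (meson lessThan_iff sum.not_neutral_contains_not_neutral)
    then obtain j where j: "j < length L" "a i * b j * of_nat (mult (L ! i \<otimes>\<^sub>o L ! j) k) \<noteq> 0"
      by (meson lessThan_iff sum.not_neutral_contains_not_neutral)
    then have "a i \<noteq> 0" "b j \<noteq> 0" "mult (L ! i \<otimes>\<^sub>o L ! j) k \<noteq> 0"
      by auto
    moreover from this have "L ! i \<otimes>\<^sub>o L ! j \<in> Ad"
      using assms i(1) j(1) fusion_subcategoryD(3)[OF fusion_subcategory_adjoint] unfolding in_ad_def by blast
    ultimately show "L ! k \<in> Ad"
      using mult_in_ad k(1) by blast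
  qed
  moreover have "fval X c = fval X a * fval X b" if X: "simple_obj C X" for X
  proof -
    have "fval X c = (\<Sum>k<length L. \<Sum>i<length L. \<Sum>j<length L. a i * b j * (of_nat (mult (L ! i \<otimes>\<^sub>o L ! j) k) * chi X (L ! k)))"
      by (simp add: fval_def c_def sum_distrib_right mult.assoc)
    also have "\<dots> = (\<Sum>i<length L. \<Sum>k<length L. \<Sum>j<length L. a i * b j * (of_nat (mult (L ! i \<otimes>\<^sub>o L ! j) k) * chi X (L ! k)))"
      by (rule sum.swap)
    also have "\<dots> = (\<Sum>i<length L. \<Sum>j<length L. \<Sum>k<length L. a i * b j * (of_nat (mult (L ! i \<otimes>\<^sub>o L ! j) k) * chi X (L ! k)))"
      by (intro sum.cong[OF refl] sum.swap)
    also have "\<dots> = (\<Sum>i<length L. \<Sum>j<length L. (a i * chi X (L ! i)) * (b j * chi X (L ! j)))"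
    proof (intro sum.cong[OF refl])
      fix i j assume "i \<in> {..<length L}" "j \<in> {..<length L}"
      then have o: "L ! i \<in> Obj C" "L ! j \<in> Obj C"
        by auto
      have "(\<Sum>k<length L. of_nat (mult (L ! i \<otimes>\<^sub>o L ! j) k) * chi X (L ! k)) = chi X (L ! i) * chi X (L ! j)"
        using chi_mult[OF X, of "L ! i \<otimes>\<^sub>o L ! j"] chi_tens[OF X o] o by simp
      then show "(\<Sum>k<length L. a i * b j * (of_nat (mult (L ! i \<otimes>\<^sub>o L ! j) k) * chi X (L ! k))) = (a i * chi X (L ! i)) * (b j * chi X (L ! j))"
        by (simp add: sum_distrib_left[symmetric])
    qed
    also have "\<dots> = fval X a * fval X b"
      by (simp add: fval_def sum_product)
    finally show ?thesis .
  qed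
  ultimately show ?thesis
    by blast
qed

text \<open>Each noninvertible \<open>L ! j\<close> differs from the unit character on some
  \<open>Z \<otimes> Z*\<close>, by \<open>invertible_of_chi_eq\<close>. Multiplying by that class
  minus the value of \<open>chi (L ! j)\<close> on it kills \<open>j\<close> and keeps the value at
  the unit nonzero.\<close>

lemma killing_element:
  assumes "finite B" "\<And>j. j \<in> B \<Longrightarrow> j < length L \<and> \<not> invertible_obj C (L ! j)"
  shows "\<exists>a. in_ad a \<and> fval (UnitO C) a \<noteq> 0 \<and> (\<forall>j\<in>B. fval (L ! j) a = 0)"
  using assms
proof (induction B rule: finite_induct)
  case empty
  let ?a = "\<lambda>k. of_nat (mult (UnitO C) k) :: 'k"
  have "in_ad ?a"
    unfolding in_ad_def using mult_in_ad fusion_subcategoryD(2)[OF fusion_subcategory_adjoint] by simp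
  moreover have "fval (UnitO C) ?a = 1"
    unfolding fval_def using chi_mult[of "UnitO C" "UnitO C"] chi_unit[OF unit_simple] by simp
  ultimately show ?case
    by (intro exI[of _ ?a]) simp
next
  case (insert j B)
  then obtain a where a: "in_ad a" "fval (UnitO C) a \<noteq> 0" "\<And>j. j \<in> B \<Longrightarrow> fval (L ! j) a = 0"
    by blast
  have j: "simple_obj C (L ! j)" "\<not> invertible_obj C (L ! j)"
    using insert.prems by auto
  then obtain Z where Z: "simple_obj C Z" "chi (L ! j) (Z \<otimes>\<^sub>o Z\<^bold>*) \<noteq> chi (UnitO C) (Z \<otimes>\<^sub>o Z\<^bold>*)"
    using invertible_of_chi_eq by blast
  let ?V = "Z \<otimes>\<^sub>o Z\<^bold>*"
  have V: "?V \<in> Obj C" "?V \<in> Ad"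
    using Z(1) adjoint_subcategory_simple by auto
  define b where "b k = of_nat (mult ?V k) - chi (L ! j) ?V * of_nat (mult (UnitO C) k)" for k
  have "in_ad b"
    unfolding in_ad_def
  proof (intro allI impI)
    fix k assume k: "k < length L" "b k \<noteq> 0"
    then have "mult ?V k \<noteq> 0 \<or> mult (UnitO C) k \<noteq> 0"
      unfolding b_def by (metis diff_0_right mult_zero_right of_nat_0)
    then show "L ! k \<in> Ad"
      using mult_in_ad[OF _ k(1)] V(2) fusion_subcategoryD(2)[OF fusion_subcategory_adjoint] by blast
  qed
  have fb: "fval X b = chi X ?V - chi (L ! j) ?V" if X: "simple_obj C X" for X
  proof -
    have "fval X b = (\<Sum>k<length L. of_nat (mult ?V k) * chi X (L ! k)) -
        chi (L ! j) ?V * (\<Sum>k<length L. of_nat (mult (UnitO C) k) * chi X (L ! k))"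
      by (simp add: fval_def b_def left_diff_distrib sum_subtractf sum_distrib_left mult.assoc)
    also have "\<dots> = chi X ?V - chi (L ! j) ?V"
      using chi_mult[OF X V(1)] chi_mult[OF X UnitO_Obj] chi_unit[OF X] by simp
    finally show ?thesis .
  qed
  obtain c where c: "in_ad c" "\<And>X. simple_obj C X \<Longrightarrow> fval X c = fval X a * fval X b"
    using fval_prod[OF a(1) \<open>in_ad b\<close>] by blast
  have "fval (UnitO C) c \<noteq> 0"
    using c(2)[OF unit_simple] a(2) fb[OF unit_simple] Z(2) by simp
  moreover have "fval (L ! i) c = 0" if "i \<in> insert j B" for i
  proof (cases "i = j")
    case True
    then show ?thesis
      using c(2)[OF j(1)] fb[OF j(1)] by simp
  next
    case False
    then show ?thesis
      using that a(3) c(2)[of "L ! i"] insert.prems by simp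
  qed
  ultimately show ?case
    using c(1) by blast
qed

definition unit_coev :: "'o \<Rightarrow> ('o, 'm) arw" where
  "unit_coev X = Arw (UnitO C) (X \<otimes>\<^sub>o X\<^bold>*) (Coev C X)"

lemma hm_unit_coev: "X \<in> Obj C \<Longrightarrow> hm (unit_coev X) (UnitO C) (X \<otimes>\<^sub>o X\<^bold>*)"
  by (simp add: hm_def unit_coev_def)

text \<open>Otherwise the zigzag identity would make the identity of \<open>X\<close>
  vanish.\<close>

lemma unit_coev_nonzero:
  assumes X: "simple_obj C X"
  shows "unit_coev X \<noteq> zr (UnitO C) (X \<otimes>\<^sub>o X\<^bold>*)"
proof
  assume z: "unit_coev X = zr (UnitO C) (X \<otimes>\<^sub>o X\<^bold>*)"
  have o: "X \<in> Obj C"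
    using X by simp
  have "unit_coev X = sc 0 (unit_coev X)"
    using z sc_zr[of "UnitO C" "X \<otimes>\<^sub>o X\<^bold>*" 0] o by simp
  then have "emb (unit_coev X) = smul 0 (emb (unit_coev X))"
    using emb_sc by metis
  then have n: "coev X = smul 0 (coev X)"
    unfolding coev_def unit_coev_def by (metis cp_smul smul_cp)
  have zz: "wh [X] (ev X) [] \<diamond> wh [] (coev X) [X] = sid [X]"
    using dpairD(9)[OF dpair_ev[OF o]] .
  have "wh [X] (ev X) [] \<diamond> wh [] (smul 0 (coev X)) [X] = smul 0 (sid [X])"
    unfolding wh_smul cp_smul zz ..
  then have "smul 1 (sid [X]) = smul 0 (sid [X])"
    using n zz o by simp
  then have "sc 1 (idn X) = sc 0 (idn X)"
    using smul_sid_inj[OF o] by blast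
  then show False
    using sc_idn_inj[OF o simple_nz[OF X]] by (metis zero_neq_one)
qed

lemma inverses_cancel_zero:
  assumes i: "inverses a b" and f: "ar f" "dm f = cd a" and z: "f \<star> a = zr (dm a) (cd f)"
  shows "f = zr (cd a) (cd f)"
proof -
  note I = inversesD[OF i]
  have "f = (f \<star> a) \<star> b"
    using I f by (simp add: cmp_assoc)
  then show ?thesis
    unfolding z using I f by (simp add: zr_cmp)
qed

lemma inverses_cancel_zero':
  assumes i: "inverses a b" and f: "ar f" "cd f = dm a" and z: "a \<star> f = zr (dm f) (cd a)"
  shows "f = zr (dm f) (dm a)"
proof -
  note I = inversesD[OF i]
  have "f = b \<star> (a \<star> f)"
    using I f by simp
  then show ?thesis
    unfolding z using I f by (simp add: cmp_zr)
qed

lemma tens_idn_nonzero: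
  assumes g: "invertible_obj C g" and f: "hm f X Y" "f \<noteq> zr X Y"
  shows "idn g \<boxtimes> f \<noteq> zr (g \<otimes>\<^sub>o X) (g \<otimes>\<^sub>o Y)"
proof
  assume z: "idn g \<boxtimes> f = zr (g \<otimes>\<^sub>o X) (g \<otimes>\<^sub>o Y)"
  have o: "g \<in> Obj C" "X \<in> Obj C" "Y \<in> Obj C"
    using g f hm_objs invertible_Obj by auto
  have "idn g \<boxtimes> zr X Y = sc 0 (idn g \<boxtimes> zr X Y)"
    using o sc_zr[of X Y 0] tns_sc[of "idn g" 0 "zr X Y"] by simp
  also have "\<dots> = zr (g \<otimes>\<^sub>o X) (g \<otimes>\<^sub>o Y)"
    using o by (simp add: sc_0)
  finally have "f = zr X Y"
    using tens_idn_faithful[OF g f(1), of "zr X Y"] z o by simp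
  then show False
    using f by simp
qed

lemma invertible_in_subcategory:
  assumes K: "fusion_subcategory C K" and g: "invertible_obj C g" and X: "simple_obj C X"
    and m: "X \<in> K" "g \<otimes>\<^sub>o X \<in> K"
  shows "g \<in> K"
proof -
  have o: "g \<in> Obj C" "X \<in> Obj C"
    using g X invertible_Obj by auto
  let ?n = "idn g \<boxtimes> unit_coev X"
  have h: "hm (unit_coev X) (UnitO C) (X \<otimes>\<^sub>o X\<^bold>*)"
    using hm_unit_coev o by blast
  have nz: "?n \<noteq> zr (g \<otimes>\<^sub>o UnitO C) (g \<otimes>\<^sub>o X \<otimes>\<^sub>o X\<^bold>*)"
    using tens_idn_nonzero[OF g h unit_coev_nonzero[OF X]] .
  have hn: "hm ?n (g \<otimes>\<^sub>o UnitO C) (g \<otimes>\<^sub>o X \<otimes>\<^sub>o X\<^bold>*)"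
    using h o by (simp add: hm_def)
  let ?f = "alq g X (X\<^bold>*) \<star> ?n \<star> rv g"
  have hf: "hm ?f g ((g \<otimes>\<^sub>o X) \<otimes>\<^sub>o X\<^bold>*)"
    using hn o by (simp add: hm_def)
  have "?f \<noteq> zr g ((g \<otimes>\<^sub>o X) \<otimes>\<^sub>o X\<^bold>*)"
  proof
    assume z: "?f = zr g ((g \<otimes>\<^sub>o X) \<otimes>\<^sub>o X\<^bold>*)"
    have hc: "ar (?n \<star> rv g)" "dm (?n \<star> rv g) = g" "cd (?n \<star> rv g) = g \<otimes>\<^sub>o X \<otimes>\<^sub>o X\<^bold>*"
      using hn o by (auto simp: hm_def)
    have "?n \<star> rv g = zr (dm (?n \<star> rv g)) (dm (alq g X (X\<^bold>*)))"
      by (rule inverses_cancel_zero'[OF inverses_sym[OF inverses_al]]) (use z hc o in simp_all)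
    then have "?n \<star> rv g = zr g (g \<otimes>\<^sub>o X \<otimes>\<^sub>o X\<^bold>*)"
      unfolding hc by simp
    then have "?n = zr (cd (rv g)) (cd ?n)"
      using hn o by (intro inverses_cancel_zero[OF inverses_sym[OF inverses_ru]]) (auto simp: hm_def)
    then show False
      using nz hn by (simp add: hm_def)
  qed
  then have "mono ?f"
    by (rule mono_from_simple[OF invertible_simple[OF g] hf])
  moreover have "(g \<otimes>\<^sub>o X) \<otimes>\<^sub>o X\<^bold>* \<in> K"
    using fusion_subcategoryD(3,4)[OF K] m by blast
  ultimately show ?thesis
    using fusion_subcategory_mono[OF K, of ?f] hf by (simp add: hm_def)
qed

text \<open>On invertible \<open>L ! j\<close> triviality of the double braiding gives
  \<open>chi (L ! j) g = dd g\<close>, and all other characters kill \<open>a\<close>; so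
  multiplication by \<open>g\<close> scales \<open>a\<close> by \<open>dd g\<close>. Thus
  \<open>g\<close> maps the support of \<open>a\<close> into itself, and two objects of
  \<open>Ad\<close> related by \<open>g\<close> force \<open>g\<close> into
  \<open>Ad\<close>.\<close>

lemma radical_in_adjoint:
  assumes g: "invertible_obj C g" and triv: "\<And>h. invertible_obj C h \<Longrightarrow> db h g = sid [h, g]"
  shows "g \<in> Ad"
proof -
  have go: "g \<in> Obj C"
    using g invertible_Obj by blast
  let ?B = "{j. j < length L \<and> \<not> invertible_obj C (L ! j)}"
  obtain a where a: "in_ad a" "fval (UnitO C) a \<noteq> 0" "\<And>j. j \<in> ?B \<Longrightarrow> fval (L ! j) a = 0"
  proof -
    have "\<exists>a. in_ad a \<and> fval (UnitO C) a \<noteq> 0 \<and> (\<forall>j\<in>?B. fval (L ! j) a = 0)"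
      by (rule killing_element) simp_all
    then show ?thesis
      using that by blast
  qed
  \<comment> \<open>The coefficients of the product of \<open>g\<close> with \<open>a\<close> in the
    fusion ring.\<close>
  define w where "w k = (\<Sum>i<length L. a i * of_nat (mult (g \<otimes>\<^sub>o L ! i) k))" for k
  have w: "w k = dd g * a k" if k: "k < length L" for k
  proof (rule ct_row_eqI[OF _ k])
    fix j assume j: "j < length L"
    have "(\<Sum>k<length L. w k * ct j k) = (\<Sum>k<length L. \<Sum>i<length L. a i * (of_nat (mult (g \<otimes>\<^sub>o L ! i) k) * ct j k))"
      by (simp add: w_def sum_distrib_right mult.assoc)
    also have "\<dots> = (\<Sum>i<length L. \<Sum>k<length L. a i * (of_nat (mult (g \<otimes>\<^sub>o L ! i) k) * ct j k))"
      by (rule sum.swap)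
    also have "\<dots> = (\<Sum>i<length L. a i * (chi (L ! j) g * ct j i))"
    proof (rule sum.cong[OF refl])
      fix i assume "i \<in> {..<length L}"
      then have o: "L ! i \<in> Obj C"
        by simp
      have "(\<Sum>k<length L. of_nat (mult (g \<otimes>\<^sub>o L ! i) k) * ct j k) = chi (L ! j) g * ct j i"
        using chi_mult[OF L_simple[OF j], of "g \<otimes>\<^sub>o L ! i"] chi_tens[OF L_simple[OF j] go o] go o by simp
      then show "(\<Sum>k<length L. a i * (of_nat (mult (g \<otimes>\<^sub>o L ! i) k) * ct j k)) = a i * (chi (L ! j) g * ct j i)"
        by (simp add: sum_distrib_left[symmetric])
    qed
    also have "\<dots> = chi (L ! j) g * fval (L ! j) a"
      by (simp add: fval_def sum_distrib_left mult_ac)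
    also have "\<dots> = dd g * fval (L ! j) a"
    proof (cases "invertible_obj C (L ! j)")
      case True
      have "db (L ! j) g = smul 1 (sid [L ! j, g])"
        using triv[OF True] go j by simp
      then have "chi (L ! j) g = dd g"
        using chi_scalar[OF L_simple[OF j] go] by simp
      then show ?thesis
        by simp
    qed (use a(3) j in simp)
    finally show "(\<Sum>k<length L. w k * ct j k) = (\<Sum>k<length L. dd g * a k * ct j k)"
      by (simp add: fval_def sum_distrib_left mult_ac)
  qed
  have "\<exists>i<length L. a i \<noteq> 0"
  proof (rule ccontr)
    assume "\<not> (\<exists>i<length L. a i \<noteq> 0)"
    then have "fval (UnitO C) a = 0"
      unfolding fval_def by (intro sum.neutral) auto
    then show False
      using a(2) by simp
  qed
  then obtain i where i: "i < length L" "a i \<noteq> 0"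
    by blast
  have gL: "simple_obj C (g \<otimes>\<^sub>o L ! l)" if "l < length L" for l
    using invertible_tens_simple[OF g] that by simp
  obtain k where k: "k < length L" "isomorphic C (g \<otimes>\<^sub>o L ! i) (L ! k)"
    using L_ex[OF gL[OF i(1)]] by blast
  \<comment> \<open>Tensoring with \<open>g\<close> is injective on classes of simple objects, so
    only the term with index \<open>i\<close> contributes to \<open>w k\<close>.\<close>
  have m: "mult (g \<otimes>\<^sub>o L ! l) k = (if l = i then 1 else 0)" if l: "l < length L" for l
  proof -
    obtain k' where k': "k' < length L" "isomorphic C (g \<otimes>\<^sub>o L ! l) (L ! k')"
      using L_ex[OF gL[OF l]] by blast
    have "mult (g \<otimes>\<^sub>o L ! l) k = (if k = k' then 1 else 0)"
      by (rule mult_simple[OF gL[OF l] k' k(1)])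
    moreover have "k = k' \<longleftrightarrow> l = i"
    proof
      assume "l = i"
      then show "k = k'"
        using L_unique[OF k(1) k'(1) k(2)] k'(2) simple_Obj[OF gL[OF i(1)]] by blast
    next
      assume kk: "k = k'"
      have o: "L ! l \<in> Obj C" "L ! i \<in> Obj C" "L ! k \<in> Obj C"
        using l i k by auto
      have go': "g \<otimes>\<^sub>o L ! l \<in> Obj C" "g \<otimes>\<^sub>o L ! i \<in> Obj C"
        using go o by auto
      have "isomorphic C (g \<otimes>\<^sub>o L ! l) (g \<otimes>\<^sub>o L ! i)"
        using isomorphic_trans[OF go'(1) o(3) go'(2) _ isomorphic_sym[OF go'(2) o(3) k(2)]] k'(2) kk by simp
      then obtain f f' where ff: "inverses f f'" "dm f = g \<otimes>\<^sub>o L ! l" "cd f = g \<otimes>\<^sub>o L ! i"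
        using isomorphicE go' by blast
      obtain h where h: "h \<in> Obj C" "isomorphic C (h \<otimes>\<^sub>o g) (UnitO C)"
        using g by (auto simp: invertible_obj_def)
      have red: "isomorphic C (h \<otimes>\<^sub>o g \<otimes>\<^sub>o Y) Y" if Y: "Y \<in> Obj C" for Y
      proof -
        have 1: "isomorphic C (h \<otimes>\<^sub>o g \<otimes>\<^sub>o Y) ((h \<otimes>\<^sub>o g) \<otimes>\<^sub>o Y)"
          by (rule isomorphic_sym[OF _ _ assoc_isomorphic[OF h(1) go Y]]) (use go h Y in simp_all)
        have 2: "isomorphic C ((h \<otimes>\<^sub>o g) \<otimes>\<^sub>o Y) (UnitO C \<otimes>\<^sub>o Y)"
          by (rule tens_isomorphic[OF _ _ _ _ h(2) isomorphic_refl[OF Y]]) (use go h Y in simp_all)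
        have 3: "isomorphic C ((h \<otimes>\<^sub>o g) \<otimes>\<^sub>o Y) Y"
          by (rule isomorphic_trans[OF _ _ _ 2 unit_left_isomorphic[OF Y]]) (use go h Y in simp_all)
        show ?thesis
          by (rule isomorphic_trans[OF _ _ _ 1 3]) (use go h Y in simp_all)
      qed
      have hi: "isomorphic C (h \<otimes>\<^sub>o g \<otimes>\<^sub>o L ! l) (h \<otimes>\<^sub>o g \<otimes>\<^sub>o L ! i)"
        using tens_isomorphic[OF h(1) h(1) go' isomorphic_refl[OF h(1)] \<open>isomorphic C (g \<otimes>\<^sub>o L ! l) (g \<otimes>\<^sub>o L ! i)\<close>] .
      have ho: "h \<otimes>\<^sub>o g \<otimes>\<^sub>o L ! l \<in> Obj C" "h \<otimes>\<^sub>o g \<otimes>\<^sub>o L ! i \<in> Obj C"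
        using h go o by simp_all
      have "isomorphic C (L ! l) (h \<otimes>\<^sub>o g \<otimes>\<^sub>o L ! i)"
        by (rule isomorphic_trans[OF o(1) ho isomorphic_sym[OF ho(1) o(1) red[OF o(1)]] hi])
      then have "isomorphic C (L ! l) (L ! i)"
        by (rule isomorphic_trans[OF o(1) ho(2) o(2) _ red[OF o(2)]])
      then show "l = i"
        by (rule L_inj[OF l i(1)])
    qed
    ultimately show ?thesis
      by simp
  qed
  have "w k = (\<Sum>l<length L. (if l = i then 1 else 0) * a l)"
    unfolding w_def using m by (intro sum.cong) auto
  then have "w k = a i"
    using i(1) by (simp add: sum_if_mult)
  then have "a k \<noteq> 0"
    using w[OF k(1)] i(2) by auto
  then have "L ! k \<in> Ad" "L ! i \<in> Ad"
    using a(1) i k(1) unfolding in_ad_def by blast+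
  moreover have "g \<otimes>\<^sub>o L ! i \<in> Ad"
    using fusion_subcategory_isomorphic[OF fusion_subcategory_adjoint \<open>L ! k \<in> Ad\<close> simple_Obj[OF gL[OF i(1)]]]
      isomorphic_sym[OF simple_Obj[OF gL[OF i(1)]] _ k(2)] k(1) by simp
  ultimately show ?thesis
    using invertible_in_subcategory[OF fusion_subcategory_adjoint g L_simple[OF i(1)]] by blast
qed


subsection \<open>Fusion subcategories generated by simple objects\<close>

text \<open>Nonzero maps from simple objects are monomorphisms, so the condition is that all simple
  subobjects satisfy \<open>P\<close>. No decomposition has to be chosen.\<close>

definition gen_subcat :: "('o \<Rightarrow> bool) \<Rightarrow> 'o set" where
  "gen_subcat P = {V \<in> Obj C. \<forall>S f. simple_obj C S \<and> hm f S V \<and> f \<noteq> zr S V \<longrightarrow> P S}"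

lemma gen_subcatI:
  "\<lbrakk>V \<in> Obj C; \<And>S f. \<lbrakk>simple_obj C S; hm f S V; f \<noteq> zr S V\<rbrakk> \<Longrightarrow> P S\<rbrakk> \<Longrightarrow> V \<in> gen_subcat P"
  unfolding gen_subcat_def by blast

lemma gen_subcatD: "\<lbrakk>V \<in> gen_subcat P; simple_obj C S; hm f S V; f \<noteq> zr S V\<rbrakk> \<Longrightarrow> P S"
  unfolding gen_subcat_def by blast

lemma dsum_inclusion_nonzero:
  assumes d: "dsum V Ys i p" and a: "a < length Ys" and s: "idn (Ys ! a) \<noteq> zr (Ys ! a) (Ys ! a)"
  shows "i a \<noteq> zr (Ys ! a) V"
proof
  assume "i a = zr (Ys ! a) V"
  then have "p a \<star> i a = zr (Ys ! a) (Ys ! a)"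
    using dsumD(3,5)[OF d a] by (simp add: cmp_zr hm_def)
  then show False
    using dsumD(6)[OF d a a] s by simp
qed

lemma gen_subcat_summand:
  assumes "V \<in> gen_subcat P" "dsum V Ys i p" "a < length Ys" "simple_obj C (Ys ! a)"
  shows "P (Ys ! a)"
  using gen_subcatD[OF assms(1,4) dsumD(4)[OF assms(2,3)] dsum_inclusion_nonzero[OF assms(2,3) simple_nz[OF assms(4)]]] .

text \<open>For tensor products, a nonzero map from a simple object into
  \<open>V \<otimes>\<^sub>o W\<close> survives projection to some simple summand of
  \<open>V\<close>, then of \<open>W\<close>, since the projectors sum to the identity; this reduces
  to the hypothesis on two simple factors.\<close>

lemma fusion_subcategory_gen:
  assumes simp: "\<And>S. P S \<Longrightarrow> simple_obj C S" and unit: "P (UnitO C)"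
    and iso: "\<And>S T. \<lbrakk>P S; simple_obj C T; isomorphic C S T\<rbrakk> \<Longrightarrow> P T"
    and tens: "\<And>A B S f. \<lbrakk>P A; P B; simple_obj C S; hm f S (A \<otimes>\<^sub>o B); f \<noteq> zr S (A \<otimes>\<^sub>o B)\<rbrakk> \<Longrightarrow> P S"
    and dual: "\<And>A. P A \<Longrightarrow> P (A\<^bold>*)"
  shows "fusion_subcategory C (gen_subcat P)"
proof -
  have from_simple: "P S" if T: "P T" and S: "simple_obj C S" "hm f S T" "f \<noteq> zr S T" for S T f
  proof -
    obtain g where g: "inverses f g"
      using Schur_iso[OF S(1) simp[OF T] S(2,3)] .
    have "isomorphic C T S"
      by (rule isomorphicI[OF inverses_sym[OF g]]) (use S(2) inversesD[OF g] in \<open>auto simp: hm_def\<close>)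
    then show ?thesis
      using iso[OF T S(1)] by blast
  qed
  have unitK: "UnitO C \<in> gen_subcat P"
    by (rule gen_subcatI[OF UnitO_Obj from_simple[OF unit]])
  have tensK: "V \<otimes>\<^sub>o W \<in> gen_subcat P" if V: "V \<in> gen_subcat P" and W: "W \<in> gen_subcat P" for V W
  proof -
    have o: "V \<in> Obj C" "W \<in> Obj C"
      using V W by (auto simp: gen_subcat_def)
    obtain Ys i p where Ys: "dsum V Ys i p" "\<And>Y. Y \<in> set Ys \<Longrightarrow> simple_obj C Y"
      using semisimple_dsum[OF o(1)] by blast
    obtain Zs j q where Zs: "dsum W Zs j q" "\<And>Y. Y \<in> set Zs \<Longrightarrow> simple_obj C Y"
      using semisimple_dsum[OF o(2)] by blast
    have "P S" if S: "simple_obj C S" "hm f S (V \<otimes>\<^sub>o W)" "f \<noteq> zr S (V \<otimes>\<^sub>o W)" for S f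
    proof -
      have So: "S \<in> Obj C"
        using S by simp
      have "\<exists>a<length Ys. (p a \<boxtimes> idn W) \<star> f \<noteq> zr S (Ys ! a \<otimes>\<^sub>o W)"
      proof (rule ccontr)
        assume n: "\<not> (\<exists>a<length Ys. (p a \<boxtimes> idn W) \<star> f \<noteq> zr S (Ys ! a \<otimes>\<^sub>o W))"
        have "(idn V \<boxtimes> idn W) \<star> f = zr S (V \<otimes>\<^sub>o W)"
        proof (rule dsum_induct[OF Ys(1)])
          show "(zr V V \<boxtimes> idn W) \<star> f = zr S (V \<otimes>\<^sub>o W)"
            using sc_tns[of 0 "zr V V" "idn W"] sc_cmp[of 0 "zr V V \<boxtimes> idn W" f] S(2) o by (simp add: sc_zr sc_0 hm_def)
          fix a assume a: "a < length Ys"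
          have "((i a \<star> p a) \<boxtimes> idn W) \<star> f = (i a \<boxtimes> idn W) \<star> ((p a \<boxtimes> idn W) \<star> f)"
            using dsumD(4,5)[OF Ys(1) a] o by (simp add: cmp_tns_idn cmp_assoc hm_def)
          also have "(p a \<boxtimes> idn W) \<star> f = zr S (Ys ! a \<otimes>\<^sub>o W)"
            using n a by blast
          finally show "((i a \<star> p a) \<boxtimes> idn W) \<star> f = zr S (V \<otimes>\<^sub>o W)"
            using dsumD(4)[OF Ys(1) a] o So by (simp add: cmp_zr hm_def)
        next
          fix h k assume "hm h V V" "hm k V V" "(h \<boxtimes> idn W) \<star> f = zr S (V \<otimes>\<^sub>o W)" "(k \<boxtimes> idn W) \<star> f = zr S (V \<otimes>\<^sub>o W)"
          then show "((h \<boxplus> k) \<boxtimes> idn W) \<star> f = zr S (V \<otimes>\<^sub>o W)"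
            using o So by (simp add: ad_tns ad_cmp hm_def)
        qed
        then show False
          using S(2,3) o by (simp add: hm_def)
      qed
      then obtain a where a: "a < length Ys" "(p a \<boxtimes> idn W) \<star> f \<noteq> zr S (Ys ! a \<otimes>\<^sub>o W)"
        by blast
      let ?Y = "Ys ! a" and ?f = "(p a \<boxtimes> idn W) \<star> f"
      have Yo: "?Y \<in> Obj C"
        using dsumD(3)[OF Ys(1) a(1)] .
      have f': "hm ?f S (?Y \<otimes>\<^sub>o W)"
        using S(2) dsumD(5)[OF Ys(1) a(1)] o by (simp add: hm_def)
      have "\<exists>b<length Zs. (idn ?Y \<boxtimes> q b) \<star> ?f \<noteq> zr S (?Y \<otimes>\<^sub>o Zs ! b)"
      proof (rule ccontr)
        assume n: "\<not> (\<exists>b<length Zs. (idn ?Y \<boxtimes> q b) \<star> ?f \<noteq> zr S (?Y \<otimes>\<^sub>o Zs ! b))"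
        have "(idn ?Y \<boxtimes> idn W) \<star> ?f = zr S (?Y \<otimes>\<^sub>o W)"
        proof (rule dsum_induct[OF Zs(1), of "\<lambda>h. (idn ?Y \<boxtimes> h) \<star> ?f = zr S (?Y \<otimes>\<^sub>o W)"])
          show "(idn ?Y \<boxtimes> zr W W) \<star> ?f = zr S (?Y \<otimes>\<^sub>o W)"
            using tns_sc[of "idn ?Y" 0 "zr W W"] sc_cmp[of 0 "idn ?Y \<boxtimes> zr W W" ?f] f' o Yo by (simp add: sc_zr sc_0 hm_def)
          fix b assume b: "b < length Zs"
          have "(idn ?Y \<boxtimes> (j b \<star> q b)) \<star> ?f = (idn ?Y \<boxtimes> j b) \<star> ((idn ?Y \<boxtimes> q b) \<star> ?f)"
            using dsumD(4,5)[OF Zs(1) b] Yo by (simp add: idn_tns_cmp cmp_assoc hm_def)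
          also have "(idn ?Y \<boxtimes> q b) \<star> ?f = zr S (?Y \<otimes>\<^sub>o Zs ! b)"
            using n b by blast
          finally show "(idn ?Y \<boxtimes> (j b \<star> q b)) \<star> ?f = zr S (?Y \<otimes>\<^sub>o W)"
            using dsumD(4)[OF Zs(1) b] Yo So by (simp add: cmp_zr hm_def)
        next
          fix h k assume "hm h W W" "hm k W W" "(idn ?Y \<boxtimes> h) \<star> ?f = zr S (?Y \<otimes>\<^sub>o W)" "(idn ?Y \<boxtimes> k) \<star> ?f = zr S (?Y \<otimes>\<^sub>o W)"
          then show "(idn ?Y \<boxtimes> (h \<boxplus> k)) \<star> ?f = zr S (?Y \<otimes>\<^sub>o W)"
            using o So Yo by (simp add: tns_ad ad_cmp hm_def)
        qed
        moreover have "(idn ?Y \<boxtimes> idn W) \<star> ?f = ?f"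
          using f' Yo o unfolding hm_def by simp
        ultimately show False
          using a(2) by simp
      qed
      then obtain b where b: "b < length Zs" "(idn ?Y \<boxtimes> q b) \<star> ?f \<noteq> zr S (?Y \<otimes>\<^sub>o Zs ! b)"
        by blast
      have "hm ((idn ?Y \<boxtimes> q b) \<star> ?f) S (?Y \<otimes>\<^sub>o Zs ! b)"
        using f' dsumD(5)[OF Zs(1) b(1)] Yo by (simp add: hm_def)
      moreover have "P ?Y"
        using gen_subcat_summand[OF V Ys(1) a(1)] Ys(2) a(1) by simp
      moreover have "P (Zs ! b)"
        using gen_subcat_summand[OF W Zs(1) b(1)] Zs(2) b(1) by simp
      ultimately show ?thesis
        using tens S(1) b(2) by blast
    qed
    then show ?thesis
      by (rule gen_subcatI[OF TensO_Obj[OF o]])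
  qed
  have dualK: "V\<^bold>* \<in> gen_subcat P" if V: "V \<in> gen_subcat P" for V
  proof -
    have o: "V \<in> Obj C"
      using V by (auto simp: gen_subcat_def)
    obtain Ys i p where Ys: "dsum V Ys i p" "\<And>Y. Y \<in> set Ys \<Longrightarrow> simple_obj C Y"
      using semisimple_dsum[OF o] by blast
    have "P S" if S: "simple_obj C S" "hm f S (V\<^bold>*)" "f \<noteq> zr S (V\<^bold>*)" for S f
    proof -
      note d = dual_dsum[OF Ys(1)]
      obtain a where a: "a < length (map (Dual C) Ys)" "dua (i a) \<star> f \<noteq> zr S (map (Dual C) Ys ! a)"
        using dsum_detect[OF d S(2,3)] .
      then have a': "a < length Ys" "dua (i a) \<star> f \<noteq> zr S ((Ys ! a)\<^bold>*)"
        by auto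
      have "P (Ys ! a)"
        using gen_subcat_summand[OF V Ys(1) a'(1)] Ys(2) a'(1) by simp
      then show ?thesis
        using from_simple[OF dual S(1) _ a'(2)] hm_cmp[OF hm_dua[OF dsumD(4)[OF Ys(1) a'(1)]] S(2)] by blast
    qed
    then show ?thesis
      by (rule gen_subcatI[OF Dual_Obj[OF o]])
  qed
  have sumK: "X \<in> gen_subcat P" if X: "set Xs \<subseteq> gen_subcat P" "direct_sum C X Xs" for Xs X
  proof -
    obtain i p where d: "dsum X Xs i p"
      using direct_sum_dsum[OF X(2)] .
    have "P S" if S: "simple_obj C S" "hm f S X" "f \<noteq> zr S X" for S f
    proof -
      obtain a where a: "a < length Xs" "p a \<star> f \<noteq> zr S (Xs ! a)"
        using dsum_detect[OF d S(2,3)] .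
      have "Xs ! a \<in> gen_subcat P"
        using X(1) a(1) by auto
      then show ?thesis
        using gen_subcatD[OF _ S(1) hm_cmp[OF dsumD(5)[OF d a(1)] S(2)] a(2)] by blast
    qed
    then show ?thesis
      by (rule gen_subcatI[OF dsumD(1)[OF d]])
  qed
  have subK: "Y \<in> gen_subcat P" if X: "X \<in> gen_subcat P" and Y: "Y \<in> Obj C" "mono_arr C Y X m" for X Y m
  proof -
    have Xo: "X \<in> Obj C"
      using X by (auto simp: gen_subcat_def)
    have mo: "mono (Arw Y X m)"
      using mono_mono_arr[OF Y(1) Xo] Y(2) by blast
    have hmm: "hm (Arw Y X m) Y X"
      using mono_ar[OF mo] by (simp add: hm_def)
    have "P S" if S: "simple_obj C S" "hm f S Y" "f \<noteq> zr S Y" for S f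
    proof -
      have "Arw Y X m \<star> f \<noteq> zr S X"
      proof
        assume "Arw Y X m \<star> f = zr S X"
        then have "Arw Y X m \<star> f = Arw Y X m \<star> zr S Y"
          using hmm S(1) by (simp add: cmp_zr hm_def)
        then have "f = zr S Y"
          using monoD[OF mo, of f S "zr S Y"] S(1,2) Y(1) by simp
        then show False
          using S by simp
      qed
      then show ?thesis
        using gen_subcatD[OF X S(1) hm_cmp[OF hmm S(2)]] by blast
    qed
    then show ?thesis
      by (rule gen_subcatI[OF Y(1)])
  qed
  show ?thesis
    unfolding fusion_subcategory_def
  proof (intro conjI)
    show "gen_subcat P \<subseteq> Obj C"
      unfolding gen_subcat_def by blast
    show "UnitO C \<in> gen_subcat P"
      by (rule unitK)
    show "\<forall>X\<in>gen_subcat P. \<forall>Y\<in>gen_subcat P. X \<otimes>\<^sub>o Y \<in> gen_subcat P"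
      using tensK by blast
    show "\<forall>X\<in>gen_subcat P. X\<^bold>* \<in> gen_subcat P"
      using dualK by blast
    show "\<forall>Xs X. set Xs \<subseteq> gen_subcat P \<and> direct_sum C X Xs \<longrightarrow> X \<in> gen_subcat P"
      using sumK by blast
    show "\<forall>X\<in>gen_subcat P. \<forall>Y\<in>Obj C. \<forall>f. mono_arr C Y X f \<longrightarrow> Y \<in> gen_subcat P"
      using subK by blast
  qed
qed

lemma simple_gen_subcat:
  assumes iso: "\<And>S T. \<lbrakk>P S; simple_obj C T; isomorphic C S T\<rbrakk> \<Longrightarrow> P T" and S: "simple_obj C S"
  shows "S \<in> gen_subcat P \<longleftrightarrow> P S"
proof
  assume "S \<in> gen_subcat P"
  then show "P S"
    using gen_subcatD[of S P S "idn S"] S simple_nz[OF S] by simp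
next
  assume P: "P S"
  have "P T" if T: "simple_obj C T" "hm f T S" "f \<noteq> zr T S" for T f
  proof -
    obtain g where g: "inverses f g"
      using Schur_iso[OF T(1) S T(2,3)] .
    have "isomorphic C S T"
      by (rule isomorphicI[OF inverses_sym[OF g]]) (use T(2) inversesD[OF g] in \<open>auto simp: hm_def\<close>)
    then show ?thesis
      using iso[OF P T(1)] by blast
  qed
  then show "S \<in> gen_subcat P"
    by (rule gen_subcatI[OF simple_Obj[OF S]])
qed

end

section \<open>Invertible objects and their double braidings\<close>

context monoidal_category
begin

lemma smul_0_eq: "\<lbrakk>sar F; sar G; dm F = dm G; cd F = cd G\<rbrakk> \<Longrightarrow> smul 0 F = smul 0 G"
  by (rule sar_eqI) (simp_all add: mp_smul sc_0 sarD)

lemma sc_inj: "\<lbrakk>ar g; g \<noteq> zr (dm g) (cd g); sc a g = sc b g\<rbrakk> \<Longrightarrow> a = b"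
proof (rule ccontr)
  assume a: "ar g" "g \<noteq> zr (dm g) (cd g)" "sc a g = sc b g" "a \<noteq> b"
  have "sc (a + - b) g = sc b g \<boxplus> sc (- b) g"
    using a(3) by (simp only: sc_ad)
  also have "\<dots> = zr (dm g) (cd g)"
    using ad_neg[of "sc b g"] a by simp
  finally show False
    using sc_eq_zr[of g "a + - b"] a by simp
qed

lemma inverses_nonzero:
  assumes i: "inverses f g" and nz: "idn (dm f) \<noteq> zr (dm f) (dm f)"
  shows "f \<noteq> zr (dm f) (cd f)"
proof
  note I = inversesD[OF i]
  assume z: "f = zr (dm f) (cd f)"
  have "idn (dm f) = g \<star> f"
    using I by simp
  also have "\<dots> = g \<star> zr (dm f) (cd f)"
    by (rule arg_cong[OF z])
  also have "\<dots> = zr (dm f) (dm f)"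
    using I by (simp add: cmp_zr)
  finally show False
    using nz by simp
qed

end

context ac_modular_category
begin

text \<open>Naturality of the double braiding along \<open>f\<close> compares the scalars, and
  \<open>idn h \<boxtimes> f\<close> is nonzero because \<open>h\<close> is invertible.\<close>

lemma db_scalar_eq:
  assumes h: "invertible_obj C h" and f: "hm f V W" "f \<noteq> zr V W"
    and d: "db h V = smul a (sid [h, V])" "db h W = smul b (sid [h, W])"
  shows "a = b"
proof -
  have o: "h \<in> Obj C" "V \<in> Obj C" "W \<in> Obj C" and fa: "ar f" "dm f = V" "cd f = W"
    using f h hm_objs invertible_Obj by (auto simp: hm_def)
  let ?F = "wh [h] (emb f) []"
  have e: "emb (idn h \<boxtimes> f) = mu h W \<diamond> ?F \<diamond> nu h V"
    using emb_tns[of "idn h" f] o fa by simp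
  have "db h W \<diamond> ?F = ?F \<diamond> db h V"
    using db_nat[OF fa(1) o(1)] fa by simp
  then have "smul b ?F = smul a ?F"
    unfolding d using o fa by (simp add: smul_cp cp_smul)
  then have "mu h W \<diamond> smul b ?F \<diamond> nu h V = mu h W \<diamond> smul a ?F \<diamond> nu h V"
    by simp
  then have "emb (sc b (idn h \<boxtimes> f)) = emb (sc a (idn h \<boxtimes> f))"
    by (simp only: emb_sc e smul_cp cp_smul)
  then have "sc b (idn h \<boxtimes> f) = sc a (idn h \<boxtimes> f)"
    using o fa by (intro emb_inj) simp_all
  then show ?thesis
    using sc_inj[of "idn h \<boxtimes> f" b a] tens_idn_nonzero[OF h f] o fa by simp
qed

text \<open>Since \<open>h \<otimes>\<^sub>o V\<close> is simple, its endomorphisms are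
  scalars.\<close>

lemma db_scalar:
  assumes h: "invertible_obj C h" and V: "simple_obj C V"
  shows "\<exists>c. db h V = smul c (sid [h, V])"
proof -
  have o: "h \<in> Obj C" "V \<in> Obj C"
    using h V invertible_Obj by auto
  have "hm (bd V h \<star> bd h V) (h \<otimes>\<^sub>o V) (h \<otimes>\<^sub>o V)"
    using o by (simp add: hm_def)
  then obtain c where "bd V h \<star> bd h V = sc c (idn (h \<otimes>\<^sub>o V))"
    using Schur_scalar[OF invertible_tens_simple[OF h V]] by blast
  then have "db h V = smul c (sid [h, V])"
    unfolding db_emb[OF o] using o by (simp add: emb_sc smul_cp cp_smul)
  then show ?thesis
    by blast
qed

text \<open>Multiplicativity of the bicharacter: in \<open>db_tens\<close> the inner twist yields
  \<open>b\<close>, after which the outer crossings close up to the double braiding with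
  \<open>V\<close>.\<close>

lemma db_tens_scalar:
  assumes o: "h \<in> Obj C" "V \<in> Obj C" "W \<in> Obj C" and d: "db h V = smul a (sid [h, V])" "db h W = smul b (sid [h, W])"
  shows "db h (V \<otimes>\<^sub>o W) = smul (a * b) (sid [h, V \<otimes>\<^sub>o W])"
proof -
  have c: "wh [] (br V h) [W] \<diamond> wh [] (br h V) [W] = smul a (sid [h, V, W])"
    using arg_cong[OF d(1), of "\<lambda>F. wh [] F [W]"] o by (simp add: db_def wh_smul)
  have "db h (V \<otimes>\<^sub>o W) = (db h (V \<otimes>\<^sub>o W) \<diamond> wh [h] (mu V W) []) \<diamond> wh [h] (nu V W) []"
    using o by (simp add: cp_assoc)
  also have "db h (V \<otimes>\<^sub>o W) \<diamond> wh [h] (mu V W) [] =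
      smul b (wh [h] (mu V W) [] \<diamond> (wh [] (br V h) [W] \<diamond> wh [] (br h V) [W]))"
    unfolding db_tens[OF o] d(2) using o by (simp add: wh_smul cp_smul smul_cp)
  also have "smul b (wh [h] (mu V W) [] \<diamond> (wh [] (br V h) [W] \<diamond> wh [] (br h V) [W])) \<diamond> wh [h] (nu V W) [] = smul (a * b) (sid [h, V \<otimes>\<^sub>o W])"
    unfolding c using o by (simp add: cp_smul smul_cp mult.commute)
  finally show ?thesis .
qed

text \<open>The scalar is idempotent, by comparison along the left unit constraint, and nonzero
  because \<open>chi_unit\<close> has the value 1.\<close>

lemma db_unit:
  assumes h: "invertible_obj C h"
  shows "db h (UnitO C) = sid [h, UnitO C]"
proof -
  let ?I = "UnitO C"
  have o: "h \<in> Obj C"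
    using h invertible_Obj by blast
  obtain c where c: "db h ?I = smul c (sid [h, ?I])"
    using db_scalar[OF h unit_simple] by blast
  have "lu ?I \<noteq> zr (?I \<otimes>\<^sub>o ?I) ?I"
  proof
    assume z: "lu ?I = zr (?I \<otimes>\<^sub>o ?I) ?I"
    have "idn ?I = lu ?I \<star> lv ?I"
      by simp
    also have "\<dots> = zr ?I ?I"
      unfolding z by (simp add: zr_cmp)
    finally show False
      using simple_nz[OF unit_simple] by simp
  qed
  moreover have "hm (lu ?I) (?I \<otimes>\<^sub>o ?I) ?I"
    by (simp add: hm_def)
  ultimately have "c * c = c"
    using db_scalar_eq[OF h _ _ db_tens_scalar[OF o UnitO_Obj UnitO_Obj c c] c] by blast
  moreover have "c \<noteq> 0"
    using chi_scalar[OF invertible_simple[OF h] UnitO_Obj c] chi_unit[OF invertible_simple[OF h]] by auto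
  ultimately show ?thesis
    using c o by simp
qed

lemma invertible_unit: "invertible_obj C (UnitO C)"
  unfolding invertible_obj_def using unit_left_isomorphic[OF UnitO_Obj] UnitO_Obj by blast

lemma dd_unit: "dd (UnitO C) = 1"
  using chi_scalar[OF unit_simple UnitO_Obj, of 1] db_unit[OF invertible_unit] chi_unit[OF unit_simple] by simp

lemma db_dsum:
  assumes X: "X \<in> Obj C" and d: "dsum V Ys i p" and t: "\<And>a. a < length Ys \<Longrightarrow> db X (Ys ! a) = sid [X, Ys ! a]"
  shows "db X V = sid [X, V]"
proof -
  have V: "V \<in> Obj C"
    using dsumD(1)[OF d] .
  have "db X V \<diamond> wh [X] (emb (idn V)) [] = wh [X] (emb (idn V)) []"
  proof (rule dsum_induct[OF d, of "\<lambda>h. db X V \<diamond> wh [X] (emb h) [] = wh [X] (emb h) []"])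
    have "zr V V = sc 0 (idn V)"
      using V by (simp add: sc_0)
    then show "db X V \<diamond> wh [X] (emb (zr V V)) [] = wh [X] (emb (zr V V)) []"
      using V X smul_0_eq[of "db X V" "sid [X, V]"] by (simp add: emb_sc wh_smul cp_smul)
    fix a assume a: "a < length Ys"
    have i: "ar (i a)" "dm (i a) = Ys ! a" "cd (i a) = V" and p: "ar (p a)" "dm (p a) = V" "cd (p a) = Ys ! a"
      using dsumD(4,5)[OF d a] by (auto simp: hm_def)
    have "db X V \<diamond> wh [X] (emb (i a)) [] = wh [X] (emb (i a)) [] \<diamond> db X (Ys ! a)"
      using db_nat[OF i(1) X] i by simp
    from cp_reassoc2[OF this] show "db X V \<diamond> wh [X] (emb (i a \<star> p a)) [] = wh [X] (emb (i a \<star> p a)) []"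
      using X i p dsumD(3)[OF d a] t[OF a] by (simp add: emb_cmp)
  next
    fix f g assume "db X V \<diamond> wh [X] (emb f) [] = wh [X] (emb f) []" "db X V \<diamond> wh [X] (emb g) [] = wh [X] (emb g) []"
    then show "db X V \<diamond> wh [X] (emb (f \<boxplus> g)) [] = wh [X] (emb (f \<boxplus> g)) []"
      by (simp add: emb_ad wh_sadd cp_sadd)
  qed
  then show ?thesis
    using X V by simp
qed

text \<open>On a simple \<open>S\<close> the scalar times \<open>dd S\<close> and
  \<open>dd S\<close> itself both equal \<open>chi (UnitO C) S\<close>; direct sums follow.\<close>

lemma db_unit_left: "V \<in> Obj C \<Longrightarrow> db (UnitO C) V = sid [UnitO C, V]"
proof -
  assume V: "V \<in> Obj C"
  have s: "db (UnitO C) S = sid [UnitO C, S]" if S: "simple_obj C S" for S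
  proof -
    obtain c where c: "db (UnitO C) S = smul c (sid [UnitO C, S])"
      using db_scalar[OF invertible_unit S] by blast
    have "c * dd S = dd S"
      using chi_scalar[OF unit_simple simple_Obj[OF S] c] chi_from_unit[OF S] dd_unit by simp
    then have "c = 1"
      using dd_nonzero[OF S] by simp
    then show ?thesis
      using c S by simp
  qed
  obtain Ys i p where Ys: "dsum V Ys i p" "\<And>Y. Y \<in> set Ys \<Longrightarrow> simple_obj C Y"
    using semisimple_dsum[OF V] by blast
  show ?thesis
    using s Ys(2) by (intro db_dsum[OF UnitO_Obj Ys(1)]) simp
qed

lemma db_trivial_iff:
  assumes "X \<in> Obj C" "Y \<in> Obj C"
  shows "db X Y = sid [X, Y] \<longleftrightarrow> bd Y X \<star> bd X Y = idn (X \<otimes>\<^sub>o Y)"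
proof
  assume "db X Y = sid [X, Y]"
  then have "mu X Y \<diamond> db X Y \<diamond> nu X Y = mu X Y \<diamond> sid [X, Y] \<diamond> nu X Y"
    by simp
  then have "emb (bd Y X \<star> bd X Y) = emb (idn (X \<otimes>\<^sub>o Y))"
    unfolding db_emb[OF assms] using assms by (simp add: cp_assoc)
  then show "bd Y X \<star> bd X Y = idn (X \<otimes>\<^sub>o Y)"
    using assms by (intro emb_inj) simp_all
next
  assume "bd Y X \<star> bd X Y = idn (X \<otimes>\<^sub>o Y)"
  then show "db X Y = sid [X, Y]"
    unfolding db_emb[OF assms] using assms by simp
qed

text \<open>A left inverse of the invertible \<open>bd X Y\<close> is also a right inverse.\<close>

lemma db_sym:
  assumes o: "X \<in> Obj C" "Y \<in> Obj C" and t: "db X Y = sid [X, Y]"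
  shows "db Y X = sid [Y, X]"
proof -
  obtain g where g: "inverses (bd X Y) g"
    using bd_inverses[OF o] by blast
  note I = inversesD[OF g]
  have e: "bd Y X \<star> bd X Y = idn (X \<otimes>\<^sub>o Y)"
    using t db_trivial_iff[OF o] by blast
  have "bd Y X = bd Y X \<star> (bd X Y \<star> g)"
    using I o by simp
  also have "\<dots> = (bd Y X \<star> bd X Y) \<star> g"
    by (simp only: cmp_assoc)
  also have "\<dots> = g"
    unfolding e using I o by simp
  finally have "bd X Y \<star> bd Y X = idn (Y \<otimes>\<^sub>o X)"
    using I o by simp
  then show ?thesis
    using db_trivial_iff[OF o(2,1)] by blast
qed

lemma centralizer_iff:
  assumes "K \<subseteq> Obj C"
  shows "Y \<in> centralizer C K \<longleftrightarrow> Y \<in> Obj C \<and> (\<forall>X\<in>K. db X Y = sid [X, Y])"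
proof -
  have "Braid C Y X \<cdot> Braid C X Y = Ident C (X \<otimes>\<^sub>o Y) \<longleftrightarrow> db X Y = sid [X, Y]" if o: "X \<in> Obj C" "Y \<in> Obj C" for X
  proof -
    have "mp (bd Y X \<star> bd X Y) = Braid C Y X \<cdot> Braid C X Y"
      using o by (simp add: mp_cmp) (simp add: bd_def)
    moreover have "mp (idn (X \<otimes>\<^sub>o Y)) = Ident C (X \<otimes>\<^sub>o Y)"
      using o by (simp add: mp_idn)
    moreover have "bd Y X \<star> bd X Y = idn (X \<otimes>\<^sub>o Y) \<longleftrightarrow> mp (bd Y X \<star> bd X Y) = mp (idn (X \<otimes>\<^sub>o Y))"
      using o ar_eqI[of "bd Y X \<star> bd X Y" "idn (X \<otimes>\<^sub>o Y)"] by auto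
    ultimately show ?thesis
      using db_trivial_iff[OF o] by simp
  qed
  then show ?thesis
    using assms unfolding centralizer_def by blast
qed

text \<open>The simple objects braiding trivially with \<open>h\<close> generate a fusion
  subcategory. It contains each \<open>Z \<otimes> Z*\<close>: the coevaluation is a nonzero map
  from the unit, so the scalars on \<open>Z\<close> and its dual multiply to 1. Hence it contains
  \<open>Ad\<close>.\<close>

lemma invertible_centralizes_adjoint:
  assumes h: "invertible_obj C h" and S: "simple_obj C S" "S \<in> Ad"
  shows "db h S = sid [h, S]"
proof -
  have ho: "h \<in> Obj C"
    using h invertible_Obj by blast
  define P where "P S \<longleftrightarrow> simple_obj C S \<and> db h S = smul 1 (sid [h, S])" for S
  have PI: "P T" if t: "simple_obj C T" "db h V = smul 1 (sid [h, V])" "hm f T V" "f \<noteq> zr T V" for T V f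
  proof -
    obtain c where c: "db h T = smul c (sid [h, T])"
      using db_scalar[OF h t(1)] by blast
    then show ?thesis
      using db_scalar_eq[OF h t(3,4) c t(2)] t(1) unfolding P_def by simp
  qed
  have iso: "P T" if t: "P S" "simple_obj C T" "isomorphic C S T" for S T
  proof -
    have S: "simple_obj C S"
      using t(1) unfolding P_def by blast
    obtain f g where fg: "inverses f g" "dm f = S" "cd f = T"
      using isomorphicE[OF t(3)] S t(2) by auto
    have "g \<noteq> zr (dm g) (cd g)"
      using inverses_nonzero[OF inverses_sym[OF fg(1)]] inversesD(3)[OF fg(1)] fg simple_nz[OF t(2)] by simp
    then show ?thesis
      using PI[OF t(2), of S g] t(1) inversesD(2-4)[OF fg(1)] fg unfolding P_def hm_def by simp
  qed
  have coev_scalar: "a * b = 1" if "simple_obj C Z" "db h Z = smul a (sid [h, Z])" "db h (Z\<^bold>*) = smul b (sid [h, Z\<^bold>*])" for Z a b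
  proof -
    have Zo: "Z \<in> Obj C" "Z\<^bold>* \<in> Obj C"
      using that(1) by simp_all
    have u: "db h (UnitO C) = smul 1 (sid [h, UnitO C])"
      using db_unit[OF h] ho by simp
    show ?thesis
      using db_scalar_eq[OF h hm_unit_coev[OF Zo(1)] unit_coev_nonzero[OF that(1)] u db_tens_scalar[OF ho Zo that(2,3)]] by simp
  qed
  have K: "fusion_subcategory C (gen_subcat P)"
  proof (rule fusion_subcategory_gen)
    show "simple_obj C S" if "P S" for S
      using that by (simp add: P_def)
    show "P (UnitO C)"
      using db_unit[OF h] ho by (simp add: P_def)
    show "P T" if "P S" "simple_obj C T" "isomorphic C S T" for S T
      using iso that by blast
    show "P S" if "P A" "P B" "simple_obj C S" "hm f S (A \<otimes>\<^sub>o B)" "f \<noteq> zr S (A \<otimes>\<^sub>o B)" for A B S f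
    proof -
      have "db h (A \<otimes>\<^sub>o B) = smul (1 * 1) (sid [h, A \<otimes>\<^sub>o B])"
        using that(1,2) ho unfolding P_def by (intro db_tens_scalar) auto
      then show ?thesis
        using PI[OF that(3) _ that(4,5)] by simp
    qed
    show "P (A\<^bold>*)" if "P A" for A
    proof -
      have A: "simple_obj C A" "db h A = smul 1 (sid [h, A])"
        using that by (auto simp: P_def)
      obtain b where b: "db h (A\<^bold>*) = smul b (sid [h, A\<^bold>*])"
        using db_scalar[OF h simple_dual[OF A(1)]] by blast
      then show ?thesis
        using coev_scalar[OF A b] simple_dual[OF A(1)] unfolding P_def by simp
    qed
  qed
  have "Z \<otimes>\<^sub>o Z\<^bold>* \<in> gen_subcat P" if Z: "simple_obj C Z" for Z
  proof (rule gen_subcatI)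
    have Zo: "Z \<in> Obj C" "Z\<^bold>* \<in> Obj C"
      using Z by simp_all
    then show "Z \<otimes>\<^sub>o Z\<^bold>* \<in> Obj C"
      by simp
    obtain a where a: "db h Z = smul a (sid [h, Z])"
      using db_scalar[OF h Z] by blast
    obtain b where b: "db h (Z\<^bold>*) = smul b (sid [h, Z\<^bold>*])"
      using db_scalar[OF h simple_dual[OF Z]] by blast
    have d: "db h (Z \<otimes>\<^sub>o Z\<^bold>*) = smul 1 (sid [h, Z \<otimes>\<^sub>o Z\<^bold>*])"
      using db_tens_scalar[OF ho Zo a b] coev_scalar[OF Z a b] by simp
    fix S f assume "simple_obj C S" "hm f S (Z \<otimes>\<^sub>o Z\<^bold>*)" "f \<noteq> zr S (Z \<otimes>\<^sub>o Z\<^bold>*)"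
    then show "P S"
      using PI d by blast
  qed
  then have "Ad \<subseteq> gen_subcat P"
    using K unfolding adjoint_subcategory_def by blast
  moreover have "S \<in> gen_subcat P \<longleftrightarrow> P S"
    by (rule simple_gen_subcat[OF _ S(1)]) (use iso in blast)
  ultimately have "P S"
    using S(2) by blast
  then show ?thesis
    using ho S(1) unfolding P_def by simp
qed


subsection \<open>The group of invertible objects\<close>

abbreviation G :: "'o set monoid" where "G \<equiv> invertibles C"

abbreviation cl :: "'o \<Rightarrow> 'o set" where "cl X \<equiv> iso_class C X"

lemma cl_eq_iff: "\<lbrakk>X \<in> Obj C; Y \<in> Obj C\<rbrakk> \<Longrightarrow> cl X = cl Y \<longleftrightarrow> isomorphic C X Y"
proof
  assume o: "X \<in> Obj C" "Y \<in> Obj C" and e: "cl X = cl Y"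
  have "Y \<in> cl Y"
    using o isomorphic_refl by (simp add: iso_class_def)
  then show "isomorphic C X Y"
    unfolding e[symmetric] by (simp add: iso_class_def)
next
  assume o: "X \<in> Obj C" "Y \<in> Obj C" and i: "isomorphic C X Y"
  have "isomorphic C X Z \<longleftrightarrow> isomorphic C Y Z" if "Z \<in> Obj C" for Z
    using isomorphic_trans[OF o(1,2) that i] isomorphic_trans[OF o(2,1) that isomorphic_sym[OF o i]] by blast
  then show "cl X = cl Y"
    unfolding iso_class_def by blast
qed

lemma invertibleI:
  assumes o: "X \<in> Obj C" "Z \<in> Obj C" and i: "isomorphic C (X \<otimes>\<^sub>o Z) (UnitO C)"
  shows "invertible_obj C X" "invertible_obj C Z"
proof -
  obtain g where "inverses (bd Z X) g"
    using bd_inverses o by blast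
  then have zx: "isomorphic C (Z \<otimes>\<^sub>o X) (X \<otimes>\<^sub>o Z)"
    by (rule isomorphicI) simp_all
  have "isomorphic C (Z \<otimes>\<^sub>o X) (UnitO C)"
    by (rule isomorphic_trans[OF _ _ _ zx i]) (use o in simp_all)
  then show "invertible_obj C X" "invertible_obj C Z"
    unfolding invertible_obj_def using o i by blast+
qed

lemma invertible_dual:
  assumes g: "invertible_obj C g"
  shows "isomorphic C (g \<otimes>\<^sub>o g\<^bold>*) (UnitO C)" "invertible_obj C (g\<^bold>*)"
proof -
  have s: "simple_obj C g" "g \<in> Obj C"
    using invertible_simple[OF g] by simp_all
  obtain k where k: "inverses (unit_coev g) k"
    using Schur_iso[OF unit_simple invertible_tens_simple[OF g simple_dual[OF s(1)]] hm_unit_coev[OF s(2)] unit_coev_nonzero[OF s(1)]] by blast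
  show i: "isomorphic C (g \<otimes>\<^sub>o g\<^bold>*) (UnitO C)"
    by (rule isomorphicI[OF inverses_sym[OF k]]) (use inversesD[OF k] in \<open>simp_all add: unit_coev_def\<close>)
  show "invertible_obj C (g\<^bold>*)"
    using invertibleI(2)[OF s(2) _ i] s(2) by simp
qed

lemma invertible_tens:
  assumes X: "invertible_obj C X" and Y: "invertible_obj C Y"
  shows "invertible_obj C (X \<otimes>\<^sub>o Y)"
proof -
  have o [simp]: "X \<in> Obj C" "Y \<in> Obj C"
    using X Y invertible_Obj by auto
  let ?I = "UnitO C"
  have 1: "isomorphic C ((Y \<otimes>\<^sub>o Y\<^bold>*) \<otimes>\<^sub>o X\<^bold>*) (?I \<otimes>\<^sub>o X\<^bold>*)"
    by (rule tens_isomorphic[OF _ _ _ _ invertible_dual(1)[OF Y] isomorphic_refl]) simp_all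
  have 2: "isomorphic C ((Y \<otimes>\<^sub>o Y\<^bold>*) \<otimes>\<^sub>o X\<^bold>*) (X\<^bold>*)"
    by (rule isomorphic_trans[OF _ _ _ 1 unit_left_isomorphic]) simp_all
  have 3: "isomorphic C (Y \<otimes>\<^sub>o Y\<^bold>* \<otimes>\<^sub>o X\<^bold>*) ((Y \<otimes>\<^sub>o Y\<^bold>*) \<otimes>\<^sub>o X\<^bold>*)"
    by (rule isomorphic_sym[OF _ _ assoc_isomorphic]) simp_all
  have 4: "isomorphic C (Y \<otimes>\<^sub>o Y\<^bold>* \<otimes>\<^sub>o X\<^bold>*) (X\<^bold>*)"
    by (rule isomorphic_trans[OF _ _ _ 3 2]) simp_all
  have 5: "isomorphic C (X \<otimes>\<^sub>o Y \<otimes>\<^sub>o Y\<^bold>* \<otimes>\<^sub>o X\<^bold>*) (X \<otimes>\<^sub>o X\<^bold>*)"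
    by (rule tens_isomorphic[OF _ _ _ _ isomorphic_refl 4]) simp_all
  have 6: "isomorphic C (X \<otimes>\<^sub>o Y \<otimes>\<^sub>o Y\<^bold>* \<otimes>\<^sub>o X\<^bold>*) ?I"
    by (rule isomorphic_trans[OF _ _ _ 5 invertible_dual(1)[OF X]]) simp_all
  have "isomorphic C ((X \<otimes>\<^sub>o Y) \<otimes>\<^sub>o Y\<^bold>* \<otimes>\<^sub>o X\<^bold>*) ?I"
    by (rule isomorphic_trans[OF _ _ _ assoc_isomorphic 6]) simp_all
  then show ?thesis
    by (rule invertibleI(1)[rotated 2]) simp_all
qed

lemma carrier_G: "carrier G = cl ` {X. invertible_obj C X}"
  and one_G: "\<one>\<^bsub>G\<^esub> = cl (UnitO C)"
  by (simp_all add: invertibles_def)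

lemma mult_G:
  assumes o: "X \<in> Obj C" "Y \<in> Obj C"
  shows "cl X \<otimes>\<^bsub>G\<^esub> cl Y = cl (X \<otimes>\<^sub>o Y)"
proof -
  have "(\<exists>X'\<in>cl X. \<exists>Y'\<in>cl Y. isomorphic C (X' \<otimes>\<^sub>o Y') Z) \<longleftrightarrow> isomorphic C (X \<otimes>\<^sub>o Y) Z" if Z: "Z \<in> Obj C" for Z
  proof
    assume "\<exists>X'\<in>cl X. \<exists>Y'\<in>cl Y. isomorphic C (X' \<otimes>\<^sub>o Y') Z"
    then obtain X' Y' where a: "X' \<in> Obj C" "isomorphic C X X'" "Y' \<in> Obj C" "isomorphic C Y Y'" "isomorphic C (X' \<otimes>\<^sub>o Y') Z"
      by (auto simp: iso_class_def)
    show "isomorphic C (X \<otimes>\<^sub>o Y) Z"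
      by (rule isomorphic_trans[OF _ _ _ tens_isomorphic[OF o(1) a(1) o(2) a(3) a(2,4)] a(5)]) (use o a Z in simp_all)
  next
    assume "isomorphic C (X \<otimes>\<^sub>o Y) Z"
    moreover have "X \<in> cl X" "Y \<in> cl Y"
      using o isomorphic_refl by (simp_all add: iso_class_def)
    ultimately show "\<exists>X'\<in>cl X. \<exists>Y'\<in>cl Y. isomorphic C (X' \<otimes>\<^sub>o Y') Z"
      by blast
  qed
  then have "{Z \<in> Obj C. \<exists>X'\<in>cl X. \<exists>Y'\<in>cl Y. isomorphic C (X' \<otimes>\<^sub>o Y') Z} = {Z \<in> Obj C. isomorphic C (X \<otimes>\<^sub>o Y) Z}"
    by blast
  then show ?thesis
    by (simp add: invertibles_def iso_class_def[of C "X \<otimes>\<^sub>o Y"])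
qed

lemma group_G: "group G"
proof (rule groupI)
  show "x \<otimes>\<^bsub>G\<^esub> y \<in> carrier G" if "x \<in> carrier G" "y \<in> carrier G" for x y
    using that invertible_tens invertible_Obj by (auto simp: carrier_G mult_G)
  show "\<one>\<^bsub>G\<^esub> \<in> carrier G"
    using invertible_unit by (auto simp: carrier_G one_G)
  show "x \<otimes>\<^bsub>G\<^esub> y \<otimes>\<^bsub>G\<^esub> z = x \<otimes>\<^bsub>G\<^esub> (y \<otimes>\<^bsub>G\<^esub> z)" if xyz: "x \<in> carrier G" "y \<in> carrier G" "z \<in> carrier G" for x y z
  proof -
    obtain X Y Z where "x = cl X" "y = cl Y" "z = cl Z" "X \<in> Obj C" "Y \<in> Obj C" "Z \<in> Obj C"
      using xyz invertible_Obj by (auto simp: carrier_G)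
    then show ?thesis
      using assoc_isomorphic[of X Y Z] by (simp add: mult_G cl_eq_iff)
  qed
  show "\<one>\<^bsub>G\<^esub> \<otimes>\<^bsub>G\<^esub> x = x" if x: "x \<in> carrier G" for x
  proof -
    obtain X where "x = cl X" "X \<in> Obj C"
      using x invertible_Obj by (auto simp: carrier_G)
    then show ?thesis
      using unit_left_isomorphic[of X] by (simp add: one_G mult_G cl_eq_iff)
  qed
  show "\<exists>y\<in>carrier G. y \<otimes>\<^bsub>G\<^esub> x = \<one>\<^bsub>G\<^esub>" if x: "x \<in> carrier G" for x
  proof -
    obtain X where X: "x = cl X" "invertible_obj C X" "X \<in> Obj C"
      using x invertible_Obj by (auto simp: carrier_G)
    then obtain Y where Y: "Y \<in> Obj C" "isomorphic C (X \<otimes>\<^sub>o Y) (UnitO C)" "isomorphic C (Y \<otimes>\<^sub>o X) (UnitO C)"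
      by (auto simp: invertible_obj_def)
    have "invertible_obj C Y"
      using invertibleI(2)[OF X(3) Y(1,2)] .
    then have "cl Y \<in> carrier G"
      by (auto simp: carrier_G)
    moreover have "cl Y \<otimes>\<^bsub>G\<^esub> x = \<one>\<^bsub>G\<^esub>"
      using X Y by (simp add: mult_G one_G cl_eq_iff)
    ultimately show ?thesis
      by blast
  qed
qed

lemma inv_G: "invertible_obj C X \<Longrightarrow> inv\<^bsub>G\<^esub> (cl X) = cl (X\<^bold>*)"
proof -
  assume X: "invertible_obj C X"
  interpret group G
    by (rule group_G)
  have o: "X \<in> Obj C"
    using X invertible_Obj by blast
  have "cl X \<otimes>\<^bsub>G\<^esub> cl (X\<^bold>*) = \<one>\<^bsub>G\<^esub>"
    using o invertible_dual(1)[OF X] by (simp add: mult_G one_G cl_eq_iff)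
  then show ?thesis
    using X invertible_dual(2)[OF X] by (intro inv_equality[OF inv_comm]) (auto simp: carrier_G)
qed

text \<open>Named after the radical of the bicharacter, with which it agrees by
  \<open>radical_in_adjoint\<close> and \<open>invertible_centralizes_adjoint\<close>.\<close>

definition Rd :: "'o set set" where
  "Rd = carrier (invertibles (C\<lparr>Obj := Ad\<rparr>))"

text \<open>The dual serves as inverse and lies in \<open>K\<close>, so invertibility in
  \<open>C\<close> is witnessed inside \<open>K\<close>.\<close>

lemma invertible_sub:
  assumes F: "fusion_subcategory C K"
  shows "invertible_obj (C\<lparr>Obj := K\<rparr>) X \<longleftrightarrow> invertible_obj C X \<and> X \<in> K"
proof
  have s: "K \<subseteq> Obj C"
    using fusion_subcategoryD(1)[OF F] .
  show "invertible_obj C X \<and> X \<in> K" if "invertible_obj (C\<lparr>Obj := K\<rparr>) X"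
    using that s by (auto simp: invertible_obj_def isomorphic_def iso_arr_def)
  assume a: "invertible_obj C X \<and> X \<in> K"
  then have o: "X \<in> Obj C" "X\<^bold>* \<in> K"
    using s fusion_subcategoryD(4)[OF F] by auto
  have 1: "isomorphic C (X \<otimes>\<^sub>o X\<^bold>*) (UnitO C)"
    using invertible_dual(1) a by blast
  obtain g where "inverses (bd (X\<^bold>*) X) g"
    using bd_inverses[of "X\<^bold>*" X] o by auto
  then have zx: "isomorphic C (X\<^bold>* \<otimes>\<^sub>o X) (X \<otimes>\<^sub>o X\<^bold>*)"
    by (rule isomorphicI) simp_all
  have "isomorphic C (X\<^bold>* \<otimes>\<^sub>o X) (UnitO C)"
    by (rule isomorphic_trans[OF _ _ _ zx 1]) (use o in simp_all)
  then show "invertible_obj (C\<lparr>Obj := K\<rparr>) X"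
    using a o 1 unfolding invertible_obj_def isomorphic_def iso_arr_def by auto
qed

lemma Rd_eq: "Rd = cl ` {X. invertible_obj C X \<and> X \<in> Ad}"
proof -
  note F = fusion_subcategory_adjoint
  have "iso_class (C\<lparr>Obj := Ad\<rparr>) X = cl X" if X: "X \<in> Ad" for X
    using fusion_subcategory_isomorphic[OF F X] fusion_subcategoryD(1)[OF F]
    by (auto simp: iso_class_def isomorphic_def iso_arr_def)
  then show ?thesis
    unfolding Rd_def by (auto simp: invertibles_def invertible_sub[OF F])
qed

lemma subgroup_Rd: "subgroup Rd G"
proof -
  interpret group G
    by (rule group_G)
  note F = fusion_subcategory_adjoint
  show ?thesis
  proof (rule subgroupI)
    show "Rd \<subseteq> carrier G"
      by (auto simp: Rd_eq carrier_G)
    show "Rd \<noteq> {}"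
      using invertible_unit fusion_subcategoryD(2)[OF F] by (auto simp: Rd_eq)
    show "inv\<^bsub>G\<^esub> x \<in> Rd" if "x \<in> Rd" for x
      using that invertible_dual(2) fusion_subcategoryD(4)[OF F] by (auto simp: Rd_eq inv_G)
    show "x \<otimes>\<^bsub>G\<^esub> y \<in> Rd" if "x \<in> Rd" "y \<in> Rd" for x y
      using that invertible_tens invertible_Obj fusion_subcategoryD(3)[OF F] by (auto simp: Rd_eq mult_G)
  qed
qed


subsection \<open>Pointed subcategories\<close>

definition inv_in :: "'o set set \<Rightarrow> 'o \<Rightarrow> bool" where
  "inv_in W S \<longleftrightarrow> invertible_obj C S \<and> cl S \<in> W"

lemma inv_in_isomorphic: "\<lbrakk>inv_in W S; simple_obj C T; isomorphic C S T\<rbrakk> \<Longrightarrow> inv_in W T"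
  using invertible_isomorphic[of S T] cl_eq_iff[of S T] invertible_Obj[of S] unfolding inv_in_def by simp

lemma fusion_subcategory_inv_in:
  assumes W: "subgroup W G"
  shows "fusion_subcategory C (gen_subcat (inv_in W))"
proof (rule fusion_subcategory_gen)
  show "simple_obj C S" if "inv_in W S" for S
    using that invertible_simple by (simp add: inv_in_def)
  show "inv_in W (UnitO C)"
    using subgroup.one_closed[OF W] invertible_unit by (simp add: inv_in_def one_G)
  show "inv_in W T" if "inv_in W S" "simple_obj C T" "isomorphic C S T" for S T
    using inv_in_isomorphic that by blast
  show "inv_in W S" if a: "inv_in W A" "inv_in W B" "simple_obj C S" "hm f S (A \<otimes>\<^sub>o B)" "f \<noteq> zr S (A \<otimes>\<^sub>o B)" for A B S f
  proof -
    have AB: "invertible_obj C A" "invertible_obj C B" "A \<in> Obj C" "B \<in> Obj C"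
      using a invertible_Obj by (auto simp: inv_in_def)
    have t: "invertible_obj C (A \<otimes>\<^sub>o B)"
      using invertible_tens AB by blast
    have "cl (A \<otimes>\<^sub>o B) \<in> W"
      using subgroup.m_closed[OF W, of "cl A" "cl B"] a(1,2) AB by (simp add: inv_in_def mult_G)
    then have w: "inv_in W (A \<otimes>\<^sub>o B)"
      using t by (simp add: inv_in_def)
    obtain g where g: "inverses f g"
      using Schur_iso[OF a(3) invertible_simple[OF t] a(4,5)] by blast
    have "isomorphic C (A \<otimes>\<^sub>o B) S"
      by (rule isomorphicI[OF inverses_sym[OF g]]) (use a(4) inversesD[OF g] in \<open>auto simp: hm_def\<close>)
    then show ?thesis
      using inv_in_isomorphic[OF w a(3)] by blast
  qed
  show "inv_in W (A\<^bold>*)" if "inv_in W A" for A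
    using that subgroup.m_inv_closed[OF W, of "cl A"] invertible_dual(2) by (simp add: inv_in_def inv_G)
qed

text \<open>A simple constituent that centralizes \<open>W\<close> also centralizes
  \<open>Rd\<close>, hence every invertible object by \<open>span\<close>. It then lies in
  \<open>Ad\<close>, so its class is in \<open>W \<inter> Rd\<close> and it is the unit.\<close>

lemma modular_inv_in:
  assumes W: "subgroup W G" and int: "W \<inter> Rd = {\<one>\<^bsub>G\<^esub>}"
    and span: "\<And>x. x \<in> carrier G \<Longrightarrow> \<exists>w\<in>W. \<exists>r\<in>Rd. x = w \<otimes>\<^bsub>G\<^esub> r"
  shows "modular_subcategory C (gen_subcat (inv_in W))"
proof -
  let ?K = "gen_subcat (inv_in W)"
  note F = fusion_subcategory_inv_in[OF W]
  have sub: "?K \<subseteq> Obj C"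
    using fusion_subcategoryD(1)[OF F] .
  have inK: "S \<in> ?K" if "inv_in W S" for S
    using simple_gen_subcat[of "inv_in W" S, OF inv_in_isomorphic] that invertible_simple by (simp add: inv_in_def)
  have "V \<in> Vec_subcategory C" if V: "V \<in> ?K" "V \<in> centralizer C ?K" for V
  proof -
    have Vo: "V \<in> Obj C"
      using V sub by blast
    obtain Ys i p where Ys: "dsum V Ys i p" "\<And>Y. Y \<in> set Ys \<Longrightarrow> simple_obj C Y"
      using semisimple_dsum[OF Vo] by blast
    have iso: "isomorphic C (Ys ! a) (UnitO C)" if a: "a < length Ys" for a
    proof -
      let ?S = "Ys ! a"
      have S: "simple_obj C ?S" "?S \<in> Obj C"
        using Ys(2) a by simp_all
      have SW: "inv_in W ?S"
        using gen_subcat_summand[OF V(1) Ys(1) a S(1)] .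
      then have Si: "invertible_obj C ?S"
        by (simp add: inv_in_def)
      \<comment> \<open>The inclusion of the summand carries the trivial double braiding with
        \<open>V\<close> over to \<open>?S\<close>.\<close>
      have w: "db h ?S = smul 1 (sid [h, ?S])" if h: "inv_in W h" for h
      proof -
        have ho: "h \<in> Obj C" "invertible_obj C h"
          using h invertible_Obj by (auto simp: inv_in_def)
        obtain c where c: "db h ?S = smul c (sid [h, ?S])"
          using db_scalar[OF ho(2) S(1)] by blast
        have "db h V = smul 1 (sid [h, V])"
          using V(2) inK[OF h] ho Vo unfolding centralizer_iff[OF sub] by simp
        then have "c = 1"
          by (rule db_scalar_eq[OF ho(2) dsumD(4)[OF Ys(1) a] dsum_inclusion_nonzero[OF Ys(1) a simple_nz[OF S(1)]] c])
        then show ?thesis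
          using c by simp
      qed
      \<comment> \<open>Up to isomorphism \<open>h\<close> is \<open>X \<otimes>\<^sub>o Y\<close>
        with \<open>X\<close> from \<open>W\<close> and \<open>Y\<close> from \<open>Rd\<close>.
        Symmetry puts \<open>?S\<close> into the first argument, where the scalars of
        \<open>X\<close> and \<open>Y\<close> multiply.\<close>
      have "db h ?S = sid [h, ?S]" if h: "invertible_obj C h" for h
      proof -
        have ho: "h \<in> Obj C"
          using h invertible_Obj by blast
        obtain x y where xy: "x \<in> W" "y \<in> Rd" "cl h = x \<otimes>\<^bsub>G\<^esub> y"
          using span[of "cl h"] h by (auto simp: carrier_G)
        obtain X where X: "x = cl X" "invertible_obj C X" "X \<in> Obj C"
          using xy(1) subgroup.subset[OF W] invertible_Obj by (auto simp: carrier_G)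
        obtain Y where Y: "y = cl Y" "invertible_obj C Y" "Y \<in> Ad" "Y \<in> Obj C"
          using xy(2) invertible_Obj by (auto simp: Rd_eq)
        have 1: "db ?S X = smul 1 (sid [?S, X])"
          using db_sym[OF X(3) S(2)] w[of X] X xy(1) S(2) by (simp add: inv_in_def)
        have 2: "db ?S Y = smul 1 (sid [?S, Y])"
          using invertible_centralizes_adjoint[OF Si invertible_simple[OF Y(2)] Y(3)] S(2) Y(4) by simp
        have i: "isomorphic C (X \<otimes>\<^sub>o Y) h"
          using xy(3) X Y ho cl_eq_iff[of h "X \<otimes>\<^sub>o Y"] isomorphic_sym[of h "X \<otimes>\<^sub>o Y"] by (simp add: mult_G)
        obtain f g where fg: "inverses f g" "dm f = X \<otimes>\<^sub>o Y" "cd f = h"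
          using isomorphicE[OF i] X Y ho by auto
        obtain c where c: "db ?S h = smul c (sid [?S, h])"
          using db_scalar[OF Si invertible_simple[OF h]] by blast
        have hf: "hm f (X \<otimes>\<^sub>o Y) h"
          using fg inversesD(1)[OF fg(1)] by (simp add: hm_def)
        have "f \<noteq> zr (X \<otimes>\<^sub>o Y) h"
          using inverses_nonzero[OF fg(1)] fg simple_nz[OF invertible_simple[OF invertible_tens[OF X(2) Y(2)]]] by simp
        then have "c = 1"
          using db_scalar_eq[OF Si hf _ db_tens_scalar[OF S(2) X(3) Y(4) 1 2] c] by simp
        then show ?thesis
          using db_sym[OF S(2) ho] c S(2) ho by simp
      qed
      then have "?S \<in> Ad"
        using radical_in_adjoint[OF Si] by blast
      then have "cl ?S \<in> W \<inter> Rd"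
        using SW Si by (auto simp: inv_in_def Rd_eq)
      then show ?thesis
        unfolding int one_G using cl_eq_iff[OF S(2) UnitO_Obj] by blast
    qed
    have "set (replicate (length Ys) (UnitO C)) \<subseteq> Obj C"
      by (simp add: set_replicate_conv_if)
    then have "\<exists>i' p'. dsum V (replicate (length Ys) (UnitO C)) i' p'"
      using iso by (intro dsum_replace[OF Ys(1)]) simp_all
    then show ?thesis
      unfolding Vec_subcategory_def using dsum_direct_sum by blast
  qed
  moreover have "V \<in> ?K \<and> V \<in> centralizer C ?K" if V: "V \<in> Vec_subcategory C" for V
  proof -
    obtain n where n: "direct_sum C V (replicate n (UnitO C))"
      using V by (auto simp: Vec_subcategory_def)
    obtain i p where d: "dsum V (replicate n (UnitO C)) i p"
      using direct_sum_dsum[OF n] by blast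
    have "set (replicate n (UnitO C)) \<subseteq> ?K"
      using fusion_subcategoryD(2)[OF F] by (simp add: set_replicate_conv_if)
    then have "V \<in> ?K"
      using fusion_subcategoryD(5)[OF F _ n] by blast
    moreover have "db X V = sid [X, V]" if "X \<in> ?K" for X
    proof -
      have X: "X \<in> Obj C"
        using that sub by blast
      show ?thesis
        by (rule db_dsum[OF X d]) (simp add: db_sym[OF UnitO_Obj X db_unit_left[OF X]])
    qed
    ultimately show ?thesis
      unfolding centralizer_iff[OF sub] using sub by blast
  qed
  ultimately show ?thesis
    unfolding modular_subcategory_def using F by blast
qed

end

section \<open>Frobenius-Perron dimensions of pointed subcategories\<close>

text \<open>For an eigenvector with eigenvalue \<open>x \<ge> 0\<close>, absolute values satisfy
  \<open>\<bar>v $ j\<bar> = x * \<bar>v $ s j\<bar>\<close>; summing over the permutation gives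
  \<open>x = 1\<close>. The vector of ones shows that 1 occurs.\<close>

lemma permutation_mat_eigenvalues:
  fixes s :: "nat \<Rightarrow> nat"
  assumes n: "n > 0" and inj: "inj_on s {..<n}" and s: "s ` {..<n} \<subseteq> {..<n}"
  shows "{x. 0 \<le> x \<and> eigenvalue (mat n n (\<lambda>(k, j). if k = s j then 1 else (0::real))) x} = {1}"
proof -
  define A where "A = mat n n (\<lambda>(k, j). if k = s j then 1 else (0::real))"
  have sb: "s ` {..<n} = {..<n}"
    using endo_inj_surj[OF _ s inj] by simp
  have Av: "(A *\<^sub>v v) $ s j = v $ j" if v: "dim_vec v = n" and j: "j < n" for v j
  proof -
    have "s j < n"
      using s j by auto
    then have "(A *\<^sub>v v) $ s j = (\<Sum>i<n. (if s j = s i then 1 else 0) * v $ i)"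
      using v by (simp add: A_def scalar_prod_def lessThan_atLeast0)
    also have "\<dots> = (\<Sum>i<n. if i = j then v $ i else 0)"
      by (rule sum.cong) (use inj j in \<open>auto simp: inj_on_def\<close>)
    finally show ?thesis
      using j by simp
  qed
  have "x = 1" if x: "0 \<le> x" "eigenvalue A x" for x
  proof -
    obtain v where v: "dim_vec v = n" "v \<noteq> 0\<^sub>v n" "A *\<^sub>v v = x \<cdot>\<^sub>v v"
      using x(2) unfolding eigenvalue_def eigenvector_def by (metis A_def carrier_vecD dim_row_mat(1))
    have "\<bar>v $ j\<bar> = x * \<bar>v $ s j\<bar>" if j: "j < n" for j
    proof -
      have "s j < n"
        using s j by auto
      then have "v $ j = x * v $ s j"
        using Av[OF v(1) j] v by simp
      then show ?thesis
        using x(1) by (simp add: abs_mult)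
    qed
    then have "(\<Sum>j<n. \<bar>v $ j\<bar>) = x * (\<Sum>j<n. \<bar>v $ s j\<bar>)"
      by (simp add: sum_distrib_left)
    also have "(\<Sum>j<n. \<bar>v $ s j\<bar>) = (\<Sum>j<n. \<bar>v $ j\<bar>)"
      using sum.reindex[OF inj, of "\<lambda>j. \<bar>v $ j\<bar>"] sb by simp
    finally have e: "(\<Sum>j<n. \<bar>v $ j\<bar>) = x * (\<Sum>j<n. \<bar>v $ j\<bar>)" .
    have "(\<Sum>j<n. \<bar>v $ j\<bar>) \<noteq> 0"
    proof
      assume "(\<Sum>j<n. \<bar>v $ j\<bar>) = 0"
      then have "\<And>j. j < n \<Longrightarrow> v $ j = 0"
        by (simp add: sum_nonneg_eq_0_iff)
      then show False
        using v by (auto intro!: eq_vecI)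
    qed
    then show ?thesis
      using e by simp
  qed
  moreover have "eigenvalue A 1"
    unfolding eigenvalue_def eigenvector_def
  proof (intro exI conjI)
    let ?o = "vec n (\<lambda>_. 1::real)"
    show "?o \<in> carrier_vec (dim_row A)"
      by (simp add: A_def)
    show "?o \<noteq> 0\<^sub>v (dim_row A)"
      using n by (metis A_def dim_row_mat(1) index_vec index_zero_vec(1) zero_neq_one)
    show "A *\<^sub>v ?o = 1 \<cdot>\<^sub>v ?o"
    proof (rule eq_vecI)
      show "dim_vec (A *\<^sub>v ?o) = dim_vec (1 \<cdot>\<^sub>v ?o)"
        by (simp add: A_def)
      fix k assume "k < dim_vec (1 \<cdot>\<^sub>v ?o)"
      then have k: "k < n"
        by simp
      then obtain j where j: "j < n" "k = s j"
        using sb by (metis imageE lessThan_iff)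
      then show "(A *\<^sub>v ?o) $ k = (1 \<cdot>\<^sub>v ?o) $ k"
        using Av[of ?o j] k by simp
    qed
  qed
  ultimately show ?thesis
    unfolding A_def by auto
qed

section \<open>Hom-spaces and simple objects of full subcategories\<close>

context ac_modular_category
begin

lemma dim_hom_simple:
  assumes S: "simple_obj C S" and T: "simple_obj C T"
  shows "vectorspace.dim class_ring (Hom C S T) = (if isomorphic C S T then 1 else 0)"
proof -
  have o: "S \<in> Obj C" "T \<in> Obj C"
    using S T by simp_all
  interpret V: vectorspace "class_ring :: 'k ring" "Hom C S T"
    by (rule hom_vectorspace[OF o])
  show ?thesis
  proof (cases "isomorphic C S T")
    case False
    have "f = \<zero>\<^bsub>Hom C S T\<^esub>" if f: "f \<in> arr C S T" for f
    proof -
      have "Arw S T f = zr S T"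
        by (rule Schur_zero[OF S T False hm_ArwI[OF o f]])
      then show ?thesis
        by (simp add: zr_def o)
    qed
    then have "V.span {\<zero>\<^bsub>Hom C S T\<^esub>} = arr C S T"
      using V.span_is_subset2[of "{\<zero>\<^bsub>Hom C S T\<^esub>}"] V.span_zero by auto
    then show ?thesis
      using V.dim0I False by simp
  next
    case True
    obtain f g where fg: "inverses f g" "dm f = S" "cd f = T"
      using isomorphicE[OF True o] .
    have f: "hm f S T" "hm g T S"
      using fg inversesD[OF fg(1)] by (auto simp: hm_def)
    let ?v = "mp f"
    have v: "?v \<in> arr C S T"
      by (rule hm_mp[OF f(1)])
    have nz: "?v \<noteq> \<zero>\<^bsub>Hom C S T\<^esub>"
    proof
      assume "?v = \<zero>\<^bsub>Hom C S T\<^esub>"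
      then have "f = zr S T"
        using hm_Arw[OF f(1)] o by (simp add: zr_def)
      then show False
        using inverses_nonzero[OF fg(1)] simple_nz[OF S] fg by simp
    qed
    have "h \<in> V.span {?v}" if h: "h \<in> arr C S T" for h
    proof -
      have H: "hm (Arw S T h) S T"
        by (rule hm_ArwI[OF o h])
      obtain c where c: "g \<star> Arw S T h = sc c (idn S)"
        using Schur_scalar[OF S hm_cmp[OF f(2) H]] by blast
      have "Arw S T h = f \<star> (g \<star> Arw S T h)"
        using inversesD(8)[OF fg(1), of "Arw S T h"] H fg by (simp add: hm_def)
      also have "\<dots> = sc c f"
        unfolding c using f(1) o by (simp add: cmp_sc hm_def)
      finally have "h = mp (sc c f)"
        by (metis arw.sel(3))
      then have "h = V.lincomb (\<lambda>_. c) {?v}"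
        using v f(1) by (simp add: V.lincomb_def mp_sc hm_def)
      then show ?thesis
        using V.finite_span[of "{?v}"] v by (auto simp: class_ring_simps)
    qed
    then have "V.span {?v} = arr C S T"
      using V.span_is_subset2[of "{?v}"] v by auto
    then show ?thesis
      using V.dim1I[OF _ nz v] True by simp
  qed
qed

lemma isomorphic_sub [simp]: "isomorphic (C\<lparr>Obj := K\<rparr>) X Y \<longleftrightarrow> isomorphic C X Y"
  by (simp add: isomorphic_def iso_arr_def)

text \<open>In the subcategory there are fewer subobjects, but also fewer objects against which
  monomorphisms are tested. Semisimplicity reconciles the two, because simple summands of objects of
  \<open>K\<close> lie in \<open>K\<close>.\<close>

lemma simple_sub:
  assumes F: "fusion_subcategory C K"
  shows "simple_obj (C\<lparr>Obj := K\<rparr>) S \<longleftrightarrow> simple_obj C S \<and> S \<in> K"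
proof
  let ?C = "C\<lparr>Obj := K\<rparr>"
  have sub: "K \<subseteq> Obj C"
    using fusion_subcategoryD(1)[OF F] .
  have zero: "zero_obj ?C X \<longleftrightarrow> zero_obj C X" if X: "X \<in> K" for X
  proof
    have o: "X \<in> Obj C"
      using X sub by blast
    show "zero_obj ?C X" if "zero_obj C X"
      using that X sub unfolding zero_obj_def by (simp add: subset_iff)
    assume "zero_obj ?C X"
    then have "\<exists>!f. f \<in> arr C X X"
      using X by (auto simp: zero_obj_def)
    then have "Ident C X = \<zero>\<^bsub>Hom C X X\<^esub>"
      using hm_mp[of "idn X" X X] hm_mp[of "zr X X" X X] o by (auto simp: mp_idn mp_zr)
    then show "zero_obj C X"
      using o by (simp add: zero_obj_iff idn_def zr_def)
  qed
  show "simple_obj C S \<and> S \<in> K" if S: "simple_obj ?C S"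
  proof -
    have SK: "S \<in> K"
      using S unfolding simple_obj_def by simp
    then have So: "S \<in> Obj C"
      using sub by blast
    have nz: "idn S \<noteq> zr S S"
      using S zero[OF SK] zero_obj_iff[OF So] by (simp add: simple_obj_def)
    obtain Ys i p where d: "dsum S Ys i p" and s: "\<And>Y. Y \<in> set Ys \<Longrightarrow> simple_obj C Y"
      using semisimple_dsum[OF So] by blast
    obtain a where a: "a < length Ys"
      using dsum_detect[OF d _ nz] So by (metis hm_idn)
    have sa: "simple_obj C (Ys ! a)"
      using s a by simp
    note ia = dsumD(4)[OF d a]
    have m: "mono (i a)"
      by (rule mono_from_simple[OF sa ia dsum_inclusion_nonzero[OF d a simple_nz[OF sa]]])
    have aK: "Ys ! a \<in> K"
      using fusion_subcategory_mono[OF F m] ia SK by (simp add: hm_def)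
    have "mono_arr C (Ys ! a) S (mp (i a))"
      using mono_mono_arr[of "Ys ! a" S "mp (i a)"] m hm_Arw[OF ia] hm_objs[OF ia] by simp
    then have "mono_arr ?C (Ys ! a) S (mp (i a))"
      using sub unfolding mono_arr_def by auto
    then have "zero_obj ?C (Ys ! a) \<or> iso_arr ?C (Ys ! a) S (mp (i a))"
      using S aK unfolding simple_obj_def by simp
    moreover have "\<not> zero_obj ?C (Ys ! a)"
      using zero[OF aK] sa unfolding simple_obj_def by blast
    ultimately have "isomorphic C (Ys ! a) S"
      unfolding isomorphic_def iso_arr_def by auto
    then show ?thesis
      using simple_isomorphic[OF sa So] SK by blast
  qed
  assume S: "simple_obj C S \<and> S \<in> K"
  then have So: "S \<in> Obj C"
    by simp
  have "iso_arr ?C Y S f" if Y: "Y \<in> K" "mono_arr ?C Y S f" "\<not> zero_obj ?C Y" for Y f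
  proof -
    have Yo: "Y \<in> Obj C"
      using Y sub by blast
    let ?f = "Arw Y S f"
    have hf: "hm ?f Y S"
      using Y So Yo by (auto simp: mono_arr_def hm_ArwI)
    \<comment> \<open>A monomorphism of the subcategory cancels only on maps out of objects of
      \<open>K\<close>, hence the membership checks below.\<close>
    have canc: "g = h" if W: "W \<in> K" and gh: "hm g W Y" "hm h W Y" "?f \<star> g = ?f \<star> h" for W g h
    proof -
      have "f \<cdot> mp g = f \<cdot> mp h"
        using gh hf mp_cmp[of ?f g] mp_cmp[of ?f h] by (simp add: hm_def)
      then have "mp g = mp h"
        using Y(2) W hm_mp[OF gh(1)] hm_mp[OF gh(2)] unfolding mono_arr_def by auto
      then show ?thesis
        using gh by (auto intro: ar_eqI simp: hm_def)
    qed
    have nz: "idn Y \<noteq> zr Y Y"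
      using zero[OF Y(1)] Y(3) zero_obj_iff[OF Yo] by blast
    obtain Ys i p where d: "dsum Y Ys i p" and s: "\<And>Z. Z \<in> set Ys \<Longrightarrow> simple_obj C Z"
      using semisimple_dsum[OF Yo] by blast
    obtain a where a: "a < length Ys"
      using dsum_detect[OF d _ nz] Yo by (metis hm_idn)
    have sa: "simple_obj C (Ys ! a)"
      using s a by simp
    note ia = dsumD(4)[OF d a]
    have in0: "i a \<noteq> zr (Ys ! a) Y"
      by (rule dsum_inclusion_nonzero[OF d a simple_nz[OF sa]])
    have aK: "Ys ! a \<in> K"
      using fusion_subcategory_mono[OF F mono_from_simple[OF sa ia in0]] ia Y(1) by (simp add: hm_def)
    have "?f \<star> i a \<noteq> zr (Ys ! a) S"
    proof
      assume "?f \<star> i a = zr (Ys ! a) S"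
      then have "?f \<star> i a = ?f \<star> zr (Ys ! a) Y"
        using cmp_zr[of ?f Y "Ys ! a"] hf hm_objs[OF ia] by (simp add: hm_def)
      then show False
        using canc[OF aK ia] in0 hm_objs[OF ia] by simp
    qed
    \<comment> \<open>A simple summand of \<open>Y\<close> maps isomorphically onto
      \<open>S\<close>. The inverse yields a section \<open>?r\<close> of \<open>?f\<close>, and
      cancelling \<open>?f\<close> makes it an inverse.\<close>
    then obtain g where g: "inverses (?f \<star> i a) g"
      using Schur_iso[OF sa conjunct1[OF S] hm_cmp[OF hf ia]] by blast
    have hg: "hm g S (Ys ! a)"
      using inversesD[OF g] hm_cmp[OF hf ia] by (simp add: hm_def)
    let ?r = "i a \<star> g"
    have hr: "hm ?r S Y"
      by (rule hm_cmp[OF ia hg])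
    have "cd (?f \<star> i a) = S"
      using hm_cmp[OF hf ia] unfolding hm_def by blast
    then have fr: "?f \<star> ?r = idn S"
      using inversesD(6)[OF g] unfolding cmp_assoc by simp
    have "?f \<star> (?r \<star> ?f) = (?f \<star> ?r) \<star> ?f"
      by (rule cmp_assoc[symmetric])
    also have "\<dots> = ?f \<star> idn Y"
      unfolding fr using hf So Yo by (simp add: hm_def)
    finally have rf: "?r \<star> ?f = idn Y"
      using canc[OF Y(1) hm_cmp[OF hr hf] iffD2[OF hm_idn, OF conjI[OF refl conjI[OF refl Yo]]]] by blast
    have "inverses ?f ?r"
      using hf hr fr rf by (simp add: inverses_def hm_def)
    then have "iso_arr C Y S f"
      using iso_arr_inverses[OF Yo So] by blast
    then show ?thesis
      by (simp add: iso_arr_def)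
  qed
  then have "\<forall>Y\<in>K. \<forall>f. mono_arr ?C Y S f \<longrightarrow> zero_obj ?C Y \<or> iso_arr ?C Y S f"
    by blast
  moreover have "\<not> zero_obj ?C S"
    using zero[of S] S unfolding simple_obj_def by blast
  moreover have "Obj ?C = K"
    by simp
  ultimately show "simple_obj ?C S"
    unfolding simple_obj_def using S by metis
qed

lemma distinct_L: "distinct L"
  unfolding distinct_conv_nth using L_inj isomorphic_refl simple_Obj[OF L_simple] by metis

lemma simple_reps_sub:
  assumes F: "fusion_subcategory C K"
  shows "simple_reps (C\<lparr>Obj := K\<rparr>) (simples (C\<lparr>Obj := K\<rparr>))"
proof -
  \<comment> \<open>Since \<open>simples\<close> is a choice, some list of representatives must be
    exhibited: the members of \<open>L\<close> that lie in \<open>K\<close>.\<close>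
  let ?C = "C\<lparr>Obj := K\<rparr>" and ?M = "filter (\<lambda>X. X \<in> K) L"
  have "simple_reps ?C ?M"
    unfolding simple_reps_def
  proof (intro conjI ballI allI impI)
    show "simple_obj ?C X" if "X \<in> set ?M" for X
      using that by (auto simp: simple_sub[OF F] in_set_conv_nth)
    fix X assume "simple_obj ?C X"
    then have X: "simple_obj C X" "X \<in> K"
      by (auto simp: simple_sub[OF F])
    obtain i where i: "i < length L" "isomorphic C X (L ! i)"
      using L_ex[OF X(1)] by blast
    have "L ! i \<in> K"
      by (rule fusion_subcategory_isomorphic[OF F X(2) _ i(2)]) (use i in simp)
    then have "L ! i \<in> set ?M"
      using i by simp
    then obtain a where a: "a < length ?M" "?M ! a = L ! i"
      by (metis in_set_conv_nth)
    show "\<exists>!a. a < length ?M \<and> isomorphic ?C X (?M ! a)"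
    proof (rule ex1I[of _ a])
      show "a < length ?M \<and> isomorphic ?C X (?M ! a)"
        using a i by simp
      fix b assume b: "b < length ?M \<and> isomorphic ?C X (?M ! b)"
      then have "?M ! b \<in> set L"
        using nth_mem[of b ?M] by auto
      then obtain j where j: "j < length L" "?M ! b = L ! j"
        by (metis in_set_conv_nth)
      have "j = i"
        by (rule L_unique[OF j(1) i(1) _ i(2)]) (use b j X in auto)
      then have "?M ! b = ?M ! a"
        using a j by simp
      then show "b = a"
        using nth_eq_iff_index_eq[OF distinct_filter[OF distinct_L], of b "\<lambda>X. X \<in> K" a] a b by simp
    qed
  qed
  then show ?thesis
    unfolding simples_def by (rule someI)
qed

section \<open>The pointed subcategory of a subgroup of invertible objects\<close>

context
  fixes W :: "'o set set"
  assumes W: "subgroup W G"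
begin

abbreviation "K\<^sub>W \<equiv> gen_subcat (inv_in W)"
abbreviation "C\<^sub>W \<equiv> C\<lparr>Obj := K\<^sub>W\<rparr>"
abbreviation "M \<equiv> simples C\<^sub>W"

lemma simple_inv_in: "simple_obj C\<^sub>W S \<longleftrightarrow> inv_in W S"
proof -
  have "S \<in> K\<^sub>W \<longleftrightarrow> inv_in W S" if "simple_obj C S"
    by (rule simple_gen_subcat[OF _ that]) (use inv_in_isomorphic in blast)
  moreover have "simple_obj C S" if "inv_in W S"
    using that invertible_simple unfolding inv_in_def by blast
  ultimately show ?thesis
    unfolding simple_sub[OF fusion_subcategory_inv_in[OF W]] by blast
qed

lemma pointed_inv_in: "pointed C\<^sub>W"
  unfolding pointed_def invertible_sub[OF fusion_subcategory_inv_in[OF W]]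
  using simple_sub[OF fusion_subcategory_inv_in[OF W]] simple_inv_in unfolding inv_in_def by blast

lemma M_props:
  shows "a < length M \<Longrightarrow> inv_in W (M ! a)"
    and "inv_in W X \<Longrightarrow> \<exists>!a. a < length M \<and> isomorphic C X (M ! a)"
  using simple_reps_sub[OF fusion_subcategory_inv_in[OF W]] unfolding simple_reps_def simple_inv_in isomorphic_sub by auto

lemma M_bij: "bij_betw (\<lambda>a. cl (M ! a)) {..<length M} W"
  unfolding bij_betw_def
proof
  have o: "M ! a \<in> Obj C" if "a < length M" for a
    using M_props(1)[OF that] invertible_Obj unfolding inv_in_def by blast
  show "inj_on (\<lambda>a. cl (M ! a)) {..<length M}"
  proof (rule inj_onI)
    fix a b assume ab: "a \<in> {..<length M}" "b \<in> {..<length M}" "cl (M ! a) = cl (M ! b)"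
    then have "isomorphic C (M ! a) (M ! b)" "isomorphic C (M ! a) (M ! a)"
      using cl_eq_iff o isomorphic_refl by auto
    then show "a = b"
      using M_props(2)[OF M_props(1)[of a]] ab by auto
  qed
  show "(\<lambda>a. cl (M ! a)) ` {..<length M} = W"
  proof
    show "(\<lambda>a. cl (M ! a)) ` {..<length M} \<subseteq> W"
      using M_props(1) by (auto simp: inv_in_def)
    show "W \<subseteq> (\<lambda>a. cl (M ! a)) ` {..<length M}"
    proof
      fix w assume w: "w \<in> W"
      then have "w \<in> carrier G"
        using subgroup.subset[OF W] by blast
      then obtain X where X: "w = cl X" "invertible_obj C X"
        by (auto simp: carrier_G)
      then obtain a where "a < length M" "isomorphic C X (M ! a)"
        using M_props(2)[of X] w by (auto simp: inv_in_def)
      then show "w \<in> (\<lambda>a. cl (M ! a)) ` {..<length M}"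
        using X cl_eq_iff[of X "M ! a"] o[of a] invertible_Obj by auto
    qed
  qed
qed

text \<open>Tensoring with \<open>X\<close> permutes the classes of simple objects by left
  translation in \<open>W\<close>, so its fusion matrix is a permutation matrix.\<close>

lemma FPdim_obj_inv_in:
  assumes X: "inv_in W X"
  shows "FPdim_obj C\<^sub>W X = 1"
proof -
  interpret group G
    by (rule group_G)
  let ?n = "length M"
  have Xi: "invertible_obj C X" "X \<in> Obj C" "cl X \<in> W"
    using X invertible_Obj unfolding inv_in_def by auto
  have Mi: "invertible_obj C (M ! j)" "M ! j \<in> Obj C" "cl (M ! j) \<in> W" if "j < ?n" for j
    using M_props(1)[OF that] invertible_Obj unfolding inv_in_def by auto
  have XM: "inv_in W (X \<otimes>\<^sub>o M ! j)" "cl (X \<otimes>\<^sub>o M ! j) = cl X \<otimes>\<^bsub>G\<^esub> cl (M ! j)" if j: "j < ?n" for j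
  proof -
    show e: "cl (X \<otimes>\<^sub>o M ! j) = cl X \<otimes>\<^bsub>G\<^esub> cl (M ! j)"
      using mult_G[OF Xi(2) Mi(2)[OF j]] by simp
    show "inv_in W (X \<otimes>\<^sub>o M ! j)"
      using invertible_tens[OF Xi(1) Mi(1)[OF j]] subgroup.m_closed[OF W Xi(3) Mi(3)[OF j]] inv_in_def[of W "X \<otimes>\<^sub>o M ! j"] e by simp
  qed
  have "\<forall>j. \<exists>a. j < ?n \<longrightarrow> a < ?n \<and> isomorphic C (X \<otimes>\<^sub>o M ! j) (M ! a)"
    using M_props(2)[OF XM(1)] by blast
  then obtain s where s: "\<And>j. j < ?n \<Longrightarrow> s j < ?n \<and> isomorphic C (X \<otimes>\<^sub>o M ! j) (M ! s j)"
    by metis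
  have XMo: "X \<otimes>\<^sub>o M ! j \<in> Obj C" if "j < ?n" for j
    using Xi(2) Mi(2)[OF that] by simp
  have cs: "cl (M ! s j) = cl X \<otimes>\<^bsub>G\<^esub> cl (M ! j)" if j: "j < ?n" for j
    using s[OF j] cl_eq_iff[of "X \<otimes>\<^sub>o M ! j" "M ! s j"] XM(2)[OF j] XMo[OF j] Mi(2)[of "s j"] by simp
  have inj: "inj_on s {..<?n}"
  proof (rule inj_onI)
    fix a b assume ab: "a \<in> {..<?n}" "b \<in> {..<?n}" "s a = s b"
    then have "cl X \<otimes>\<^bsub>G\<^esub> cl (M ! a) = cl X \<otimes>\<^bsub>G\<^esub> cl (M ! b)"
      using cs[of a] cs[of b] by simp
    then have "cl (M ! a) = cl (M ! b)"
      using Units_l_cancel[of "cl X" "cl (M ! a)" "cl (M ! b)"] Units_eq ab Mi(3)[of a] Mi(3)[of b] Xi(3) subgroup.subset[OF W]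
      by auto
    then show "a = b"
      using M_bij ab by (auto simp: bij_betw_def inj_on_def)
  qed
  have "vectorspace.dim class_ring (Hom C (M ! k) (X \<otimes>\<^sub>o M ! j)) = (if k = s j then 1 else 0)"
    if kj: "k < ?n" "j < ?n" for k j
  proof -
    have "isomorphic C (M ! k) (X \<otimes>\<^sub>o M ! j) \<longleftrightarrow> cl (M ! k) = cl (M ! s j)"
      using cl_eq_iff[OF Mi(2)[OF kj(1)] XMo[OF kj(2)]] XM(2)[OF kj(2)] cs[OF kj(2)] by simp
    also have "\<dots> \<longleftrightarrow> k = s j"
      using M_bij kj s[OF kj(2)] by (auto simp: bij_betw_def inj_on_def)
    finally show ?thesis
      using dim_hom_simple[of "M ! k" "X \<otimes>\<^sub>o M ! j"] invertible_simple[OF Mi(1)[OF kj(1)]]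
        invertible_simple[of "X \<otimes>\<^sub>o M ! j"] XM(1)[OF kj(2)] by (simp add: inv_in_def)
  qed
  then have "fusion_mat C\<^sub>W X = mat ?n ?n (\<lambda>(k, j). if k = s j then 1 else 0)"
    unfolding fusion_mat_def by (intro eq_matI) auto
  moreover have "?n > 0"
    using M_props(2)[OF X] by auto
  moreover have "s ` {..<?n} \<subseteq> {..<?n}"
    using s by auto
  ultimately show ?thesis
    unfolding FPdim_obj_def using permutation_mat_eigenvalues[OF _ inj] by simp
qed

lemma FPdim_inv_in: "FPdim C\<^sub>W = real (card W)"
proof -
  have "FPdim_obj C\<^sub>W X = 1" if "X \<in> set M" for X
    using that M_props(1) FPdim_obj_inv_in by (metis in_set_conv_nth)
  then have "FPdim C\<^sub>W = (\<Sum>X\<leftarrow>M. 1)"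
    unfolding FPdim_def by (intro arg_cong[where f = sum_list] map_cong) auto
  also have "\<dots> = real (length M)"
    by (simp add: sum_list_triv)
  also have "length M = card W"
    using bij_betw_same_card[OF M_bij] by simp
  finally show ?thesis .
qed

end

end


section \<open>Complements in elementary abelian groups of rank two\<close>

text \<open>Multiplication from \<open>W \<times> R\<close> is injective because the intersection is
  trivial, and the cardinalities then force surjectivity.\<close>

lemma (in group) mult_span:
  assumes W: "subgroup W G" and R: "subgroup R G" and int: "W \<inter> R = {\<one>}"
    and card: "card W * card R = Coset.order G" and fin: "finite (carrier G)" and x: "x \<in> carrier G"
  shows "\<exists>w\<in>W. \<exists>r\<in>R. x = w \<otimes> r"
proof -
  have s: "W \<subseteq> carrier G" "R \<subseteq> carrier G"
    using subgroup.subset W R by auto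
  let ?m = "\<lambda>(w, r). w \<otimes> r"
  have "inj_on ?m (W \<times> R)"
  proof (rule inj_onI, clarify)
    fix w r w' r' assume a: "w \<in> W" "r \<in> R" "w' \<in> W" "r' \<in> R" "w \<otimes> r = w' \<otimes> r'"
    then have c: "w \<in> carrier G" "r \<in> carrier G" "w' \<in> carrier G" "r' \<in> carrier G"
      using s by auto
    have "inv w' \<otimes> w = inv w' \<otimes> (w \<otimes> r) \<otimes> inv r"
      using c by (simp add: m_assoc)
    also have "\<dots> = inv w' \<otimes> (w' \<otimes> r') \<otimes> inv r"
      by (simp only: a(5))
    also have "\<dots> = r' \<otimes> inv r"
      using c by (simp flip: m_assoc)
    finally have e: "inv w' \<otimes> w = r' \<otimes> inv r" .
    have "inv w' \<otimes> w \<in> W"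
      using a W by (simp add: subgroup.m_closed subgroup.m_inv_closed)
    moreover have "inv w' \<otimes> w \<in> R"
      unfolding e using a R by (simp add: subgroup.m_closed subgroup.m_inv_closed)
    ultimately have 1: "inv w' \<otimes> w = \<one>"
      using int by blast
    have "w = w'"
      using 1 c by (metis inv_equality inv_inv inv_closed)
    moreover have "r = r'"
      using a(5) c calculation by simp
    ultimately show "w = w' \<and> r = r'"
      by blast
  qed
  then have "card (?m ` (W \<times> R)) = card (carrier G)"
    using card by (simp add: card_image card_cartesian_product Coset.order_def)
  moreover have "?m ` (W \<times> R) \<subseteq> carrier G"
    using s by auto
  ultimately have "?m ` (W \<times> R) = carrier G"
    using card_subset_eq[OF fin] by blast
  then have "x \<in> ?m ` (W \<times> R)"
    using x by simp
  then show ?thesis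
    by auto
qed

text \<open>The order of \<open>R\<close> is 1, \<open>p\<close> or the square of \<open>p\<close>.
  In the middle case any \<open>g\<close> outside \<open>R\<close> generates a complement, since
  nontrivial elements have order \<open>p\<close>.\<close>

lemma (in group) complement_exists:
  assumes p: "Factorial_Ring.prime p" and order: "Coset.order G = p\<^sup>2" and exp: "\<And>x. x \<in> carrier G \<Longrightarrow> x [^] p = \<one>"
    and R: "subgroup R G"
  shows "\<exists>W. subgroup W G \<and> W \<inter> R = {\<one>} \<and> card W * card R = Coset.order G"
proof -
  have "Coset.order G \<noteq> 0"
    using order p by auto
  then have fin: "finite (carrier G)"
    by (auto simp: Coset.order_def intro: card_ge_0_finite)
  have Rs: "R \<subseteq> carrier G" "\<one> \<in> R"
    using subgroup.subset[OF R] subgroup.one_closed[OF R] by auto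
  have "card R dvd p\<^sup>2"
    using lagrange[OF R] order by (metis dvd_triv_right)
  then obtain i where i: "i \<le> 2" "card R = p ^ i"
    using divides_primepow_nat[OF p] by blast
  consider "card R = 1" | "card R = p\<^sup>2" | "card R = p"
    using i by (metis One_nat_def le_Suc_eq le_zero_eq numeral_2_eq_2 power_0 power_one_right)
  then show ?thesis
  proof cases
    case 1
    then have "R = {\<one>}"
      using Rs(2) by (metis card_1_singletonE singletonD)
    then show ?thesis
      using subgroup_self 1 by (intro exI[of _ "carrier G"]) (auto simp: Coset.order_def)
  next
    case 2
    then show ?thesis
      using triv_subgroup order Rs by (intro exI[of _ "{\<one>}"]) auto
  next
    case 3
    have pp: "1 < p"
      using p prime_gt_1_nat by blast
    have gen: "card (generate G {x}) = p" if x: "x \<in> carrier G" "x \<noteq> \<one>" for x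
    proof -
      have "ord x dvd p" "ord x \<noteq> 1"
        using exp[OF x(1)] pow_eq_id[OF x(1)] x ord_eq_1[OF x(1)] by auto
      then have "ord x = p"
        using p by (metis prime_nat_iff)
      then show ?thesis
        using generate_pow_card[OF x(1)] by simp
    qed
    have "card R < card (carrier G)"
      using 3 order pp by (simp add: Coset.order_def power2_eq_square)
    then obtain g where g: "g \<in> carrier G" "g \<notin> R"
      using Rs(1) by (metis less_irrefl subsetI subset_antisym)
    let ?W = "generate G {g}"
    have W: "subgroup ?W G"
      using generate_is_subgroup[of "{g}"] g by simp
    have Ws: "?W \<subseteq> carrier G" "g \<in> ?W" "\<one> \<in> ?W"
      using subgroup.subset[OF W] generate.incl[of g "{g}" G] generate.one[of G "{g}"] by auto
    have cW: "card ?W = p"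
      using gen[OF g(1)] g(2) Rs(2) by metis
    have "w = \<one>" if w: "w \<in> ?W" "w \<in> R" for w
    proof (rule ccontr)
      assume n: "w \<noteq> \<one>"
      \<comment> \<open>A nontrivial common element would generate all of \<open>?W\<close> inside
        \<open>R\<close>, which then contains \<open>g\<close>.\<close>
      have "w \<in> carrier G"
        using w Rs by blast
      then have c: "card (generate G {w}) = card ?W"
        using gen n cW by simp
      have "generate G {w} \<subseteq> ?W" "generate G {w} \<subseteq> R"
        using generate_subgroup_incl[of "{w}"] w W R by auto
      moreover have "finite ?W"
        using Ws(1) fin finite_subset by blast
      ultimately have "?W \<subseteq> R"
        using card_subset_eq c by metis
      then show False
        using Ws(2) g(2) by blast
    qed
    then have "?W \<inter> R = {\<one>}"
      using Ws(3) Rs(2) by blast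
    then show ?thesis
      using W cW 3 order by (intro exI[of _ ?W]) (simp add: power2_eq_square)
  qed
qed

text \<open>Powers in the product are taken componentwise, and every \<open>p\<close>-th power in
  the cyclic group of order \<open>p\<close> is trivial.\<close>

lemma exponent_of_iso:
  fixes G :: "('a, 'b) monoid_scheme"
  assumes G: "group G" and iso: "G \<cong> integer_mod_group p \<times>\<times> integer_mod_group p" and x: "x \<in> carrier G"
  shows "x [^]\<^bsub>G\<^esub> p = \<one>\<^bsub>G\<^esub>"
proof -
  let ?Z = "integer_mod_group p"
  let ?H = "?Z \<times>\<times> ?Z"
  interpret G: group G
    by (rule G)
  interpret H: group ?H
    by (rule DirProd_group) simp_all
  obtain h where h: "h \<in> iso G ?H"
    using iso by (auto simp: is_iso_def)
  interpret h: group_hom G ?H h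
    using h by unfold_locales (simp add: Group.iso_def)
  have pow: "y [^]\<^bsub>?H\<^esub> n = (fst y [^]\<^bsub>?Z\<^esub> n, snd y [^]\<^bsub>?Z\<^esub> n)" for y and n :: nat
    by (induction n) (simp_all add: nat_pow_def mult_DirProd')
  have "h (x [^]\<^bsub>G\<^esub> p) = h x [^]\<^bsub>?H\<^esub> p"
    by (rule h.hom_nat_pow[OF x])
  also have "\<dots> = h \<one>\<^bsub>G\<^esub>"
    unfolding pow by simp
  finally show ?thesis
    using h x by (auto simp: Group.iso_def bij_betw_def inj_on_def)
qed

theorem proposition3p17:
  fixes C :: "('o, 'm, 'k::{alg_closed_field, field_char_0}) spcat"
    and p :: nat
  assumes "modular_category C"
    and "FPdim C \<in> \<int>"
    and "prime p" and "odd p"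
    and "Coset.order (invertibles C) = p\<^sup>2"
    and "invertibles C \<cong> integer_mod_group p \<times>\<times> integer_mod_group p"
  shows "\<exists>K. modular_subcategory C K \<and> pointed (C\<lparr>Obj := K\<rparr>) \<and>
    FPdim (C\<lparr>Obj := K\<rparr>) =
      real (card (rcosets\<^bsub>invertibles C\<^esub> carrier (invertibles (C\<lparr>Obj := adjoint_subcategory C\<rparr>))))"
proof -
  interpret ac_modular_category C
    using assms(1) by (rule ac_modular_category.intro)
  interpret G: group G
    by (rule group_G)
  have "Factorial_Ring.prime p"
    using assms(3) .
  then obtain W where W: "subgroup W G" "W \<inter> Rd = {\<one>\<^bsub>G\<^esub>}" "card W * card Rd = Coset.order G"
    using G.complement_exists[OF _ assms(5) _ subgroup_Rd] exponent_of_iso[OF group_G assms(6)] by blast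
  have "Coset.order G \<noteq> 0"
    using assms(3,5) by auto
  then have fin: "finite (carrier G)" and R0: "card Rd \<noteq> 0"
    using W(3) by (auto simp: Coset.order_def intro: card_ge_0_finite intro!: Nat.gr0I)
  \<comment> \<open>Lagrange's theorem and the complement give two factorisations of the group order
    with the common factor \<open>card Rd\<close>.\<close>
  have "card (rcosets\<^bsub>G\<^esub> Rd) * card Rd = card W * card Rd"
    using G.lagrange[OF subgroup_Rd] W(3) by simp
  then have "card W = card (rcosets\<^bsub>G\<^esub> Rd)"
    using R0 by simp
  then have "FPdim (C\<lparr>Obj := gen_subcat (inv_in W)\<rparr>) = real (card (rcosets\<^bsub>G\<^esub> Rd))"
    using FPdim_inv_in[OF W(1)] by simp
  then show ?thesis
    using modular_inv_in[OF W(1,2) G.mult_span[OF W(1) subgroup_Rd W(2,3) fin]] pointed_inv_in[OF W(1)]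
    unfolding Rd_def by blast
qed

end
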